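(* Consider the system $$dx(t)=[Ax(t)+Bu(t)+f(x(t))]\,dt+\sum_{i=1}^d N_ix(t-)\,dM_i(t),\quad x(0)=0,\qquad y(t)=Cx(t),\quad t\in[0,T].$$ Let $P$ and $Q$ be average monotonicity Gramians for a set of controls $\mathcal U\subseteq L^2_T$ and constants $c_1,c_2$. Let $(p_k)_{k=1,\dots,n}$ be an orthonormal basis of $\mathbb R^n$ consisting of eigenvectors of $P$ with corresponding eigenvalues $(\lambda_{P,k})$, and let $(q_k)_{k=1,\dots,n}$ be an orthonormal basis of $\mathbb R^n$ consisting of eigenvectors of $Q$ with corresponding eigenvalues $(\lambda_{Q,k})$. Set $c=\max\{0,2(c_2-c_1)\}$. Then, for all $u\in\mathcal U$, all $k\in\{1,\dots,n\}$ and all $t\in[0,T]$, $$\sup_{t\in[0,T]}\mathbb E\,\langle x(t),p_k\rangle_2^2\le \lambda_{P,k}\,e^{cT}\,\|u\|_{L^2_T}^2,$$ and $$\mathbb E\int_0^t\|y(s)\|_2^2\,ds\le 2\,\mathbb E\int_0^t\langle Qx(s),Bu(s)\rangle_2\,e^{c(t-s)}\,ds =2\sum_{k=1}^n\lambda_{Q,k}\,\mathbb E\int_0^t\langle q_k,x(s)\rangle_2\,\langle q_k,Bu(s)\rangle_2\,e^{c(t-s)}\,ds .$$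
   Context: Let $(\Omega,\mathcal F,(\mathcal F_t)_{t\in[0,T]},\mathbb P)$ be a filtered probability space with right-continuous and complete filtration. $M=(M_1,\dots,M_d)^\top$ is an $\mathbb R^d$-valued, square integrable, mean zero Lévy process, adapted to $(\mathcal F_t)$, with increments $M(t+h)-M(t)$ independent of $\mathcal F_t$; $K=(k_{ij})_{i,j=1,\dots,d}$ is its (positive semidefinite) covariance matrix, defined by $\mathbb E[M(t)M(t)^\top]=Kt$. $A,N_1,\dots,N_d\in\mathbb R^{n\times n}$, $B\in\mathbb R^{n\times m}$, $C\in\mathbb R^{p\times n}$; $x(t-)=\lim_{s\uparrow t}x(s)$. The function $f:\mathbb R^n\to\mathbb R^n$ satisfies $f(0)=0$, is locally Lipschitz (Lipschitz on every ball $\{\|x\|_2\le R\}$), and satisfies $\langle x,f(x)\rangle_2\le c_f\|x\|_2^2$ for all $x$ with some constant $c_f\in\mathbb R$. $L^2_T$ is the set of $(\mathcal F_t)$-adapted $\mathbb R^m$-valued processes $u$ with $\|u\|_{L^2_T}^2:=\mathbb E\int_0^T\|u(t)\|_2^2dt<\infty$. $x=x(\cdot,0,u)$ denotes the solution of the state equation with zero initial state and control $u$. For symmetric matrices, $>,\ge,<,\le$ refer to the Loewner order. Standing assumption: all eigenvalues of $I\otimes(A+c_1I)+(A+c_1I)\otimes I+\sum_{i,j=1}^dN_i\otimes N_j\,k_{ij}$ have negative real part. Definition (average monotonicity Gramians). Let $c_1,c_2$ be constants and $\mathcal U\subseteq L^2_T$. A pair $(P,Q)$ of matrices with $P,Q>0$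 (symmetric positive definite) is called average monotonicity Gramians for $\mathcal U$ if $$(A+c_1 I)^\top P^{-1}+P^{-1}(A+c_1 I)+\sum_{i,j=1}^d N_i^\top P^{-1}N_jk_{ij}\le -P^{-1}BB^\top P^{-1},$$ $$(A+c_1 I)^\top Q+Q(A+c_1 I)+\sum_{i,j=1}^d N_i^\top QN_jk_{ij}\le -C^\top C,$$ and $$\mathbb E\int_0^t\langle x(s),P^{-1}f(x(s))\rangle_2ds\le c_2\,\mathbb E\int_0^t\|P^{-\frac12}x(s)\|_2^2ds,\qquad \mathbb E\int_0^t\langle x(s),Qf(x(s))\rangle_2ds\le c_2\,\mathbb E\int_0^t\|Q^{\frac12}x(s)\|_2^2ds$$ for all $t\in[0,T]$ and all state variables $x(\cdot)=x(\cdot,0,u)$ with $u\in\mathcal U$. *)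

theory Defs
  imports "HOL-Probability.Probability"
begin

section \<open>Matrices\<close>

definition symmetric_matrix :: "real^'n^'n \<Rightarrow> bool" where
  "symmetric_matrix X \<longleftrightarrow> transpose X = X"

definition pos_semidefinite :: "real^'n^'n \<Rightarrow> bool" where
  "pos_semidefinite X \<longleftrightarrow> symmetric_matrix X \<and> (\<forall>v. 0 \<le> v \<bullet> (X *v v))"

definition pos_definite :: "real^'n^'n \<Rightarrow> bool" where
  "pos_definite X \<longleftrightarrow> symmetric_matrix X \<and> (\<forall>v. v \<noteq> 0 \<longrightarrow> 0 < v \<bullet> (X *v v))"

definition loewner_le :: "real^'n^'n \<Rightarrow> real^'n^'n \<Rightarrow> bool" where
  "loewner_le X Y \<longleftrightarrow> pos_semidefinite (Y - X)"

text \<open>The unique positive semidefinite square root; only used for positive semidefinite arguments.\<close>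

definition matrix_sqrt :: "real^'n^'n \<Rightarrow> real^'n^'n" where
  "matrix_sqrt X = (THE R. pos_semidefinite R \<and> R ** R = X)"

text \<open>Kronecker product; rows and columns are indexed by pairs (outer index, inner index).\<close>

definition kronecker :: "real^'b^'a \<Rightarrow> real^'e^'c \<Rightarrow> real^('b \<times> 'e)^('a \<times> 'c)" where
  "kronecker X Y = (\<chi> r s. X $ fst r $ fst s * Y $ snd r $ snd s)"

definition complex_eigenvalue :: "real^'n^'n \<Rightarrow> complex \<Rightarrow> bool" where
  "complex_eigenvalue X z \<longleftrightarrow>
     (\<exists>v. v \<noteq> 0 \<and> map_matrix complex_of_real X *v v = z *s v)"

definition orthonormal_eigenbasis ::
    "real^'n^'n \<Rightarrow> ('n \<Rightarrow> real^'n) \<Rightarrow> ('n \<Rightarrow> real) \<Rightarrow> bool" where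
  "orthonormal_eigenbasis X b lam \<longleftrightarrow>
     (\<forall>i j. b i \<bullet> b j = (if i = j then 1 else 0)) \<and> span (range b) = UNIV \<and>
     (\<forall>k. X *v b k = lam k *\<^sub>R b k)"

section \<open>Filtrations and processes on a finite time horizon\<close>

text \<open>Processes and filtrations are indexed by \<^typ>\<open>real\<close>, but only their values at times in
  \<open>{0..T}\<close> are ever constrained or used.\<close>

definition filtered_prob_space :: "'a measure \<Rightarrow> real \<Rightarrow> (real \<Rightarrow> 'a measure) \<Rightarrow> bool" where
  "filtered_prob_space Pr T F \<longleftrightarrow>
     prob_space Pr \<and>
     (\<forall>t\<in>{0..T}. subalgebra Pr (F t)) \<and>
     (\<forall>s\<in>{0..T}. \<forall>t\<in>{0..T}. s \<le> t \<longrightarrow> sets (F s) \<subseteq> sets (F t)) \<and>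
     (\<forall>t\<in>{0..<T}. (\<Inter>s\<in>{t<..T}. sets (F s)) = sets (F t)) \<and>
     (\<forall>A\<in>null_sets Pr. \<forall>B. B \<subseteq> A \<longrightarrow> B \<in> sets (F 0))"

definition adapted ::
    "real \<Rightarrow> (real \<Rightarrow> 'a measure) \<Rightarrow> (real \<Rightarrow> 'a \<Rightarrow> 'b::topological_space) \<Rightarrow> bool" where
  "adapted T F X \<longleftrightarrow> (\<forall>t\<in>{0..T}. X t \<in> borel_measurable (F t))"

definition jointly_measurable ::
    "'a measure \<Rightarrow> real \<Rightarrow> (real \<Rightarrow> 'a \<Rightarrow> 'b::topological_space) \<Rightarrow> bool" where
  "jointly_measurable Pr T X \<longleftrightarrow>
     (\<lambda>(s, \<omega>). X s \<omega>) \<in> borel_measurable (restrict_space lborel {0..T} \<Otimes>\<^sub>M Pr)"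

definition cadlag_on :: "real \<Rightarrow> (real \<Rightarrow> 'b::topological_space) \<Rightarrow> bool" where
  "cadlag_on T g \<longleftrightarrow>
     (\<forall>t\<in>{0..<T}. (g \<longlongrightarrow> g t) (at_right t)) \<and>
     (\<forall>t\<in>{0<..T}. \<exists>l. (g \<longlongrightarrow> l) (at_left t))"

text \<open>The process \<open>x(t-)\<close>, with the usual convention \<open>x(0-) = x(0)\<close>.\<close>

definition left_lim :: "(real \<Rightarrow> 'a \<Rightarrow> 'b::t2_space) \<Rightarrow> real \<Rightarrow> 'a \<Rightarrow> 'b" where
  "left_lim X t \<omega> = (if t \<le> 0 then X 0 \<omega> else Lim (at_left t) (\<lambda>s. X s \<omega>))"

text \<open>\<open>time_mean Pr t g\<close> is the expectation of the integral of \<open>g\<close> over \<open>[0,t]\<close>. Since the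
  Bochner integral is 0 for non-integrable functions, the existence of this quantity is expressed
  separately by \<open>time_integrable\<close>.\<close>

definition time_mean :: "'a measure \<Rightarrow> real \<Rightarrow> (real \<Rightarrow> 'a \<Rightarrow> real) \<Rightarrow> real" where
  "time_mean Pr t g = (\<integral>\<omega>. (LINT s:{0..t}|lborel. g s \<omega>) \<partial>Pr)"

definition time_integrable :: "'a measure \<Rightarrow> real \<Rightarrow> (real \<Rightarrow> 'a \<Rightarrow> real) \<Rightarrow> bool" where
  "time_integrable Pr t g \<longleftrightarrow>
     integrable (restrict_space lborel {0..t} \<Otimes>\<^sub>M Pr) (\<lambda>(s, \<omega>). g s \<omega>)"

definition L2_controls ::
    "'a measure \<Rightarrow> real \<Rightarrow> (real \<Rightarrow> 'a measure) \<Rightarrow> (real \<Rightarrow> 'a \<Rightarrow> real^'m) set" where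
  "L2_controls Pr T F =
     {u. adapted T F u \<and> jointly_measurable Pr T u \<and>
         time_integrable Pr T (\<lambda>s \<omega>. (norm (u s \<omega>))\<^sup>2)}"

definition L2_norm_control ::
    "'a measure \<Rightarrow> real \<Rightarrow> (real \<Rightarrow> 'a \<Rightarrow> real^'m) \<Rightarrow> real" where
  "L2_norm_control Pr T u = sqrt (time_mean Pr T (\<lambda>s \<omega>. (norm (u s \<omega>))\<^sup>2))"

definition converges_in_prob ::
    "'a measure \<Rightarrow> (nat \<Rightarrow> 'a \<Rightarrow> 'b::real_normed_vector) \<Rightarrow> ('a \<Rightarrow> 'b) \<Rightarrow> bool" where
  "converges_in_prob Pr X Z \<longleftrightarrow>
     (\<forall>\<epsilon>>0. (\<lambda>n. measure Pr {\<omega> \<in> space Pr. norm (X n \<omega> - Z \<omega>) > \<epsilon>}) \<longlonglongrightarrow> 0)"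

section \<open>Levy processes\<close>

definition levy_process ::
    "'a measure \<Rightarrow> real \<Rightarrow> (real \<Rightarrow> 'a \<Rightarrow> real^'d) \<Rightarrow> bool" where
  "levy_process Pr T L \<longleftrightarrow>
     (\<forall>t\<in>{0..T}. L t \<in> borel_measurable Pr) \<and>
     (AE \<omega> in Pr. L 0 \<omega> = 0) \<and>
     (\<forall>(m::nat) \<tau>. (\<forall>j\<le>m. \<tau> j \<in> {0..T}) \<and> (\<forall>j<m. \<tau> j \<le> \<tau> (Suc j)) \<longrightarrow>
        prob_space.indep_vars Pr (\<lambda>_. borel) (\<lambda>j \<omega>. L (\<tau> (Suc j)) \<omega> - L (\<tau> j) \<omega>) {..<m}) \<and>
     (\<forall>s\<in>{0..T}. \<forall>t\<in>{s..T}.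
        distr Pr borel (\<lambda>\<omega>. L t \<omega> - L s \<omega>) = distr Pr borel (L (t - s))) \<and>
     (\<forall>s\<in>{0..T}. \<forall>\<epsilon>>0.
        ((\<lambda>t. measure Pr {\<omega> \<in> space Pr. norm (L t \<omega> - L s \<omega>) > \<epsilon>}) \<longlongrightarrow> 0)
          (at s within {0..T})) \<and>
     (AE \<omega> in Pr. cadlag_on T (\<lambda>t. L t \<omega>))"

text \<open>The driving noise: a square integrable, mean zero, adapted Levy process whose increments are
  independent of the past, with covariance matrix \<open>K\<close> (which is then automatically positive
  semidefinite for \<open>T > 0\<close>).\<close>

definition levy_noise ::
    "'a measure \<Rightarrow> real \<Rightarrow> (real \<Rightarrow> 'a measure) \<Rightarrow> (real \<Rightarrow> 'a \<Rightarrow> real^'d) \<Rightarrow> real^'d^'d \<Rightarrow> bool"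
  where
  "levy_noise Pr T F L K \<longleftrightarrow>
     levy_process Pr T L \<and> adapted T F L \<and>
     (\<forall>t\<in>{0..T}. integrable Pr (\<lambda>\<omega>. (norm (L t \<omega>))\<^sup>2) \<and> (\<integral>\<omega>. L t \<omega> \<partial>Pr) = 0) \<and>
     (\<forall>s\<in>{0..T}. \<forall>t\<in>{s..T}. prob_space.indep_set Pr (sets (F s))
        (sets (vimage_algebra (space Pr) (\<lambda>\<omega>. L t \<omega> - L s \<omega>) borel))) \<and>
     (\<forall>t\<in>{0..T}. \<forall>i j. (\<integral>\<omega>. L t \<omega> $ i * L t \<omega> $ j \<partial>Pr) = K $ i $ j * t)"

section \<open>Stochastic integration\<close>

text \<open>The data \<open>(m, \<tau>, \<xi>)\<close> describes the simple process that equals \<open>\<xi> j\<close> on the interval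
  \<open>(\<tau> j, \<tau> (j+1)]\<close> for \<open>j < m\<close>, where \<open>\<xi> j\<close> is bounded and measurable at time \<open>\<tau> j\<close>.\<close>

definition simple_data ::
    "'a measure \<Rightarrow> real \<Rightarrow> (real \<Rightarrow> 'a measure) \<Rightarrow> nat \<Rightarrow> (nat \<Rightarrow> real) \<Rightarrow>
     (nat \<Rightarrow> 'a \<Rightarrow> real^'n) \<Rightarrow> bool" where
  "simple_data Pr T F m \<tau> \<xi> \<longleftrightarrow>
     (\<forall>j\<le>m. \<tau> j \<in> {0..T}) \<and> (\<forall>j<m. \<tau> j \<le> \<tau> (Suc j)) \<and>
     (\<forall>j<m. \<xi> j \<in> borel_measurable (F (\<tau> j)) \<and> bounded (\<xi> j ` space Pr))"

definition simple_process ::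
    "nat \<Rightarrow> (nat \<Rightarrow> real) \<Rightarrow> (nat \<Rightarrow> 'a \<Rightarrow> real^'n) \<Rightarrow> real \<Rightarrow> 'a \<Rightarrow> real^'n" where
  "simple_process m \<tau> \<xi> s \<omega> = (\<Sum>j<m. indicator {\<tau> j<..\<tau> (Suc j)} s *\<^sub>R \<xi> j \<omega>)"

definition simple_integral ::
    "nat \<Rightarrow> (nat \<Rightarrow> real) \<Rightarrow> (nat \<Rightarrow> 'a \<Rightarrow> real^'n) \<Rightarrow> (real \<Rightarrow> 'a \<Rightarrow> real) \<Rightarrow>
     real \<Rightarrow> 'a \<Rightarrow> real^'n" where
  "simple_integral m \<tau> \<xi> Z t \<omega> =
     (\<Sum>j<m. (Z (min t (\<tau> (Suc j))) \<omega> - Z (min t (\<tau> j)) \<omega>) *\<^sub>R \<xi> j \<omega>)"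

definition predictable_sigma ::
    "'a measure \<Rightarrow> real \<Rightarrow> (real \<Rightarrow> 'a measure) \<Rightarrow> (real \<times> 'a) measure" where
  "predictable_sigma Pr T F = sigma ({0..T} \<times> space Pr)
     ({{0} \<times> A | A. A \<in> sets (F 0)} \<union>
      {{s<..t} \<times> A | s t A. 0 \<le> s \<and> s \<le> t \<and> t \<le> T \<and> A \<in> sets (F s)})"

text \<open>\<open>J\<close> is (a version of) the Ito integral process of the predictable integrand \<open>Y\<close>, with almost
  surely square integrable paths, against the scalar square integrable Levy martingale \<open>Z\<close>. As the
  predictable quadratic variation of \<open>Z\<close> is a multiple of Lebesgue measure, the integral is the limit
  in probability of integrals of simple processes that converge to \<open>Y\<close> in \<open>L\<^sup>2([0,T])\<close> in
  probability; the limit does not depend on the approximating sequence.\<close>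

definition has_ito_integral ::
    "'a measure \<Rightarrow> real \<Rightarrow> (real \<Rightarrow> 'a measure) \<Rightarrow> (real \<Rightarrow> 'a \<Rightarrow> real) \<Rightarrow>
     (real \<Rightarrow> 'a \<Rightarrow> real^'n) \<Rightarrow> (real \<Rightarrow> 'a \<Rightarrow> real^'n) \<Rightarrow> bool" where
  "has_ito_integral Pr T F Z Y J \<longleftrightarrow>
     (\<lambda>(s, \<omega>). Y s \<omega>) \<in> borel_measurable (predictable_sigma Pr T F) \<and>
     (AE \<omega> in Pr. set_integrable lborel {0..T} (\<lambda>s. (norm (Y s \<omega>))\<^sup>2)) \<and>
     adapted T F J \<and> (AE \<omega> in Pr. cadlag_on T (\<lambda>t. J t \<omega>)) \<and>
     (\<exists>(m :: nat \<Rightarrow> nat) \<tau> \<xi>.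
        (\<forall>n. simple_data Pr T F (m n) (\<tau> n) (\<xi> n)) \<and>
        converges_in_prob Pr
          (\<lambda>n \<omega>. LINT s:{0..T}|lborel. (norm (simple_process (m n) (\<tau> n) (\<xi> n) s \<omega> - Y s \<omega>))\<^sup>2)
          (\<lambda>\<omega>. 0) \<and>
        (\<forall>t\<in>{0..T}. converges_in_prob Pr
          (\<lambda>n. simple_integral (m n) (\<tau> n) (\<xi> n) Z t) (J t)))"

section \<open>The controlled system and its Gramians\<close>

text \<open>\<open>x\<close> solves \<open>dx = [A x + B u + f(x)] dt + \<Sum>i. N i x(t-) dM i\<close> with \<open>x(0) = 0\<close>.\<close>

definition state_solution ::
    "'a measure \<Rightarrow> real \<Rightarrow> (real \<Rightarrow> 'a measure) \<Rightarrow> (real \<Rightarrow> 'a \<Rightarrow> real^'d) \<Rightarrow>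
     real^'n^'n \<Rightarrow> real^'m^'n \<Rightarrow> ('d \<Rightarrow> real^'n^'n) \<Rightarrow> (real^'n \<Rightarrow> real^'n) \<Rightarrow>
     (real \<Rightarrow> 'a \<Rightarrow> real^'m) \<Rightarrow> (real \<Rightarrow> 'a \<Rightarrow> real^'n) \<Rightarrow> bool" where
  "state_solution Pr T F M A B N f u x \<longleftrightarrow>
     adapted T F x \<and> (\<forall>\<omega>\<in>space Pr. cadlag_on T (\<lambda>t. x t \<omega>)) \<and>
     (AE \<omega> in Pr. set_integrable lborel {0..T} (\<lambda>s. A *v x s \<omega> + B *v u s \<omega> + f (x s \<omega>))) \<and>
     (\<exists>J. (\<forall>i. has_ito_integral Pr T F (\<lambda>t \<omega>. M t \<omega> $ i) (\<lambda>s \<omega>. N i *v left_lim x s \<omega>) (J i)) \<and>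
        (AE \<omega> in Pr. \<forall>t\<in>{0..T}.
           x t \<omega> = (LINT s:{0..t}|lborel. A *v x s \<omega> + B *v u s \<omega> + f (x s \<omega>))
                     + (\<Sum>i\<in>UNIV. J i t \<omega>)))"

text \<open>The two mean inequalities in the definition of the Gramians presuppose that their left-hand
  sides exist, which is made explicit here. For their right-hand sides no such clause is needed:
  solutions of the state equation have finite second moments bounded on \<open>[0,T]\<close>, by the one-sided
  linear growth of \<open>f\<close>.\<close>

definition average_monotonicity_gramians ::
    "'a measure \<Rightarrow> real \<Rightarrow> (real \<Rightarrow> 'a measure) \<Rightarrow> (real \<Rightarrow> 'a \<Rightarrow> real^'d) \<Rightarrow> real^'d^'d \<Rightarrow>
     real^'n^'n \<Rightarrow> real^'m^'n \<Rightarrow> real^'n^'p \<Rightarrow> ('d \<Rightarrow> real^'n^'n) \<Rightarrow> (real^'n \<Rightarrow> real^'n) \<Rightarrow>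
     real \<Rightarrow> real \<Rightarrow> (real \<Rightarrow> 'a \<Rightarrow> real^'m) set \<Rightarrow> real^'n^'n \<Rightarrow> real^'n^'n \<Rightarrow> bool" where
  "average_monotonicity_gramians Pr T F M K A B C N f c1 c2 \<U> P Q \<longleftrightarrow>
     pos_definite P \<and> pos_definite Q \<and>
     loewner_le
       (transpose (A + c1 *\<^sub>R mat 1) ** matrix_inv P + matrix_inv P ** (A + c1 *\<^sub>R mat 1)
          + (\<Sum>i\<in>UNIV. \<Sum>j\<in>UNIV. K $ i $ j *\<^sub>R (transpose (N i) ** matrix_inv P ** N j)))
       (- (matrix_inv P ** B ** transpose B ** matrix_inv P)) \<and>
     loewner_le
       (transpose (A + c1 *\<^sub>R mat 1) ** Q + Q ** (A + c1 *\<^sub>R mat 1)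
          + (\<Sum>i\<in>UNIV. \<Sum>j\<in>UNIV. K $ i $ j *\<^sub>R (transpose (N i) ** Q ** N j)))
       (- (transpose C ** C)) \<and>
     (\<forall>u\<in>\<U>. \<forall>x. state_solution Pr T F M A B N f u x \<longrightarrow> (\<forall>t\<in>{0..T}.
        time_integrable Pr t (\<lambda>s \<omega>. x s \<omega> \<bullet> (matrix_inv P *v f (x s \<omega>))) \<and>
        time_mean Pr t (\<lambda>s \<omega>. x s \<omega> \<bullet> (matrix_inv P *v f (x s \<omega>)))
          \<le> c2 * time_mean Pr t (\<lambda>s \<omega>. (norm (matrix_sqrt (matrix_inv P) *v x s \<omega>))\<^sup>2) \<and>
        time_integrable Pr t (\<lambda>s \<omega>. x s \<omega> \<bullet> (Q *v f (x s \<omega>))) \<and>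
        time_mean Pr t (\<lambda>s \<omega>. x s \<omega> \<bullet> (Q *v f (x s \<omega>)))
          \<le> c2 * time_mean Pr t (\<lambda>s \<omega>. (norm (matrix_sqrt Q *v x s \<omega>))\<^sup>2)))"

end

theory Submission
  imports Defs
begin

text \<open>
  Ito's formula is needed only in expectation, for quadratic forms, and as an inequality. If
  \<open>y = D + Z\<close> with a drift \<open>D\<close> and a stochastic integral \<open>Z\<close>, the three parts of the expectation of
  \<open>y \<bullet> X y\<close> come from Fubini (\<open>D \<bullet> X D\<close>), the martingale property (\<open>D \<bullet> X Z\<close>) and the isometry
  (\<open>Z \<bullet> X Z\<close>). All of this is carried out on elementary integrands and passed to the limit.

  No moments of the state are known beforehand, so drift and integrands are first restricted to the
  predictable set where a continuous adapted clock, the time integral of \<open>1 + \<bar>x\<bar>\<^sup>2 + \<bar>f x\<bar>\<^sup>2\<close>, is below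
  a level \<open>R\<close>. On the event that the clock is still below \<open>R\<close> at time \<open>t\<close>, the restricted process
  agrees with the state up to time \<open>t\<close>. Taking \<open>X = I\<close>, the one-sided growth condition and Gronwall's
  inequality bound the second moments uniformly in \<open>R\<close>; then \<open>R\<close> tends to infinity, and \<open>X = P\<^sup>-\<^sup>1\<close> and
  \<open>X = Q\<close> together with the Gramian inequalities and Gronwall's inequality give the two estimates.
\<close>

section \<open>Square integrable functions\<close>

text \<open>The Ito integrals in the state equation are known only as limits in probability of
  simple integrals, without any moments, whereas the isometry speaks about square integrable
  elementary integrands. The approximating simple processes are therefore cut before the limit is
  taken: by the clock, and by a cap \<open>R1 + 1\<close> on their own energy, where
  \<open>R1\<close> bounds the energy of the restricted limit. The slack 1 makes the cap inactive
  for late approximations, so on the clock event cut and uncut integrals eventually agree, and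
  Fatou's lemma carries the isometry bound over to \<open>J\<close>.

  Only an inequality results because the quadratic expansion is computed on the whole space while
  the state is approximated only on the clock event; as \<open>X\<close> is positive semidefinite,
  the complement may be dropped. The restricted stochastic integral itself is never constructed.

  The control stays out of the clock: it is adapted and jointly measurable, which does not directly
  make its energy integral adapted. Its share of the drift is square integrable over time and
  probability from the start.\<close>

definition sqint :: "'a measure \<Rightarrow> ('a \<Rightarrow> 'b::euclidean_space) \<Rightarrow> bool" where
  "sqint M f \<longleftrightarrow> f \<in> borel_measurable M \<and> integrable M (\<lambda>x. (norm (f x))\<^sup>2)"

lemma sqintI: "f \<in> borel_measurable M \<Longrightarrow> integrable M (\<lambda>x. (norm (f x))\<^sup>2) \<Longrightarrow> sqint M f"
  by (simp add: sqint_def)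

lemma sqint_measurable: "sqint M f \<Longrightarrow> f \<in> borel_measurable M"
  by (simp add: sqint_def)

lemma sqint_integrable: "sqint M f \<Longrightarrow> integrable M (\<lambda>x. (norm (f x))\<^sup>2)"
  by (simp add: sqint_def)

lemma sqint_mono:
  assumes "sqint M f" "g \<in> borel_measurable M" "\<And>x. x \<in> space M \<Longrightarrow> norm (g x) \<le> c * norm (f x)"
  shows "sqint M g"
proof (rule sqintI)
  show "integrable M (\<lambda>x. (norm (g x))\<^sup>2)"
  proof (rule Bochner_Integration.integrable_bound[of _ "\<lambda>x. c\<^sup>2 * (norm (f x))\<^sup>2"])
    show "integrable M (\<lambda>x. c\<^sup>2 * (norm (f x))\<^sup>2)" using sqint_integrable[OF assms(1)] by simp
    show "AE x in M. norm ((norm (g x))\<^sup>2) \<le> norm (c\<^sup>2 * (norm (f x))\<^sup>2)"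
      using power_mono[OF assms(3) norm_ge_zero, of _ 2] by (intro AE_I2) (auto simp: power_mult_distrib)
  qed (use assms in measurable)
qed (use assms in simp)

lemma norm_add_sq_le: "(norm (a + b))\<^sup>2 \<le> 2 * (norm a)\<^sup>2 + 2 * (norm (b::'b::real_normed_vector))\<^sup>2"
proof -
  have "(norm (a + b))\<^sup>2 \<le> (norm a + norm b)\<^sup>2" by (simp add: norm_triangle_ineq power_mono)
  also have "\<dots> \<le> 2 * (norm a)\<^sup>2 + 2 * (norm b)\<^sup>2"
    using sum_squares_bound[of "norm a" "norm b"] by (simp add: power2_sum)
  finally show ?thesis .
qed

lemma norm_diff_sq_le: "(norm (a - b))\<^sup>2 \<le> 2 * (norm a)\<^sup>2 + 2 * (norm (b::'b::real_normed_vector))\<^sup>2"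
  using norm_add_sq_le[of a "-b"] by simp

lemma sqint_add:
  assumes "sqint M f" "sqint M g" shows "sqint M (\<lambda>x. f x + g x)"
proof (rule sqintI)
  note [measurable] = assms[THEN sqint_measurable]
  show "(\<lambda>x. f x + g x) \<in> borel_measurable M" by measurable
  show "integrable M (\<lambda>x. (norm (f x + g x))\<^sup>2)"
    by (rule Bochner_Integration.integrable_bound[of _ "\<lambda>x. 2 * (norm (f x))\<^sup>2 + 2 * (norm (g x))\<^sup>2"])
      (use assms[THEN sqint_integrable] norm_add_sq_le in auto)
qed

lemma sqint_zero [simp]: "sqint M (\<lambda>x. 0)"
  by (simp add: sqint_def)

lemma sqint_scaleR: "sqint M f \<Longrightarrow> sqint M (\<lambda>x. c *\<^sub>R f x)"
  by (rule sqint_mono[of M f _ "\<bar>c\<bar>"]) (auto dest: sqint_measurable)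

lemma sqint_diff: "sqint M f \<Longrightarrow> sqint M g \<Longrightarrow> sqint M (\<lambda>x. f x - g x)"
  using sqint_add[of M f "\<lambda>x. (-1) *\<^sub>R g x"] sqint_scaleR[of M g "-1"] by simp

lemma sqint_sum: "(\<And>i. i \<in> I \<Longrightarrow> sqint M (f i)) \<Longrightarrow> sqint M (\<lambda>x. \<Sum>i\<in>I. f i x)"
  by (induction I rule: infinite_finite_induct) (auto intro: sqint_add)

section \<open>Matrices acting on square integrable functions\<close>

lemma matrix_vector_measurable [measurable (raw)]:
  fixes X :: "real^'n^'m"
  shows "f \<in> borel_measurable M \<Longrightarrow> (\<lambda>x. X *v f x) \<in> borel_measurable M"
  by (rule borel_measurable_continuous_on[where f="\<lambda>v. X *v v"])
     (auto intro!: linear_continuous_on linear_linear[THEN iffD2])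

lemma matrix_vector_norm_le:
  fixes X :: "real^'n^'m"
  obtains c where "0 \<le> c" "\<And>v. norm (X *v v) \<le> c * norm v"
proof -
  have "bounded_linear ((*v) X)" by simp
  from bounded_linear.nonneg_bounded[OF this] obtain c where "0 \<le> c" "\<And>v. norm (X *v v) \<le> norm v * c"
    by auto
  then show ?thesis by (intro that[of c]) (auto simp: mult.commute)
qed

lemma sqint_matrix:
  fixes X :: "real^'n^'m"
  assumes "sqint M f" shows "sqint M (\<lambda>x. X *v f x)"
proof -
  obtain c where "\<And>v. norm (X *v v) \<le> c * norm v" using matrix_vector_norm_le[of X] by metis
  then show ?thesis using assms by (intro sqint_mono[OF assms, of _ c]) (auto dest: sqint_measurable)
qed

lemma sqint_mult_integrable:
  assumes "sqint M f" "sqint M g" shows "integrable M (\<lambda>x. norm (f x) * norm (g x))"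
proof (rule Bochner_Integration.integrable_bound[of _ "\<lambda>x. (norm (f x))\<^sup>2 + (norm (g x))\<^sup>2"])
  note [measurable] = assms[THEN sqint_measurable]
  show "(\<lambda>x. norm (f x) * norm (g x)) \<in> borel_measurable M" by measurable
  have "a * b \<le> a\<^sup>2 + b\<^sup>2" if "0 \<le> a" "0 \<le> b" for a b :: real
    using sum_squares_bound[of a b] mult_nonneg_nonneg[OF that] by linarith
  then show "AE x in M. norm (norm (f x) * norm (g x)) \<le> norm ((norm (f x))\<^sup>2 + (norm (g x))\<^sup>2)"
    by (intro AE_I2) simp
qed (use assms[THEN sqint_integrable] in simp)

lemma sqint_inner_integrable:
  assumes "sqint M f" "sqint M g" shows "integrable M (\<lambda>x. f x \<bullet> g x)"
  by (rule Bochner_Integration.integrable_bound[OF sqint_mult_integrable[OF assms]])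
     (use assms[THEN sqint_measurable] in \<open>auto intro: Cauchy_Schwarz_ineq2\<close>)

text \<open>The quadratic polynomial \<open>a - 2 * r * p + r\<^sup>2 * b\<close> in
  \<open>r\<close> is the integral of a square, so its discriminant cannot be positive.\<close>

lemma integral_sq_cauchy_schwarz:
  fixes f g :: "'a \<Rightarrow> real"
  assumes f: "sqint M f" and g: "sqint M g"
  shows "\<bar>\<integral>x. f x * g x \<partial>M\<bar> \<le> sqrt ((\<integral>x. (f x)\<^sup>2 \<partial>M) * (\<integral>x. (g x)\<^sup>2 \<partial>M))"
proof -
  define a b p where "a = (\<integral>x. (f x)\<^sup>2 \<partial>M)" "b = (\<integral>x. (g x)\<^sup>2 \<partial>M)" "p = (\<integral>x. f x * g x \<partial>M)"
  note i = sqint_integrable[OF f, simplified] sqint_integrable[OF g, simplified]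
    sqint_inner_integrable[OF f g, simplified]
  have q: "0 \<le> a - 2 * r * p + r\<^sup>2 * b" for r
  proof -
    have "0 \<le> (\<integral>x. (f x - r * g x)\<^sup>2 \<partial>M)" by simp
    also have "\<dots> = (\<integral>x. (f x)\<^sup>2 - 2 * r * (f x * g x) + r\<^sup>2 * (g x)\<^sup>2 \<partial>M)"
      by (simp add: power2_eq_square algebra_simps)
    also have "\<dots> = a - 2 * r * p + r\<^sup>2 * b" using i by (simp add: a_b_p_def)
    finally show ?thesis .
  qed
  have b: "0 \<le> b" by (simp add: a_b_p_def)
  have "p\<^sup>2 \<le> a * b"
  proof (cases "b = 0")
    case True
    have "p = 0"
    proof (rule ccontr)
      assume "p \<noteq> 0"
      \<comment> \<open>With \<open>b = 0\<close> the polynomial is linear in \<open>r\<close>, and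
        this choice of \<open>r\<close> gives it the value -1.\<close>
      with q[of "(a + 1) / (2 * p)"] True show False by (simp add: field_simps)
    qed
    then show ?thesis using True by simp
  next
    case False
    then show ?thesis using q[of "p / b"] b by (simp add: power2_eq_square field_simps)
  qed
  then show ?thesis unfolding a_b_p_def[symmetric] by (metis real_sqrt_abs real_sqrt_le_mono)
qed

lemma integral_inner_cauchy_schwarz:
  assumes f: "sqint M f" and g: "sqint M g"
  shows "\<bar>\<integral>x. f x \<bullet> g x \<partial>M\<bar> \<le> sqrt ((\<integral>x. (norm (f x))\<^sup>2 \<partial>M) * (\<integral>x. (norm (g x))\<^sup>2 \<partial>M))"
proof -
  have n: "sqint M (\<lambda>x. norm (f x))" "sqint M (\<lambda>x. norm (g x))"
    using f g by (auto simp: sqint_def)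
  have "\<bar>\<integral>x. f x \<bullet> g x \<partial>M\<bar> \<le> (\<integral>x. norm (f x) * norm (g x) \<partial>M)"
    unfolding real_norm_def[symmetric]
    by (rule order_trans[OF integral_norm_bound integral_mono[OF integrable_norm[OF sqint_inner_integrable[OF f g]]
        sqint_mult_integrable[OF f g]]]) (simp add: Cauchy_Schwarz_ineq2)

  also have "\<dots> \<le> \<bar>\<integral>x. norm (f x) * norm (g x) \<partial>M\<bar>" by simp
  finally show ?thesis using integral_sq_cauchy_schwarz[OF n] by simp
qed

text \<open>Writing \<open>V n\<close> as \<open>v\<close> plus an error, and likewise
  \<open>W n\<close>, leaves three error terms, each containing a difference and hence small by
  Cauchy-Schwarz. Limits of isometries and of quadratic forms are taken through this lemma.\<close>

lemma sqint_inner_tendsto: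
  assumes V: "\<And>n. sqint M (V n)" "sqint M v" "(\<lambda>n. \<integral>x. (norm (V n x - v x))\<^sup>2 \<partial>M) \<longlonglongrightarrow> 0"
    and W: "\<And>n. sqint M (W n)" "sqint M w" "(\<lambda>n. \<integral>x. (norm (W n x - w x))\<^sup>2 \<partial>M) \<longlonglongrightarrow> 0"
  shows "(\<lambda>n. \<integral>x. V n x \<bullet> W n x \<partial>M) \<longlonglongrightarrow> (\<integral>x. v x \<bullet> w x \<partial>M)"
proof -
  define d e p q where "d n = (\<integral>x. (norm (V n x - v x))\<^sup>2 \<partial>M)" 
    "e n = (\<integral>x. (norm (W n x - w x))\<^sup>2 \<partial>M)" "p = (\<integral>x. (norm (v x))\<^sup>2 \<partial>M)" "q = (\<integral>x. (norm (w x))\<^sup>2 \<partial>M)" for n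
  note sd = sqint_diff[OF V(1) V(2)] and se = sqint_diff[OF W(1) W(2)]
  have eq: "(\<integral>x. V n x \<bullet> W n x \<partial>M) - (\<integral>x. v x \<bullet> w x \<partial>M) =
     (\<integral>x. (V n x - v x) \<bullet> (W n x - w x) \<partial>M) + (\<integral>x. (V n x - v x) \<bullet> w x \<partial>M) + (\<integral>x. v x \<bullet> (W n x - w x) \<partial>M)" for n
  proof -
    note i = sqint_inner_integrable[OF sd[of n] se[of n]] sqint_inner_integrable[OF sd[of n] W(2)]
       sqint_inner_integrable[OF V(2) se[of n]] sqint_inner_integrable[OF V(1)[of n] W(1)[of n]]
       sqint_inner_integrable[OF V(2) W(2)]
    have "(\<integral>x. V n x \<bullet> W n x \<partial>M) - (\<integral>x. v x \<bullet> w x \<partial>M) = (\<integral>x. V n x \<bullet> W n x - v x \<bullet> w x \<partial>M)"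
      by (rule Bochner_Integration.integral_diff[OF i(4,5), symmetric])
    also have "\<dots> = (\<integral>x. ((V n x - v x) \<bullet> (W n x - w x) + (V n x - v x) \<bullet> w x) + v x \<bullet> (W n x - w x) \<partial>M)"
      by (rule Bochner_Integration.integral_cong) (auto simp: inner_diff_left inner_diff_right)
    also have "\<dots> = (\<integral>x. (V n x - v x) \<bullet> (W n x - w x) \<partial>M) + (\<integral>x. (V n x - v x) \<bullet> w x \<partial>M) + (\<integral>x. v x \<bullet> (W n x - w x) \<partial>M)"
      by (simp only: Bochner_Integration.integral_add[OF Bochner_Integration.integrable_add[OF i(1,2)] i(3)]
        Bochner_Integration.integral_add[OF i(1,2)])
    finally show ?thesis .
  qed
  have le: "norm ((\<integral>x. V n x \<bullet> W n x \<partial>M) - (\<integral>x. v x \<bullet> w x \<partial>M)) \<le> sqrt (d n * e n) + sqrt (d n * q) + sqrt (p * e n)" for n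
    using integral_inner_cauchy_schwarz[OF sd[of n] se[of n]] integral_inner_cauchy_schwarz[OF sd[of n] W(2)]
      integral_inner_cauchy_schwarz[OF V(2) se[of n]]
    unfolding eq d_e_p_q_def real_norm_def by linarith
  have lim: "(\<lambda>n. sqrt (d n * e n) + sqrt (d n * q) + sqrt (p * e n)) \<longlonglongrightarrow> 0"
  proof -
    have "d \<longlonglongrightarrow> 0" "e \<longlonglongrightarrow> 0" using V(3) W(3) by (simp_all add: d_e_p_q_def(1,2)[abs_def])
    then have "(\<lambda>n. sqrt (d n * e n) + sqrt (d n * q) + sqrt (p * e n)) \<longlonglongrightarrow> sqrt (0*0) + sqrt (0 * q) + sqrt (p * 0)"
      by (intro tendsto_intros)
    then show ?thesis by simp
  qed
  have "(\<lambda>n. (\<integral>x. V n x \<bullet> W n x \<partial>M) - (\<integral>x. v x \<bullet> w x \<partial>M)) \<longlonglongrightarrow> 0"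
    by (rule Lim_null_comparison[OF always_eventually[OF allI[OF le]] lim])
  then show ?thesis by (rule LIM_zero_cancel)
qed

section \<open>Indefinite integrals and Gronwall's inequality\<close>

text \<open>Integration by parts without derivatives: as \<open>g\<close> and \<open>h\<close> are
  merely integrable, the product of the two integrals is read as an integral over a square, which is
  split along the diagonal and iterated in the two possible orders.\<close>

lemma indefinite_integral_mult:
  fixes g h :: "real \<Rightarrow> real"
  assumes g: "set_integrable lborel {0..t} g" and h: "set_integrable lborel {0..t} h"
  shows "set_integrable lborel {0..t} (\<lambda>s. g s * (LINT r:{0..s}|lborel. h r))" (is ?A)
    and "(LINT s:{0..t}|lborel. g s) * (LINT s:{0..t}|lborel. h s) =
      (LINT s:{0..t}|lborel. g s * (LINT r:{0..s}|lborel. h r)) +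
      (LINT s:{0..t}|lborel. h s * (LINT r:{0..s}|lborel. g r))" (is ?B)
proof -
  define g' where "g' s = indicator {0..t} s * g s" for s
  define h' where "h' s = indicator {0..t} s * h s" for s
  have [simp]: "integrable lborel g'" "integrable lborel h'"
    using g h unfolding set_integrable_def g'_def h'_def by auto
  have [measurable]: "g' \<in> borel_measurable borel" "h' \<in> borel_measurable borel"
    using borel_measurable_integrable[of lborel g'] borel_measurable_integrable[of lborel h'] by auto
  have int: "integrable (lborel \<Otimes>\<^sub>M lborel) (\<lambda>(s, r). g' s * h' r)"
  proof (rule lborel_pair.Fubini_integrable)
    show "(\<lambda>(s, r). g' s * h' r) \<in> borel_measurable (lborel \<Otimes>\<^sub>M lborel)" by measurable
    show "integrable lborel (\<lambda>s. LINT r|lborel. norm (case (s, r) of (s, r) \<Rightarrow> g' s * h' r))"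
      by (simp add: abs_mult)
  qed auto
  have m1: "(\<lambda>(s, r). indicator {..s} r * (g' s * h' r)) \<in> borel_measurable (lborel \<Otimes>\<^sub>M lborel)"
    and m2: "(\<lambda>(s, r). indicator {s<..} r * (g' s * h' r)) \<in> borel_measurable (lborel \<Otimes>\<^sub>M lborel)"
    unfolding indicator_def of_bool_def atMost_iff greaterThan_iff by measurable
  have in1: "integrable (lborel \<Otimes>\<^sub>M lborel) (\<lambda>(s, r). indicator {..s} r * (g' s * h' r))"
    by (rule Bochner_Integration.integrable_bound[OF int m1]) (auto split: split_indicator)
  have in2: "integrable (lborel \<Otimes>\<^sub>M lborel) (\<lambda>(s, r). indicator {s<..} r * (g' s * h' r))"
    by (rule Bochner_Integration.integrable_bound[OF int m2]) (auto split: split_indicator)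
  \<comment> \<open>The diagonal belongs to only one half of the square; the other half gets its
    endpoint back because a single point is null.\<close>
  have ae: "(LINT s|lborel. indicator {..<r} s * f s) = (LINT s|lborel. indicator {..r} s * f s)"
    if [measurable]: "f \<in> borel_measurable borel" for f :: "real \<Rightarrow> real" and r
    by (rule integral_cong_AE) (use AE_lborel_singleton[of r] in \<open>auto split: split_indicator elim!: eventually_mono\<close>)
  have eg: "g' s * (LINT r|lborel. indicator {..s} r * h' r) = indicator {0..t} s * (g s * (LINT r:{0..s}|lborel. h r))" for s
    by (auto simp: g'_def h'_def set_lebesgue_integral_def split: split_indicator
        intro!: Bochner_Integration.integral_cong arg_cong[where f="\<lambda>x. g s * x"] disjI2)
  have eh: "h' s * (LINT r|lborel. indicator {..s} r * g' r) = indicator {0..t} s * (h s * (LINT r:{0..s}|lborel. g r))" for s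
    by (auto simp: g'_def h'_def set_lebesgue_integral_def split: split_indicator
        intro!: Bochner_Integration.integral_cong arg_cong[where f="\<lambda>x. h s * x"] disjI2)
  have i1: "integrable lborel (\<lambda>s. g' s * (LINT r|lborel. indicator {..s} r * h' r))"
    using lborel_pair.integrable_fst'[OF in1] by (simp add: mult.left_commute)
  show ?A using i1 unfolding eg set_integrable_def by simp
  have "(LINT s|lborel. g' s) * (LINT s|lborel. h' s) = (LINT s|lborel. LINT r|lborel. g' s * h' r)"
    by simp
  also have "\<dots> = (\<integral>z. (case z of (s, r) \<Rightarrow> g' s * h' r) \<partial>(lborel \<Otimes>\<^sub>M lborel))"
    using lborel_pair.integral_fst'[OF int] by simp
  also have "\<dots> = (\<integral>z. (case z of (s, r) \<Rightarrow> indicator {..s} r * (g' s * h' r)) + (case z of (s, r) \<Rightarrow> indicator {s<..} r * (g' s * h' r)) \<partial>(lborel \<Otimes>\<^sub>M lborel))"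
    by (rule Bochner_Integration.integral_cong) (auto split: split_indicator)
  also have "\<dots> = (\<integral>z. (case z of (s, r) \<Rightarrow> indicator {..s} r * (g' s * h' r)) \<partial>(lborel \<Otimes>\<^sub>M lborel))
      + (\<integral>z. (case z of (s, r) \<Rightarrow> indicator {s<..} r * (g' s * h' r)) \<partial>(lborel \<Otimes>\<^sub>M lborel))"
    by (rule Bochner_Integration.integral_add[OF in1 in2])
  also have "(\<integral>z. (case z of (s, r) \<Rightarrow> indicator {..s} r * (g' s * h' r)) \<partial>(lborel \<Otimes>\<^sub>M lborel))
     = (LINT s|lborel. g' s * (LINT r|lborel. indicator {..s} r * h' r))"
    using lborel_pair.integral_fst'[OF in1] by (simp add: mult.left_commute)
  also have "(\<integral>z. (case z of (s, r) \<Rightarrow> indicator {s<..} r * (g' s * h' r)) \<partial>(lborel \<Otimes>\<^sub>M lborel))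
     = (LINT r|lborel. LINT s|lborel. indicator {s<..} r * (g' s * h' r))"
    using lborel_pair.integral_snd[OF in2] by simp
  also have "\<dots> = (LINT r|lborel. LINT s|lborel. h' r * (indicator {..<r} s * g' s))"
    by (intro Bochner_Integration.integral_cong refl) (auto split: split_indicator)
  also have "\<dots> = (LINT r|lborel. h' r * (LINT s|lborel. indicator {..r} s * g' s))"
    by (simp add: ae)
  finally show ?B unfolding eg eh by (simp add: g'_def h'_def set_lebesgue_integral_def)
qed

text \<open>Integration by parts against \<open>k r = -c * exp (- c * r)\<close>, whose indefinite
  integral is \<open>exp (- c * s) - 1\<close>. The term belonging to the constant -1 occurs on both
  sides and cancels.\<close>

lemma indefinite_integral_exp_mult:
  fixes g :: "real \<Rightarrow> real"
  assumes g: "set_integrable lborel {0..t} g" and t: "0 \<le> t"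
  shows "set_integrable lborel {0..t} (\<lambda>s. exp (-c * s) * g s)"
    and "set_integrable lborel {0..t} (\<lambda>s. exp (-c * s) * (LINT r:{0..s}|lborel. g r))"
    and "exp (-c * t) * (LINT s:{0..t}|lborel. g s) =
      (LINT s:{0..t}|lborel. exp (-c * s) * g s) - c * (LINT s:{0..t}|lborel. exp (-c * s) * (LINT r:{0..s}|lborel. g r))"
proof -
  have int: "set_integrable lborel {0..s} (\<lambda>r. exp (- c * r))" for s
    by (rule borel_integrable_atLeastAtMost') (auto intro!: continuous_intros)
  define k where "k r = -c * exp (- c * r)" for r
  have h: "set_integrable lborel {0..s} k" for s
    unfolding k_def by (intro set_integrable_mult_right int)
  have H: "(LINT r:{0..s}|lborel. k r) = exp (-c * s) - 1" if "0 \<le> s" for s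
  proof -
    have "(LINT r:{0..s}|lborel. k r) = exp (-c * s) - exp (-c * 0)"
      unfolding set_lebesgue_integral_def k_def
      by (rule integral_FTC_Icc[OF that])
        (auto intro!: derivative_eq_intros continuous_intros simp: has_real_derivative_iff_has_vector_derivative[symmetric])
    then show ?thesis by simp
  qed
  note m = indefinite_integral_mult[OF g h] indefinite_integral_mult(1)[OF h g]
  have eq: "indicator {0..t} s *\<^sub>R (g s * (LINT r:{0..s}|lborel. k r)) = indicator {0..t} s *\<^sub>R (exp (-c * s) * g s - g s)" for s
  proof (cases "s \<in> {0..t}")
    case True
    then have "0 \<le> s" by simp
    show ?thesis unfolding H[OF \<open>0 \<le> s\<close>] by (simp add: algebra_simps)
  qed simp
  have "set_integrable lborel {0..t} (\<lambda>s. exp (-c * s) * g s - g s)"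
    using m(1) unfolding set_integrable_def eq by simp
  from set_integral_add(1)[OF this g] show 1: "set_integrable lborel {0..t} (\<lambda>s. exp (-c * s) * g s)" by simp
  show 2: "set_integrable lborel {0..t} (\<lambda>s. exp (-c * s) * (LINT r:{0..s}|lborel. g r))"
  proof (cases "c = 0")
    case True
    show ?thesis using indefinite_integral_mult(1)[OF int[of t] g] by simp
  next
    case False
    show ?thesis using indefinite_integral_mult(1)[OF int[of t] g] by simp
  qed
  have "(LINT s:{0..t}|lborel. g s) * (exp (-c * t) - 1) =
    (LINT s:{0..t}|lborel. exp (-c * s) * g s - g s) + (LINT s:{0..t}|lborel. -c * (exp (-c * s) * (LINT r:{0..s}|lborel. g r)))"
  proof -
    have e2: "(LINT s:{0..t}|lborel. g s * (LINT r:{0..s}|lborel. k r)) = (LINT s:{0..t}|lborel. exp (-c * s) * g s - g s)"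
      unfolding set_lebesgue_integral_def[of lborel "{0..t}"] eq ..
    show ?thesis using m(2) unfolding e2 H[OF t] unfolding k_def mult.assoc .
  qed
  also have "\<dots> = (LINT s:{0..t}|lborel. exp (-c * s) * g s) - (LINT s:{0..t}|lborel. g s)
      - c * (LINT s:{0..t}|lborel. exp (-c * s) * (LINT r:{0..s}|lborel. g r))"
    unfolding set_integral_mult_right set_integral_diff(2)[OF 1 g] by simp
  finally show "exp (-c * t) * (LINT s:{0..t}|lborel. g s) =
      (LINT s:{0..t}|lborel. exp (-c * s) * g s) - c * (LINT s:{0..t}|lborel. exp (-c * s) * (LINT r:{0..s}|lborel. g r))"
    by (simp add: algebra_simps)
qed

text \<open>Multiplying the hypothesis by the integrating factor \<open>exp (-c * s)\<close> and
  integrating bounds the integral of \<open>g\<close>, which is then inserted into the hypothesis at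
  \<open>t\<close>. Keeping \<open>\<alpha>\<close> inside the integral, with no sign condition,
  matters later: there \<open>\<alpha>\<close> contains the negative of the output energy.\<close>

lemma gronwall_integrable:
  fixes g \<alpha> :: "real \<Rightarrow> real"
  assumes c: "0 \<le> c" and g: "set_integrable lborel {0..T} g" and a: "set_integrable lborel {0..T} \<alpha>"
    and le: "\<And>t. t \<in> {0..T} \<Longrightarrow> g t \<le> (LINT s:{0..t}|lborel. \<alpha> s) + c * (LINT s:{0..t}|lborel. g s)"
    and t: "t \<in> {0..T}"
  shows "g t \<le> (LINT s:{0..t}|lborel. exp (c * (t - s)) * \<alpha> s)"
proof -
  have gt: "set_integrable lborel {0..t} g" "set_integrable lborel {0..t} \<alpha>" and t0: "0 \<le> t"
    using t g a by (auto intro: set_integrable_subset)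
  note G = indefinite_integral_exp_mult[OF gt(1) t0, of c]
  note A = indefinite_integral_exp_mult[OF gt(2) t0, of c]
  have "exp (-c * t) * (LINT s:{0..t}|lborel. g s) =
     (LINT s:{0..t}|lborel. exp (-c * s) * g s - c * (exp (-c * s) * (LINT r:{0..s}|lborel. g r)))"
    using set_integral_diff(2)[OF G(1) set_integrable_mult_right[OF G(2), of c]] G(3) by simp
  also have "\<dots> \<le> (LINT s:{0..t}|lborel. exp (-c * s) * (LINT r:{0..s}|lborel. \<alpha> r))"
  proof (rule set_integral_mono[OF _ A(2)])
    show "set_integrable lborel {0..t} (\<lambda>s. exp (-c * s) * g s - c * (exp (-c * s) * (LINT r:{0..s}|lborel. g r)))"
      using set_integral_diff(1)[OF G(1) set_integrable_mult_right[OF G(2), of c]] by simp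
    fix s assume "s \<in> {0..t}"
    with le[of s] t have "g s - c * (LINT r:{0..s}|lborel. g r) \<le> (LINT r:{0..s}|lborel. \<alpha> r)" by auto
    from mult_left_mono[OF this, of "exp (-c * s)"]
    show "exp (-c * s) * g s - c * (exp (-c * s) * (LINT r:{0..s}|lborel. g r)) \<le> exp (-c * s) * (LINT r:{0..s}|lborel. \<alpha> r)"
      by (simp add: algebra_simps)
  qed
  finally have 1: "c * (exp (-c * t) * (LINT s:{0..t}|lborel. g s)) \<le> c * (LINT s:{0..t}|lborel. exp (-c * s) * (LINT r:{0..s}|lborel. \<alpha> r))"
    by (rule mult_left_mono[OF _ c])
  have "exp (-c * t) * g t \<le> exp (-c * t) * (LINT s:{0..t}|lborel. \<alpha> s) + c * (exp (-c * t) * (LINT s:{0..t}|lborel. g s))"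
    using mult_left_mono[OF le[OF t], of "exp (-c * t)"] by (simp add: algebra_simps)
  also have "\<dots> \<le> (LINT s:{0..t}|lborel. exp (-c * s) * \<alpha> s)"
    using 1 A(3) by simp
  finally have "exp (c * t) * (exp (-c * t) * g t) \<le> exp (c * t) * (LINT s:{0..t}|lborel. exp (-c * s) * \<alpha> s)"
    by (rule mult_left_mono) simp
  also have "\<dots> = (LINT s:{0..t}|lborel. exp (c * (t - s)) * \<alpha> s)"
  proof -
    have "exp (c * (t - s)) * \<alpha> s = exp (c * t) * (exp (-c * s) * \<alpha> s)" for s
      by (simp add: right_diff_distrib exp_diff exp_minus field_simps)
    then show ?thesis by (simp only: set_integral_mult_right)
  qed
  finally show ?thesis by (simp add: exp_minus mult.assoc[symmetric])
qed

text \<open>The distance truncated at 1 is bounded, so convergence in probability makes its mean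
  tend to zero. Convergence in L1 has an almost surely convergent subsequence, and distances below 1
  are not affected by the truncation.\<close>

lemma converges_in_prob_AE_subseq:
  fixes X :: "nat \<Rightarrow> 'a \<Rightarrow> 'b::{real_normed_vector,second_countable_topology}"
  assumes P: "prob_space Pr" and [measurable]: "\<And>n. X n \<in> borel_measurable Pr" "Z \<in> borel_measurable Pr"
    and conv: "converges_in_prob Pr X Z"
  obtains r where "strict_mono (r::nat \<Rightarrow> nat)" "AE \<omega> in Pr. (\<lambda>n. X (r n) \<omega>) \<longlonglongrightarrow> Z \<omega>"
proof -
  interpret prob_space Pr by fact
  define d where "d n \<omega> = min 1 (norm (X n \<omega> - Z \<omega>))" for n \<omega>
  have [measurable]: "d n \<in> borel_measurable Pr" for n unfolding d_def by measurable
  have di: "integrable Pr (d n)" for n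
    by (rule integrable_const_bound[of _ 1]) (auto simp: d_def)
  have "(\<lambda>n. \<integral>\<omega>. norm (d n \<omega>) \<partial>Pr) \<longlonglongrightarrow> 0"
  proof (rule LIMSEQ_I)
    fix e :: real assume e: "0 < e"
    have "(\<lambda>n. measure Pr {\<omega> \<in> space Pr. norm (X n \<omega> - Z \<omega>) > e / 2}) \<longlonglongrightarrow> 0"
      using conv half_gt_zero[OF e] unfolding converges_in_prob_def by blast
    from order_tendstoD(2)[OF this, of "e/2"] e
    have "\<forall>\<^sub>F n in sequentially. measure Pr {\<omega> \<in> space Pr. norm (X n \<omega> - Z \<omega>) > e / 2} < e / 2" by simp
    then obtain n0 where n0: "\<And>n. n \<ge> n0 \<Longrightarrow> measure Pr {\<omega> \<in> space Pr. norm (X n \<omega> - Z \<omega>) > e / 2} < e / 2"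
      by (auto simp: eventually_sequentially)
    have "norm ((\<integral>\<omega>. norm (d n \<omega>) \<partial>Pr) - 0) < e" if "n \<ge> n0" for n
    proof -
      have "(\<integral>\<omega>. norm (d n \<omega>) \<partial>Pr) \<le> (\<integral>\<omega>. e / 2 + indicator {\<omega> \<in> space Pr. norm (X n \<omega> - Z \<omega>) > e / 2} \<omega> \<partial>Pr)"
      proof (rule integral_mono)
        show "integrable Pr (\<lambda>\<omega>. e / 2 + indicator {\<omega> \<in> space Pr. norm (X n \<omega> - Z \<omega>) > e / 2} \<omega>)"
          by (intro Bochner_Integration.integrable_add integrable_const integrable_real_indicator)
             (auto simp: emeasure_eq_measure)
        show "integrable Pr (\<lambda>\<omega>. norm (d n \<omega>))" using di[of n] by (rule integrable_norm)
      qed (use e in \<open>auto simp: d_def split: split_indicator\<close>)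
      also have "\<dots> = e / 2 + measure Pr {\<omega> \<in> space Pr. norm (X n \<omega> - Z \<omega>) > e / 2}"
        by (subst Bochner_Integration.integral_add)
          (auto intro!: integrable_real_indicator simp: prob_space emeasure_eq_measure)
      also have "\<dots> < e" using n0[OF that] by simp
      finally show ?thesis by simp
    qed
    then show "\<exists>no. \<forall>n\<ge>no. norm ((\<integral>\<omega>. norm (d n \<omega>) \<partial>Pr) - 0) < e" by blast
  qed
  from tendsto_L1_AE_subseq[OF di this] obtain r where r: "strict_mono r" "AE \<omega> in Pr. (\<lambda>n. d (r n) \<omega>) \<longlonglongrightarrow> 0"
    by blast
  from r(2) have "AE \<omega> in Pr. (\<lambda>n. X (r n) \<omega>) \<longlonglongrightarrow> Z \<omega>"
  proof eventually_elim
    case (elim \<omega>)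
    have "\<forall>\<^sub>F n in sequentially. d (r n) \<omega> < 1" using order_tendstoD(2)[OF elim, of 1] by simp
    then have "\<forall>\<^sub>F n in sequentially. d (r n) \<omega> = norm (X (r n) \<omega> - Z \<omega>)"
      by eventually_elim (auto simp: d_def min_def split: if_splits)
    with elim have "(\<lambda>n. norm (X (r n) \<omega> - Z \<omega>)) \<longlonglongrightarrow> 0" by (simp add: tendsto_cong)
    then show ?case by (metis LIM_zero_cancel tendsto_norm_zero_iff)
  qed
  with r(1) show thesis by (rule that)
qed

section \<open>Cadlag paths\<close>

text \<open>The one-sided limits bound the path near every time, and finitely many such
  neighbourhoods cover the compact interval.\<close>

lemma cadlag_on_bounded:
  fixes g :: "real \<Rightarrow> 'b::real_normed_vector"
  assumes g: "cadlag_on T g"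
  shows "bounded (g ` {0..T})"
proof -
  have loc: "\<exists>d>0. \<exists>C. \<forall>s\<in>{0..T}. dist s t < d \<longrightarrow> norm (g s) \<le> C" if t: "t \<in> {0..T}" for t
  proof -
    have R: "\<exists>d>0. \<exists>C. \<forall>s\<in>{0..T}. t < s \<and> s < t + d \<longrightarrow> norm (g s) \<le> C"
    proof (cases "t < T")
      case True
      then have "((\<lambda>s. norm (g s)) \<longlongrightarrow> norm (g t)) (at_right t)"
        using g t by (auto simp: cadlag_on_def intro: tendsto_norm)
      from order_tendstoD(2)[OF this, of "norm (g t) + 1"]
      have "eventually (\<lambda>s. norm (g s) < norm (g t) + 1) (at_right t)" by simp
      then obtain b where "b > t" "\<And>s. t < s \<Longrightarrow> s < b \<Longrightarrow> norm (g s) < norm (g t) + 1"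
        by (auto simp: eventually_at_right_field)
      then show ?thesis
        by (intro exI[where x="b - t"], intro conjI exI[where x="norm (g t) + 1"]) (auto intro: less_imp_le)
    qed (auto intro!: exI[of _ 1])
    have L: "\<exists>d>0. \<exists>C. \<forall>s\<in>{0..T}. s < t \<and> t - d < s \<longrightarrow> norm (g s) \<le> C"
    proof (cases "0 < t")
      case True
      then obtain l where "(g \<longlongrightarrow> l) (at_left t)" using g t unfolding cadlag_on_def by force
      then have "((\<lambda>s. norm (g s)) \<longlongrightarrow> norm l) (at_left t)" by (rule tendsto_norm)
      from order_tendstoD(2)[OF this, of "norm l + 1"]
      have "eventually (\<lambda>s. norm (g s) < norm l + 1) (at_left t)" by simp
      then obtain b where "b < t" "\<And>s. b < s \<Longrightarrow> s < t \<Longrightarrow> norm (g s) < norm l + 1"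
        by (auto simp: eventually_at_left_field)
      then show ?thesis
        by (intro exI[where x="t - b"], intro conjI exI[where x="norm l + 1"]) (auto intro: less_imp_le)
    qed (auto intro!: exI[of _ 1])
    from R obtain d1 C1 where 1: "d1 > 0" "\<And>s. s \<in> {0..T} \<Longrightarrow> t < s \<Longrightarrow> s < t + d1 \<Longrightarrow> norm (g s) \<le> C1" by blast
    from L obtain d2 C2 where 2: "d2 > 0" "\<And>s. s \<in> {0..T} \<Longrightarrow> s < t \<Longrightarrow> t - d2 < s \<Longrightarrow> norm (g s) \<le> C2" by blast
    show ?thesis
    proof (rule exI[of _ "min d1 d2"], intro conjI exI[of _ "max (norm (g t)) (max C1 C2)"] ballI impI)
      fix s assume s: "s \<in> {0..T}" "dist s t < min d1 d2"
      then consider "s = t" | "t < s" "s < t + d1" | "s < t" "t - d2 < s"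
        by (cases s t rule: linorder_cases) (auto simp: dist_real_def)
      then show "norm (g s) \<le> max (norm (g t)) (max C1 C2)"
        using 1(2)[OF s(1)] 2(2)[OF s(1)] by cases (auto simp: le_max_iff_disj)
    qed (use 1 2 in auto)
  qed
  then obtain d C where d: "\<And>t. t \<in> {0..T} \<Longrightarrow> 0 < d t"
    and C: "\<And>t s. t \<in> {0..T} \<Longrightarrow> s \<in> {0..T} \<Longrightarrow> dist s t < d t \<Longrightarrow> norm (g s) \<le> C t" by metis
  have "{0..T} \<subseteq> (\<Union>t\<in>{0..T}. ball t (d t))" using d by force
  then obtain D where D: "D \<subseteq> {0..T}" "finite D" "{0..T} \<subseteq> (\<Union>t\<in>D. ball t (d t))"
    using compactE_image[OF compact_Icc, of "{0..T}" "\<lambda>t. ball t (d t)"] by (metis open_ball)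
  have "norm (g s) \<le> Max (insert 0 (C ` D))" if s: "s \<in> {0..T}" for s
  proof -
    from D(3) s obtain t where t: "t \<in> D" "dist s t < d t" by (auto simp: dist_commute)
    with C[of t s] D(1) s have "norm (g s) \<le> C t" by auto
    also have "\<dots> \<le> Max (insert 0 (C ` D))" using t D(2) by (intro Max_ge) auto
    finally show ?thesis .
  qed
  then show ?thesis by (auto simp: bounded_iff intro!: exI[of _ "Max (insert 0 (C ` D))"])
qed

text \<open>A time \<open>t\<close> with left limit below \<open>g t\<close> is recorded by a
  rational \<open>p\<close> strictly between the two values and a rational \<open>r\<close> before
  \<open>t\<close> such that \<open>g\<close> stays below \<open>p\<close> between \<open>r\<close>
  and \<open>t\<close>. Two different times cannot share such a pair, since the earlier one has a
  value above \<open>p\<close> inside the window of the later one.\<close>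

lemma countable_left_jumps_real:
  fixes g :: "real \<Rightarrow> real"
  shows "countable {t. \<exists>l. (g \<longlongrightarrow> l) (at_left t) \<and> l < g t}"
proof -
  define S where "S p r = {t. r < t \<and> p < g t \<and> (\<forall>s. r < s \<and> s < t \<longrightarrow> g s < p)}" for p r :: real
  have one: "t = t'" if "t \<in> S p r" "t' \<in> S p r" for p r t t'
    using that by (cases t t' rule: linorder_cases) (auto simp: S_def dest: spec[of _ t] spec[of _ t'])
  have cS: "countable (S p r)" for p r
  proof (cases "S p r = {}")
    case False
    then obtain t where "t \<in> S p r" by auto
    with one have "S p r = {t}" by auto
    then show ?thesis by simp
  qed simp
  have "{t. \<exists>l. (g \<longlongrightarrow> l) (at_left t) \<and> l < g t} \<subseteq> (\<Union>p\<in>\<rat>. \<Union>r\<in>\<rat>. S p r)"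
  proof safe
    fix t l assume l: "(g \<longlongrightarrow> l) (at_left t)" "l < g t"
    obtain p where p: "p \<in> \<rat>" "l < p" "p < g t" using Rats_dense_in_real[OF l(2)] by auto
    from order_tendstoD(2)[OF l(1) p(2)] obtain b where b: "b < t" "\<And>s. b < s \<Longrightarrow> s < t \<Longrightarrow> g s < p"
      by (auto simp: eventually_at_left_field)
    obtain r where "r \<in> \<rat>" "b < r" "r < t" using Rats_dense_in_real[OF b(1)] by auto
    with p b show "t \<in> (\<Union>p\<in>\<rat>. \<Union>r\<in>\<rat>. S p r)" by (force simp: S_def)
  qed
  moreover have "countable (\<Union>p\<in>\<rat>. \<Union>r\<in>\<rat>. S p r)"
    using cS by (intro countable_UN countable_rat) auto
  ultimately show ?thesis by (rule countable_subset)
qed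

text \<open>A jump of a vector shows in some component, upwards for it or for its negative, so the
  real case applies.\<close>

lemma countable_left_jumps:
  fixes g :: "real \<Rightarrow> real^'n"
  shows "countable {t. \<exists>l. (g \<longlongrightarrow> l) (at_left t) \<and> l \<noteq> g t}"
proof -
  define U where "U = (\<Union>i. {t. \<exists>l. ((\<lambda>s. g s $ i) \<longlongrightarrow> l) (at_left t) \<and> l < g t $ i} \<union>
       {t. \<exists>l. ((\<lambda>s. - g s $ i) \<longlongrightarrow> l) (at_left t) \<and> l < - g t $ i})"
  have "countable U" unfolding U_def
    by (intro countable_UN countable_Un countable_left_jumps_real) auto
  moreover have "{t. \<exists>l. (g \<longlongrightarrow> l) (at_left t) \<and> l \<noteq> g t} \<subseteq> U"
  proof safe
    fix t l assume l: "(g \<longlongrightarrow> l) (at_left t)" "l \<noteq> g t"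
    then obtain i where "l $ i \<noteq> g t $ i" by (auto simp: vec_eq_iff)
    moreover have "((\<lambda>s. g s $ i) \<longlongrightarrow> l $ i) (at_left t)" "((\<lambda>s. - g s $ i) \<longlongrightarrow> - l $ i) (at_left t)"
      using l by (auto intro!: tendsto_intros)
    ultimately show "t \<in> U" unfolding U_def by (auto simp: linorder_neq_iff intro!: exI[of _ i]) 
  qed
  ultimately show ?thesis by (rule countable_subset[rotated])
qed

text \<open>The path is sampled at the next grid time to the right, capped at \<open>t\<close>, and
  right-continuity makes the samples converge. Because of the cap only times up to \<open>t\<close>
  are sampled, so \<open>M\<close> may be the sigma-algebra at time \<open>t\<close>: this is
  progressive measurability.\<close>

lemma cadlag_adapted_measurable:
  fixes X :: "real \<Rightarrow> 'a \<Rightarrow> 'b::{real_normed_vector,second_countable_topology}"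
  assumes t: "0 \<le> t" and X: "\<And>s. s \<in> {0..t} \<Longrightarrow> X s \<in> borel_measurable M"
    and right: "\<And>s \<omega>. s \<in> {0..<t} \<Longrightarrow> \<omega> \<in> space M \<Longrightarrow> ((\<lambda>s. X s \<omega>) \<longlongrightarrow> X s \<omega>) (at_right s)"
  shows "(\<lambda>(s, \<omega>). indicator {0..t} s *\<^sub>R X s \<omega>) \<in> borel_measurable (borel \<Otimes>\<^sub>M M)"
proof (rule borel_measurable_LIMSEQ_metric)
  \<comment> \<open>Floor plus one lies strictly to the right of \<open>s\<close>, as a limit along
    \<open>at_right s\<close> requires; inside the horizon only \<open>s = t\<close> is sampled at
    itself.\<close>
  define q where "q n s = max 0 (min t ((real_of_int \<lfloor>real (Suc n) * s\<rfloor> + 1) / real (Suc n)))" for n and s :: real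
  define Z where "Z n = (\<lambda>(s, \<omega>). indicator {0..t} s *\<^sub>R X (q n s) \<omega>)" for n
  show "Z n \<in> borel_measurable (borel \<Otimes>\<^sub>M M)" for n
  proof -
    have [measurable]: "(\<lambda>z. X (max 0 (min t ((real_of_int i + 1) / real (Suc n)))) (snd z)) \<in> borel_measurable (borel \<Otimes>\<^sub>M M)" for i
      by (intro measurable_compose[OF measurable_snd X]) (use t in auto)
    have "(\<lambda>z. X (max 0 (min t ((real_of_int \<lfloor>real (Suc n) * fst z\<rfloor> + 1) / real (Suc n)))) (snd z)) \<in> borel_measurable (borel \<Otimes>\<^sub>M M)"
      by (rule measurable_compose_countable[where f="\<lambda>i z. X (max 0 (min t ((real_of_int i + 1) / real (Suc n)))) (snd z)" and g="\<lambda>z. \<lfloor>real (Suc n) * fst z\<rfloor>"])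
        measurable
    then have [measurable]: "(\<lambda>z. X (q n (fst z)) (snd z)) \<in> borel_measurable (borel \<Otimes>\<^sub>M M)"
      unfolding q_def .
    show ?thesis unfolding Z_def split_beta' by measurable
  qed
  fix z :: "real \<times> 'a" assume "z \<in> space (borel \<Otimes>\<^sub>M M)"
  then obtain s \<omega> where z: "z = (s, \<omega>)" "\<omega> \<in> space M" by (auto simp: space_pair_measure)
  show "(\<lambda>n. Z n z) \<longlonglongrightarrow> (case z of (s, \<omega>) \<Rightarrow> indicator {0..t} s *\<^sub>R X s \<omega>)"
  proof (cases "s \<in> {0..t}")
    case True
    have gt: "s < (real_of_int \<lfloor>real (Suc n) * s\<rfloor> + 1) / real (Suc n)" for n
      by (simp add: pos_less_divide_eq mult.commute[of s] del: of_nat_Suc)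
    have ub: "(real_of_int \<lfloor>real (Suc n) * s\<rfloor> + 1) / real (Suc n) \<le> s + 1 / real (Suc n)" for n
      by (simp add: field_simps del: of_nat_Suc)
    have q0: "q n s = min t ((real_of_int \<lfloor>real (Suc n) * s\<rfloor> + 1) / real (Suc n))" for n
      using True gt[of n] t unfolding q_def by auto
    have "(\<lambda>n. X (q n s) \<omega>) \<longlonglongrightarrow> X s \<omega>"
    proof (cases "s = t")
      case True
      have "q n s = t" for n using gt[of n] q0[of n] True by (simp add: min_def)
      then show ?thesis using True by simp
    next
      case False
      with True have st: "s < t" by simp
      have "q n s > s" for n using gt[of n] st unfolding q0 by simp
      moreover have "(\<lambda>n. q n s) \<longlonglongrightarrow> s"
      proof (rule tendsto_sandwich[OF always_eventually always_eventually tendsto_const])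
        show "\<forall>n. s \<le> q n s" using calculation by (auto intro: less_imp_le)
        show "\<forall>n. q n s \<le> s + 1 / real (Suc n)" using ub unfolding q0 by (auto intro: min.coboundedI2)
        have "(\<lambda>n. s + 1 / real (Suc n)) \<longlonglongrightarrow> s + 0" by (intro tendsto_intros LIMSEQ_Suc lim_1_over_n)
        then show "(\<lambda>n. s + 1 / real (Suc n)) \<longlonglongrightarrow> s" by simp
      qed
      ultimately have "filterlim (\<lambda>n. q n s) (at_right s) sequentially"
        by (auto simp: filterlim_at less_imp_neq[symmetric] intro!: always_eventually)
      from filterlim_compose[OF right[of s \<omega>] this] True st z show ?thesis by auto
    qed
    then show ?thesis using True by (simp add: Z_def z)
  qed (simp add: Z_def z)
qed

section \<open>Integrals over time and probability\<close>

text \<open>The given notions integrate over a product with a restricted time axis. This turns them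
  into integrals over the full product with an indicator in time, the form in which everything below
  is computed.\<close>

lemma pair_measure_restrict_space_left:
  assumes M: "sigma_finite_measure M" and N: "sigma_finite_measure N" and A: "A \<in> sets M"
  shows "restrict_space M A \<Otimes>\<^sub>M N = restrict_space (M \<Otimes>\<^sub>M N) (A \<times> space N)"
proof (rule pair_measure_eqI)
  have AN: "A \<times> space N \<in> sets (M \<Otimes>\<^sub>M N)" using A by auto
  show "sets (restrict_space M A \<Otimes>\<^sub>M N) = sets (restrict_space (M \<Otimes>\<^sub>M N) (A \<times> space N))"
  proof (rule antisym)
    show "sets (restrict_space M A \<Otimes>\<^sub>M N) \<subseteq> sets (restrict_space (M \<Otimes>\<^sub>M N) (A \<times> space N))"
    proof (rule sets_pair_in_sets)
      fix a b assume "a \<in> sets (restrict_space M A)" "b \<in> sets N"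
      then show "a \<times> b \<in> sets (restrict_space (M \<Otimes>\<^sub>M N) (A \<times> space N))"
        using A AN sets.sets_into_space[of b N] by (subst sets_restrict_space_iff) (auto simp: sets_restrict_space_iff)
    qed
    show "sets (restrict_space (M \<Otimes>\<^sub>M N) (A \<times> space N)) \<subseteq> sets (restrict_space M A \<Otimes>\<^sub>M N)"
    proof
      fix C assume "C \<in> sets (restrict_space (M \<Otimes>\<^sub>M N) (A \<times> space N))"
      then have C: "C \<subseteq> A \<times> space N" "C \<in> sets (M \<Otimes>\<^sub>M N)" using AN by (auto simp: sets_restrict_space_iff)
      have "(\<lambda>z. (fst z, snd z)) \<in> restrict_space M A \<Otimes>\<^sub>M N \<rightarrow>\<^sub>M M \<Otimes>\<^sub>M N"
        by (intro measurable_Pair measurable_compose[OF measurable_fst measurable_restrict_space1] measurable_snd) simp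
      from measurable_sets[OF this C(2)] C(1) sets.sets_into_space[OF A]
      show "C \<in> sets (restrict_space M A \<Otimes>\<^sub>M N)"
        by (simp add: space_pair_measure vimage_def space_restrict_space Int_absorb2 subset_iff)
    qed
  qed
  show "sigma_finite_measure (restrict_space M A)" using M A by (rule sigma_finite_measure_restrict_space)
  show "sigma_finite_measure N" by fact
  interpret N: sigma_finite_measure N by fact
  fix a b assume ab: "a \<in> sets (restrict_space M A)" "b \<in> sets N"
  then have a: "a \<in> sets M" "a \<subseteq> A" using A by (auto simp: sets_restrict_space_iff)
  show "emeasure (restrict_space M A) a * emeasure N b = emeasure (restrict_space (M \<Otimes>\<^sub>M N) (A \<times> space N)) (a \<times> b)"
    using a ab(2) A AN sets.sets_into_space[OF ab(2)]
    by (subst (1 2) emeasure_restrict_space) (auto simp: N.emeasure_pair_measure_Times)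
qed

lemma time_integrable_iff:
  assumes P: "prob_space Pr"
  shows "time_integrable Pr t g \<longleftrightarrow> integrable (lborel \<Otimes>\<^sub>M Pr) (\<lambda>(s, \<omega>). indicator {0..t} s * g s \<omega>)"
proof -
  interpret prob_space Pr by fact
  have "time_integrable Pr t g \<longleftrightarrow> integrable (restrict_space (lborel \<Otimes>\<^sub>M Pr) ({0..t} \<times> space Pr)) (\<lambda>(s, \<omega>). g s \<omega>)"
    unfolding time_integrable_def
    by (subst pair_measure_restrict_space_left) (auto intro: lborel.sigma_finite_measure_axioms sigma_finite_measure_axioms)
  also have "\<dots> \<longleftrightarrow> integrable (lborel \<Otimes>\<^sub>M Pr) (\<lambda>z. indicator ({0..t} \<times> space Pr) z *\<^sub>R (case z of (s, \<omega>) \<Rightarrow> g s \<omega>))"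
    by (rule integrable_restrict_space) auto
  also have "\<dots> \<longleftrightarrow> integrable (lborel \<Otimes>\<^sub>M Pr) (\<lambda>(s, \<omega>). indicator {0..t} s * g s \<omega>)"
    by (rule Bochner_Integration.integrable_cong) (auto simp: space_pair_measure indicator_times)
  finally show ?thesis .
qed

lemma jointly_measurable_iff:
  fixes X :: "real \<Rightarrow> 'a \<Rightarrow> 'b::real_normed_vector"
  assumes P: "prob_space Pr"
  shows "jointly_measurable Pr T X \<longleftrightarrow> (\<lambda>(s, \<omega>). indicator {0..T} s *\<^sub>R X s \<omega>) \<in> borel_measurable (borel \<Otimes>\<^sub>M Pr)"
proof -
  interpret prob_space Pr by fact
  have "jointly_measurable Pr T X \<longleftrightarrow> (\<lambda>(s, \<omega>). X s \<omega>) \<in> borel_measurable (restrict_space (lborel \<Otimes>\<^sub>M Pr) ({0..T} \<times> space Pr))"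
    unfolding jointly_measurable_def
    by (subst pair_measure_restrict_space_left) (auto intro: lborel.sigma_finite_measure_axioms sigma_finite_measure_axioms)
  also have "\<dots> \<longleftrightarrow> (\<lambda>z. indicator ({0..T} \<times> space Pr) z *\<^sub>R (case z of (s, \<omega>) \<Rightarrow> X s \<omega>)) \<in> borel_measurable (lborel \<Otimes>\<^sub>M Pr)"
    by (rule borel_measurable_restrict_space_iff) auto
  also have "\<dots> \<longleftrightarrow> (\<lambda>(s, \<omega>). indicator {0..T} s *\<^sub>R X s \<omega>) \<in> borel_measurable (lborel \<Otimes>\<^sub>M Pr)"
    by (rule measurable_cong) (auto simp: space_pair_measure indicator_times)
  also have "\<dots> \<longleftrightarrow> (\<lambda>(s, \<omega>). indicator {0..T} s *\<^sub>R X s \<omega>) \<in> borel_measurable (borel \<Otimes>\<^sub>M Pr)"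
    by (simp add: measurable_def space_pair_measure cong: sets_pair_measure_cong)
  finally show ?thesis .
qed

text \<open>\<open>time_mean\<close> iterates the two integrals with time inside; integrability over
  the product licenses Fubini.\<close>

lemma time_mean_eq:
  assumes P: "prob_space Pr" and g: "time_integrable Pr t g"
  shows "time_mean Pr t g = (\<integral>z. indicator {0..t} (fst z) * g (fst z) (snd z) \<partial>(lborel \<Otimes>\<^sub>M Pr))"
proof -
  interpret prob_space Pr by fact
  interpret pair_sigma_finite lborel Pr ..
  note i = g[unfolded time_integrable_iff[OF P]]
  show "time_mean Pr t g = (\<integral>z. indicator {0..t} (fst z) * g (fst z) (snd z) \<partial>(lborel \<Otimes>\<^sub>M Pr))"
    using integral_snd[OF i] by (simp add: time_mean_def set_lebesgue_integral_def split_beta')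
qed

section \<open>Increments of the noise\<close>

lemma borel_measurable_vec_nth:
  "f \<in> borel_measurable M \<Longrightarrow> (\<lambda>x. (f x :: real^'n) $ i) \<in> borel_measurable M"
  by (rule borel_measurable_continuous_on[where f="\<lambda>v. v $ i"]) (auto intro!: continuous_intros)

lemma integrable_vec_nth: "integrable M f \<Longrightarrow> integrable M (\<lambda>x. (f x :: real^'n) $ i)"
  by (rule integrable_bounded_linear[OF bounded_linear_vec_nth])

lemma integral_vec_nth: "integrable M f \<Longrightarrow> (\<integral>x. (f x :: real^'n) $ i \<partial>M) = (\<integral>x. f x \<partial>M) $ i"
  by (rule integral_bounded_linear[OF bounded_linear_vec_nth])

lemma (in finite_measure) sqint_imp_integrable: "sqint M f \<Longrightarrow> integrable M f"
proof (rule Bochner_Integration.integrable_bound[of _ "\<lambda>x. 1 + (norm (f x))\<^sup>2"])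
  have "a \<le> 1 + a\<^sup>2" if "0 \<le> a" for a :: real using sum_squares_bound[of 1 a] that by simp
  then show "AE x in M. norm (f x) \<le> norm (1 + (norm (f x))\<^sup>2)" by (intro AE_I2) simp
qed (auto simp: sqint_def)

locale levy_driven =
  fixes Pr :: "'a measure" and T :: real and F :: "real \<Rightarrow> 'a measure"
    and M :: "real \<Rightarrow> 'a \<Rightarrow> real^'d" and K :: "real^'d^'d"
  assumes T_pos: "0 < T" and filt: "filtered_prob_space Pr T F" and noise: "levy_noise Pr T F M K"
begin

sublocale prob_space Pr
  using filt by (simp add: filtered_prob_space_def)

sublocale time: pair_sigma_finite lborel Pr ..

abbreviation Lam :: "(real \<times> 'a) measure" where
  "Lam \<equiv> lborel \<Otimes>\<^sub>M Pr"

text \<open>Integrals over time and probability are kept on the product space; \<open>Lint t g\<close> is the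
  expectation of the integral of \<open>g\<close> over \<open>[0,t]\<close>.\<close>

abbreviation joint :: "(real \<Rightarrow> 'a \<Rightarrow> 'b::topological_space) \<Rightarrow> bool" where
  "joint g \<equiv> (\<lambda>z. g (fst z) (snd z)) \<in> borel_measurable (borel \<Otimes>\<^sub>M Pr)"

abbreviation Lint :: "real \<Rightarrow> (real \<Rightarrow> 'a \<Rightarrow> real) \<Rightarrow> real" where
  "Lint t g \<equiv> (\<integral>z. indicator {0..t} (fst z) * g (fst z) (snd z) \<partial>Lam)"

abbreviation Lintegrable :: "real \<Rightarrow> (real \<Rightarrow> 'a \<Rightarrow> real) \<Rightarrow> bool" where
  "Lintegrable t g \<equiv> integrable Lam (\<lambda>z. indicator {0..t} (fst z) * g (fst z) (snd z))"

abbreviation Lsqint :: "real \<Rightarrow> (real \<Rightarrow> 'a \<Rightarrow> 'b::euclidean_space) \<Rightarrow> bool" where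
  "Lsqint t g \<equiv> sqint Lam (\<lambda>z. indicator {0..t} (fst z) *\<^sub>R g (fst z) (snd z))"

lemma F_subalgebra: "t \<in> {0..T} \<Longrightarrow> subalgebra Pr (F t)"
  using filt by (simp add: filtered_prob_space_def)

lemma F_measurable_Pr: "t \<in> {0..T} \<Longrightarrow> f \<in> borel_measurable (F t) \<Longrightarrow> f \<in> borel_measurable Pr"
  by (rule measurable_from_subalg[OF F_subalgebra])

lemma space_F: "t \<in> {0..T} \<Longrightarrow> space (F t) = space Pr"
  using F_subalgebra by (simp add: subalgebra_def)

lemma F_measurable_mono:
  assumes "f \<in> borel_measurable (F s)" "0 \<le> s" "s \<le> t" "t \<le> T"
  shows "f \<in> borel_measurable (F t)"
proof (rule measurable_from_subalg[OF _ assms(1)])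
  have "sets (F s) \<subseteq> sets (F t)"
    using filt assms by (auto simp: filtered_prob_space_def)
  then show "subalgebra (F t) (F s)" using assms by (simp add: subalgebra_def space_F)
qed

definition inc :: "'d \<Rightarrow> real \<Rightarrow> real \<Rightarrow> 'a \<Rightarrow> real" where
  "inc i s t \<omega> = M t \<omega> $ i - M s \<omega> $ i"

lemma inc_add: "inc i s t \<omega> + inc i t v \<omega> = inc i s v \<omega>"
  by (simp add: inc_def)

lemma inc_same [simp]: "inc i s s \<omega> = 0"
  by (simp add: inc_def)

lemma M_sqint: "t \<in> {0..T} \<Longrightarrow> sqint Pr (M t)"
  using noise by (auto simp: levy_noise_def levy_process_def sqint_def)

lemma M_measurable_F: "t \<in> {0..T} \<Longrightarrow> M t \<in> borel_measurable (F t)"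
  using noise by (auto simp: levy_noise_def adapted_def)

lemma M_component_sqint: "t \<in> {0..T} \<Longrightarrow> sqint Pr (\<lambda>\<omega>. M t \<omega> $ i)"
  by (rule sqint_mono[OF M_sqint, of t _ 1]) (auto intro!: borel_measurable_vec_nth sqint_measurable[OF M_sqint] simp: component_le_norm_cart)

lemma inc_sqint: "s \<in> {0..T} \<Longrightarrow> t \<in> {0..T} \<Longrightarrow> sqint Pr (inc i s t)"
  unfolding inc_def[abs_def] by (intro sqint_diff M_component_sqint)

lemma inc_measurable_F: "0 \<le> s \<Longrightarrow> s \<le> t \<Longrightarrow> t \<le> T \<Longrightarrow> inc i s t \<in> borel_measurable (F t)"
  unfolding inc_def[abs_def]
  using M_measurable_F[of t] F_measurable_mono[OF M_measurable_F[of s], of t]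
  by (intro borel_measurable_diff borel_measurable_vec_nth) auto


lemma inc_integrable: "s \<in> {0..T} \<Longrightarrow> t \<in> {0..T} \<Longrightarrow> integrable Pr (inc i s t)"
  by (intro sqint_imp_integrable inc_sqint)

lemma M_mean: "t \<in> {0..T} \<Longrightarrow> (\<integral>\<omega>. M t \<omega> $ i \<partial>Pr) = 0"
proof -
  assume t: "t \<in> {0..T}"
  from sqint_imp_integrable[OF M_sqint[OF t]] have "(\<integral>\<omega>. M t \<omega> $ i \<partial>Pr) = (\<integral>\<omega>. M t \<omega> \<partial>Pr) $ i"
    by (rule integral_vec_nth)
  then show ?thesis using noise t by (simp add: levy_noise_def)
qed

lemma inc_mean: "s \<in> {0..T} \<Longrightarrow> t \<in> {0..T} \<Longrightarrow> (\<integral>\<omega>. inc i s t \<omega> \<partial>Pr) = 0"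
  unfolding inc_def
  by (subst Bochner_Integration.integral_diff) (auto intro!: sqint_imp_integrable M_component_sqint simp: M_mean)

text \<open>Stationarity moves the increment to \<open>M (t - s)\<close>, whose second moments are
  given by \<open>K\<close>.\<close>

lemma inc_covariance:
  assumes "0 \<le> s" "s \<le> t" "t \<le> T"
  shows "(\<integral>\<omega>. inc i s t \<omega> * inc j s t \<omega> \<partial>Pr) = K $ i $ j * (t - s)"
proof -
  have meas [measurable]: "M r \<in> borel_measurable Pr" if "r \<in> {0..T}" for r
    using M_sqint[OF that] by (rule sqint_measurable)
  have [measurable]: "(\<lambda>v::real^'d. v $ i * v $ j) \<in> borel_measurable borel"
    by (intro borel_measurable_times borel_measurable_vec_nth) auto
  have "(\<integral>\<omega>. inc i s t \<omega> * inc j s t \<omega> \<partial>Pr) = (\<integral>v. v $ i * v $ j \<partial>distr Pr borel (\<lambda>\<omega>. M t \<omega> - M s \<omega>))"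
    using meas[of s] meas[of t] assms by (subst integral_distr) (auto simp: inc_def)
  also have "distr Pr borel (\<lambda>\<omega>. M t \<omega> - M s \<omega>) = distr Pr borel (M (t - s))"
    using noise assms by (auto simp: levy_noise_def levy_process_def)
  also have "(\<integral>v. v $ i * v $ j \<partial>distr Pr borel (M (t - s))) = (\<integral>\<omega>. M (t - s) \<omega> $ i * M (t - s) \<omega> $ j \<partial>Pr)"
    using meas[of "t - s"] assms by (subst integral_distr) auto
  also have "\<dots> = K $ i $ j * (t - s)"
    using noise assms by (auto simp: levy_noise_def)
  finally show ?thesis .
qed

text \<open>Symmetry of \<open>K\<close> is read off from the second moments of the increment over
  \<open>[0,T]\<close>, an interval of positive length.\<close>

lemma K_sym: "K $ i $ j = K $ j $ i"
  using inc_covariance[of 0 T i j] inc_covariance[of 0 T j i] T_pos by (simp add: mult.commute)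

text \<open>The noise provides independence of two sigma-algebras, and those generated by
  \<open>\<zeta>\<close> and by \<open>\<phi>\<close> of the increment are contained in them. A
  general \<open>\<phi>\<close> is allowed so that products of two components of the increment are
  covered too.\<close>

lemma indep_increment:
  fixes \<zeta> :: "'a \<Rightarrow> real" and \<phi> :: "real^'d \<Rightarrow> real"
  assumes st: "0 \<le> s" "s \<le> t" "t \<le> T" and z: "\<zeta> \<in> borel_measurable (F s)" and p [measurable]: "\<phi> \<in> borel_measurable borel"
  shows "indep_var borel \<zeta> borel (\<lambda>\<omega>. \<phi> (M t \<omega> - M s \<omega>))"
proof -
  let ?V = "vimage_algebra (space Pr) (\<lambda>\<omega>. M t \<omega> - M s \<omega>) borel"
  have [measurable]: "M s \<in> borel_measurable Pr" "M t \<in> borel_measurable Pr" "\<zeta> \<in> borel_measurable Pr"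
    using st F_measurable_Pr[OF _ z] by (auto intro!: sqint_measurable M_sqint)
  have V: "(\<lambda>\<omega>. \<phi> (M t \<omega> - M s \<omega>)) \<in> borel_measurable ?V"
    by (rule measurable_compose[OF measurable_vimage_algebra1 p]) auto
  have "indep_set (sets (F s)) (sets ?V)" using noise st by (auto simp: levy_noise_def)
  moreover have 1: "sigma_sets (space Pr) {\<zeta> -` A \<inter> space Pr |A. A \<in> sets borel} \<subseteq> sets (F s)"
    using measurable_sets[OF z] space_F[of s] st
      sets.sigma_sets_subset[of "{\<zeta> -` A \<inter> space Pr |A. A \<in> sets borel}" "F s"] by auto
  moreover have 2: "sigma_sets (space Pr) {(\<lambda>\<omega>. \<phi> (M t \<omega> - M s \<omega>)) -` A \<inter> space Pr |A. A \<in> sets borel} \<subseteq> sets ?V"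
    using measurable_sets[OF V]
      sets.sigma_sets_subset[of "{(\<lambda>\<omega>. \<phi> (M t \<omega> - M s \<omega>)) -` A \<inter> space Pr |A. A \<in> sets borel}" ?V] by auto
  ultimately have "indep_set (sigma_sets (space Pr) {\<zeta> -` A \<inter> space Pr |A. A \<in> sets borel})
       (sigma_sets (space Pr) {(\<lambda>\<omega>. \<phi> (M t \<omega> - M s \<omega>)) -` A \<inter> space Pr |A. A \<in> sets borel})"
    unfolding indep_set_def by - (erule indep_sets_mono_sets, use 1 2 in \<open>auto split: bool.split\<close>)
  then show ?thesis unfolding indep_var_eq by auto
qed

lemma orthogonal_increment:
  fixes \<zeta> :: "'a \<Rightarrow> real"
  assumes st: "0 \<le> s" "s \<le> t" "t \<le> T" and z: "\<zeta> \<in> borel_measurable (F s)" "integrable Pr \<zeta>"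
  shows "integrable Pr (\<lambda>\<omega>. \<zeta> \<omega> * inc i s t \<omega>)" "(\<integral>\<omega>. \<zeta> \<omega> * inc i s t \<omega> \<partial>Pr) = 0"
proof -
  have "indep_var borel \<zeta> borel (\<lambda>\<omega>. (M t \<omega> - M s \<omega>) $ i)"
    by (rule indep_increment[OF st z(1), of "\<lambda>v. v $ i"]) (intro borel_measurable_vec_nth, simp)
  then have ind: "indep_var borel \<zeta> borel (inc i s t)" by (simp add: inc_def[abs_def])
  show "integrable Pr (\<lambda>\<omega>. \<zeta> \<omega> * inc i s t \<omega>)"
    using indep_var_integrable[OF ind z(2) inc_integrable] st by simp
  show "(\<integral>\<omega>. \<zeta> \<omega> * inc i s t \<omega> \<partial>Pr) = 0"
    using indep_var_lebesgue_integral[OF ind z(2) inc_integrable] st by (simp add: inc_mean)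
qed

lemma increment_product_mean:
  fixes \<zeta> :: "'a \<Rightarrow> real"
  assumes st: "0 \<le> s" "s \<le> t" "t \<le> T" and z: "\<zeta> \<in> borel_measurable (F s)" "integrable Pr \<zeta>"
  shows "(\<integral>\<omega>. \<zeta> \<omega> * (inc i s t \<omega> * inc j s t \<omega>) \<partial>Pr) = K $ i $ j * (t - s) * (\<integral>\<omega>. \<zeta> \<omega> \<partial>Pr)"
proof -
  have "indep_var borel \<zeta> borel (\<lambda>\<omega>. (M t \<omega> - M s \<omega>) $ i * (M t \<omega> - M s \<omega>) $ j)"
    by (rule indep_increment[OF st z(1), of "\<lambda>v. v $ i * v $ j"]) (intro borel_measurable_times borel_measurable_vec_nth; simp)
  then have ind: "indep_var borel \<zeta> borel (\<lambda>\<omega>. inc i s t \<omega> * inc j s t \<omega>)" by (simp add: inc_def[abs_def])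
  have "integrable Pr (\<lambda>\<omega>. inc i s t \<omega> * inc j s t \<omega>)"
    using sqint_inner_integrable[OF inc_sqint inc_sqint, of s t s t i j] st by simp
  from indep_var_lebesgue_integral[OF ind z(2) this] show ?thesis using st by (simp add: inc_covariance)
qed

definition bounded_rv :: "real \<Rightarrow> ('a \<Rightarrow> 'b::euclidean_space) \<Rightarrow> bool" where
  "bounded_rv s \<xi> \<longleftrightarrow> \<xi> \<in> borel_measurable (F s) \<and> bounded (\<xi> ` space Pr)"

lemma bounded_rvE:
  assumes "bounded_rv s \<xi>"
  obtains C where "0 \<le> C" "\<And>\<omega>. \<omega> \<in> space Pr \<Longrightarrow> norm (\<xi> \<omega>) \<le> C"
  using assms unfolding bounded_rv_def bounded_pos by (meson image_eqI less_imp_le)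

lemma bounded_rv_mono: "bounded_rv s \<xi> \<Longrightarrow> 0 \<le> s \<Longrightarrow> s \<le> t \<Longrightarrow> t \<le> T \<Longrightarrow> bounded_rv t \<xi>"
  unfolding bounded_rv_def using F_measurable_mono by blast

lemma bounded_rv_integrable:
  assumes "bounded_rv s \<xi>" "s \<in> {0..T}" shows "integrable Pr \<xi>"
proof -
  obtain C where "\<And>\<omega>. \<omega> \<in> space Pr \<Longrightarrow> norm (\<xi> \<omega>) \<le> C" using bounded_rvE[OF assms(1)] by metis
  then show ?thesis
    by (intro integrable_const_bound[of _ C]) (use assms F_measurable_Pr in \<open>auto simp: bounded_rv_def\<close>)
qed

lemma bounded_rv_scale_sqint:
  assumes "bounded_rv s \<xi>" "s \<in> {0..T}" "sqint Pr (f::'a \<Rightarrow> real)"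
  shows "sqint Pr (\<lambda>\<omega>. f \<omega> *\<^sub>R \<xi> \<omega>)"
proof -
  obtain C where "\<And>\<omega>. \<omega> \<in> space Pr \<Longrightarrow> norm (\<xi> \<omega>) \<le> C" using bounded_rvE[OF assms(1)] by metis
  moreover have "\<xi> \<in> borel_measurable Pr" using assms(1,2) F_measurable_Pr by (auto simp: bounded_rv_def)
  ultimately show ?thesis
    using sqint_measurable[OF assms(3)]
    by (intro sqint_mono[OF assms(3), of _ C]) (auto simp: mult.commute[of C] intro!: mult_left_mono)
qed

lemma bounded_rv_inner:
  fixes X :: "real^'n^'n"
  assumes x: "bounded_rv s \<xi>" and y: "bounded_rv s \<eta>"
  shows "bounded_rv s (\<lambda>\<omega>. \<xi> \<omega> \<bullet> (X *v \<eta> \<omega>))"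
proof -
  obtain C where C: "0 \<le> C" "\<And>\<omega>. \<omega> \<in> space Pr \<Longrightarrow> norm (\<xi> \<omega>) \<le> C" using bounded_rvE[OF x] by metis
  obtain D where D: "0 \<le> D" "\<And>\<omega>. \<omega> \<in> space Pr \<Longrightarrow> norm (\<eta> \<omega>) \<le> D" using bounded_rvE[OF y] by metis
  obtain c where c: "0 \<le> c" "\<And>v. norm (X *v v) \<le> c * norm v" using matrix_vector_norm_le[of X] by metis
  have "\<bar>\<xi> \<omega> \<bullet> (X *v \<eta> \<omega>)\<bar> \<le> C * (c * D)" if "\<omega> \<in> space Pr" for \<omega>
  proof -
    have "\<bar>\<xi> \<omega> \<bullet> (X *v \<eta> \<omega>)\<bar> \<le> norm (\<xi> \<omega>) * norm (X *v \<eta> \<omega>)" by (rule Cauchy_Schwarz_ineq2)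
    also have "\<dots> \<le> C * (c * D)"
      using C D c that by (intro mult_mono order_trans[OF c(2)]) auto
    finally show ?thesis .
  qed
  then have "bounded ((\<lambda>\<omega>. \<xi> \<omega> \<bullet> (X *v \<eta> \<omega>)) ` space Pr)" by (auto simp: bounded_iff)
  moreover have "(\<lambda>\<omega>. \<xi> \<omega> \<bullet> (X *v \<eta> \<omega>)) \<in> borel_measurable (F s)"
    using x y by (auto simp: bounded_rv_def)
  ultimately show ?thesis by (simp add: bounded_rv_def)
qed

text \<open>Only the overlap of the intervals contributes. The part of the first increment before
  \<open>a'\<close> is known at time \<open>a'\<close>, to which the second increment is orthogonal;
  past the end of the overlap only one of the increments goes on, and it is orthogonal to everything
  known there.\<close>

lemma two_increments_mean_ordered:
  fixes \<eta> :: "'a \<Rightarrow> real"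
  assumes ab: "0 \<le> a" "a \<le> b" "b \<le> T" and ab': "a \<le> a'" "a' \<le> b'" "b' \<le> T" and e: "bounded_rv a' \<eta>"
  shows "(\<integral>\<omega>. \<eta> \<omega> * (inc i a b \<omega> * inc j a' b' \<omega>) \<partial>Pr) = K $ i $ j * max 0 (min b b' - a') * (\<integral>\<omega>. \<eta> \<omega> \<partial>Pr)"
proof -
  have in0: "a \<in> {0..T}" "b \<in> {0..T}" "a' \<in> {0..T}" "b' \<in> {0..T}" using ab ab' by auto
  have ei: "integrable Pr (\<lambda>\<omega>. \<eta> \<omega> * inc k u v \<omega>)" if "u \<in> {0..T}" "v \<in> {0..T}" for k u v
    using sqint_imp_integrable[OF bounded_rv_scale_sqint[OF e in0(3) inc_sqint[OF that, of k]]]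
    by (simp add: mult.commute)
  have eii: "integrable Pr (\<lambda>\<omega>. \<eta> \<omega> * inc k u v \<omega> * inc l u' v' \<omega>)"
    if "u \<in> {0..T}" "v \<in> {0..T}" "u' \<in> {0..T}" "v' \<in> {0..T}" for k u v l u' v'
    using sqint_inner_integrable[OF bounded_rv_scale_sqint[OF e in0(3) inc_sqint[OF that(1,2), of k]] inc_sqint[OF that(3,4), of l]]
    by (simp add: mult.commute)
  have em: "\<eta> \<in> borel_measurable (F r)" if "a' \<le> r" "r \<le> T" for r
    by (rule F_measurable_mono[OF e[unfolded bounded_rv_def, THEN conjunct1] _ that]) (use in0 in simp)
  \<comment> \<open>Splits the first increment at \<open>a'\<close>; if it ends earlier, its second
    piece is empty.\<close>
  define d where "d = min b a'"
  have d: "a \<le> d" "d \<le> a'" "d \<in> {0..T}" "d \<le> b" using ab ab' by (auto simp: d_def)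
  have "(\<integral>\<omega>. \<eta> \<omega> * (inc i a b \<omega> * inc j a' b' \<omega>) \<partial>Pr) =
    (\<integral>\<omega>. \<eta> \<omega> * inc i a d \<omega> * inc j a' b' \<omega> + \<eta> \<omega> * inc i d b \<omega> * inc j a' b' \<omega> \<partial>Pr)"
    unfolding inc_add[of i a d _ b, symmetric] by (simp only: distrib_left distrib_right mult.assoc)
  also have "\<dots> = (\<integral>\<omega>. \<eta> \<omega> * inc i a d \<omega> * inc j a' b' \<omega> \<partial>Pr) + (\<integral>\<omega>. \<eta> \<omega> * inc i d b \<omega> * inc j a' b' \<omega> \<partial>Pr)"
    by (rule Bochner_Integration.integral_add) (intro eii in0 d)+
  also have "(\<integral>\<omega>. \<eta> \<omega> * inc i a d \<omega> * inc j a' b' \<omega> \<partial>Pr) = 0"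
  proof (rule orthogonal_increment)
    have "inc i a d \<in> borel_measurable (F a')"
      by (rule F_measurable_mono[OF inc_measurable_F[of a d i] _ d(2)]) (use d ab in0 in simp_all)
    then show "(\<lambda>\<omega>. \<eta> \<omega> * inc i a d \<omega>) \<in> borel_measurable (F a')"
      by (intro borel_measurable_times em) (use in0 in simp_all)
    show "integrable Pr (\<lambda>\<omega>. \<eta> \<omega> * inc i a d \<omega>)" by (intro ei in0 d)
  qed (use in0 ab' in auto)
  also have "(\<integral>\<omega>. \<eta> \<omega> * inc i d b \<omega> * inc j a' b' \<omega> \<partial>Pr) = K $ i $ j * max 0 (min b b' - a') * (\<integral>\<omega>. \<eta> \<omega> \<partial>Pr)"
  proof (cases "b \<le> a'")
    case True
    then show ?thesis by (simp add: d_def)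
  next
    case False
    then have da: "d = a'" by (simp add: d_def)
    define c where "c = min b b'"
    have c: "a' \<le> c" "c \<le> b" "c \<le> b'" "c \<in> {0..T}" using False ab ab' by (auto simp: c_def)
    \<comment> \<open>\<open>c\<close> is the end of one of the two intervals, so one factor is an
      increment over an empty interval.\<close>
    have z: "inc i c b \<omega> * inc j c b' \<omega> = 0" for \<omega> by (auto simp: c_def min_def)
    have "\<eta> \<omega> * inc i a' b \<omega> * inc j a' b' \<omega> =
      (\<eta> \<omega> * (inc i a' c \<omega> * inc j a' c \<omega>) + \<eta> \<omega> * inc i a' c \<omega> * inc j c b' \<omega>) + \<eta> \<omega> * inc j a' c \<omega> * inc i c b \<omega>" for \<omega>
    proof -
      have "\<eta> \<omega> * inc i a' b \<omega> * inc j a' b' \<omega> = \<eta> \<omega> * (inc i a' c \<omega> + inc i c b \<omega>) * (inc j a' c \<omega> + inc j c b' \<omega>)"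
        by (simp only: inc_add mult.assoc)
      also have "\<dots> = (\<eta> \<omega> * (inc i a' c \<omega> * inc j a' c \<omega>) + \<eta> \<omega> * inc i a' c \<omega> * inc j c b' \<omega>) + \<eta> \<omega> * inc j a' c \<omega> * inc i c b \<omega>
          + \<eta> \<omega> * (inc i c b \<omega> * inc j c b' \<omega>)" by (simp add: algebra_simps)
      finally show ?thesis by (simp add: z)
    qed
    then have "(\<integral>\<omega>. \<eta> \<omega> * inc i d b \<omega> * inc j a' b' \<omega> \<partial>Pr) =
       (\<integral>\<omega>. (\<eta> \<omega> * (inc i a' c \<omega> * inc j a' c \<omega>) + \<eta> \<omega> * inc i a' c \<omega> * inc j c b' \<omega>) + \<eta> \<omega> * inc j a' c \<omega> * inc i c b \<omega> \<partial>Pr)"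
      by (simp add: da)
    also have "\<dots> = (\<integral>\<omega>. \<eta> \<omega> * (inc i a' c \<omega> * inc j a' c \<omega>) \<partial>Pr) + (\<integral>\<omega>. \<eta> \<omega> * inc i a' c \<omega> * inc j c b' \<omega> \<partial>Pr)
        + (\<integral>\<omega>. \<eta> \<omega> * inc j a' c \<omega> * inc i c b \<omega> \<partial>Pr)"
    proof -
      note I = eii[OF in0(3) c(4) in0(3) c(4), of i j, unfolded mult.assoc] eii[OF in0(3) c(4) c(4) in0(4), of i j]
        eii[OF in0(3) c(4) c(4) in0(2), of j i]
      show ?thesis
        by (simp only: Bochner_Integration.integral_add[OF Bochner_Integration.integrable_add[OF I(1,2)] I(3)]
          Bochner_Integration.integral_add[OF I(1,2)])
    qed
    also have "(\<integral>\<omega>. \<eta> \<omega> * inc i a' c \<omega> * inc j c b' \<omega> \<partial>Pr) = 0"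
      by (rule orthogonal_increment(2)) ((rule ei inc_measurable_F borel_measurable_times em | use c in0 in simp)+)
    also have "(\<integral>\<omega>. \<eta> \<omega> * inc j a' c \<omega> * inc i c b \<omega> \<partial>Pr) = 0"
      by (rule orthogonal_increment(2)) ((rule ei inc_measurable_F borel_measurable_times em | use c in0 in simp)+)
    also have "(\<integral>\<omega>. \<eta> \<omega> * (inc i a' c \<omega> * inc j a' c \<omega>) \<partial>Pr) = K $ i $ j * (c - a') * (\<integral>\<omega>. \<eta> \<omega> \<partial>Pr)"
      by (rule increment_product_mean) ((rule em bounded_rv_integrable[OF e] | use c in0 in simp)+)
    finally show ?thesis using c by (simp add: c_def)
  qed
  finally show ?thesis by simp
qed

text \<open>Symmetry of \<open>K\<close> allows the increments to be exchanged so that the one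
  starting later comes second.\<close>

lemma two_increments_mean:
  fixes \<eta> :: "'a \<Rightarrow> real"
  assumes ab: "0 \<le> a" "a \<le> b" "b \<le> T" and ab': "0 \<le> a'" "a' \<le> b'" "b' \<le> T" and e: "bounded_rv (max a a') \<eta>"
  shows "(\<integral>\<omega>. \<eta> \<omega> * (inc i a b \<omega> * inc j a' b' \<omega>) \<partial>Pr) = K $ i $ j * max 0 (min b b' - max a a') * (\<integral>\<omega>. \<eta> \<omega> \<partial>Pr)"
proof (cases "a \<le> a'")
  case True
  then show ?thesis using two_increments_mean_ordered[OF ab True ab'(2,3), of \<eta> i j] e by (simp add: max_def)
next
  case False
  then have "a' \<le> a" by simp
  from two_increments_mean_ordered[OF ab' this ab(2,3), of \<eta> j i] e False show ?thesis
    by (simp add: max_def K_sym[of j i] min.commute mult.commute[of "inc j a' b' _"])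
qed

end

section \<open>Elementary integrands\<close>

context levy_driven
begin

text \<open>Indices are pairs because a cut simple process is indexed by an interval of its
  partition and a cell of a time grid.\<close>

definition elem_data :: "(nat \<times> nat) set \<Rightarrow> (nat \<times> nat \<Rightarrow> real) \<Rightarrow> (nat \<times> nat \<Rightarrow> real) \<Rightarrow> (nat \<times> nat \<Rightarrow> 'a \<Rightarrow> real^'n) \<Rightarrow> bool" where
  "elem_data I a b \<xi> \<longleftrightarrow> finite I \<and> (\<forall>k\<in>I. 0 \<le> a k \<and> a k \<le> b k \<and> b k \<le> T \<and> bounded_rv (a k) (\<xi> k))"

definition elem_proc :: "(nat \<times> nat) set \<Rightarrow> (nat \<times> nat \<Rightarrow> real) \<Rightarrow> (nat \<times> nat \<Rightarrow> real) \<Rightarrow> (nat \<times> nat \<Rightarrow> 'a \<Rightarrow> real^'n) \<Rightarrow> real \<Rightarrow> 'a \<Rightarrow> real^'n" where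
  "elem_proc I a b \<xi> s \<omega> = (\<Sum>k\<in>I. indicator {a k<..b k} s *\<^sub>R \<xi> k \<omega>)"

definition elem_int :: "(nat \<times> nat) set \<Rightarrow> (nat \<times> nat \<Rightarrow> real) \<Rightarrow> (nat \<times> nat \<Rightarrow> real) \<Rightarrow> (nat \<times> nat \<Rightarrow> 'a \<Rightarrow> real^'n) \<Rightarrow> 'd \<Rightarrow> real \<Rightarrow> 'a \<Rightarrow> real^'n" where
  "elem_int I a b \<xi> i t \<omega> = (\<Sum>k\<in>I. inc i (min t (a k)) (min t (b k)) \<omega> *\<^sub>R \<xi> k \<omega>)"

text \<open>\<open>G\<close> is a finite sum of terms \<open>1\<^bsub>(a,b]\<^esub> \<xi>\<close> with possibly overlapping intervals, and \<open>S i\<close> is its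
  integral against the \<open>i\<close>-th component of the noise. Allowing overlaps spares all common refinements.\<close>

definition elementary :: "(real \<Rightarrow> 'a \<Rightarrow> real^'n) \<Rightarrow> ('d \<Rightarrow> real \<Rightarrow> 'a \<Rightarrow> real^'n) \<Rightarrow> bool" where
  "elementary G S \<longleftrightarrow> (\<exists>I a b \<xi>. elem_data I a b \<xi> \<and> G = elem_proc I a b \<xi> \<and> S = elem_int I a b \<xi>)"

lemma time_indicator_sqint:
  fixes t :: real
  shows "sqint Lam (\<lambda>z. indicator {0..t} (fst z) :: real)"
proof (rule sqintI)
  have "integrable Lam (indicator ({0..t} \<times> space Pr) :: _ \<Rightarrow> real)"
  proof (rule integrable_real_indicator)
    show "{0..t} \<times> space Pr \<in> sets Lam" by (intro pair_measureI) auto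
    have "emeasure Lam ({0..t} \<times> space Pr) = emeasure lborel {0..t} * emeasure Pr (space Pr)"
      by (rule emeasure_pair_measure_Times) auto
    then show "emeasure Lam ({0..t} \<times> space Pr) < \<infinity>"
      by (simp add: emeasure_space_1 emeasure_lborel_Icc_eq)
  qed
  moreover have "indicator ({0..t} \<times> space Pr) z = (norm (indicator {0..t} (fst z) :: real))\<^sup>2"
    if "z \<in> space Lam" for z
    using that by (cases z) (auto simp: space_pair_measure indicator_times power2_eq_square split: split_indicator)
  ultimately show "integrable Lam (\<lambda>z. (norm (indicator {0..t} (fst z) :: real))\<^sup>2)"
    by (simp cong: Bochner_Integration.integrable_cong)
qed measurable

lemma elementary_sqint:
  assumes "elementary G S"
  shows "Lsqint t G"
proof -
  obtain I a b \<xi> where d: "elem_data I a b \<xi>" and G: "G = elem_proc I a b \<xi>" 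
    using assms by (auto simp: elementary_def)
  have "Lsqint t (\<lambda>s \<omega>. indicator {a k<..b k} s *\<^sub>R \<xi> k \<omega>)"
    if "k \<in> I" for k
  proof -
    have k: "bounded_rv (a k) (\<xi> k)" "a k \<in> {0..T}" using d that by (auto simp: elem_data_def)
    obtain C where C: "\<And>\<omega>. \<omega> \<in> space Pr \<Longrightarrow> norm (\<xi> k \<omega>) \<le> C" "0 \<le> C" using bounded_rvE[OF k(1)] by metis
    have [measurable]: "\<xi> k \<in> borel_measurable Pr" using k F_measurable_Pr by (auto simp: bounded_rv_def)
    show ?thesis
      by (rule sqint_mono[OF time_indicator_sqint[of t], of _ C])
        (use C in \<open>auto simp: space_pair_measure split: split_indicator\<close>)
  qed
  then show ?thesis unfolding G elem_proc_def scaleR_sum_right by (intro sqint_sum)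
qed

lemma elementary_int_sqint:
  assumes "elementary G S" "t \<in> {0..T}"
  shows "sqint Pr (S i t)"
proof -
  obtain I a b \<xi> where d: "elem_data I a b \<xi>" and S: "S = elem_int I a b \<xi>" 
    using assms by (auto simp: elementary_def)
  have "sqint Pr (\<lambda>\<omega>. inc i (min t (a k)) (min t (b k)) \<omega> *\<^sub>R \<xi> k \<omega>)" if "k \<in> I" for k
    by (rule bounded_rv_scale_sqint[of "a k"]) 
      (use d that assms(2) in \<open>auto simp: elem_data_def intro!: inc_sqint\<close>)
  then show ?thesis unfolding S elem_int_def[abs_def] by (intro sqint_sum)
qed

text \<open>Checked term by term: between \<open>s\<close> and \<open>t\<close> a term either does
  not change or gains an increment over an interval starting no earlier than \<open>s\<close> and
  \<open>a k\<close>, which is orthogonal to the inner product of \<open>\<zeta>\<close> and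
  \<open>\<xi> k\<close>.\<close>

lemma elementary_martingale:
  assumes G: "elementary G S" and st: "0 \<le> s" "s \<le> t" "t \<le> T"
    and z: "sqint Pr \<zeta>" "\<zeta> \<in> borel_measurable (F s)"
  shows "(\<integral>\<omega>. \<zeta> \<omega> \<bullet> S i t \<omega> \<partial>Pr) = (\<integral>\<omega>. \<zeta> \<omega> \<bullet> S i s \<omega> \<partial>Pr)"
proof -
  obtain I a b \<xi> where d: "elem_data I a b \<xi>" and S: "S = elem_int I a b \<xi>" 
    using G by (auto simp: elementary_def)
  have i1: "integrable Pr (\<lambda>\<omega>. \<zeta> \<omega> \<bullet> (inc i (min r (a k)) (min r (b k)) \<omega> *\<^sub>R \<xi> k \<omega>))" if "k \<in> I" "r \<in> {0..T}" for k r
    by (rule sqint_inner_integrable[OF z(1) bounded_rv_scale_sqint[of "a k"]]) 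
      (use d that in \<open>auto simp: elem_data_def intro!: inc_sqint\<close>)
  have eq: "(\<integral>\<omega>. \<zeta> \<omega> \<bullet> (inc i (min t (a k)) (min t (b k)) \<omega> *\<^sub>R \<xi> k \<omega>) \<partial>Pr) =
     (\<integral>\<omega>. \<zeta> \<omega> \<bullet> (inc i (min s (a k)) (min s (b k)) \<omega> *\<^sub>R \<xi> k \<omega>) \<partial>Pr)" if k: "k \<in> I" for k
  proof -
    have kk: "0 \<le> a k" "a k \<le> b k" "b k \<le> T" "bounded_rv (a k) (\<xi> k)" using d k by (auto simp: elem_data_def)
    consider "b k \<le> s" | "t \<le> a k" | "s < b k" "a k < t" by linarith
    then show ?thesis
    proof cases
      case 1
      then have "min t (a k) = min s (a k)" "min t (b k) = min s (b k)" using st kk by auto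
      then show ?thesis by simp
    next
      case 2
      then have "min t (a k) = min t (b k)" "min s (a k) = min s (b k)" using st kk by auto
      then show ?thesis by simp
    next
      case 3
      define c where "c = max s (a k)"
      define e where "e = min t (b k)"
      have ce: "0 \<le> c" "c \<le> e" "e \<le> T" "s \<le> c" "a k \<le> c" using st kk 3 by (auto simp: c_def e_def)
      have "inc i (min t (a k)) (min t (b k)) \<omega> - inc i (min s (a k)) (min s (b k)) \<omega> = inc i c e \<omega>" for \<omega>
        using st 3 kk by (auto simp: inc_def c_def e_def min_def max_def)
      note dd = this
      have df: "\<zeta> \<omega> \<bullet> (inc i (min t (a k)) (min t (b k)) \<omega> *\<^sub>R \<xi> k \<omega>) - \<zeta> \<omega> \<bullet> (inc i (min s (a k)) (min s (b k)) \<omega> *\<^sub>R \<xi> k \<omega>)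
         = (\<zeta> \<omega> \<bullet> \<xi> k \<omega>) * inc i c e \<omega>" for \<omega>
        unfolding dd[symmetric] by (simp add: right_diff_distrib mult.commute)
      have "(\<integral>\<omega>. (\<zeta> \<omega> \<bullet> \<xi> k \<omega>) * inc i c e \<omega> \<partial>Pr) = 0"
      proof (rule orthogonal_increment(2)[OF ce(1-3)])
        show "(\<lambda>\<omega>. \<zeta> \<omega> \<bullet> \<xi> k \<omega>) \<in> borel_measurable (F c)"
        proof (rule borel_measurable_inner)
          show "\<zeta> \<in> borel_measurable (F c)" by (rule F_measurable_mono[OF z(2)]) (use st ce in auto)
          show "\<xi> k \<in> borel_measurable (F c)"
            by (rule F_measurable_mono[OF kk(4)[unfolded bounded_rv_def, THEN conjunct1]]) (use kk ce in auto)
        qed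
        have "sqint Pr (\<lambda>\<omega>. (1::real) *\<^sub>R \<xi> k \<omega>)"
          by (rule bounded_rv_scale_sqint[OF kk(4)]) (use kk in \<open>auto simp: sqint_def\<close>)
        then show "integrable Pr (\<lambda>\<omega>. \<zeta> \<omega> \<bullet> \<xi> k \<omega>)" by (intro sqint_inner_integrable[OF z(1)]) simp
      qed
      then show ?thesis
        using Bochner_Integration.integral_diff[OF i1[OF k, of t] i1[OF k, of s]] st unfolding df by simp
    qed
  qed
  have "(\<integral>\<omega>. \<zeta> \<omega> \<bullet> S i r \<omega> \<partial>Pr) = (\<Sum>k\<in>I. \<integral>\<omega>. \<zeta> \<omega> \<bullet> (inc i (min r (a k)) (min r (b k)) \<omega> *\<^sub>R \<xi> k \<omega>) \<partial>Pr)" if "r \<in> {0..T}" for r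
    unfolding S elem_int_def inner_sum_right by (rule Bochner_Integration.integral_sum) (rule i1[OF _ that])
  then show ?thesis using st eq by (simp del: inner_scaleR_right)
qed

lemma integral_time_prob_product:
  fixes h :: "real \<Rightarrow> real" and e :: "'a \<Rightarrow> real"
  assumes "integrable lborel h" "integrable Pr e"
  shows "integrable Lam (\<lambda>z. h (fst z) * e (snd z))"
    "(\<integral>z. h (fst z) * e (snd z) \<partial>Lam) = (\<integral>s. h s \<partial>lborel) * (\<integral>\<omega>. e \<omega> \<partial>Pr)"
proof -
  have [measurable]: "h \<in> borel_measurable lborel" "e \<in> borel_measurable Pr" using assms by auto
  show i: "integrable Lam (\<lambda>z. h (fst z) * e (snd z))"
    by (rule time.Fubini_integrable) (use assms in \<open>auto simp: abs_mult\<close>)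
  show "(\<integral>z. h (fst z) * e (snd z) \<partial>Lam) = (\<integral>s. h s \<partial>lborel) * (\<integral>\<omega>. e \<omega> \<partial>Pr)"
    using time.integral_fst'[OF i] by simp
qed

text \<open>Both sides are bilinear in the terms of the two sums. For a pair of terms the weighted
  mean of the product of increments involves the length of the overlap, which is the time integral
  of the product of the indicators. Two different noise components are treated at once because they
  may be correlated.\<close>

lemma elementary_isometry:
  fixes X :: "real^'n^'n"
  assumes G: "elementary G S" and G': "elementary G' S'" and t: "t \<in> {0..T}"
  shows "(\<integral>\<omega>. S i t \<omega> \<bullet> (X *v S' j t \<omega>) \<partial>Pr) =
    K $ i $ j * (Lint t (\<lambda>s \<omega>. G s \<omega> \<bullet> (X *v G' s \<omega>)))"
proof -
  obtain I a b \<xi> where d: "elem_data I a b \<xi>" and GS: "G = elem_proc I a b \<xi>" "S = elem_int I a b \<xi>" 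
    using G by (auto simp: elementary_def)
  obtain I' a' b' \<xi>' where d': "elem_data I' a' b' \<xi>'" and GS': "G' = elem_proc I' a' b' \<xi>'" "S' = elem_int I' a' b' \<xi>'" 
    using G' by (auto simp: elementary_def)
  define \<eta> where "\<eta> k l \<omega> = \<xi> k \<omega> \<bullet> (X *v \<xi>' l \<omega>)" for k l \<omega>
  define h :: "nat \<times> nat \<Rightarrow> nat \<times> nat \<Rightarrow> real \<Rightarrow> real"
    where "h k l s = indicator {0..t} s * (indicator {a k<..b k} s * indicator {a' l<..b' l} s)" for k l s
  define ii where "ii k l \<omega> = inc i (min t (a k)) (min t (b k)) \<omega> * inc j (min t (a' l)) (min t (b' l)) \<omega>" for k l \<omega>
  have kl: "0 \<le> a k" "a k \<le> b k" "b k \<le> T" "bounded_rv (a k) (\<xi> k)"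
     "0 \<le> a' l" "a' l \<le> b' l" "b' l \<le> T" "bounded_rv (a' l) (\<xi>' l)" if "k \<in> I" "l \<in> I'" for k l
    using that d d' by (auto simp: elem_data_def)
  have e: "bounded_rv (max (a k) (a' l)) (\<eta> k l)" if "k \<in> I" "l \<in> I'" for k l
    unfolding \<eta>_def
    by (rule bounded_rv_inner) (rule bounded_rv_mono[of "a k"] bounded_rv_mono[of "a' l"]; use kl[OF that] in auto)+
  have ei: "integrable Pr (\<eta> k l)" if "k \<in> I" "l \<in> I'" for k l
    by (rule bounded_rv_integrable[OF e[OF that]]) (use kl[OF that] in auto)
  have eii: "integrable Pr (\<lambda>\<omega>. \<eta> k l \<omega> * ii k l \<omega>)" if "k \<in> I" "l \<in> I'" for k l
  proof -
    have m: "max (a k) (a' l) \<in> {0..T}" using kl[OF that] by auto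
    have mm: "min t (a k) \<in> {0..T}" "min t (b k) \<in> {0..T}" "min t (a' l) \<in> {0..T}" "min t (b' l) \<in> {0..T}"
      using kl[OF that] t by auto
    show ?thesis
      using sqint_inner_integrable[OF bounded_rv_scale_sqint[OF e[OF that] m inc_sqint[OF mm(1,2), of i]] inc_sqint[OF mm(3,4), of j]]
      unfolding ii_def inner_real_def real_scaleR_def by (simp only: ac_simps)
  qed
  have hset: "h k l = indicator {max (a k) (a' l)<..min t (min (b k) (b' l))}" if "k \<in> I" "l \<in> I'" for k l
    using kl[OF that] by (auto simp: h_def fun_eq_iff split: split_indicator)
  have hi: "integrable lborel (h k l)" if "k \<in> I" "l \<in> I'" for k l
  proof -
    have "emeasure lborel {x<..y} < \<infinity>" for x y :: real by (cases "x \<le> y") auto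
    then show ?thesis unfolding hset[OF that] by (intro integrable_real_indicator) auto
  qed
  have hint: "(\<integral>s. h k l s \<partial>lborel) = max 0 (min (min t (b k)) (min t (b' l)) - max (min t (a k)) (min t (a' l)))"
    if "k \<in> I" "l \<in> I'" for k l
  proof -
    have "(\<integral>s. h k l s \<partial>lborel) = max 0 (min t (min (b k) (b' l)) - max (a k) (a' l))"
      unfolding hset[OF that] by (auto simp: max_def)
    also have "\<dots> = max 0 (min (min t (b k)) (min t (b' l)) - max (min t (a k)) (min t (a' l)))"
      using kl[OF that] by (auto simp: min_def max_def)
    finally show ?thesis .
  qed
  have key: "(\<integral>\<omega>. \<eta> k l \<omega> * ii k l \<omega> \<partial>Pr) = K $ i $ j * ((\<integral>s. h k l s \<partial>lborel) * (\<integral>\<omega>. \<eta> k l \<omega> \<partial>Pr))"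
    if kl': "k \<in> I" "l \<in> I'" for k l
  \<comment> \<open>If both intervals start before \<open>t\<close>, capping at \<open>t\<close>
    leaves their left ends alone, so \<open>\<eta> k l\<close> is known at the later of the capped
    left ends, as \<open>two_increments_mean\<close> requires. Otherwise a capped interval is empty
    and both sides vanish.\<close>
  proof (cases "a k < t \<and> a' l < t")
    case True
    then have m: "max (min t (a k)) (min t (a' l)) = max (a k) (a' l)" by auto
    show ?thesis
      unfolding ii_def hint[OF kl']
      by (subst two_increments_mean) (use kl[OF kl'] t e[OF kl'] m in \<open>auto simp: mult.assoc\<close>)
  next
    case False
    then have "ii k l = (\<lambda>_. 0)" using kl[OF kl'] by (auto simp: ii_def fun_eq_iff min_def)
    moreover have "(\<integral>s. h k l s \<partial>lborel) = 0" unfolding hint[OF kl'] using False kl[OF kl'] by (auto simp: min_def max_def)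
    ultimately show ?thesis by simp
  qed
  have bil: "(\<Sum>k\<in>I. c k *\<^sub>R v k) \<bullet> (X *v (\<Sum>l\<in>I'. c' l *\<^sub>R v' l)) = (\<Sum>k\<in>I. \<Sum>l\<in>I'. (v k \<bullet> (X *v v' l)) * (c k * c' l))"
    for c c' v v'
  proof -
    have "X *v (\<Sum>l\<in>I'. c' l *\<^sub>R v' l) = (\<Sum>l\<in>I'. c' l *\<^sub>R (X *v v' l))"
      by (simp add: linear_sum[OF matrix_vector_mul_linear] linear_scale[OF matrix_vector_mul_linear])
    then show ?thesis
      by (simp add: inner_sum_left inner_sum_right mult_ac sum_distrib_left) (rule sum.swap)
  qed
  have "(\<integral>\<omega>. S i t \<omega> \<bullet> (X *v S' j t \<omega>) \<partial>Pr) = (\<integral>\<omega>. (\<Sum>k\<in>I. \<Sum>l\<in>I'. \<eta> k l \<omega> * ii k l \<omega>) \<partial>Pr)"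
    unfolding GS GS' elem_int_def bil \<eta>_def ii_def ..
  also have "\<dots> = (\<Sum>k\<in>I. \<Sum>l\<in>I'. \<integral>\<omega>. \<eta> k l \<omega> * ii k l \<omega> \<partial>Pr)"
    by (subst Bochner_Integration.integral_sum; (intro Bochner_Integration.integrable_sum eii sum.cong refl Bochner_Integration.integral_sum; assumption)?)
  also have "\<dots> = (\<Sum>k\<in>I. \<Sum>l\<in>I'. K $ i $ j * (\<integral>z. h k l (fst z) * \<eta> k l (snd z) \<partial>Lam))"
    by (intro sum.cong refl) (simp add: key integral_time_prob_product(2)[OF hi ei])
  also have "\<dots> = K $ i $ j * (\<integral>z. (\<Sum>k\<in>I. \<Sum>l\<in>I'. h k l (fst z) * \<eta> k l (snd z)) \<partial>Lam)"
    unfolding sum_distrib_left[symmetric]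
    by (subst Bochner_Integration.integral_sum; (intro Bochner_Integration.integrable_sum integral_time_prob_product(1) hi ei arg_cong2[where f="(*)"] sum.cong refl Bochner_Integration.integral_sum[symmetric]; assumption)?)
  also have "(\<integral>z. (\<Sum>k\<in>I. \<Sum>l\<in>I'. h k l (fst z) * \<eta> k l (snd z)) \<partial>Lam) =
     (Lint t (\<lambda>s \<omega>. G s \<omega> \<bullet> (X *v G' s \<omega>)))"
    unfolding GS GS' elem_proc_def bil \<eta>_def h_def sum_distrib_left by (simp only: mult_ac)
  finally show ?thesis .
qed

text \<open>The square of a difference is expanded into three inner products, each an instance of
  the isometry for \<open>mat 1\<close>. This avoids forming the difference of two elementary
  processes.\<close>

lemma elementary_int_diff:
  assumes G: "elementary G S" and G': "elementary G' S'" and t: "t \<in> {0..T}"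
  shows "(\<integral>\<omega>. (norm (S i t \<omega> - S' i t \<omega>))\<^sup>2 \<partial>Pr) =
    K $ i $ i * (Lint t (\<lambda>s \<omega>. (norm (G s \<omega> - G' s \<omega>))\<^sup>2))"
proof -
  have ns: "(norm (v - w))\<^sup>2 = (v \<bullet> (mat 1 *v v) - 2 * (v \<bullet> (mat 1 *v w))) + w \<bullet> (mat 1 *v w)" for v w :: "real^'n"
    by (simp add: power2_norm_eq_inner inner_diff_left inner_diff_right inner_commute)
  let ?g = "\<lambda>G G' z. indicator {0..t} (fst z) * (G (fst z) (snd z) \<bullet> (mat 1 *v G' (fst z) (snd z)))"
  have iS: "integrable Pr (\<lambda>\<omega>. S i t \<omega> \<bullet> (mat 1 *v S' i t \<omega>))" if "elementary G S" "elementary G' S'"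
    for G G' and S S' :: "'d \<Rightarrow> real \<Rightarrow> 'a \<Rightarrow> real^'n"
    using that t by (intro sqint_inner_integrable sqint_matrix elementary_int_sqint)
  have iG: "integrable Lam (?g G G')" if "elementary G S" "elementary G' S'"
    for G G' and S S' :: "'d \<Rightarrow> real \<Rightarrow> 'a \<Rightarrow> real^'n"
    using sqint_inner_integrable[OF elementary_sqint[OF that(1), of t] elementary_sqint[OF that(2), of t]]
    by (simp add: indicator_inter_arith[symmetric] mult.assoc[symmetric])
  have "(\<integral>\<omega>. (norm (S i t \<omega> - S' i t \<omega>))\<^sup>2 \<partial>Pr) = (\<integral>\<omega>. S i t \<omega> \<bullet> (mat 1 *v S i t \<omega>) \<partial>Pr)
      - 2 * (\<integral>\<omega>. S i t \<omega> \<bullet> (mat 1 *v S' i t \<omega>) \<partial>Pr) + (\<integral>\<omega>. S' i t \<omega> \<bullet> (mat 1 *v S' i t \<omega>) \<partial>Pr)"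
    unfolding ns using iS[OF G G] iS[OF G G'] iS[OF G' G'] by (simp del: matrix_vector_mul_lid)
  also have "\<dots> = K $ i $ i * ((\<integral>z. ?g G G z \<partial>Lam) - 2 * (\<integral>z. ?g G G' z \<partial>Lam) + (\<integral>z. ?g G' G' z \<partial>Lam))"
    unfolding elementary_isometry[OF G G t] elementary_isometry[OF G G' t] elementary_isometry[OF G' G' t]
    by (simp only: algebra_simps)
  also have "(\<integral>z. ?g G G z \<partial>Lam) - 2 * (\<integral>z. ?g G G' z \<partial>Lam) + (\<integral>z. ?g G' G' z \<partial>Lam)
    = (\<integral>z. (?g G G z - 2 * ?g G G' z) + ?g G' G' z \<partial>Lam)"
    using iG[OF G G] iG[OF G G'] iG[OF G' G'] by (simp del: matrix_vector_mul_lid)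
  also have "\<dots> = (Lint t (\<lambda>s \<omega>. (norm (G s \<omega> - G' s \<omega>))\<^sup>2))"
    unfolding ns by (intro Bochner_Integration.integral_cong refl) (simp only: algebra_simps)
  finally show ?thesis .
qed

end

section \<open>Localization of Ito integrals\<close>

lemma partition_mono:
  fixes \<tau> :: "nat \<Rightarrow> real"
  assumes "\<forall>j<m. \<tau> j \<le> \<tau> (Suc j)" "j \<le> k" "k \<le> m"
  shows "\<tau> j \<le> \<tau> k"
  using assms(2,3)
proof (induction k rule: dec_induct)
  case (step k)
  then have "\<tau> j \<le> \<tau> k" "\<tau> k \<le> \<tau> (Suc k)" using assms(1) by (auto simp: Suc_le_eq)
  then show ?case by simp
qed simp

lemma partition_unique:
  fixes \<tau> :: "nat \<Rightarrow> real"
  assumes mono: "\<forall>j<m. \<tau> j \<le> \<tau> (Suc j)" and jk: "j < m" "k < m"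
    and s: "s \<in> {\<tau> j<..\<tau> (Suc j)}" "s \<in> {\<tau> k<..\<tau> (Suc k)}"
  shows "j = k"
proof (rule ccontr)
  assume "j \<noteq> k"
  then consider "Suc j \<le> k" | "Suc k \<le> j" by linarith
  then show False
    using partition_mono[of m \<tau> "Suc j" k] partition_mono[of m \<tau> "Suc k" j] mono jk s by cases force+
qed

lemma partition_exists:
  fixes g :: "nat \<Rightarrow> real"
  assumes "g 0 < s" "s \<le> g L"
  shows "\<exists>l<L. s \<in> {g l<..g (Suc l)}"
  using assms(2)
proof (induction L)
  case (Suc L)
  then show ?case by (cases "s \<le> g L") (auto intro: less_SucI)
qed (use assms in auto)

lemma simple_process_cases:
  assumes mono: "\<forall>j<m. \<tau> j \<le> \<tau> (Suc j)"
  obtains j where "j < m" "s \<in> {\<tau> j<..\<tau> (Suc j)}" "simple_process m \<tau> \<xi> s \<omega> = \<xi> j \<omega>"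
      "(\<Sum>k<m. indicator {\<tau> k<..\<tau> (Suc k)} s * (norm (\<xi> k \<omega>))\<^sup>2) = (norm (\<xi> j \<omega>))\<^sup>2"
    | "\<forall>j<m. s \<notin> {\<tau> j<..\<tau> (Suc j)}" "simple_process m \<tau> \<xi> s \<omega> = 0"
      "(\<Sum>k<m. indicator {\<tau> k<..\<tau> (Suc k)} s * (norm (\<xi> k \<omega>))\<^sup>2) = 0"
proof (cases "\<exists>j<m. s \<in> {\<tau> j<..\<tau> (Suc j)}")
  case True
  then obtain j where j: "j < m" "s \<in> {\<tau> j<..\<tau> (Suc j)}" by auto
  have z: "indicator {\<tau> k<..\<tau> (Suc k)} s = (if k = j then 1 else (0::real))" if "k < m" for k
  proof (cases "s \<in> {\<tau> k<..\<tau> (Suc k)}")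
    case True
    then have "k = j" by (rule partition_unique[OF mono that j(1) _ j(2)])
    with True show ?thesis by simp
  next
    case False
    then have "k \<noteq> j" using j(2) by auto
    with False show ?thesis by simp
  qed
  show thesis
  proof (rule that(1)[OF j])
    have "simple_process m \<tau> \<xi> s \<omega> = (\<Sum>k<m. if k = j then \<xi> k \<omega> else 0)"
      unfolding simple_process_def by (intro sum.cong refl) (simp add: z)
    then show "simple_process m \<tau> \<xi> s \<omega> = \<xi> j \<omega>" using j by simp
    have "(\<Sum>k<m. indicator {\<tau> k<..\<tau> (Suc k)} s * (norm (\<xi> k \<omega>))\<^sup>2) = (\<Sum>k<m. if k = j then (norm (\<xi> k \<omega>))\<^sup>2 else 0)"
      by (intro sum.cong refl) (simp add: z)
    then show "(\<Sum>k<m. indicator {\<tau> k<..\<tau> (Suc k)} s * (norm (\<xi> k \<omega>))\<^sup>2) = (norm (\<xi> j \<omega>))\<^sup>2"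
      using j by simp
  qed
next
  case False
  then have "indicator {\<tau> k<..\<tau> (Suc k)} s = (0::real)" if "k < m" for k
    using that by (auto split: split_indicator)
  with False show thesis by (intro that(2)) (auto simp: simple_process_def)
qed

lemma simple_process_norm_sq:
  assumes mono: "\<forall>j<m. \<tau> j \<le> \<tau> (Suc j)"
  shows "(norm (simple_process m \<tau> \<xi> s \<omega>))\<^sup>2 = (\<Sum>j<m. indicator {\<tau> j<..\<tau> (Suc j)} s * (norm (\<xi> j \<omega>))\<^sup>2)"
  by (rule simple_process_cases[OF mono, where s=s and \<omega>=\<omega> and \<xi>=\<xi>]) (simp_all only: norm_zero power_zero_numeral)

text \<open>The explicit sum shows which values \<open>\<xi> j\<close> enter the energy up to
  \<open>v\<close>: only those with \<open>\<tau> j < v\<close>. This makes the energy up to the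
  right end of a short cell measurable at its left end.\<close>

lemma simple_process_energy:
  assumes mono: "\<forall>j<m. \<tau> j \<le> \<tau> (Suc j)" and pos: "\<forall>j\<le>m. 0 \<le> \<tau> j"
  shows "set_integrable lborel {0..v} (\<lambda>s. (norm (simple_process m \<tau> \<xi> s \<omega>))\<^sup>2)"
    and "(LINT s:{0..v}|lborel. (norm (simple_process m \<tau> \<xi> s \<omega>))\<^sup>2) =
      (\<Sum>j<m. max 0 (min v (\<tau> (Suc j)) - \<tau> j) * (norm (\<xi> j \<omega>))\<^sup>2)"
proof -
  have eq: "indicator {0..v} s * (norm (simple_process m \<tau> \<xi> s \<omega>))\<^sup>2 =
      (\<Sum>j<m. indicator {\<tau> j<..min v (\<tau> (Suc j))} s * (norm (\<xi> j \<omega>))\<^sup>2)" for s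
    unfolding simple_process_norm_sq[OF mono] sum_distrib_left
  proof (intro sum.cong refl)
    fix j assume "j \<in> {..<m}"
    then have "0 \<le> \<tau> j" using pos by simp
    then show "indicator {0..v} s * (indicator {\<tau> j<..\<tau> (Suc j)} s * (norm (\<xi> j \<omega>))\<^sup>2) =
       indicator {\<tau> j<..min v (\<tau> (Suc j))} s * (norm (\<xi> j \<omega>))\<^sup>2"
      by (auto split: split_indicator)
  qed
  have i: "integrable lborel (indicator {x<..y} :: real \<Rightarrow> real)" for x y :: real
  proof -
    have "emeasure lborel {x<..y} < \<infinity>" by (cases "x \<le> y") auto
    then show ?thesis by (intro integrable_real_indicator) auto
  qed
  show "set_integrable lborel {0..v} (\<lambda>s. (norm (simple_process m \<tau> \<xi> s \<omega>))\<^sup>2)"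
    unfolding set_integrable_def real_scaleR_def eq
    by (intro Bochner_Integration.integrable_sum integrable_mult_left i)
  have "(LINT s:{0..v}|lborel. (norm (simple_process m \<tau> \<xi> s \<omega>))\<^sup>2) =
    (\<Sum>j<m. (LINT s|lborel. indicator {\<tau> j<..min v (\<tau> (Suc j))} s) * (norm (\<xi> j \<omega>))\<^sup>2)"
    unfolding set_lebesgue_integral_def real_scaleR_def eq
    by (subst Bochner_Integration.integral_sum) (auto intro!: integrable_mult_left i)
  also have "\<dots> = (\<Sum>j<m. max 0 (min v (\<tau> (Suc j)) - \<tau> j) * (norm (\<xi> j \<omega>))\<^sup>2)"
    by (intro sum.cong refl) (auto simp: max_def)
  finally show "(LINT s:{0..v}|lborel. (norm (simple_process m \<tau> \<xi> s \<omega>))\<^sup>2) =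
      (\<Sum>j<m. max 0 (min v (\<tau> (Suc j)) - \<tau> j) * (norm (\<xi> j \<omega>))\<^sup>2)" .
qed

context levy_driven
begin

text \<open>The simple process is switched off on each cell of a refined grid on which \<open>A\<close> has already
  reached \<open>R\<close>, or on which its own energy would exceed \<open>R'\<close>. The energy up to the right end of a cell
  is known at the left end, so the result is still predictable.\<close>

lemma cut_simple_process:
  fixes \<xi> :: "nat \<Rightarrow> 'a \<Rightarrow> real^'n" and A :: "real \<Rightarrow> 'a \<Rightarrow> real"
  assumes simple: "simple_data Pr T F m \<tau> \<xi>"
    and A: "\<And>s. s \<in> {0..T} \<Longrightarrow> A s \<in> borel_measurable (F s)"
    and A_mono: "\<And>s t \<omega>. 0 \<le> s \<Longrightarrow> s \<le> t \<Longrightarrow> t \<le> T \<Longrightarrow> \<omega> \<in> space Pr \<Longrightarrow> A s \<omega> \<le> A t \<omega>"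
    and L: "0 < (L::nat)" and R': "0 \<le> R'"
  obtains G S where "elementary G S"
    "\<And>s \<omega>. \<omega> \<in> space Pr \<Longrightarrow> G s \<omega> = 0 \<or> G s \<omega> = simple_process m \<tau> \<xi> s \<omega>"
    "\<And>\<omega>. \<omega> \<in> space Pr \<Longrightarrow> (LINT s:{0..T}|lborel. (norm (G s \<omega>))\<^sup>2) \<le> R'"
    "\<And>s \<omega>. \<omega> \<in> space Pr \<Longrightarrow> (\<And>r. r \<in> {0..T} \<Longrightarrow> s - T / real L \<le> r \<Longrightarrow> R \<le> A r \<omega>) \<Longrightarrow> G s \<omega> = 0"
    "\<And>t \<omega>. \<omega> \<in> space Pr \<Longrightarrow> t \<in> {0..T} \<Longrightarrow> A t \<omega> < R \<Longrightarrow>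
       (LINT s:{0..min T (t + T / real L)}|lborel. (norm (simple_process m \<tau> \<xi> s \<omega>))\<^sup>2) \<le> R' \<Longrightarrow>
       (\<forall>s\<le>t. G s \<omega> = simple_process m \<tau> \<xi> s \<omega>) \<and>
       (\<forall>i. S i t \<omega> = simple_integral m \<tau> \<xi> (\<lambda>t \<omega>. M t \<omega> $ i) t \<omega>)"
proof -
  have tau: "\<And>j. j < m \<Longrightarrow> \<tau> j \<le> \<tau> (Suc j)" "\<And>j. j \<le> m \<Longrightarrow> 0 \<le> \<tau> j" "\<And>j. j \<le> m \<Longrightarrow> \<tau> j \<le> T"
    and xi: "\<And>j. j < m \<Longrightarrow> bounded_rv (\<tau> j) (\<xi> j)"
    using simple by (auto simp: simple_data_def bounded_rv_def)
  have tau': "\<forall>j<m. \<tau> j \<le> \<tau> (Suc j)" "\<forall>j\<le>m. 0 \<le> \<tau> j" using tau by auto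
  define H where "H = simple_process m \<tau> \<xi>"
  define C where "C v \<omega> = (LINT s:{0..v}|lborel. (norm (H s \<omega>))\<^sup>2)" for v \<omega>
  have Hi: "set_integrable lborel {0..v} (\<lambda>s. (norm (H s \<omega>))\<^sup>2)" for v \<omega>
    unfolding H_def by (rule simple_process_energy(1)[OF tau'])
  have C_eq: "C v \<omega> = (\<Sum>j<m. max 0 (min v (\<tau> (Suc j)) - \<tau> j) * (norm (\<xi> j \<omega>))\<^sup>2)" for v \<omega>
    unfolding C_def H_def by (rule simple_process_energy(2)[OF tau'])
  have C_mono: "C v \<omega> \<le> C w \<omega>" if "v \<le> w" for v w \<omega>
    unfolding C_eq using that by (intro sum_mono mult_right_mono) auto
  define g where "g l = real l * T / real L" for l
  have g: "g 0 = 0" "g L = T" "\<And>l. g (Suc l) = g l + T / real L"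
    using L by (auto simp: g_def field_simps)
  define \<delta> where "\<delta> = T / real L"
  have \<delta>: "0 < \<delta>" "\<And>l. g (Suc l) = g l + \<delta>" using L T_pos g(3) by (auto simp: \<delta>_def)
  have g_mono: "g l \<le> g (Suc l)" for l using T_pos by (simp add: g(3))
  then have g_mono': "\<forall>l<L. g l \<le> g (Suc l)" by simp
  \<comment> \<open>Grid points are clamped into the \<open>j\<close>-th interval of the partition,
    so that cell \<open>(j, l)\<close> is the intersection of that interval with the
    \<open>l\<close>-th grid interval; it may be empty.\<close>
  define \<phi> where "\<phi> j l = max (\<tau> j) (min (\<tau> (Suc j)) (g l))" for j l
  define a where "a = (\<lambda>(j, l). \<phi> j l)"
  define b where "b = (\<lambda>(j, l). \<phi> j (Suc l))"
  define I where "I = {..<m} \<times> {..<L}"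
  define cl where "cl k \<omega> \<longleftrightarrow> A (a k) \<omega> < R \<and> C (b k) \<omega> \<le> R'" for k \<omega>
  define \<xi>' where "\<xi>' k \<omega> = (if cl k \<omega> then \<xi> (fst k) \<omega> else 0)" for k \<omega>
  define G where "G = elem_proc I a b \<xi>'"
  define S where "S = elem_int I a b \<xi>'"
  have ab: "0 \<le> a k" "a k \<le> b k" "b k \<le> T" "b k \<le> a k + \<delta>" "\<tau> (fst k) \<le> a k" "b k \<le> \<tau> (Suc (fst k))" if "k \<in> I" for k
  proof -
    obtain j l where k: "k = (j, l)" "j < m" "l < L" using \<open>k \<in> I\<close> by (auto simp: I_def)
    note t = tau(1)[of j] tau(2)[of j] tau(3)[of "Suc j"] k(2)
    show "0 \<le> a k" "a k \<le> b k" "b k \<le> T" "b k \<le> a k + \<delta>" "\<tau> (fst k) \<le> a k" "b k \<le> \<tau> (Suc (fst k))"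
      using t \<delta>(1) \<delta>(2)[of l] unfolding k a_def b_def \<phi>_def by (auto simp: max_def min_def)
  qed
  have cell: "s \<in> {a (j, l)<..b (j, l)} \<longleftrightarrow> s \<in> {\<tau> j<..\<tau> (Suc j)} \<and> s \<in> {g l<..g (Suc l)}" if "j < m" for j l s
    using tau(1)[OF that] g_mono[of l] unfolding a_def b_def \<phi>_def by (auto simp: max_def min_def split: if_splits)
  have proc: "(\<exists>k\<in>I. s \<in> {a k<..b k} \<and> G s \<omega> = \<xi>' k \<omega> \<and> H s \<omega> = \<xi> (fst k) \<omega>) \<or> (G s \<omega> = 0 \<and> H s \<omega> = 0)" for s \<omega>
  proof (rule simple_process_cases[OF tau'(1), where s=s and \<omega>=\<omega> and \<xi>=\<xi>])
    fix j assume j: "j < m" "s \<in> {\<tau> j<..\<tau> (Suc j)}" and H: "simple_process m \<tau> \<xi> s \<omega> = \<xi> j \<omega>"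
    have "g 0 < s" "s \<le> g L" using j tau(2)[of j] tau(3)[of "Suc j"] by (auto simp: g)
    then obtain l where l: "l < L" "s \<in> {g l<..g (Suc l)}" using partition_exists by blast
    have kI: "(j, l) \<in> I" using j l by (simp add: I_def)
    have mem: "s \<in> {a (j, l)<..b (j, l)}" using cell[OF j(1)] j l by simp
    have uniq: "k = (j, l)" if "k \<in> I" "s \<in> {a k<..b k}" for k
    proof -
      obtain j' l' where k: "k = (j', l')" "j' < m" "l' < L" using \<open>k \<in> I\<close> by (auto simp: I_def)
      with that cell[OF k(2)] have "s \<in> {\<tau> j'<..\<tau> (Suc j')}" "s \<in> {g l'<..g (Suc l')}" by auto
      with partition_unique[OF tau'(1) k(2) j(1) _ j(2)] partition_unique[OF g_mono' k(3) l(1) _ l(2)]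
      show ?thesis by (simp add: k)
    qed
    have "G s \<omega> = (\<Sum>k\<in>I. if k = (j, l) then \<xi>' k \<omega> else 0)"
      unfolding G_def elem_proc_def
    proof (intro sum.cong refl)
      fix k assume k: "k \<in> I"
      show "indicator {a k<..b k} s *\<^sub>R \<xi>' k \<omega> = (if k = (j, l) then \<xi>' k \<omega> else 0)"
      proof (cases "s \<in> {a k<..b k}")
        case True
        with uniq[OF k] show ?thesis by simp
      next
        case False
        with mem have "k \<noteq> (j, l)" by auto
        with False show ?thesis by simp
      qed
    qed
    then have "G s \<omega> = \<xi>' (j, l) \<omega>" using kI by (simp add: I_def)
    then show ?thesis using kI mem H by (intro disjI1 bexI[of _ "(j, l)"]) (auto simp: H_def)
  next
    assume no: "\<forall>j<m. s \<notin> {\<tau> j<..\<tau> (Suc j)}" and H: "simple_process m \<tau> \<xi> s \<omega> = 0"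
    have "indicator {a k<..b k} s = (0::real)" if "k \<in> I" for k
      using that no cell by (auto simp: I_def split: split_indicator)
    then have "G s \<omega> = 0" unfolding G_def elem_proc_def by simp
    then show ?thesis using H by (simp add: H_def)
  qed
  have Hxi: "G s \<omega> = 0 \<or> (\<exists>k\<in>I. s \<in> {a k<..b k} \<and> cl k \<omega> \<and> G s \<omega> = H s \<omega>)" for s \<omega>
    using proc[of s \<omega>] by (auto simp: \<xi>'_def)
  have chi_meas: "{\<omega> \<in> space (F (a k)). cl k \<omega>} \<in> sets (F (a k))" if k: "k \<in> I" for k
  proof -
    have ak: "a k \<in> {0..T}" using ab[OF k] by auto
    have fk: "fst k < m" using k by (auto simp: I_def)
    have [measurable]: "A (a k) \<in> borel_measurable (F (a k))" by (rule A[OF ak])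
    \<comment> \<open>A term with \<open>\<tau> j < b k\<close> belongs to the partition interval
      containing the cell or to an earlier one, because the cell ends within its interval. Hence
      \<open>\<tau> j \<le> a k\<close>, and \<open>\<xi> j\<close> is known at \<open>a k\<close>.
      All other terms are zero.\<close>
    have "(\<lambda>\<omega>. max 0 (min (b k) (\<tau> (Suc j)) - \<tau> j) * (norm (\<xi> j \<omega>))\<^sup>2) \<in> borel_measurable (F (a k))"
      if j: "j < m" for j
    proof (cases "\<tau> j < b k")
      case True
      have "j \<le> fst k"
      proof (rule ccontr)
        assume "\<not> j \<le> fst k"
        then have "\<tau> (Suc (fst k)) \<le> \<tau> j" by (intro partition_mono[OF tau'(1)]) (use j in auto)
        with ab(6)[OF k] True show False by simp
      qed
      then have "\<tau> j \<le> \<tau> (fst k)" by (intro partition_mono[OF tau'(1)]) (use fk in auto)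
      with ab[OF k] have "\<tau> j \<le> a k" "a k \<le> T" by auto
      with xi[OF j] tau(2)[of j] j have "\<xi> j \<in> borel_measurable (F (a k))"
        by (intro F_measurable_mono[of "\<xi> j" "\<tau> j" "a k"]) (auto simp: bounded_rv_def)
      then show ?thesis by (intro borel_measurable_times borel_measurable_power borel_measurable_norm) auto
    next
      case False
      then have "max 0 (min (b k) (\<tau> (Suc j)) - \<tau> j) = 0" by auto
      then show ?thesis by simp
    qed
    then have [measurable]: "C (b k) \<in> borel_measurable (F (a k))"
      unfolding C_eq[abs_def] by (intro borel_measurable_sum) auto
    show ?thesis unfolding cl_def by measurable
  qed
  have ed: "elem_data I a b \<xi>'"
    unfolding elem_data_def
  proof (intro conjI ballI)
    show "finite I" by (simp add: I_def)
    fix k assume k: "k \<in> I"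
    show "0 \<le> a k" "a k \<le> b k" "b k \<le> T" using ab[OF k] by auto
    have fk: "fst k < m" using k by (auto simp: I_def)
    have bx: "bounded_rv (a k) (\<xi> (fst k))"
      by (rule bounded_rv_mono[OF xi[OF fk]]) (use ab[OF k] tau(2)[of "fst k"] fk in auto)
    have "\<xi>' k \<in> borel_measurable (F (a k))"
      unfolding \<xi>'_def[abs_def]
      by (rule measurable_If) (use bx chi_meas[OF k] in \<open>auto simp: bounded_rv_def\<close>)
    moreover have "bounded (\<xi>' k ` space Pr)"
    proof -
      have "\<xi>' k ` space Pr \<subseteq> insert 0 (\<xi> (fst k) ` space Pr)" by (auto simp: \<xi>'_def)
      moreover have "bounded (insert 0 (\<xi> (fst k) ` space Pr))" using bx by (simp add: bounded_rv_def)
      ultimately show ?thesis using bounded_subset by blast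
    qed
    ultimately show "bounded_rv (a k) (\<xi>' k)" by (simp add: bounded_rv_def)
  qed
  have el: "elementary G S" unfolding elementary_def G_def S_def using ed by blast
  show thesis
  proof (rule that[OF el])
    fix s \<omega> assume w: "\<omega> \<in> space Pr"
    show "G s \<omega> = 0 \<or> G s \<omega> = simple_process m \<tau> \<xi> s \<omega>" using Hxi[of s \<omega>] by (auto simp: H_def)
  next
    fix \<omega> assume w: "\<omega> \<in> space Pr"
    define Act where "Act = {k \<in> I. cl k \<omega>}"
    have fin: "finite Act" by (simp add: Act_def I_def)
    show "(LINT s:{0..T}|lborel. (norm (G s \<omega>))\<^sup>2) \<le> R'"
    proof (cases "Act = {}")
      case True
      then have "G s \<omega> = 0" for s using Hxi[of s \<omega>] by (auto simp: Act_def)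
      then show ?thesis using R' by (simp add: set_lebesgue_integral_def)
    next
      case False
      \<comment> \<open>The active cell with the last right end: everything that survives lies
        before that end, and up to there the uncut energy is at most \<open>R'\<close> because the
        cell is active.\<close>
      then obtain k where k: "k \<in> Act" "\<And>k'. k' \<in> Act \<Longrightarrow> b k' \<le> b k"
        using Max_in[of "b ` Act"] Max_ge[of "b ` Act"] fin by (metis (no_types, lifting) finite_imageI imageE image_eqI image_is_empty)
      have "(LINT s:{0..T}|lborel. (norm (G s \<omega>))\<^sup>2) \<le> C (b k) \<omega>"
        unfolding C_def set_lebesgue_integral_def
      proof (rule integral_mono')
        show "integrable lborel (\<lambda>s. indicator {0..b k} s *\<^sub>R (norm (H s \<omega>))\<^sup>2)"
          using Hi[of "b k" \<omega>] by (simp add: set_integrable_def)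
        fix s :: real
        show "indicator {0..T} s *\<^sub>R (norm (G s \<omega>))\<^sup>2 \<le> indicator {0..b k} s *\<^sub>R (norm (H s \<omega>))\<^sup>2"
        proof (cases "G s \<omega> = 0")
          case False
          then obtain k' where k': "k' \<in> I" "s \<in> {a k'<..b k'}" "cl k' \<omega>" "G s \<omega> = H s \<omega>" using Hxi[of s \<omega>] by auto
          with k(2)[of k'] have "s \<le> b k" by (auto simp: Act_def)
          then show ?thesis using k'(4) by (auto split: split_indicator)
        qed simp
      qed auto
      also have "\<dots> \<le> R'" using k(1) by (auto simp: Act_def cl_def)
      finally show ?thesis .
    qed
  next
    fix s \<omega> assume w: "\<omega> \<in> space Pr" and big: "\<And>r. r \<in> {0..T} \<Longrightarrow> s - T / real L \<le> r \<Longrightarrow> R \<le> A r \<omega>"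
    show "G s \<omega> = 0"
    proof (rule ccontr)
      assume "G s \<omega> \<noteq> 0"
      then obtain k where k: "k \<in> I" "s \<in> {a k<..b k}" "cl k \<omega>" using Hxi[of s \<omega>] by auto
      \<comment> \<open>The cell containing \<open>s\<close> starts at most one grid step
        \<open>T / real L\<close> earlier, where the clock is already at \<open>R\<close>.\<close>
      with big[of "a k"] ab[OF k(1)] show False by (auto simp: cl_def \<delta>_def)
    qed
  next
    fix t \<omega> assume w: "\<omega> \<in> space Pr" and t: "t \<in> {0..T}" and At: "A t \<omega> < R"
      and en: "(LINT s:{0..min T (t + T / real L)}|lborel. (norm (simple_process m \<tau> \<xi> s \<omega>))\<^sup>2) \<le> R'"
    \<comment> \<open>Up to time \<open>t\<close> nothing is cut. A cell that starts before
      \<open>t\<close> may end one grid step after \<open>t\<close>, which is why the energy is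
      assumed to stay below \<open>R'\<close> until then.\<close>
    have act: "cl k \<omega>" if k: "k \<in> I" "a k < t" for k
    proof -
      have "A (a k) \<omega> \<le> A t \<omega>" using ab[OF k(1)] k t w by (intro A_mono) auto
      moreover have "C (b k) \<omega> \<le> C (min T (t + T / real L)) \<omega>" using ab[OF k(1)] k by (intro C_mono) (auto simp: \<delta>_def)
      ultimately show ?thesis using At en by (auto simp: cl_def C_def H_def)
    qed
    have "G s \<omega> = simple_process m \<tau> \<xi> s \<omega>" if "s \<le> t" for s
      using proc[of s \<omega>] that act by (auto simp: H_def \<xi>'_def)
    moreover have "S i t \<omega> = simple_integral m \<tau> \<xi> (\<lambda>t \<omega>. M t \<omega> $ i) t \<omega>" for i
    proof -
      have "S i t \<omega> = (\<Sum>k\<in>I. inc i (min t (a k)) (min t (b k)) \<omega> *\<^sub>R \<xi> (fst k) \<omega>)"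
        unfolding S_def elem_int_def
      proof (intro sum.cong refl)
        fix k assume k: "k \<in> I"
        show "inc i (min t (a k)) (min t (b k)) \<omega> *\<^sub>R \<xi>' k \<omega> = inc i (min t (a k)) (min t (b k)) \<omega> *\<^sub>R \<xi> (fst k) \<omega>"
        proof (cases "a k < t")
          case True
          then show ?thesis using act[OF k] by (simp add: \<xi>'_def)
        next
          case False
          then have "min t (a k) = min t (b k)" using ab[OF k] by auto
          then show ?thesis by simp
        qed
      qed
      also have "\<dots> = (\<Sum>j<m. \<Sum>l<L. inc i (min t (\<phi> j l)) (min t (\<phi> j (Suc l))) \<omega> *\<^sub>R \<xi> j \<omega>)"
        unfolding I_def by (simp add: sum.cartesian_product a_def b_def split_beta')
      also have "\<dots> = (\<Sum>j<m. (M (min t (\<tau> (Suc j))) \<omega> $ i - M (min t (\<tau> j)) \<omega> $ i) *\<^sub>R \<xi> j \<omega>)"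
      proof (intro sum.cong refl)
        fix j assume j: "j \<in> {..<m}"
        \<comment> \<open>The clamped grid runs from one end of the \<open>j\<close>-th interval to
          the other, so the increments over its cells telescope.\<close>
        have e: "\<phi> j 0 = \<tau> j" "\<phi> j L = \<tau> (Suc j)"
          using tau(1)[of j] tau(2)[of j] tau(3)[of "Suc j"] tau(2)[of "Suc j"] j by (auto simp: \<phi>_def g max_def)
        have "(\<Sum>l<L. inc i (min t (\<phi> j l)) (min t (\<phi> j (Suc l))) \<omega>) = M (min t (\<phi> j L)) \<omega> $ i - M (min t (\<phi> j 0)) \<omega> $ i"
          unfolding inc_def by (rule sum_lessThan_telescope)
        then show "(\<Sum>l<L. inc i (min t (\<phi> j l)) (min t (\<phi> j (Suc l))) \<omega> *\<^sub>R \<xi> j \<omega>) =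
          (M (min t (\<tau> (Suc j))) \<omega> $ i - M (min t (\<tau> j)) \<omega> $ i) *\<^sub>R \<xi> j \<omega>"
          by (simp add: scaleR_sum_left[symmetric] e)
      qed
      finally show ?thesis by (simp add: simple_integral_def)
    qed
    ultimately show "(\<forall>s\<le>t. G s \<omega> = simple_process m \<tau> \<xi> s \<omega>) \<and>
       (\<forall>i. S i t \<omega> = simple_integral m \<tau> \<xi> (\<lambda>t \<omega>. M t \<omega> $ i) t \<omega>)" by simp
  qed
qed

end

text \<open>The bounds \<open>b n + c\<close> need not have a common integrable majorant, as
  \<open>b n\<close> tends to zero only in the mean. The excess of \<open>a n\<close> over
  \<open>b n\<close> is dominated by the fixed function \<open>c\<close> and eventually vanishes, so
  dominated convergence is applied to the excess alone.\<close>

lemma set_integral_tendsto_zero_split: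
  fixes a b :: "nat \<Rightarrow> real \<Rightarrow> real"
  assumes [measurable]: "\<And>n. a n \<in> borel_measurable borel" "\<And>n. b n \<in> borel_measurable borel"
    and c: "set_integrable lborel A c" "c \<in> borel_measurable borel" and A [measurable]: "A \<in> sets borel"
    and a: "\<And>n s. s \<in> A \<Longrightarrow> 0 \<le> a n s" "\<And>n s. s \<in> A \<Longrightarrow> a n s \<le> b n s + c s"
    and b: "\<And>n s. s \<in> A \<Longrightarrow> 0 \<le> b n s" "\<And>n. set_integrable lborel A (b n)" "(\<lambda>n. LINT s:A|lborel. b n s) \<longlonglongrightarrow> 0"
    and ev: "AE s in lborel. s \<in> A \<longrightarrow> (\<forall>\<^sub>F n in sequentially. a n s \<le> b n s)"
  shows "(\<lambda>n. LINT s:A|lborel. a n s) \<longlonglongrightarrow> 0"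
proof -
  define f where "f n s = indicator A s * max 0 (a n s - b n s)" for n s
  have f: "(\<lambda>n. LINT s|lborel. f n s) \<longlonglongrightarrow> (LINT s::real|lborel. 0)"
  proof (rule integral_dominated_convergence[where w="\<lambda>s. indicator A s * \<bar>c s\<bar>"])
    show "integrable lborel (\<lambda>s. indicator A s * \<bar>c s\<bar>)"
      using set_integrable_abs[OF c(1)] by (simp add: set_integrable_def)
    show "AE s in lborel. (\<lambda>n. f n s) \<longlonglongrightarrow> 0"
      using ev
    proof eventually_elim
      case (elim s)
      show ?case
      proof (cases "s \<in> A")
        case True
        with elim have "\<forall>\<^sub>F n in sequentially. a n s \<le> b n s" by simp
        then have "\<forall>\<^sub>F n in sequentially. f n s = 0" by eventually_elim (simp add: f_def max_def)
        then show ?thesis by (rule tendsto_eventually)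
      qed (simp add: f_def)
    qed
    show "AE s in lborel. norm (f n s) \<le> indicator A s * \<bar>c s\<bar>" for n
    proof (intro AE_I2)
      fix s show "norm (f n s) \<le> indicator A s * \<bar>c s\<bar>"
        using a(2)[of s n] by (auto simp: f_def split: split_indicator)
    qed
    show "f n \<in> borel_measurable lborel" for n unfolding f_def by measurable
  qed simp
  have fi: "integrable lborel (f n)" for n
  proof (rule Bochner_Integration.integrable_bound[of _ "\<lambda>s. indicator A s * \<bar>c s\<bar>"])
    show "integrable lborel (\<lambda>s. indicator A s * \<bar>c s\<bar>)"
      using set_integrable_abs[OF c(1)] by (simp add: set_integrable_def)
    show "f n \<in> borel_measurable lborel" unfolding f_def by measurable
    show "AE s in lborel. norm (f n s) \<le> norm (indicator A s * \<bar>c s\<bar>)"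
    proof (intro AE_I2)
      fix s show "norm (f n s) \<le> norm (indicator A s * \<bar>c s\<bar>)"
        using a(2)[of s n] by (auto simp: f_def split: split_indicator)
    qed
  qed
  have le: "(LINT s:A|lborel. a n s) \<le> (LINT s|lborel. f n s) + (LINT s:A|lborel. b n s)" for n
  proof -
    have "(LINT s:A|lborel. a n s) \<le> (LINT s|lborel. f n s + indicator A s *\<^sub>R b n s)"
      unfolding set_lebesgue_integral_def
    proof (rule integral_mono')
      show "integrable lborel (\<lambda>s. f n s + indicator A s *\<^sub>R b n s)"
        using fi b(2)[of n] by (auto simp: set_integrable_def)
      fix s show "indicator A s *\<^sub>R a n s \<le> f n s + indicator A s *\<^sub>R b n s"
        by (auto simp: f_def split: split_indicator)
      show "0 \<le> f n s + indicator A s *\<^sub>R b n s"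
        using b(1)[of s n] by (auto simp: f_def split: split_indicator)
    qed
    also have "\<dots> = (LINT s|lborel. f n s) + (LINT s:A|lborel. b n s)"
      unfolding set_lebesgue_integral_def
      by (rule Bochner_Integration.integral_add) (use fi b(2)[of n] in \<open>auto simp: set_integrable_def\<close>)
    finally show ?thesis .
  qed
  show ?thesis
  proof (rule tendsto_sandwich[OF always_eventually always_eventually tendsto_const])
    show "\<forall>n. 0 \<le> (LINT s:A|lborel. a n s)"
      using a(1) by (auto simp: set_lebesgue_integral_def split: split_indicator intro!: integral_nonneg_AE AE_I2)
    show "\<forall>n. (LINT s:A|lborel. a n s) \<le> (LINT s|lborel. f n s) + (LINT s:A|lborel. b n s)" using le by blast
    show "(\<lambda>n. (LINT s|lborel. f n s) + (LINT s:A|lborel. b n s)) \<longlonglongrightarrow> 0"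
      using tendsto_add[OF f b(3)] by simp
  qed
qed

section \<open>Measurability and integrability on the product of time and probability\<close>

context levy_driven
begin

lemma slice_measurable:
  "joint Y \<Longrightarrow> \<omega> \<in> space Pr \<Longrightarrow> (\<lambda>s. Y s \<omega>) \<in> borel_measurable borel"
  using measurable_Pair1[of "\<lambda>z. Y (fst z) (snd z)" borel Pr borel \<omega>] by simp

lemma section_measurable:
  "joint Y \<Longrightarrow> (\<lambda>\<omega>. Y s \<omega>) \<in> borel_measurable Pr"
  using measurable_Pair2[of "\<lambda>z. Y (fst z) (snd z)" borel Pr borel s] by simp

text \<open>The upper limit is moved into the integrand as an indicator that is jointly measurable
  in all variables, so that the measurability of parameter integrals applies.\<close>

lemma indefinite_integral_joint:
  fixes g :: "real \<Rightarrow> 'a \<Rightarrow> 'b::euclidean_space"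
  assumes "joint g"
  shows "joint (\<lambda>t \<omega>. LINT s:{0..t}|lborel. g s \<omega>)"
proof -
  have [measurable]: "(\<lambda>p. g (snd p) (snd (fst p))) \<in> borel_measurable ((borel \<Otimes>\<^sub>M Pr) \<Otimes>\<^sub>M lborel)"
  proof -
    have "(\<lambda>p. (snd p, snd (fst p))) \<in> (borel \<Otimes>\<^sub>M Pr) \<Otimes>\<^sub>M lborel \<rightarrow>\<^sub>M borel \<Otimes>\<^sub>M Pr" by measurable
    from measurable_compose[OF this assms] show ?thesis by simp
  qed
  have "(\<lambda>p. (if 0 \<le> snd p \<and> snd p \<le> fst (fst p) then 1 else 0) *\<^sub>R g (snd p) (snd (fst p))) \<in> borel_measurable ((borel \<Otimes>\<^sub>M Pr) \<Otimes>\<^sub>M lborel)"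
    by measurable
  then have "(\<lambda>z. LINT r|lborel. (if 0 \<le> r \<and> r \<le> fst z then 1 else 0) *\<^sub>R g r (snd z)) \<in> borel_measurable (borel \<Otimes>\<^sub>M Pr)"
    by (intro lborel.borel_measurable_lebesgue_integral) (simp add: split_beta')
  moreover have "indicator {0..s} r = (if 0 \<le> r \<and> r \<le> s then 1 else (0::real))" for r s :: real by (simp add: indicator_def)
  ultimately show ?thesis by (simp add: set_lebesgue_integral_def)
qed

lemma set_integral_measurable:
  fixes g :: "real \<Rightarrow> 'a \<Rightarrow> 'b::euclidean_space"
  shows "joint g \<Longrightarrow> (\<lambda>\<omega>. LINT s:{0..t}|lborel. g s \<omega>) \<in> borel_measurable Pr"
  by (rule section_measurable[OF indefinite_integral_joint])

lemma Lam_measurable: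
  "f \<in> borel_measurable (borel \<Otimes>\<^sub>M Pr) \<Longrightarrow> f \<in> borel_measurable Lam"
  by (simp add: measurable_def space_pair_measure cong: sets_pair_measure_cong)

lemma Lam_time:
  fixes g :: "real \<Rightarrow> 'a \<Rightarrow> real"
  assumes "Lintegrable t g"
  shows "(Lint t g) = (LINT s:{0..t}|lborel. \<integral>\<omega>. g s \<omega> \<partial>Pr)"
    "set_integrable lborel {0..t} (\<lambda>s. \<integral>\<omega>. g s \<omega> \<partial>Pr)"
    "(Lint t g) = (\<integral>\<omega>. (LINT s:{0..t}|lborel. g s \<omega>) \<partial>Pr)"
    "AE s in lborel. s \<in> {0..t} \<longrightarrow> integrable Pr (g s)"
proof -
  have i: "integrable Lam (case_prod (\<lambda>s \<omega>. indicator {0..t} s * g s \<omega>))" using assms by (simp add: split_beta')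
  show "(Lint t g) = (LINT s:{0..t}|lborel. \<integral>\<omega>. g s \<omega> \<partial>Pr)"
    using time.integral_fst[OF i] by (simp add: split_beta' set_lebesgue_integral_def)
  show "set_integrable lborel {0..t} (\<lambda>s. \<integral>\<omega>. g s \<omega> \<partial>Pr)"
    using time.integrable_fst[OF i] by (simp add: set_integrable_def)
  show "(Lint t g) = (\<integral>\<omega>. (LINT s:{0..t}|lborel. g s \<omega>) \<partial>Pr)"
    using time.integral_snd[OF i] by (simp add: split_beta' set_lebesgue_integral_def)
  show "AE s in lborel. s \<in> {0..t} \<longrightarrow> integrable Pr (g s)"
    using time.AE_integrable_fst[OF i] by eventually_elim (auto split: split_indicator_asm)
qed

lemma Lam_subinterval:
  fixes g :: "real \<times> 'a \<Rightarrow> real"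
  assumes "integrable Lam (\<lambda>z. indicator {0..T} (fst z) * g z)" "t \<in> {0..T}"
  shows "integrable Lam (\<lambda>z. indicator {0..t} (fst z) * g z)"
proof -
  have "integrable Lam (\<lambda>z. indicator {0..t} (fst z) * (indicator {0..T} (fst z) * g z))"
    by (rule Bochner_Integration.integrable_bound[OF assms(1)])
       (use borel_measurable_integrable[OF assms(1)] in \<open>auto split: split_indicator\<close>)
  moreover have "indicator {0..t} s * (indicator {0..T} s * y) = indicator {0..t} s * (y::real)" for s y
    using assms(2) by (auto split: split_indicator)
  ultimately show ?thesis by simp
qed

lemma Lam_sqintI:
  fixes g :: "real \<Rightarrow> 'a \<Rightarrow> 'b::euclidean_space"
  assumes [measurable]: "joint g"
    and i: "Lintegrable T (\<lambda>s \<omega>. (norm (g s \<omega>))\<^sup>2)" and t: "t \<in> {0..T}"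
  shows "Lsqint t g"
proof (rule sqintI)
  have [measurable]: "(\<lambda>z. g (fst z) (snd z)) \<in> borel_measurable Lam"
    by (rule Lam_measurable[OF assms(1)])
  have "(norm (indicator {0..t} (fst z) *\<^sub>R g (fst z) (snd z)))\<^sup>2 = indicator {0..t} (fst z) * (norm (g (fst z) (snd z)))\<^sup>2" for z
    by (auto split: split_indicator)
  then show "integrable Lam (\<lambda>z. (norm (indicator {0..t} (fst z) *\<^sub>R g (fst z) (snd z)))\<^sup>2)"
    using Lam_subinterval[OF i t] by simp
  show "(\<lambda>z. indicator {0..t} (fst z) *\<^sub>R g (fst z) (snd z)) \<in> borel_measurable Lam" by measurable
qed

text \<open>Tonelli: the path integrals are bounded by one deterministic constant, hence so is the
  double integral. Processes restricted by the clock are shown to be integrable in this way.\<close>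

lemma time_prob_integrable:
  fixes g :: "real \<Rightarrow> 'a \<Rightarrow> real"
  assumes m [measurable]: "joint g"
    and pos: "\<And>s \<omega>. s \<in> {0..t} \<Longrightarrow> \<omega> \<in> space Pr \<Longrightarrow> 0 \<le> g s \<omega>"
    and int: "\<And>\<omega>. \<omega> \<in> space Pr \<Longrightarrow> set_integrable lborel {0..t} (\<lambda>s. g s \<omega>)"
    and bound: "\<And>\<omega>. \<omega> \<in> space Pr \<Longrightarrow> (LINT s:{0..t}|lborel. g s \<omega>) \<le> C"
  shows "Lintegrable t g"
proof (rule integrableI_bounded)
  have [measurable]: "(\<lambda>z. g (fst z) (snd z)) \<in> borel_measurable Lam"
    by (rule Lam_measurable[OF m])
  show "(\<lambda>z. indicator {0..t} (fst z) * g (fst z) (snd z)) \<in> borel_measurable Lam" by measurable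
  have "(\<integral>\<^sup>+z. ennreal (norm (indicator {0..t} (fst z) * g (fst z) (snd z))) \<partial>Lam) =
    (\<integral>\<^sup>+\<omega>. (\<integral>\<^sup>+s. ennreal (norm (indicator {0..t} s * g s \<omega>)) \<partial>lborel) \<partial>Pr)"
    by (subst time.nn_integral_snd[symmetric]) auto
  also have "\<dots> \<le> (\<integral>\<^sup>+\<omega>. ennreal C \<partial>Pr)"
  proof (rule nn_integral_mono)
    fix \<omega> assume w: "\<omega> \<in> space Pr"
    have "(\<integral>\<^sup>+s. ennreal (norm (indicator {0..t} s * g s \<omega>)) \<partial>lborel) = (\<integral>\<^sup>+s. ennreal (indicator {0..t} s * g s \<omega>) \<partial>lborel)"
      using pos w by (intro nn_integral_cong) (auto split: split_indicator)
    also have "\<dots> = ennreal (LINT s:{0..t}|lborel. g s \<omega>)"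
      unfolding set_lebesgue_integral_def real_scaleR_def
      by (rule nn_integral_eq_integral) (use int[OF w] pos w in \<open>auto simp: set_integrable_def split: split_indicator\<close>)
    also have "\<dots> \<le> ennreal C" using bound[OF w] by (rule ennreal_leI)
    finally show "(\<integral>\<^sup>+s. ennreal (norm (indicator {0..t} s * g s \<omega>)) \<partial>lborel) \<le> ennreal C" .
  qed
  also have "\<dots> < \<infinity>" by (simp add: emeasure_space_1)
  finally show "(\<integral>\<^sup>+z. ennreal (norm (indicator {0..t} (fst z) * g (fst z) (snd z))) \<partial>Lam) < \<infinity>" .
qed

lemma simple_process_measurable:
  assumes "simple_data Pr T F m \<tau> \<xi>"
  shows "joint (simple_process m \<tau> \<xi>)"
proof -
  have [measurable]: "\<xi> j \<in> borel_measurable Pr" if "j < m" for j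
    using assms that by (auto simp: simple_data_def intro!: F_measurable_Pr[of "\<tau> j"])
  show ?thesis unfolding simple_process_def
    by (intro borel_measurable_sum) measurable
qed

lemma simple_integral_measurable:
  assumes "simple_data Pr T F m \<tau> \<xi>" "t \<in> {0..T}"
  shows "simple_integral m \<tau> \<xi> (\<lambda>t \<omega>. M t \<omega> $ i) t \<in> borel_measurable Pr"
proof -
  have [measurable]: "\<xi> j \<in> borel_measurable Pr" if "j < m" for j
    using assms that by (auto simp: simple_data_def intro!: F_measurable_Pr[of "\<tau> j"])
  have [measurable]: "(\<lambda>\<omega>. M (min t (\<tau> j)) \<omega> $ i) \<in> borel_measurable Pr" if "j \<le> m" for j
    by (rule sqint_measurable[OF M_component_sqint]) (use assms that in \<open>auto simp: simple_data_def min_def\<close>)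
  show ?thesis unfolding simple_integral_def[abs_def]
    by (intro borel_measurable_sum) measurable
qed

lemma elementary_measurable:
  assumes "elementary G S"
  shows "joint G"
proof -
  obtain I a b \<xi> where d: "elem_data I a b \<xi>" and G: "G = elem_proc I a b \<xi>" 
    using assms by (auto simp: elementary_def)
  have [measurable]: "\<xi> k \<in> borel_measurable Pr" if "k \<in> I" for k
    using d that by (auto simp: elem_data_def bounded_rv_def intro!: F_measurable_Pr[of "a k"])
  show ?thesis unfolding G elem_proc_def
    by (intro borel_measurable_sum) measurable
qed

end

text \<open>One noise component. The integrand \<open>Y\<close> is linked to the integral
  \<open>J\<close> only by the two limit relations, so it may be any suitable process that agrees
  with the predictable integrand at almost all times; left limits are removed in this way later. The
  clock \<open>A\<close> is strictly increasing, so that it meets the level \<open>R\<close> at most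
  once.\<close>

locale ito_cut = levy_driven Pr T F M K
  for Pr :: "'a measure" and T :: real and F :: "real \<Rightarrow> 'a measure"
    and M :: "real \<Rightarrow> 'a \<Rightarrow> real^'d" and K :: "real^'d^'d" +
  fixes i :: 'd and Y :: "real \<Rightarrow> 'a \<Rightarrow> real^'n" and J :: "real \<Rightarrow> 'a \<Rightarrow> real^'n"
    and m :: "nat \<Rightarrow> nat" and \<tau> :: "nat \<Rightarrow> nat \<Rightarrow> real" and \<xi> :: "nat \<Rightarrow> nat \<Rightarrow> 'a \<Rightarrow> real^'n"
    and A :: "real \<Rightarrow> 'a \<Rightarrow> real" and R R1 :: real
  assumes Y_meas: "joint Y"
    and Y_int: "\<And>\<omega>. \<omega> \<in> space Pr \<Longrightarrow> set_integrable lborel {0..T} (\<lambda>s. (norm (Y s \<omega>))\<^sup>2)"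
    and simple: "\<And>n. simple_data Pr T F (m n) (\<tau> n) (\<xi> n)"
    and H_conv: "converges_in_prob Pr (\<lambda>n \<omega>. LINT s:{0..T}|lborel. (norm (simple_process (m n) (\<tau> n) (\<xi> n) s \<omega> - Y s \<omega>))\<^sup>2) (\<lambda>\<omega>. 0)"
    and I_conv: "\<And>t. t \<in> {0..T} \<Longrightarrow> converges_in_prob Pr (\<lambda>n. simple_integral (m n) (\<tau> n) (\<xi> n) (\<lambda>t \<omega>. M t \<omega> $ i) t) (J t)"
    and J_meas: "\<And>t. t \<in> {0..T} \<Longrightarrow> J t \<in> borel_measurable Pr"
    and A_meas: "\<And>s. s \<in> {0..T} \<Longrightarrow> A s \<in> borel_measurable (F s)"
    and A_joint: "joint A"
    and A_strict: "\<And>s t \<omega>. 0 \<le> s \<Longrightarrow> s < t \<Longrightarrow> t \<le> T \<Longrightarrow> \<omega> \<in> space Pr \<Longrightarrow> A s \<omega> < A t \<omega>"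
    and A_cont: "\<And>\<omega>. \<omega> \<in> space Pr \<Longrightarrow> continuous_on {0..T} (\<lambda>s. A s \<omega>)"
    and R1: "0 \<le> R1" "\<And>\<omega>. \<omega> \<in> space Pr \<Longrightarrow> (LINT s:{0..T}|lborel. (if A s \<omega> < R then (norm (Y s \<omega>))\<^sup>2 else 0)) \<le> R1"
begin

definition YR :: "real \<Rightarrow> 'a \<Rightarrow> real^'n" where
  "YR s \<omega> = (if A s \<omega> < R then Y s \<omega> else 0)"

definition H :: "nat \<Rightarrow> real \<Rightarrow> 'a \<Rightarrow> real^'n" where
  "H n = simple_process (m n) (\<tau> n) (\<xi> n)"

lemma A_mono: "0 \<le> s \<Longrightarrow> s \<le> t \<Longrightarrow> t \<le> T \<Longrightarrow> \<omega> \<in> space Pr \<Longrightarrow> A s \<omega> \<le> A t \<omega>"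
  using A_strict[of s t \<omega>] by (cases "s = t") auto

lemma YR_meas: "joint YR"
  unfolding YR_def using Y_meas A_joint by measurable

lemma H_meas: "joint (H n)"
  unfolding H_def by (rule simple_process_measurable[OF simple])

lemma path_sqint:
  fixes g :: "real \<Rightarrow> real^'n"
  assumes "g \<in> borel_measurable borel" "set_integrable lborel {0..t} (\<lambda>s. (norm (g s))\<^sup>2)"
  shows "sqint lborel (\<lambda>s. indicator {0..t} s *\<^sub>R g s)"
proof (rule sqintI)
  have "(norm (indicator {0..t} s *\<^sub>R g s))\<^sup>2 = indicator {0..t} s *\<^sub>R (norm (g s))\<^sup>2" for s
    by (auto split: split_indicator)
  then show "integrable lborel (\<lambda>s. (norm (indicator {0..t} s *\<^sub>R g s))\<^sup>2)"
    using assms(2) by (simp add: set_integrable_def)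
qed (use assms(1) in measurable)

lemma H_int: "set_integrable lborel {0..t} (\<lambda>s. (norm (H n s \<omega>))\<^sup>2)"
  unfolding H_def by (rule simple_process_energy(1)) (use simple[of n] in \<open>auto simp: simple_data_def\<close>)

lemma HY_int:
  assumes w: "\<omega> \<in> space Pr"
  shows "set_integrable lborel {0..T} (\<lambda>s. (norm (H n s \<omega> - Y s \<omega>))\<^sup>2)"
proof -
  have "sqint lborel (\<lambda>s. indicator {0..T} s *\<^sub>R H n s \<omega> - indicator {0..T} s *\<^sub>R Y s \<omega>)"
    by (intro sqint_diff path_sqint slice_measurable H_meas Y_meas H_int Y_int w)
  from sqint_integrable[OF this]
  have "integrable lborel (\<lambda>s. (norm (indicator {0..T} s *\<^sub>R H n s \<omega> - indicator {0..T} s *\<^sub>R Y s \<omega>))\<^sup>2)" .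
  moreover have "(norm (indicator {0..T} s *\<^sub>R H n s \<omega> - indicator {0..T} s *\<^sub>R Y s \<omega>))\<^sup>2 =
     indicator {0..T} s *\<^sub>R (norm (H n s \<omega> - Y s \<omega>))\<^sup>2" for s
    by (auto split: split_indicator)
  ultimately show ?thesis by (simp add: set_integrable_def)
qed

lemma YR_int: "\<omega> \<in> space Pr \<Longrightarrow> set_integrable lborel {0..T} (\<lambda>s. (norm (YR s \<omega>))\<^sup>2)"
proof (rule set_integrable_bound[OF Y_int])
  assume w: "\<omega> \<in> space Pr"
  have [measurable]: "(\<lambda>s. YR s \<omega>) \<in> borel_measurable borel" by (rule slice_measurable[OF YR_meas w])
  show "set_borel_measurable lborel {0..T} (\<lambda>s. (norm (YR s \<omega>))\<^sup>2)" unfolding set_borel_measurable_def by measurable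
qed (auto simp: YR_def)

lemma YR_energy: "\<omega> \<in> space Pr \<Longrightarrow> (LINT s:{0..T}|lborel. (norm (YR s \<omega>))\<^sup>2) \<le> R1"
proof -
  assume w: "\<omega> \<in> space Pr"
  have "(norm (YR s \<omega>))\<^sup>2 = (if A s \<omega> < R then (norm (Y s \<omega>))\<^sup>2 else 0)" for s by (simp add: YR_def)
  then show ?thesis using R1(2)[OF w] by simp
qed

lemma energy_tendsto:
  assumes w: "\<omega> \<in> space Pr" and t: "t \<in> {0..T}"
    and conv: "(\<lambda>n. LINT s:{0..T}|lborel. (norm (H (r n) s \<omega> - Y s \<omega>))\<^sup>2) \<longlonglongrightarrow> 0"
  shows "(\<lambda>n. LINT s:{0..t}|lborel. (norm (H (r n) s \<omega>))\<^sup>2) \<longlonglongrightarrow> (LINT s:{0..t}|lborel. (norm (Y s \<omega>))\<^sup>2)"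
proof -
  let ?h = "\<lambda>n s. indicator {0..t} s *\<^sub>R H (r n) s \<omega>" and ?y = "\<lambda>s. indicator {0..t} s *\<^sub>R Y s \<omega>"
  have Yt: "set_integrable lborel {0..t} (\<lambda>s. (norm (Y s \<omega>))\<^sup>2)"
    using t by (intro set_integrable_subset[OF Y_int[OF w]]) auto
  have h: "sqint lborel (?h n)" for n by (intro path_sqint slice_measurable H_meas H_int w)
  have y: "sqint lborel ?y" by (intro path_sqint slice_measurable Y_meas Yt w)
  have "(LINT s|lborel. (norm (?h n s - ?y s))\<^sup>2) \<le> (LINT s:{0..T}|lborel. (norm (H (r n) s \<omega> - Y s \<omega>))\<^sup>2)" for n
    unfolding set_lebesgue_integral_def
    by (rule integral_mono') (use HY_int[OF w, of "r n"] t in \<open>auto simp: set_integrable_def split: split_indicator\<close>)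
  then have d: "(\<lambda>n. LINT s|lborel. (norm (?h n s - ?y s))\<^sup>2) \<longlonglongrightarrow> 0"
    by (intro tendsto_sandwich[OF always_eventually always_eventually tendsto_const conv]) auto
  have sq: "v \<bullet> v = (norm v)\<^sup>2" "(norm (indicator {0..t} s *\<^sub>R v))\<^sup>2 = indicator {0..t} s *\<^sub>R (norm v)\<^sup>2"
    for v :: "real^'n" and s by (auto simp: power2_norm_eq_inner split: split_indicator)
  from sqint_inner_tendsto[OF h y d h y d] show ?thesis
    unfolding sq(1) sq(2) set_lebesgue_integral_def .
qed

end

context ito_cut
begin

lemma YR_sqint: "Lsqint T YR"
proof (rule sqintI)
  have "Lintegrable T (\<lambda>s \<omega>. (norm (YR s \<omega>))\<^sup>2)"
    by (rule time_prob_integrable[where C=R1]) (use YR_meas YR_int YR_energy in \<open>auto\<close>)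
  moreover have "(norm (indicator {0..T} (fst z) *\<^sub>R YR (fst z) (snd z)))\<^sup>2 = indicator {0..T} (fst z) * (norm (YR (fst z) (snd z)))\<^sup>2" for z
    by (auto split: split_indicator)
  ultimately show "integrable Lam (\<lambda>z. (norm (indicator {0..T} (fst z) *\<^sub>R YR (fst z) (snd z)))\<^sup>2)"
    by simp
  have [measurable]: "(\<lambda>z. YR (fst z) (snd z)) \<in> borel_measurable Lam"
    by (rule Lam_measurable[OF YR_meas])
  show "(\<lambda>z. indicator {0..T} (fst z) *\<^sub>R YR (fst z) (snd z)) \<in> borel_measurable Lam" by measurable
qed

text \<open>The output of \<open>cut_simple_process\<close> for the \<open>k\<close>-th
  approximation on a grid of \<open>L\<close> cells, with energy cap \<open>R1 + 1\<close>. As the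
  restricted limit has energy at most \<open>R1\<close>, the extra 1 keeps good approximations below
  the cap until the clock reaches \<open>R\<close>.\<close>

definition cut_at :: "nat \<Rightarrow> nat \<Rightarrow> (real \<Rightarrow> 'a \<Rightarrow> real^'n) \<Rightarrow> ('d \<Rightarrow> real \<Rightarrow> 'a \<Rightarrow> real^'n) \<Rightarrow> bool" where
  "cut_at k L G S \<longleftrightarrow> elementary G S \<and>
    (\<forall>\<omega>\<in>space Pr. (\<forall>s. G s \<omega> = 0 \<or> G s \<omega> = H k s \<omega>) \<and>
      (LINT s:{0..T}|lborel. (norm (G s \<omega>))\<^sup>2) \<le> R1 + 1 \<and>
      (\<forall>s. (\<forall>r\<in>{0..T}. s - T / real L \<le> r \<longrightarrow> R \<le> A r \<omega>) \<longrightarrow> G s \<omega> = 0) \<and>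
      (\<forall>t\<in>{0..T}. A t \<omega> < R \<longrightarrow> (LINT s:{0..min T (t + T / real L)}|lborel. (norm (H k s \<omega>))\<^sup>2) \<le> R1 + 1 \<longrightarrow>
       (\<forall>s\<le>t. G s \<omega> = H k s \<omega>) \<and>
       S i t \<omega> = simple_integral (m k) (\<tau> k) (\<xi> k) (\<lambda>t \<omega>. M t \<omega> $ i) t \<omega>))"

lemma cut_at_exists:
  assumes "0 < L" shows "\<exists>G S. cut_at k L G S"
proof -
  have R': "0 \<le> R1 + 1" using R1(1) by simp
  show ?thesis
    by (rule cut_simple_process[OF simple[of k] A_meas A_mono assms R', of R]) 
      (auto simp: cut_at_def H_def intro!: exI)
qed

text \<open>On a path along which the uncut processes converge, there are three kinds of times.
  While the clock is below \<open>R\<close>, late cut processes coincide with the uncut ones; once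
  it is above \<open>R\<close>, a fine grid has switched them off, as is the limit
  \<open>YR\<close>; and it equals \<open>R\<close> at most once.\<close>

lemma path_cut_tendsto:
  assumes w: "\<omega> \<in> space Pr" and G: "\<And>n. cut_at (r n) (Suc n) (G n) (S n)"
    and conv: "(\<lambda>n. LINT s:{0..T}|lborel. (norm (H (r n) s \<omega> - Y s \<omega>))\<^sup>2) \<longlonglongrightarrow> 0"
  shows "t \<in> {0..T} \<Longrightarrow> A t \<omega> < R \<Longrightarrow> \<forall>\<^sub>F n in sequentially. (\<forall>s\<le>t. G n s \<omega> = H (r n) s \<omega>) \<and>
       S n i t \<omega> = simple_integral (m (r n)) (\<tau> (r n)) (\<xi> (r n)) (\<lambda>t \<omega>. M t \<omega> $ i) t \<omega>"
    and "(\<lambda>n. LINT s:{0..T}|lborel. (norm (G n s \<omega> - YR s \<omega>))\<^sup>2) \<longlonglongrightarrow> 0"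
proof -
  have ev: "\<forall>\<^sub>F n in sequentially. (\<forall>s\<le>t. G n s \<omega> = H (r n) s \<omega>) \<and>
       S n i t \<omega> = simple_integral (m (r n)) (\<tau> (r n)) (\<xi> (r n)) (\<lambda>t \<omega>. M t \<omega> $ i) t \<omega>"
    if t: "t \<in> {0..T}" and At: "A t \<omega> < R" for t
  proof -
    \<comment> \<open>A time beyond \<open>t\<close>, or the end of the horizon, at which the clock
      is still below \<open>R\<close> by continuity. The energy condition looks one grid step ahead
      of \<open>t\<close>, and for fine grids this step ends before \<open>t'\<close>.\<close>
    obtain t' where t': "t' \<in> {0..T}" "A t' \<omega> < R" "t' = T \<or> t < t'" 
    proof (cases "t = T")
      case True
      with t At that[of T] T_pos show thesis by auto
    next
      case False
      then have tT: "t < T" using t by simp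
      have "((\<lambda>s. A s \<omega>) \<longlongrightarrow> A t \<omega>) (at t within {0..T})"
        using A_cont[OF w] t by (auto simp: continuous_on_def)
      then have "\<forall>\<^sub>F s in at t within {0..T}. A s \<omega> < R" using At by (rule order_tendstoD(2))
      then obtain d where d: "d > 0" "\<And>s. s \<in> {0..T} \<Longrightarrow> s \<noteq> t \<Longrightarrow> dist s t < d \<Longrightarrow> A s \<omega> < R"
        by (auto simp: eventually_at)
      show thesis
        using that[of "min T (t + d / 2)"] d(2)[of "min T (t + d / 2)"] d(1) tT t by (auto simp: dist_real_def min_def)
    qed
    have small: "\<forall>\<^sub>F n in sequentially. min T (t + T / real (Suc n)) \<le> t'"
    proof (cases "t' = T")
      case False
      with t' have "0 < t' - t" by simp
      moreover have "(\<lambda>n. T / real (Suc n)) \<longlonglongrightarrow> 0" 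
        using tendsto_mult_right_zero[OF LIMSEQ_Suc[OF lim_1_over_n], of T] by simp
      ultimately have "\<forall>\<^sub>F n in sequentially. T / real (Suc n) < t' - t" by (rule order_tendstoD(2)[rotated])
      then show ?thesis by eventually_elim auto
    qed simp
    have "(LINT s:{0..t'}|lborel. (norm (Y s \<omega>))\<^sup>2) \<le> (LINT s:{0..T}|lborel. (norm (YR s \<omega>))\<^sup>2)"
      unfolding set_lebesgue_integral_def
    proof (rule integral_mono')
      show "integrable lborel (\<lambda>s. indicator {0..T} s *\<^sub>R (norm (YR s \<omega>))\<^sup>2)"
        using YR_int[OF w] by (simp add: set_integrable_def)
      fix s :: real
      show "indicator {0..t'} s *\<^sub>R (norm (Y s \<omega>))\<^sup>2 \<le> indicator {0..T} s *\<^sub>R (norm (YR s \<omega>))\<^sup>2"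
      proof (cases "s \<in> {0..t'}")
        case True
        then have "A s \<omega> \<le> A t' \<omega>" using t' w by (intro A_mono) auto
        then show ?thesis using True t' by (simp add: YR_def)
      qed simp
    qed auto
    \<comment> \<open>Strict thanks to the slack in the cap, so the inequality passes from the limit
      to the approximating energies.\<close>
    also have "\<dots> < R1 + 1" using YR_energy[OF w] by simp
    finally have "\<forall>\<^sub>F n in sequentially. (LINT s:{0..t'}|lborel. (norm (H (r n) s \<omega>))\<^sup>2) < R1 + 1"
      by (rule order_tendstoD(2)[OF energy_tendsto[OF w t'(1) conv]])
    with small show ?thesis
    proof eventually_elim
      case (elim n)
      have "(LINT s:{0..min T (t + T / real (Suc n))}|lborel. (norm (H (r n) s \<omega>))\<^sup>2) \<le> (LINT s:{0..t'}|lborel. (norm (H (r n) s \<omega>))\<^sup>2)"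
        unfolding set_lebesgue_integral_def
        by (rule integral_mono') (use H_int[of t' "r n" \<omega>] elim(1) in \<open>auto simp: set_integrable_def split: split_indicator\<close>)
      with elim(2) have "(LINT s:{0..min T (t + T / real (Suc n))}|lborel. (norm (H (r n) s \<omega>))\<^sup>2) \<le> R1 + 1" by linarith
      with G[of n] w t At show ?case unfolding cut_at_def by blast
    qed
  qed
  then show "t \<in> {0..T} \<Longrightarrow> A t \<omega> < R \<Longrightarrow> \<forall>\<^sub>F n in sequentially. (\<forall>s\<le>t. G n s \<omega> = H (r n) s \<omega>) \<and>
       S n i t \<omega> = simple_integral (m (r n)) (\<tau> (r n)) (\<xi> (r n)) (\<lambda>t \<omega>. M t \<omega> $ i) t \<omega>" .
  have Gm: "(\<lambda>s. G n s \<omega>) \<in> borel_measurable borel" for n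
    using G[of n] by (intro slice_measurable[OF elementary_measurable w]) (auto simp: cut_at_def)
  note ms = Gm slice_measurable[OF YR_meas w] slice_measurable[OF H_meas w] slice_measurable[OF Y_meas w]
  show "(\<lambda>n. LINT s:{0..T}|lborel. (norm (G n s \<omega> - YR s \<omega>))\<^sup>2) \<longlonglongrightarrow> 0"
  \<comment> \<open>\<open>b\<close> carries the error of the uncut processes, which vanishes in the
    mean. \<open>c\<close> carries the energy of \<open>Y\<close>, a fixed bound for what is lost
    where cut process and restricted limit are not switched off at the same times.\<close>
  proof (rule set_integral_tendsto_zero_split[where b="\<lambda>n s. 2 * (norm (H (r n) s \<omega> - Y s \<omega>))\<^sup>2" and c="\<lambda>s. 2 * (norm (Y s \<omega>))\<^sup>2"])
    note [measurable] = ms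
    show "(\<lambda>s. (norm (G n s \<omega> - YR s \<omega>))\<^sup>2) \<in> borel_measurable borel" for n by measurable
    show "(\<lambda>s. 2 * (norm (H (r n) s \<omega> - Y s \<omega>))\<^sup>2) \<in> borel_measurable borel" for n by measurable
    show "set_integrable lborel {0..T} (\<lambda>s. 2 * (norm (Y s \<omega>))\<^sup>2)"
      using Y_int[OF w] by (intro set_integrable_mult_right) auto
    show "(\<lambda>s. 2 * (norm (Y s \<omega>))\<^sup>2) \<in> borel_measurable borel" by measurable
    show "set_integrable lborel {0..T} (\<lambda>s. 2 * (norm (H (r n) s \<omega> - Y s \<omega>))\<^sup>2)" for n
      using HY_int[OF w] by (intro set_integrable_mult_right) auto
    show "(\<lambda>n. LINT s:{0..T}|lborel. 2 * (norm (H (r n) s \<omega> - Y s \<omega>))\<^sup>2) \<longlonglongrightarrow> 0"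
      using tendsto_mult_right_zero[OF conv, of 2] by simp
    show "(norm (G n s \<omega> - YR s \<omega>))\<^sup>2 \<le> 2 * (norm (H (r n) s \<omega> - Y s \<omega>))\<^sup>2 + 2 * (norm (Y s \<omega>))\<^sup>2" for n s
    proof -
      have "G n s \<omega> = 0 \<or> G n s \<omega> = H (r n) s \<omega>" using G[of n] w by (auto simp: cut_at_def)
      moreover have "(norm (H (r n) s \<omega>))\<^sup>2 \<le> 2 * (norm (H (r n) s \<omega> - Y s \<omega>))\<^sup>2 + 2 * (norm (Y s \<omega>))\<^sup>2"
        using norm_add_sq_le[of "H (r n) s \<omega> - Y s \<omega>" "Y s \<omega>"] by simp
      ultimately show ?thesis by (auto simp: YR_def add_increasing2)
    qed
    have "AE s in lborel. A s \<omega> \<noteq> R \<or> s \<notin> {0..T}"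
    proof -
      have "\<exists>s0. \<forall>s\<in>{0..T}. A s \<omega> = R \<longrightarrow> s = s0"
      proof (cases "\<exists>s0\<in>{0..T}. A s0 \<omega> = R")
        case True
        then obtain s0 where s0: "s0 \<in> {0..T}" "A s0 \<omega> = R" by auto
        have "s = s0" if "s \<in> {0..T}" "A s \<omega> = R" for s
          using A_strict[of s s0 \<omega>] A_strict[of s0 s \<omega>] s0 that w by (cases s s0 rule: linorder_cases) auto
        then show ?thesis by (intro exI[of _ s0]) auto
      qed auto
      then obtain s0 where "\<forall>s\<in>{0..T}. A s \<omega> = R \<longrightarrow> s = s0" by auto
      then show ?thesis using AE_lborel_singleton[of s0] by (auto elim!: eventually_mono)
    qed
    then show "AE s in lborel. s \<in> {0..T} \<longrightarrow> (\<forall>\<^sub>F n in sequentially. (norm (G n s \<omega> - YR s \<omega>))\<^sup>2 \<le> 2 * (norm (H (r n) s \<omega> - Y s \<omega>))\<^sup>2)"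
    proof eventually_elim
      case (elim s)
      show ?case
      proof
        assume s: "s \<in> {0..T}"
        with elim consider "A s \<omega> < R" | "R < A s \<omega>" by force
        then show "\<forall>\<^sub>F n in sequentially. (norm (G n s \<omega> - YR s \<omega>))\<^sup>2 \<le> 2 * (norm (H (r n) s \<omega> - Y s \<omega>))\<^sup>2"
        proof cases
          case 1
          from ev[OF s 1] show ?thesis by eventually_elim (use 1 in \<open>simp add: YR_def\<close>)
        next
          case 2
          \<comment> \<open>A time before \<open>s\<close> at which the clock has already reached
            \<open>R\<close>. As soon as the grid step is below \<open>s - r0\<close>, the clock is
            at \<open>R\<close> on the whole stretch where the cell of \<open>s\<close> can start,
            and the cell is switched off. For \<open>r0 = 0\<close> this holds on every
            grid.\<close>
          obtain r0 where r0: "r0 \<in> {0..T}" "R \<le> A r0 \<omega>" "r0 = 0 \<or> r0 < s"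
          proof (cases "s = 0")
            case True
            with s 2 that[of 0] show thesis by auto
          next
            case False
            then have s0: "0 < s" using s by simp
            have "((\<lambda>s. A s \<omega>) \<longlongrightarrow> A s \<omega>) (at s within {0..T})"
              using A_cont[OF w] s by (auto simp: continuous_on_def)
            then have "\<forall>\<^sub>F v in at s within {0..T}. R < A v \<omega>" using 2 by (rule order_tendstoD(1))
            then obtain d where d: "d > 0" "\<And>v. v \<in> {0..T} \<Longrightarrow> v \<noteq> s \<Longrightarrow> dist v s < d \<Longrightarrow> R < A v \<omega>"
              by (auto simp: eventually_at)
            define v where "v = max 0 (s - d / 2)"
            have v: "v \<in> {0..T}" "v < s" "dist v s < d" using d(1) s0 s by (auto simp: v_def dist_real_def max_def)
            with d(2)[of v] have "R < A v \<omega>" by auto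
            with v that[of v] show thesis by auto
          qed
          have "\<forall>\<^sub>F n in sequentially. r0 = 0 \<or> T / real (Suc n) < s - r0"
          proof (cases "r0 = 0")
            case False
            with r0 have "0 < s - r0" by simp
            moreover have "(\<lambda>n. T / real (Suc n)) \<longlonglongrightarrow> 0" 
              using tendsto_mult_right_zero[OF LIMSEQ_Suc[OF lim_1_over_n], of T] by simp
            ultimately have "\<forall>\<^sub>F n in sequentially. T / real (Suc n) < s - r0" by (rule order_tendstoD(2)[rotated])
            then show ?thesis by eventually_elim auto
          qed simp
          then show ?thesis
          proof eventually_elim
            case (elim n)
            have "R \<le> A v \<omega>" if "v \<in> {0..T}" "s - T / real (Suc n) \<le> v" for v
            proof -
              have "r0 \<le> v" using elim that r0 by auto
              then have "A r0 \<omega> \<le> A v \<omega>" using that r0 w by (intro A_mono) auto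
              then show ?thesis using r0 by simp
            qed
            then have "G n s \<omega> = 0" using G[of n] w unfolding cut_at_def by blast
            then show ?case using 2 by (simp add: YR_def)
          qed
        qed
      qed
    qed
  qed auto
qed

text \<open>Energy caps allow dominated convergence for the integrands. For the integrals,
  \<open>J\<close> is an almost sure limit of simple integrals along a subsequence, and these
  eventually agree with the cut ones on the clock event, so Fatou's lemma turns the isometry for two
  cut processes into a bound on the distance to \<open>J\<close>.\<close>

theorem elementary_approximation:
  obtains G S where "\<And>n. elementary (G n) (S n)"
    "(\<lambda>n. Lint T (\<lambda>s \<omega>. (norm (G n s \<omega> - YR s \<omega>))\<^sup>2)) \<longlonglongrightarrow> 0"
    "\<And>n t. t \<in> {0..T} \<Longrightarrow> integrable Pr (\<lambda>\<omega>. if A t \<omega> < R then (norm (S n i t \<omega> - J t \<omega>))\<^sup>2 else 0)"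
    "\<And>n t. t \<in> {0..T} \<Longrightarrow> (\<integral>\<omega>. (if A t \<omega> < R then (norm (S n i t \<omega> - J t \<omega>))\<^sup>2 else 0) \<partial>Pr) \<le>
       2 * \<bar>K $ i $ i\<bar> * (Lint T (\<lambda>s \<omega>. (norm (G n s \<omega> - YR s \<omega>))\<^sup>2))"
proof -
  have Wm: "(\<lambda>\<omega>. LINT s:{0..T}|lborel. (norm (simple_process (m n) (\<tau> n) (\<xi> n) s \<omega> - Y s \<omega>))\<^sup>2) \<in> borel_measurable Pr" for n
  proof -
    note [measurable] = simple_process_measurable[OF simple] Y_meas
    show ?thesis by (rule set_integral_measurable) measurable
  qed
  obtain r where r: "strict_mono r"
    "AE \<omega> in Pr. (\<lambda>n. LINT s:{0..T}|lborel. (norm (simple_process (m (r n)) (\<tau> (r n)) (\<xi> (r n)) s \<omega> - Y s \<omega>))\<^sup>2) \<longlonglongrightarrow> 0"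
    using converges_in_prob_AE_subseq[OF prob_space_axioms Wm _ H_conv] by auto
  have "\<forall>n. \<exists>G S. cut_at (r n) (Suc n) G S" by (simp add: cut_at_exists)
  then obtain G S where G: "\<And>n. cut_at (r n) (Suc n) (G n) (S n)" by metis
  have el: "elementary (G n) (S n)" for n using G[of n] by (simp add: cut_at_def)
  note Gm [measurable] = elementary_measurable[OF el] 
  note [measurable] = YR_meas
  have good: "AE \<omega> in Pr. \<omega> \<in> space Pr \<and> (\<lambda>n. LINT s:{0..T}|lborel. (norm (H (r n) s \<omega> - Y s \<omega>))\<^sup>2) \<longlonglongrightarrow> 0"
    using r(2) AE_space by eventually_elim (simp add: H_def)
  define D where "D n z = (norm (G n (fst z) (snd z) - YR (fst z) (snd z)))\<^sup>2" for n z
  define d where "d n = (\<integral>z. indicator {0..T} (fst z) * D n z \<partial>Lam)" for n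
  have Di: "integrable Lam (\<lambda>z. indicator {0..T} (fst z) * D n z)" for n
  proof -
    have "(norm (indicator {0..T} (fst z) *\<^sub>R G n (fst z) (snd z) - indicator {0..T} (fst z) *\<^sub>R YR (fst z) (snd z)))\<^sup>2 = indicator {0..T} (fst z) * D n z" for z
      by (auto simp: D_def split: split_indicator)
    then show ?thesis
      using sqint_integrable[OF sqint_diff[OF elementary_sqint[OF el[of n], of T] YR_sqint]] by simp
  qed
  \<comment> \<open>The bound is \<open>2 * (R1 + 1) + 2 * R1\<close>, from the energy cap on
    \<open>G n\<close> and the energy of \<open>YR\<close>.\<close>
  have pathD: "(LINT s:{0..T}|lborel. D n (s, \<omega>)) \<le> 4 * R1 + 2" if w: "\<omega> \<in> space Pr" for n \<omega>
  proof -
    have Gb: "(LINT s:{0..T}|lborel. (norm (G n s \<omega>))\<^sup>2) \<le> R1 + 1" using G[of n] w by (auto simp: cut_at_def)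
    have Gi: "set_integrable lborel {0..T} (\<lambda>s. (norm (G n s \<omega>))\<^sup>2)"
    proof (rule set_integrable_bound[OF H_int[of T "r n" \<omega>]])
      note [measurable] = slice_measurable[OF Gm w]
      show "set_borel_measurable lborel {0..T} (\<lambda>s. (norm (G n s \<omega>))\<^sup>2)" unfolding set_borel_measurable_def by measurable
      show "AE s in lborel. s \<in> {0..T} \<longrightarrow> norm ((norm (G n s \<omega>))\<^sup>2) \<le> norm ((norm (H (r n) s \<omega>))\<^sup>2)"
      proof (intro AE_I2 impI)
        fix s
        have "G n s \<omega> = 0 \<or> G n s \<omega> = H (r n) s \<omega>" using G[of n] w by (auto simp: cut_at_def)
        then show "norm ((norm (G n s \<omega>))\<^sup>2) \<le> norm ((norm (H (r n) s \<omega>))\<^sup>2)" by auto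
      qed
    qed
    have "(LINT s:{0..T}|lborel. D n (s, \<omega>)) \<le> (LINT s:{0..T}|lborel. 2 * (norm (G n s \<omega>))\<^sup>2 + 2 * (norm (YR s \<omega>))\<^sup>2)"
      unfolding set_lebesgue_integral_def
    proof (rule integral_mono')
      show "integrable lborel (\<lambda>s. indicator {0..T} s *\<^sub>R (2 * (norm (G n s \<omega>))\<^sup>2 + 2 * (norm (YR s \<omega>))\<^sup>2))"
        using set_integral_add(1)[OF set_integrable_mult_right[OF Gi] set_integrable_mult_right[OF YR_int[OF w]], of 2 2]
        by (simp add: set_integrable_def)
    qed (auto simp: D_def norm_diff_sq_le split: split_indicator)
    also have "\<dots> = 2 * (LINT s:{0..T}|lborel. (norm (G n s \<omega>))\<^sup>2) + 2 * (LINT s:{0..T}|lborel. (norm (YR s \<omega>))\<^sup>2)"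
      using set_integral_add(2)[OF set_integrable_mult_right[OF Gi] set_integrable_mult_right[OF YR_int[OF w]], of 2 2]
      by simp
    also have "\<dots> \<le> 4 * R1 + 2" using Gb YR_energy[OF w] by simp
    finally show ?thesis .
  qed
  have d_eq: "d n = (\<integral>\<omega>. (LINT s:{0..T}|lborel. D n (s, \<omega>)) \<partial>Pr)" for n
    using time.integral_snd[of "\<lambda>s \<omega>. indicator {0..T} s * D n (s, \<omega>)"] Di[of n]
    by (simp add: d_def set_lebesgue_integral_def split_beta')
  have Dm: "(\<lambda>\<omega>. LINT s:{0..T}|lborel. D n (s, \<omega>)) \<in> borel_measurable Pr" for n
    unfolding D_def fst_conv snd_conv by (rule set_integral_measurable) measurable
  have d0: "d \<longlonglongrightarrow> 0"
  proof -
    have "(\<lambda>n. \<integral>\<omega>. (LINT s:{0..T}|lborel. D n (s, \<omega>)) \<partial>Pr) \<longlonglongrightarrow> (\<integral>\<omega>. 0 \<partial>Pr)"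
    proof (rule integral_dominated_convergence[where w="\<lambda>_. 4 * R1 + 2"])
      show "AE \<omega> in Pr. (\<lambda>n. LINT s:{0..T}|lborel. D n (s, \<omega>)) \<longlonglongrightarrow> 0"
        using good by eventually_elim (auto simp: D_def intro!: path_cut_tendsto(2)[where r=r and S=S] G)
      show "AE \<omega> in Pr. norm (LINT s:{0..T}|lborel. D n (s, \<omega>)) \<le> 4 * R1 + 2" for n
      proof (rule AE_I2)
        fix \<omega> assume w: "\<omega> \<in> space Pr"
        have "0 \<le> (LINT s:{0..T}|lborel. D n (s, \<omega>))"
          unfolding set_lebesgue_integral_def by (rule integral_nonneg_AE) (auto simp: D_def)
        then show "norm (LINT s:{0..T}|lborel. D n (s, \<omega>)) \<le> 4 * R1 + 2" using pathD[OF w, of n] by simp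
      qed
    qed (use Dm in auto)
    then show ?thesis unfolding d_eq[abs_def] by simp
  qed
  have Gdiff: "(Lint t (\<lambda>s \<omega>. (norm (G n s \<omega> - G k s \<omega>))\<^sup>2)) \<le> 2 * d n + 2 * d k"
    if t: "t \<in> {0..T}" for n k t
  proof -
    have "(Lint t (\<lambda>s \<omega>. (norm (G n s \<omega> - G k s \<omega>))\<^sup>2)) \<le>
      (\<integral>z. 2 * (indicator {0..T} (fst z) * D n z) + 2 * (indicator {0..T} (fst z) * D k z) \<partial>Lam)"
    proof (rule integral_mono')
      show "integrable Lam (\<lambda>z. 2 * (indicator {0..T} (fst z) * D n z) + 2 * (indicator {0..T} (fst z) * D k z))"
        using Di[of n] Di[of k] by (intro Bochner_Integration.integrable_add integrable_mult_right) auto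
      fix z :: "real \<times> 'a"
      have "(norm (G n (fst z) (snd z) - G k (fst z) (snd z)))\<^sup>2 \<le> 2 * D n z + 2 * D k z"
        using norm_diff_sq_le[of "G n (fst z) (snd z) - YR (fst z) (snd z)" "G k (fst z) (snd z) - YR (fst z) (snd z)"]
        by (simp add: D_def)
      then show "indicator {0..t} (fst z) * (norm (G n (fst z) (snd z) - G k (fst z) (snd z)))\<^sup>2 \<le>
         2 * (indicator {0..T} (fst z) * D n z) + 2 * (indicator {0..T} (fst z) * D k z)"
        using t by (auto simp: D_def split: split_indicator)
      show "0 \<le> 2 * (indicator {0..T} (fst z) * D n z) + 2 * (indicator {0..T} (fst z) * D k z)"
        by (auto simp: D_def split: split_indicator)
    qed
    also have "\<dots> = 2 * d n + 2 * d k"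
      unfolding d_def using Di[of n] Di[of k] by simp
    finally show ?thesis .
  qed
  have Sm [measurable]: "S n j t \<in> borel_measurable Pr" if "t \<in> {0..T}" for n j t
    by (rule sqint_measurable[OF elementary_int_sqint[OF el that]])
  \<comment> \<open>Fatou in the second index: by the isometry the mean square distance of
    \<open>S n\<close> and \<open>S (q k)\<close> is at most
    \<open>\<bar>K $ i $ i\<bar> * (2 * d n + 2 * d (q k))\<close>, and \<open>d (q k)\<close>
    vanishes as \<open>k\<close> grows. The absolute value makes the product monotone whatever the
    sign of the diagonal entry.\<close>
  have nn: "(\<integral>\<^sup>+\<omega>. ennreal (if A t \<omega> < R then (norm (S n i t \<omega> - J t \<omega>))\<^sup>2 else 0) \<partial>Pr) \<le> ennreal (2 * \<bar>K $ i $ i\<bar> * d n)"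
    if t: "t \<in> {0..T}" for n t
  proof -
    note [measurable] = J_meas[OF t] F_measurable_Pr[OF t A_meas[OF t]]
    let ?I = "\<lambda>k. simple_integral (m (r k)) (\<tau> (r k)) (\<xi> (r k)) (\<lambda>t \<omega>. M t \<omega> $ i) t"
    have "converges_in_prob Pr ?I (J t)"
      unfolding converges_in_prob_def
    proof (intro allI impI)
      fix e :: real assume "0 < e"
      with I_conv[OF t] have "(\<lambda>n. measure Pr {\<omega> \<in> space Pr. norm (simple_integral (m n) (\<tau> n) (\<xi> n) (\<lambda>t \<omega>. M t \<omega> $ i) t \<omega> - J t \<omega>) > e}) \<longlonglongrightarrow> 0"
        by (simp add: converges_in_prob_def)
      from LIMSEQ_subseq_LIMSEQ[OF this r(1)]
      show "(\<lambda>k. measure Pr {\<omega> \<in> space Pr. norm (?I k \<omega> - J t \<omega>) > e}) \<longlonglongrightarrow> 0" by (simp add: o_def)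
    qed
    moreover have "?I k \<in> borel_measurable Pr" for k by (rule simple_integral_measurable[OF simple t])
    ultimately obtain q where q: "strict_mono q" "AE \<omega> in Pr. (\<lambda>k. ?I (q k) \<omega>) \<longlonglongrightarrow> J t \<omega>"
      using converges_in_prob_AE_subseq[OF prob_space_axioms _ J_meas[OF t], of ?I] by blast
    let ?f = "\<lambda>k \<omega>. ennreal (if A t \<omega> < R then (norm (S n i t \<omega> - S (q k) i t \<omega>))\<^sup>2 else 0)"
    have "AE \<omega> in Pr. ennreal (if A t \<omega> < R then (norm (S n i t \<omega> - J t \<omega>))\<^sup>2 else 0) = liminf (\<lambda>k. ?f k \<omega>)"
      using q(2) good
    proof eventually_elim
      case (elim \<omega>)
      have "(\<lambda>k. ?f k \<omega>) \<longlonglongrightarrow> ennreal (if A t \<omega> < R then (norm (S n i t \<omega> - J t \<omega>))\<^sup>2 else 0)"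
      proof (cases "A t \<omega> < R")
        case True
        have "\<forall>\<^sub>F k in sequentially. S k i t \<omega> = ?I k \<omega>"
          using path_cut_tendsto(1)[of \<omega> r G S t] elim(2) G t True by (auto elim: eventually_mono)
        then have "\<forall>\<^sub>F k in sequentially. S (q k) i t \<omega> = ?I (q k) \<omega>"
          by (rule eventually_subseq[OF q(1)])
        with elim(1) have "(\<lambda>k. S (q k) i t \<omega>) \<longlonglongrightarrow> J t \<omega>" by (simp add: tendsto_cong)
        then have "(\<lambda>k. ennreal ((norm (S n i t \<omega> - S (q k) i t \<omega>))\<^sup>2)) \<longlonglongrightarrow> ennreal ((norm (S n i t \<omega> - J t \<omega>))\<^sup>2)"
          by (intro tendsto_ennrealI tendsto_intros)
        then show ?thesis using True by simp
      qed simp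
      then show ?case by (intro lim_imp_Liminf[symmetric]) auto
    qed
    then have "(\<integral>\<^sup>+\<omega>. ennreal (if A t \<omega> < R then (norm (S n i t \<omega> - J t \<omega>))\<^sup>2 else 0) \<partial>Pr) = (\<integral>\<^sup>+\<omega>. liminf (\<lambda>k. ?f k \<omega>) \<partial>Pr)"
      by (rule nn_integral_cong_AE)
    also have "\<dots> \<le> liminf (\<lambda>k. \<integral>\<^sup>+\<omega>. ?f k \<omega> \<partial>Pr)"
      by (rule nn_integral_liminf) (use Sm[OF t] in measurable)
    also have "\<dots> \<le> liminf (\<lambda>k. ennreal (\<bar>K $ i $ i\<bar> * (2 * d n + 2 * d (q k))))"
    proof (intro Liminf_mono always_eventually allI)
      fix k
      have sq: "integrable Pr (\<lambda>\<omega>. (norm (S n i t \<omega> - S (q k) i t \<omega>))\<^sup>2)"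
        by (intro sqint_integrable sqint_diff elementary_int_sqint[OF el t])
      have "(\<integral>\<^sup>+\<omega>. ?f k \<omega> \<partial>Pr) \<le> (\<integral>\<^sup>+\<omega>. ennreal ((norm (S n i t \<omega> - S (q k) i t \<omega>))\<^sup>2) \<partial>Pr)"
        by (intro nn_integral_mono) auto
      also have "\<dots> = ennreal (\<integral>\<omega>. (norm (S n i t \<omega> - S (q k) i t \<omega>))\<^sup>2 \<partial>Pr)"
        by (rule nn_integral_eq_integral[OF sq]) auto
      also have "\<dots> \<le> ennreal (\<bar>K $ i $ i\<bar> * (2 * d n + 2 * d (q k)))"
        unfolding elementary_int_diff[OF el el t]
        by (intro ennreal_leI mult_mono Gdiff[OF t]) auto
      finally show "(\<integral>\<^sup>+\<omega>. ?f k \<omega> \<partial>Pr) \<le> ennreal (\<bar>K $ i $ i\<bar> * (2 * d n + 2 * d (q k)))" .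
    qed
    also have "\<dots> = ennreal (\<bar>K $ i $ i\<bar> * (2 * d n + 2 * 0))"
      by (intro lim_imp_Liminf tendsto_ennrealI tendsto_intros LIMSEQ_subseq_LIMSEQ[OF d0 q(1), unfolded o_def]) simp
    finally show ?thesis by (simp add: mult_ac)
  qed
  have int: "integrable Pr (\<lambda>\<omega>. if A t \<omega> < R then (norm (S n i t \<omega> - J t \<omega>))\<^sup>2 else 0)" if t: "t \<in> {0..T}" for n t
  proof (rule integrableI_bounded)
    note [measurable] = J_meas[OF t] F_measurable_Pr[OF t A_meas[OF t]] Sm[OF t]
    show "(\<lambda>\<omega>. if A t \<omega> < R then (norm (S n i t \<omega> - J t \<omega>))\<^sup>2 else 0) \<in> borel_measurable Pr" by measurable
    have "(\<integral>\<^sup>+\<omega>. ennreal (norm (if A t \<omega> < R then (norm (S n i t \<omega> - J t \<omega>))\<^sup>2 else 0)) \<partial>Pr)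
       = (\<integral>\<^sup>+\<omega>. ennreal (if A t \<omega> < R then (norm (S n i t \<omega> - J t \<omega>))\<^sup>2 else 0) \<partial>Pr)"
      by (intro nn_integral_cong) auto
    also have "\<dots> < \<infinity>" using nn[OF t, of n] by (rule le_less_trans) simp
    finally show "(\<integral>\<^sup>+\<omega>. ennreal (norm (if A t \<omega> < R then (norm (S n i t \<omega> - J t \<omega>))\<^sup>2 else 0)) \<partial>Pr) < \<infinity>" .
  qed
  have d_pos: "0 \<le> d n" for n unfolding d_def D_def by (intro integral_nonneg_AE AE_I2) auto
  have le: "(\<integral>\<omega>. (if A t \<omega> < R then (norm (S n i t \<omega> - J t \<omega>))\<^sup>2 else 0) \<partial>Pr) \<le> 2 * \<bar>K $ i $ i\<bar> * d n" if t: "t \<in> {0..T}" for n t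
  proof -
    have "ennreal (\<integral>\<omega>. (if A t \<omega> < R then (norm (S n i t \<omega> - J t \<omega>))\<^sup>2 else 0) \<partial>Pr)
       = (\<integral>\<^sup>+\<omega>. ennreal (if A t \<omega> < R then (norm (S n i t \<omega> - J t \<omega>))\<^sup>2 else 0) \<partial>Pr)"
      by (rule nn_integral_eq_integral[OF int[OF t], symmetric]) auto
    also note nn[OF t, of n]
    finally show ?thesis using d_pos[of n] by (simp add: ennreal_le_iff)
  qed
  show thesis
  proof (rule that)
    show "elementary (G n) (S n)" for n by (rule el)
    show "(\<lambda>n. Lint T (\<lambda>s \<omega>. (norm (G n s \<omega> - YR s \<omega>))\<^sup>2)) \<longlonglongrightarrow> 0"
      using d0 unfolding d_def[abs_def] D_def .
  qed (use int le in \<open>auto simp: d_def D_def\<close>)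
qed

end

section \<open>Ito's inequality for quadratic forms\<close>

lemma norm_sum_sq_le:
  fixes v :: "'i::finite \<Rightarrow> 'b::real_normed_vector"
  shows "(norm (\<Sum>i\<in>UNIV. v i))\<^sup>2 \<le> real CARD('i) * (\<Sum>i\<in>UNIV. (norm (v i))\<^sup>2)"
proof -
  have "(norm (\<Sum>i\<in>UNIV. v i))\<^sup>2 \<le> (\<Sum>i\<in>UNIV. norm (v i))\<^sup>2"
    by (intro power_mono norm_sum) auto
  also have "\<dots> \<le> (\<Sum>i\<in>UNIV. (norm (v i))\<^sup>2) * (\<Sum>i\<in>(UNIV::'i set). 1\<^sup>2)"
    using Cauchy_Schwarz_ineq_sum[of "\<lambda>i. norm (v i)" "\<lambda>_. 1" "UNIV :: 'i set"] by simp
  finally show ?thesis by (simp add: mult.commute)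
qed

lemma set_integral_norm_sq_le:
  fixes g :: "real \<Rightarrow> real^'n"
  assumes g: "sqint lborel (\<lambda>s. indicator {0..T} s *\<^sub>R g s)" and t: "t \<in> {0..T}"
  shows "set_integrable lborel {0..t} g"
    and "(norm (LINT s:{0..t}|lborel. g s))\<^sup>2 \<le> T * (LINT s:{0..T}|lborel. (norm (g s))\<^sup>2)"
proof -
  have T0: "0 \<le> T" using t by simp
  let ?h = "\<lambda>s. norm (indicator {0..T} s *\<^sub>R g s)" and ?i = "indicator {0..T} :: real \<Rightarrow> real"
  have i: "sqint lborel ?i"
  proof (rule sqintI)
    have "integrable lborel ?i" by (rule integrable_real_indicator) (auto simp: T0)
    moreover have "(norm (?i s))\<^sup>2 = ?i s" for s by (auto split: split_indicator)
    ultimately show "integrable lborel (\<lambda>s. (norm (?i s))\<^sup>2)" by simp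
  qed simp
  have h: "sqint lborel ?h"
    by (intro sqintI measurable_compose[OF sqint_measurable[OF g] borel_measurable_norm])
       (use sqint_integrable[OF g] in simp)
  have hi: "integrable lborel (\<lambda>s. ?h s * ?i s)" using sqint_inner_integrable[OF h i] by simp
  have gm: "(\<lambda>s. indicator {0..T} s *\<^sub>R g s) \<in> borel_measurable lborel" using g by (rule sqint_measurable)
  have eq: "indicator {0..t} s *\<^sub>R g s = indicator {0..t} s *\<^sub>R (indicator {0..T} s *\<^sub>R g s)" for s
    using t by (auto split: split_indicator)
  have m: "(\<lambda>s. indicator {0..t} s *\<^sub>R g s) \<in> borel_measurable lborel"
    unfolding eq using gm by measurable
  show int: "set_integrable lborel {0..t} g"
    unfolding set_integrable_def
    by (rule Bochner_Integration.integrable_bound[OF hi m]) (use t in \<open>auto split: split_indicator\<close>)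
  have "norm (LINT s:{0..t}|lborel. g s) \<le> (LINT s|lborel. norm (indicator {0..t} s *\<^sub>R g s))"
    unfolding set_lebesgue_integral_def by (rule integral_norm_bound)
  also have "\<dots> \<le> (LINT s|lborel. ?h s * ?i s)"
    by (rule integral_mono[OF integrable_norm[OF int[unfolded set_integrable_def]] hi])
       (use t in \<open>auto split: split_indicator\<close>)
  also have "\<dots> \<le> sqrt ((LINT s|lborel. (?h s)\<^sup>2) * (LINT s|lborel. (?i s)\<^sup>2))"
    using integral_sq_cauchy_schwarz[OF h i] by linarith
  also have "(LINT s|lborel. (?i s)\<^sup>2) = T"
  proof -
    have "(?i s)\<^sup>2 = ?i s" for s by (auto split: split_indicator)
    then show ?thesis using T0 by simp
  qed
  also have "(LINT s|lborel. (?h s)\<^sup>2) = (LINT s:{0..T}|lborel. (norm (g s))\<^sup>2)"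
    unfolding set_lebesgue_integral_def by (intro Bochner_Integration.integral_cong) (auto split: split_indicator)
  finally have "(norm (LINT s:{0..t}|lborel. g s))\<^sup>2 \<le> (sqrt ((LINT s:{0..T}|lborel. (norm (g s))\<^sup>2) * T))\<^sup>2"
    by (intro power_mono) auto
  also have "\<dots> = T * (LINT s:{0..T}|lborel. (norm (g s))\<^sup>2)"
  proof -
    have "0 \<le> (LINT s:{0..T}|lborel. (norm (g s))\<^sup>2)"
      unfolding set_lebesgue_integral_def by (rule integral_nonneg_AE) auto
    then show ?thesis using T0 by (simp add: mult.commute)
  qed
  finally show "(norm (LINT s:{0..t}|lborel. g s))\<^sup>2 \<le> T * (LINT s:{0..T}|lborel. (norm (g s))\<^sup>2)" .
qed

text \<open>The chain rule for a path with a merely integrable derivative, summed up from the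
  product rule for pairs of components; symmetry of \<open>X\<close> merges the two halves into the
  factor 2.\<close>

lemma indefinite_integral_quadratic:
  fixes g :: "real \<Rightarrow> real^'n" and X :: "real^'n^'n"
  assumes g: "set_integrable lborel {0..t} g" and X: "\<And>v w. v \<bullet> (X *v w) = w \<bullet> (X *v v)"
  shows "(LINT s:{0..t}|lborel. g s) \<bullet> (X *v (LINT s:{0..t}|lborel. g s)) =
     2 * (LINT s:{0..t}|lborel. g s \<bullet> (X *v (LINT r:{0..s}|lborel. g r)))"
proof -
  define G where "G s = (LINT r:{0..s}|lborel. g r)" for s
  define G' where "G' i s = (LINT r:{0..s}|lborel. g r $ i)" for i s
  have gi: "set_integrable lborel {0..t} (\<lambda>s. g s $ i)" for i
    using integrable_vec_nth[OF g[unfolded set_integrable_def], of i] by (simp add: set_integrable_def)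
  have Gi: "G s $ i = G' i s" if "s \<le> t" for i s
  proof -
    have "set_integrable lborel {0..s} g" using that by (intro set_integrable_subset[OF g]) auto
    then show ?thesis unfolding G_def G'_def set_lebesgue_integral_def set_integrable_def
      by (subst integral_vec_nth[symmetric]) auto
  qed
  have quad: "v \<bullet> (X *v w) = (\<Sum>i\<in>UNIV. \<Sum>j\<in>UNIV. X $ i $ j * (v $ i * w $ j))" for v w :: "real^'n"
    by (simp add: inner_vec_def matrix_vector_mult_def sum_distrib_left mult_ac)
  note p = indefinite_integral_mult[OF gi gi]
  have "G t \<bullet> (X *v G t) = (\<Sum>i\<in>UNIV. \<Sum>j\<in>UNIV. X $ i $ j * (G' i t * G' j t))"
    by (simp add: quad Gi)
  also have "\<dots> = (\<Sum>i\<in>UNIV. \<Sum>j\<in>UNIV. X $ i $ j * (LINT s:{0..t}|lborel. g s $ i * G' j s) + X $ i $ j * (LINT s:{0..t}|lborel. g s $ j * G' i s))"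
    unfolding G'_def p(2) by (simp only: distrib_left)
  also have "\<dots> = (\<Sum>i\<in>UNIV. \<Sum>j\<in>UNIV. X $ i $ j * (LINT s:{0..t}|lborel. g s $ i * G' j s)) + (\<Sum>i\<in>UNIV. \<Sum>j\<in>UNIV. X $ j $ i * (LINT s:{0..t}|lborel. g s $ i * G' j s))"
    by (subst (3) sum.swap) (simp add: sum.distrib)
  also have "(\<Sum>i\<in>UNIV. \<Sum>j\<in>UNIV. X $ j $ i * (LINT s:{0..t}|lborel. g s $ i * G' j s)) = (\<Sum>i\<in>UNIV. \<Sum>j\<in>UNIV. X $ i $ j * (LINT s:{0..t}|lborel. g s $ i * G' j s))"
  proof -
    have "X $ j $ i = X $ i $ j" for i j
      using X[of "axis j 1" "axis i 1"] by (simp add: inner_axis' matrix_vector_mul_component inner_axis)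
    then show ?thesis by simp
  qed
  also have "(\<Sum>i\<in>UNIV. \<Sum>j\<in>UNIV. X $ i $ j * (LINT s:{0..t}|lborel. g s $ i * G' j s)) = (LINT s:{0..t}|lborel. g s \<bullet> (X *v G s))"
  proof -
    have "(LINT s:{0..t}|lborel. g s \<bullet> (X *v G s)) = (LINT s|lborel. (\<Sum>i\<in>UNIV. \<Sum>j\<in>UNIV. X $ i $ j * (indicator {0..t} s *\<^sub>R (g s $ i * G' j s))))"
      unfolding set_lebesgue_integral_def
      by (intro Bochner_Integration.integral_cong refl) (auto simp: quad Gi split: split_indicator)
    also have "\<dots> = (\<Sum>i\<in>UNIV. \<Sum>j\<in>UNIV. X $ i $ j * (LINT s|lborel. indicator {0..t} s *\<^sub>R (g s $ i * G' j s)))"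
      using p(1) unfolding G'_def set_integrable_def
      by (subst Bochner_Integration.integral_sum; (intro Bochner_Integration.integrable_sum integrable_mult_right)?; simp)+
    finally show ?thesis by (simp add: set_lebesgue_integral_def)
  qed
  finally show ?thesis by (simp add: G_def)
qed

text \<open>All noise components share the clock \<open>A\<close> and the level \<open>R\<close>.
  The decomposition \<open>x_eq\<close> concerns the unrestricted drift and integrals; restricted
  objects are compared with it only on the event that the clock is below \<open>R\<close>.\<close>

locale ito_system = levy_driven Pr T F M K
  for Pr :: "'a measure" and T :: real and F :: "real \<Rightarrow> 'a measure"
    and M :: "real \<Rightarrow> 'a \<Rightarrow> real^'d" and K :: "real^'d^'d" +
  fixes x b :: "real \<Rightarrow> 'a \<Rightarrow> real^'n" and Y J :: "'d \<Rightarrow> real \<Rightarrow> 'a \<Rightarrow> real^'n"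
    and m :: "'d \<Rightarrow> nat \<Rightarrow> nat" and \<tau> :: "'d \<Rightarrow> nat \<Rightarrow> nat \<Rightarrow> real" and \<xi> :: "'d \<Rightarrow> nat \<Rightarrow> nat \<Rightarrow> 'a \<Rightarrow> real^'n"
    and A :: "real \<Rightarrow> 'a \<Rightarrow> real" and R R1 :: real and X :: "real^'n^'n"
  assumes cuts: "\<And>i. ito_cut Pr T F M K i (Y i) (J i) (m i) (\<tau> i) (\<xi> i) A R R1"
    and b_meas: "joint b"
    and b_adapted: "\<And>s. s \<in> {0..T} \<Longrightarrow> b s \<in> borel_measurable (F s)"
    and b_int: "Lintegrable T (\<lambda>s \<omega>. if A s \<omega> < R then (norm (b s \<omega>))\<^sup>2 else 0)"
    and x_meas: "joint x"
    and x_int: "Lintegrable T (\<lambda>s \<omega>. if A s \<omega> < R then (norm (x s \<omega>))\<^sup>2 else 0)"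
    and x_eq: "AE \<omega> in Pr. \<forall>t\<in>{0..T}. x t \<omega> = (LINT s:{0..t}|lborel. b s \<omega>) + (\<Sum>i\<in>UNIV. J i t \<omega>)"
    and X_sym: "\<And>v w. v \<bullet> (X *v w) = w \<bullet> (X *v v)" and X_pos: "\<And>v. 0 \<le> v \<bullet> (X *v v)"
begin

lemma A_joint [measurable]: "joint A"
  using cuts by (rule ito_cut.A_joint)

lemma A_adapted: "s \<in> {0..T} \<Longrightarrow> A s \<in> borel_measurable (F s)"
  using cuts by (rule ito_cut.A_meas)

lemma A_mono: "0 \<le> s \<Longrightarrow> s \<le> t \<Longrightarrow> t \<le> T \<Longrightarrow> \<omega> \<in> space Pr \<Longrightarrow> A s \<omega> \<le> A t \<omega>"
  using cuts by (rule ito_cut.A_mono)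

definition bR :: "real \<Rightarrow> 'a \<Rightarrow> real^'n" where "bR s \<omega> = (if A s \<omega> < R then b s \<omega> else 0)"

definition xR :: "real \<Rightarrow> 'a \<Rightarrow> real^'n" where "xR s \<omega> = (if A s \<omega> < R then x s \<omega> else 0)"

definition YR :: "'d \<Rightarrow> real \<Rightarrow> 'a \<Rightarrow> real^'n" where "YR i s \<omega> = (if A s \<omega> < R then Y i s \<omega> else 0)"

definition D :: "real \<Rightarrow> 'a \<Rightarrow> real^'n" where "D t \<omega> = (LINT s:{0..t}|lborel. bR s \<omega>)"

lemma bR_meas [measurable]: "joint bR"
  unfolding bR_def using b_meas by measurable

lemma xR_meas [measurable]: "joint xR"
  unfolding xR_def using x_meas by measurable

lemma D_meas [measurable]: "joint D"
  unfolding D_def by (rule indefinite_integral_joint[OF bR_meas])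

lemma bR_int: "Lintegrable T (\<lambda>s \<omega>. (norm (bR s \<omega>))\<^sup>2)"
proof -
  have "(norm (bR s \<omega>))\<^sup>2 = (if A s \<omega> < R then (norm (b s \<omega>))\<^sup>2 else 0)" for s \<omega> by (simp add: bR_def)
  then show ?thesis using b_int by simp
qed

lemma xR_int: "Lintegrable T (\<lambda>s \<omega>. (norm (xR s \<omega>))\<^sup>2)"
proof -
  have "(norm (xR s \<omega>))\<^sup>2 = (if A s \<omega> < R then (norm (x s \<omega>))\<^sup>2 else 0)" for s \<omega> by (simp add: xR_def)
  then show ?thesis using x_int by simp
qed

lemmas bR_sqint = Lam_sqintI[OF bR_meas bR_int] and xR_sqint = Lam_sqintI[OF xR_meas xR_int]

lemma YR_sqint: "t \<in> {0..T} \<Longrightarrow> Lsqint t (YR i)"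
proof -
  assume t: "t \<in> {0..T}"
  interpret c: ito_cut Pr T F M K i "Y i" "J i" "m i" "\<tau> i" "\<xi> i" A R R1 by (rule cuts)
  have e: "c.YR = YR i" by (simp add: fun_eq_iff YR_def c.YR_def)
  note [measurable] = Lam_measurable[OF c.YR_meas[unfolded e]]
  show ?thesis
    by (rule sqint_mono[OF c.YR_sqint[unfolded e], of _ 1]) (use t in \<open>auto split: split_indicator\<close>)
qed

lemma bR_path: "AE \<omega> in Pr. sqint lborel (\<lambda>s. indicator {0..T} s *\<^sub>R bR s \<omega>)"
proof -
  have "AE \<omega> in Pr. integrable lborel (\<lambda>s. indicator {0..T} s * (norm (bR s \<omega>))\<^sup>2)"
    using time.AE_integrable_snd[of "\<lambda>s \<omega>. indicator {0..T} s * (norm (bR s \<omega>))\<^sup>2"] bR_int by (simp add: split_beta')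
  then show ?thesis using AE_space
  proof eventually_elim
    case (elim \<omega>)
    note [measurable] = slice_measurable[OF bR_meas elim(2)]
    have "(norm (indicator {0..T} s *\<^sub>R bR s \<omega>))\<^sup>2 = indicator {0..T} s * (norm (bR s \<omega>))\<^sup>2" for s
      by (auto split: split_indicator)
    then show ?case using elim by (intro sqintI) auto
  qed
qed

lemma D_bound: "AE \<omega> in Pr. \<forall>t\<in>{0..T}. (norm (D t \<omega>))\<^sup>2 \<le> T * (LINT s:{0..T}|lborel. (norm (bR s \<omega>))\<^sup>2)"
  using bR_path by eventually_elim (auto simp: D_def intro!: set_integral_norm_sq_le(2))

lemma bR_energy_integrable: "integrable Pr (\<lambda>\<omega>. LINT s:{0..T}|lborel. (norm (bR s \<omega>))\<^sup>2)"
  using time.integrable_snd[of "\<lambda>s \<omega>. indicator {0..T} s * (norm (bR s \<omega>))\<^sup>2"] bR_int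
  by (simp add: split_beta' set_lebesgue_integral_def)

lemma D_sqint: "t \<in> {0..T} \<Longrightarrow> sqint Pr (D t)"
proof (rule sqintI)
  assume t: "t \<in> {0..T}"
  show m [measurable]: "D t \<in> borel_measurable Pr" by (rule section_measurable[OF D_meas])
  show "integrable Pr (\<lambda>\<omega>. (norm (D t \<omega>))\<^sup>2)"
  proof (rule Bochner_Integration.integrable_bound)
    show "integrable Pr (\<lambda>\<omega>. T * (LINT s:{0..T}|lborel. (norm (bR s \<omega>))\<^sup>2))"
      using bR_energy_integrable by simp
    show "AE \<omega> in Pr. norm ((norm (D t \<omega>))\<^sup>2) \<le> norm (T * (LINT s:{0..T}|lborel. (norm (bR s \<omega>))\<^sup>2))"
      using D_bound by eventually_elim (use t in force)
  qed measurable
qed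

lemma D_Lam_sqint: "t \<in> {0..T} \<Longrightarrow> Lsqint t D"
proof (rule Lam_sqintI[OF D_meas])
  show "Lintegrable T (\<lambda>s \<omega>. (norm (D s \<omega>))\<^sup>2)"
  proof (rule Bochner_Integration.integrable_bound)
    have "integrable lborel (indicator {0..T} :: real \<Rightarrow> real)" using T_pos by (intro integrable_real_indicator) auto
    from integral_time_prob_product(1)[OF this integrable_mult_right[OF bR_energy_integrable, of T]]
    show "Lintegrable T (\<lambda>r \<omega>. T * (LINT s:{0..T}|lborel. (norm (bR s \<omega>))\<^sup>2))" by simp
    show "(\<lambda>z. indicator {0..T} (fst z) * (norm (D (fst z) (snd z)))\<^sup>2) \<in> borel_measurable Lam"
      using Lam_measurable[OF D_meas] by measurable
    \<comment> \<open>A null set \<open>N\<close> of outcomes becomes the null set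
      \<open>UNIV \<times> N\<close> of the product.\<close>
    have "AE z in Lam. \<forall>t\<in>{0..T}. (norm (D t (snd z)))\<^sup>2 \<le> T * (LINT s:{0..T}|lborel. (norm (bR s (snd z)))\<^sup>2)"
    proof -
      have "AE \<omega> in distr Lam Pr snd. \<forall>t\<in>{0..T}. (norm (D t \<omega>))\<^sup>2 \<le> T * (LINT s:{0..T}|lborel. (norm (bR s \<omega>))\<^sup>2)"
      proof -
        obtain N where N: "{\<omega> \<in> space Pr. \<not> (\<forall>t\<in>{0..T}. (norm (D t \<omega>))\<^sup>2 \<le> T * (LINT s:{0..T}|lborel. (norm (bR s \<omega>))\<^sup>2))} \<subseteq> N"
          "emeasure Pr N = 0" "N \<in> sets Pr" using AE_E[OF D_bound] by blast
        have "snd -` N \<inter> space Lam = UNIV \<times> N"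
          using sets.sets_into_space[OF N(3)] by (auto simp: space_pair_measure)
        then have "emeasure (distr Lam Pr snd) N = emeasure Lam (UNIV \<times> N)"
          by (subst emeasure_distr[OF measurable_snd N(3)]) (simp only:)
        also have "\<dots> = 0" using N by (subst emeasure_pair_measure_Times) auto
        finally show ?thesis using N by (intro AE_I[of _ _ N]) auto
      qed
      then show ?thesis by (rule AE_distrD[OF measurable_snd])
    qed
    then show "AE z in Lam. norm (indicator {0..T} (fst z) * (norm (D (fst z) (snd z)))\<^sup>2) \<le>
        norm (indicator {0..T} (fst z) * (T * (LINT s:{0..T}|lborel. (norm (bR s (snd z)))\<^sup>2)))"
      by eventually_elim (auto split: split_indicator intro: order_trans[OF _ abs_ge_self])
  qed
qed

end

lemma sqint_matrix_tendsto:
  fixes X :: "real^'n^'m"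
  assumes V: "\<And>n. sqint M (V n)" "sqint M v" and lim: "(\<lambda>n. \<integral>x. (norm (V n x - v x))\<^sup>2 \<partial>M) \<longlonglongrightarrow> 0"
  shows "(\<lambda>n. \<integral>x. (norm (X *v V n x - X *v v x))\<^sup>2 \<partial>M) \<longlonglongrightarrow> 0"
proof -
  obtain k where k: "\<And>v. norm (X *v v) \<le> k * norm v" using matrix_vector_norm_le[of X] by metis
  have le: "norm (\<integral>x. (norm (X *v V n x - X *v v x))\<^sup>2 \<partial>M) \<le> k\<^sup>2 * (\<integral>x. (norm (V n x - v x))\<^sup>2 \<partial>M)" for n
  proof -
    have "(\<integral>x. (norm (X *v V n x - X *v v x))\<^sup>2 \<partial>M) \<le> (\<integral>x. k\<^sup>2 * (norm (V n x - v x))\<^sup>2 \<partial>M)"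
    proof (rule integral_mono')
      show "integrable M (\<lambda>x. k\<^sup>2 * (norm (V n x - v x))\<^sup>2)"
        using sqint_integrable[OF sqint_diff[OF V(1)[of n] V(2)]] by simp
      show "(norm (X *v V n x - X *v v x))\<^sup>2 \<le> k\<^sup>2 * (norm (V n x - v x))\<^sup>2" for x
        unfolding matrix_vector_mult_diff_distrib[symmetric] power_mult_distrib[symmetric]
        by (intro power_mono k) auto
    qed auto
    then show ?thesis by simp
  qed
  show ?thesis
    by (rule Lim_null_comparison[OF always_eventually[OF allI[OF le]] tendsto_mult_right_zero[OF lim]])
qed

section \<open>The expectation of the quadratic form\<close>

context ito_system
begin

text \<open>Since the clock is nondecreasing, on its event at time \<open>t\<close> the restricted
  drift integral \<open>D t\<close> is the full one, so \<open>x t - D t\<close> is the sum of the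
  \<open>J i t\<close>. The squared errors of the components add up with the factor
  \<open>CARD('d)\<close> from Cauchy-Schwarz for sums.\<close>

lemma state_approximation:
  obtains G S e where "\<And>i n. elementary (G i n) (S i n)"
    "\<And>i. (\<lambda>n. Lint T (\<lambda>s \<omega>. (norm (G i n s \<omega> - YR i s \<omega>))\<^sup>2)) \<longlonglongrightarrow> 0"
    "e \<longlonglongrightarrow> 0"
    "\<And>n t. t \<in> {0..T} \<Longrightarrow> sqint Pr (\<lambda>\<omega>. if A t \<omega> < R then (\<Sum>i\<in>UNIV. S i n i t \<omega>) - (x t \<omega> - D t \<omega>) else 0)"
    "\<And>n t. t \<in> {0..T} \<Longrightarrow> (\<integral>\<omega>. (norm (if A t \<omega> < R then (\<Sum>i\<in>UNIV. S i n i t \<omega>) - (x t \<omega> - D t \<omega>) else 0))\<^sup>2 \<partial>Pr) \<le> e n"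
proof -
  let ?d = "\<lambda>i G. Lint T (\<lambda>s \<omega>. (norm (G s \<omega> - YR i s \<omega>))\<^sup>2)"
  let ?I = "\<lambda>i S t \<omega>. if A t \<omega> < R then (norm (S i t \<omega> - J i t \<omega>))\<^sup>2 else 0"
  define Q where "Q i G S \<longleftrightarrow> (\<forall>n. elementary (G n) (S n)) \<and> (\<lambda>n. ?d i (G n)) \<longlonglongrightarrow> 0 \<and>
     (\<forall>n. \<forall>t\<in>{0..T}. integrable Pr (?I i (S n) t) \<and> (\<integral>\<omega>. ?I i (S n) t \<omega> \<partial>Pr) \<le> 2 * \<bar>K $ i $ i\<bar> * ?d i (G n))" for i G S
  have ex: "\<exists>G S. Q i G S" for i
  proof -
    interpret c: ito_cut Pr T F M K i "Y i" "J i" "m i" "\<tau> i" "\<xi> i" A R R1 by (rule cuts)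
    have e: "c.YR = YR i" by (simp add: fun_eq_iff YR_def c.YR_def)
    show ?thesis unfolding Q_def by (rule c.elementary_approximation[unfolded e]) blast
  qed
  then obtain G S where QGS: "\<And>i. Q i (G i) (S i)" by metis
  have GS: "\<And>i n. elementary (G i n) (S i n)" "\<And>i. (\<lambda>n. ?d i (G i n)) \<longlonglongrightarrow> 0"
     "\<And>i n t. t \<in> {0..T} \<Longrightarrow> integrable Pr (?I i (S i n) t)"
     "\<And>i n t. t \<in> {0..T} \<Longrightarrow> (\<integral>\<omega>. ?I i (S i n) t \<omega> \<partial>Pr) \<le> 2 * \<bar>K $ i $ i\<bar> * ?d i (G i n)"
    using QGS unfolding Q_def by blast+
  define e where "e n = real CARD('d) * (\<Sum>i\<in>UNIV. 2 * \<bar>K $ i $ i\<bar> * ?d i (G i n))" for n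
  let ?W = "\<lambda>n t \<omega>. if A t \<omega> < R then (\<Sum>i\<in>UNIV. S i n i t \<omega>) - (x t \<omega> - D t \<omega>) else 0"
  have e0: "e \<longlonglongrightarrow> 0"
  proof -
    have "e \<longlonglongrightarrow> real CARD('d) * (\<Sum>i\<in>(UNIV::'d set). 2 * \<bar>K $ i $ i\<bar> * 0)"
      unfolding e_def[abs_def] by (intro tendsto_intros GS(2))
    then show ?thesis by simp
  qed
  have W_le: "AE \<omega> in Pr. (norm (?W n t \<omega>))\<^sup>2 \<le> real CARD('d) * (\<Sum>i\<in>UNIV. ?I i (S i n) t \<omega>)" if t: "t \<in> {0..T}" for n t
    using x_eq AE_space
  proof eventually_elim
    case (elim \<omega>)
    show ?case
    proof (cases "A t \<omega> < R")
      case True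
      have "D t \<omega> = (LINT s:{0..t}|lborel. b s \<omega>)"
        unfolding D_def set_lebesgue_integral_def
      proof (intro Bochner_Integration.integral_cong refl)
        fix s show "indicator {0..t} s *\<^sub>R bR s \<omega> = indicator {0..t} s *\<^sub>R b s \<omega>"
        proof (cases "s \<in> {0..t}")
          case True
          then have "A s \<omega> \<le> A t \<omega>" using t elim(2) by (intro A_mono) auto
          then show ?thesis using \<open>A t \<omega> < R\<close> by (simp add: bR_def)
        qed simp
      qed
      with elim(1) t have "x t \<omega> - D t \<omega> = (\<Sum>i\<in>UNIV. J i t \<omega>)" by simp
      then have "?W n t \<omega> = (\<Sum>i\<in>UNIV. S i n i t \<omega> - J i t \<omega>)" using True by (simp add: sum_subtractf)
      then show ?thesis using norm_sum_sq_le[of "\<lambda>i. S i n i t \<omega> - J i t \<omega>"] True by simp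
    qed simp
  qed
  have Wm: "?W n t \<in> borel_measurable Pr" if t: "t \<in> {0..T}" for n t
  proof -
    note [measurable] = F_measurable_Pr[OF t A_adapted[OF t]] section_measurable[OF x_meas, of t] section_measurable[OF D_meas, of t]
      sqint_measurable[OF elementary_int_sqint[OF GS(1) t]]
    show ?thesis by measurable
  qed
  have Ii: "integrable Pr (\<lambda>\<omega>. real CARD('d) * (\<Sum>i\<in>UNIV. ?I i (S i n) t \<omega>))" if t: "t \<in> {0..T}" for n t
    using GS(3)[OF t] by (intro integrable_mult_right Bochner_Integration.integrable_sum) auto
  have Wi: "sqint Pr (?W n t)" if t: "t \<in> {0..T}" for n t
  proof (rule sqintI[OF Wm[OF t]])
    show "integrable Pr (\<lambda>\<omega>. (norm (?W n t \<omega>))\<^sup>2)"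
      by (rule Bochner_Integration.integrable_bound[OF Ii[OF t, of n]])
        (use Wm[OF t, of n] W_le[OF t, of n] in \<open>auto elim!: eventually_mono intro: order_trans[OF _ abs_ge_self]\<close>)
  qed
  have "(\<integral>\<omega>. (norm (?W n t \<omega>))\<^sup>2 \<partial>Pr) \<le> e n" if t: "t \<in> {0..T}" for n t
  proof -
    have "(\<integral>\<omega>. (norm (?W n t \<omega>))\<^sup>2 \<partial>Pr) \<le> (\<integral>\<omega>. real CARD('d) * (\<Sum>i\<in>UNIV. ?I i (S i n) t \<omega>) \<partial>Pr)"
      by (rule integral_mono_AE[OF sqint_integrable[OF Wi[OF t]] Ii[OF t] W_le[OF t]])
    also have "\<dots> = real CARD('d) * (\<Sum>i\<in>UNIV. \<integral>\<omega>. ?I i (S i n) t \<omega> \<partial>Pr)"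
      by (simp add: Bochner_Integration.integral_sum[OF GS(3)[OF t]])
    also have "\<dots> \<le> e n" unfolding e_def by (intro mult_left_mono sum_mono GS(4)[OF t]) auto
    finally show ?thesis .
  qed
  then show thesis using that[of G S e] GS(1,2) e0 Wi by auto
qed

lemma indicator_inner:
  "(indicator I s *\<^sub>R v) \<bullet> (X *v (indicator I s *\<^sub>R w)) = indicator I s * (v \<bullet> (X *v w))"
  by (auto split: split_indicator)

lemma Lam_inner_integrable:
  assumes "sqint Lam (\<lambda>z. indicator {0..t} (fst z) *\<^sub>R g z)" "sqint Lam (\<lambda>z. indicator {0..t} (fst z) *\<^sub>R h z)"
  shows "integrable Lam (\<lambda>z. indicator {0..t} (fst z) * (g z \<bullet> (X *v h z)))"
  using sqint_inner_integrable[OF assms(1) sqint_matrix[OF assms(2), of X]] by (simp only: indicator_inner)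

lemma bR_section_sqint: "AE s in lborel. s \<in> {0..T} \<longrightarrow> sqint Pr (bR s)"
  using Lam_time(4)[OF bR_int]
  by eventually_elim (auto intro!: sqintI section_measurable[OF bR_meas])

lemma drift_quadratic:
  assumes t: "t \<in> {0..T}"
  shows "(\<integral>\<omega>. D t \<omega> \<bullet> (X *v D t \<omega>) \<partial>Pr) =
    2 * (Lint t (\<lambda>s \<omega>. bR s \<omega> \<bullet> (X *v D s \<omega>)))"
proof -
  have i: "Lintegrable t (\<lambda>s \<omega>. bR s \<omega> \<bullet> (X *v D s \<omega>))"
    by (rule Lam_inner_integrable[OF bR_sqint[OF t] D_Lam_sqint[OF t]])
  have "AE \<omega> in Pr. D t \<omega> \<bullet> (X *v D t \<omega>) = 2 * (LINT s:{0..t}|lborel. bR s \<omega> \<bullet> (X *v D s \<omega>))"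
    using bR_path
  proof eventually_elim
    case (elim \<omega>)
    from indefinite_integral_quadratic[OF set_integral_norm_sq_le(1)[OF elim t] X_sym]
    show ?case by (simp add: D_def)
  qed
  then have "(\<integral>\<omega>. D t \<omega> \<bullet> (X *v D t \<omega>) \<partial>Pr) = (\<integral>\<omega>. 2 * (LINT s:{0..t}|lborel. bR s \<omega> \<bullet> (X *v D s \<omega>)) \<partial>Pr)"
  proof (rule integral_cong_AE[rotated 2])
    note [measurable] = section_measurable[OF D_meas, of t] bR_meas
    show "(\<lambda>\<omega>. D t \<omega> \<bullet> (X *v D t \<omega>)) \<in> borel_measurable Pr" by measurable
    have "(\<lambda>\<omega>. LINT s:{0..t}|lborel. bR s \<omega> \<bullet> (X *v D s \<omega>)) \<in> borel_measurable Pr"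
      by (rule set_integral_measurable) measurable
    then show "(\<lambda>\<omega>. 2 * (LINT s:{0..t}|lborel. bR s \<omega> \<bullet> (X *v D s \<omega>))) \<in> borel_measurable Pr" by simp
  qed
  then show ?thesis using Lam_time(3)[OF i] by simp
qed

text \<open>\<open>D t\<close> is the time integral of the \<open>bR s\<close>, each of them known
  at time \<open>s\<close>. Fubini brings the expectation inside, and the martingale property
  replaces \<open>Z t\<close> by \<open>Z s\<close>. The replacement is needed because the state at
  \<open>s\<close>, not at \<open>t\<close>, has to appear next to the drift at
  \<open>s\<close>.\<close>

lemma drift_martingale:
  fixes S :: "'d \<Rightarrow> 'd \<Rightarrow> real \<Rightarrow> 'a \<Rightarrow> real^'n"
  assumes el: "\<And>i. elementary (G i) (S i)" and t: "t \<in> {0..T}"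
  defines "Z \<equiv> \<lambda>s \<omega>. \<Sum>i\<in>UNIV. S i i s \<omega>"
  shows "set_integrable lborel {0..t} (\<lambda>s. \<integral>\<omega>. bR s \<omega> \<bullet> (X *v Z t \<omega>) \<partial>Pr)"
    "AE s in lborel. s \<in> {0..t} \<longrightarrow> (\<integral>\<omega>. bR s \<omega> \<bullet> (X *v Z t \<omega>) \<partial>Pr) = (\<integral>\<omega>. bR s \<omega> \<bullet> (X *v Z s \<omega>) \<partial>Pr)"
    "(\<integral>\<omega>. D t \<omega> \<bullet> (X *v Z t \<omega>) \<partial>Pr) = (LINT s:{0..t}|lborel. \<integral>\<omega>. bR s \<omega> \<bullet> (X *v Z t \<omega>) \<partial>Pr)"
proof -
  have Z: "sqint Pr (Z s)" if "s \<in> {0..T}" for s unfolding Z_def by (intro sqint_sum elementary_int_sqint[OF el that])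
  have ZL: "Lsqint t (\<lambda>s \<omega>. Z t \<omega>)"
  proof (rule sqintI)
    note [measurable] = sqint_measurable[OF Z[OF t]]
    show "(\<lambda>z. indicator {0..t} (fst z) *\<^sub>R Z t (snd z)) \<in> borel_measurable Lam" by measurable
    have "integrable lborel (indicator {0..t} :: real \<Rightarrow> real)" using t by (intro integrable_real_indicator) auto
    from integral_time_prob_product(1)[OF this sqint_integrable[OF Z[OF t]]]
    show "integrable Lam (\<lambda>z. (norm (indicator {0..t} (fst z) *\<^sub>R Z t (snd z)))\<^sup>2)"
      by (rule Bochner_Integration.integrable_cong[THEN iffD1, OF refl, rotated]) (auto split: split_indicator)
  qed
  have i: "Lintegrable t (\<lambda>s \<omega>. bR s \<omega> \<bullet> (X *v Z t \<omega>))"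
    by (rule Lam_inner_integrable[OF bR_sqint[OF t] ZL])
  note L = Lam_time[where g="\<lambda>s \<omega>. bR s \<omega> \<bullet> (X *v Z t \<omega>)", OF i]
  show "set_integrable lborel {0..t} (\<lambda>s. \<integral>\<omega>. bR s \<omega> \<bullet> (X *v Z t \<omega>) \<partial>Pr)" by (rule L(2))
  have "AE \<omega> in Pr. D t \<omega> \<bullet> (X *v Z t \<omega>) = (LINT s:{0..t}|lborel. bR s \<omega> \<bullet> (X *v Z t \<omega>))"
    using bR_path
  proof eventually_elim
    case (elim \<omega>)
    from set_integral_norm_sq_le(1)[OF elim t]
    have "integrable lborel (\<lambda>s. indicator {0..t} s *\<^sub>R bR s \<omega>)" by (simp add: set_integrable_def)
    from integral_inner_left[OF this, of "X *v Z t \<omega>"]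
    show ?case by (simp add: D_def set_lebesgue_integral_def)
  qed
  then have "(\<integral>\<omega>. D t \<omega> \<bullet> (X *v Z t \<omega>) \<partial>Pr) = (\<integral>\<omega>. (LINT s:{0..t}|lborel. bR s \<omega> \<bullet> (X *v Z t \<omega>)) \<partial>Pr)"
  proof (rule integral_cong_AE[rotated 2])
    note [measurable] = section_measurable[OF D_meas, of t] sqint_measurable[OF Z[OF t]] bR_meas
    show "(\<lambda>\<omega>. D t \<omega> \<bullet> (X *v Z t \<omega>)) \<in> borel_measurable Pr" by measurable
    show "(\<lambda>\<omega>. LINT s:{0..t}|lborel. bR s \<omega> \<bullet> (X *v Z t \<omega>)) \<in> borel_measurable Pr"
      by (rule set_integral_measurable) measurable
  qed
  then show "(\<integral>\<omega>. D t \<omega> \<bullet> (X *v Z t \<omega>) \<partial>Pr) = (LINT s:{0..t}|lborel. \<integral>\<omega>. bR s \<omega> \<bullet> (X *v Z t \<omega>) \<partial>Pr)"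
    using L(1,3) by simp
  show "AE s in lborel. s \<in> {0..t} \<longrightarrow> (\<integral>\<omega>. bR s \<omega> \<bullet> (X *v Z t \<omega>) \<partial>Pr) = (\<integral>\<omega>. bR s \<omega> \<bullet> (X *v Z s \<omega>) \<partial>Pr)"
    using bR_section_sqint
  proof eventually_elim
    case (elim s)
    show ?case
    proof
      assume s: "s \<in> {0..t}"
      then have sT: "s \<in> {0..T}" using t by auto
      with elim have b: "sqint Pr (\<lambda>\<omega>. X *v bR s \<omega>)" by (intro sqint_matrix) auto
      have bF: "(\<lambda>\<omega>. X *v bR s \<omega>) \<in> borel_measurable (F s)"
        unfolding bR_def using A_adapted[OF sT] b_adapted[OF sT] by measurable
      have eq: "(\<integral>\<omega>. bR s \<omega> \<bullet> (X *v Z r \<omega>) \<partial>Pr) = (\<Sum>i\<in>UNIV. \<integral>\<omega>. (X *v bR s \<omega>) \<bullet> S i i r \<omega> \<partial>Pr)" if r: "r \<in> {0..T}" for r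
      proof -
        have "(\<integral>\<omega>. bR s \<omega> \<bullet> (X *v Z r \<omega>) \<partial>Pr) = (\<integral>\<omega>. (\<Sum>i\<in>UNIV. (X *v bR s \<omega>) \<bullet> S i i r \<omega>) \<partial>Pr)"
          unfolding X_sym[of "bR s _"] Z_def inner_sum_left
          by (intro Bochner_Integration.integral_cong sum.cong refl inner_commute)
        also have "\<dots> = (\<Sum>i\<in>UNIV. \<integral>\<omega>. (X *v bR s \<omega>) \<bullet> S i i r \<omega> \<partial>Pr)"
          by (intro Bochner_Integration.integral_sum sqint_inner_integrable[OF b] elementary_int_sqint[OF el r])
        finally show ?thesis .
      qed
      show "(\<integral>\<omega>. bR s \<omega> \<bullet> (X *v Z t \<omega>) \<partial>Pr) = (\<integral>\<omega>. bR s \<omega> \<bullet> (X *v Z s \<omega>) \<partial>Pr)"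
        unfolding eq[OF t] eq[OF sT]
        by (intro sum.cong refl elementary_martingale[OF el _ _ _ b bF]) (use s t in auto)
    qed
  qed
qed

text \<open>With \<open>Z n\<close> the sum of the cut integrals, the expectation of the quadratic
  form of \<open>D t + Z n t\<close> is expanded exactly, and its limit is the right-hand side. But
  \<open>D t + Z n t\<close> approximates the state only on the clock event; discarding the rest
  costs the equality and uses that \<open>X\<close> is positive semidefinite.\<close>

theorem ito_inequality:
  assumes t: "t \<in> {0..T}"
  shows "sqint Pr (xR t)"
    "(\<integral>\<omega>. xR t \<omega> \<bullet> (X *v xR t \<omega>) \<partial>Pr) \<le> (Lint t (\<lambda>s \<omega>. 2 * (bR s \<omega> \<bullet> (X *v xR s \<omega>))
       + (\<Sum>i\<in>UNIV. \<Sum>j\<in>UNIV. K $ i $ j * (YR i s \<omega> \<bullet> (X *v YR j s \<omega>)))))"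
proof -
  obtain G S e where el: "\<And>i n. elementary (G i n) (S i n)"
    and Gc: "\<And>i. (\<lambda>n. Lint T (\<lambda>s \<omega>. (norm (G i n s \<omega> - YR i s \<omega>))\<^sup>2)) \<longlonglongrightarrow> 0"
    and e: "e \<longlonglongrightarrow> 0"
    and W0: "\<And>n t. t \<in> {0..T} \<Longrightarrow> sqint Pr (\<lambda>\<omega>. if A t \<omega> < R then (\<Sum>i\<in>UNIV. S i n i t \<omega>) - (x t \<omega> - D t \<omega>) else 0)"
      "\<And>n t. t \<in> {0..T} \<Longrightarrow> (\<integral>\<omega>. (norm (if A t \<omega> < R then (\<Sum>i\<in>UNIV. S i n i t \<omega>) - (x t \<omega> - D t \<omega>) else 0))\<^sup>2 \<partial>Pr) \<le> e n"
    by (rule state_approximation) blast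
  define Z where "Z n s \<omega> = (\<Sum>i\<in>UNIV. S i n i s \<omega>)" for n s \<omega>
  define W where "W n s \<omega> = (if A s \<omega> < R then Z n s \<omega> - (x s \<omega> - D s \<omega>) else 0)" for n s \<omega>
  have W: "\<And>n s. s \<in> {0..T} \<Longrightarrow> sqint Pr (W n s)" "\<And>n s. s \<in> {0..T} \<Longrightarrow> (\<integral>\<omega>. (norm (W n s \<omega>))\<^sup>2 \<partial>Pr) \<le> e n"
    using W0 unfolding W_def[abs_def] Z_def[abs_def] by auto
  have Z: "sqint Pr (Z n s)" if "s \<in> {0..T}" for s n unfolding Z_def by (intro sqint_sum elementary_int_sqint[OF el that])
  have cut_sqint: "sqint Pr (\<lambda>\<omega>. if A s \<omega> < R then g \<omega> else 0)" if "sqint Pr g" "s \<in> {0..T}" for g :: "'a \<Rightarrow> real^'n" and s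
  proof -
    note [measurable] = F_measurable_Pr[OF that(2) A_adapted[OF that(2)]] sqint_measurable[OF that(1)]
    show ?thesis by (rule sqint_mono[OF that(1), of _ 1]) auto
  qed
  have xs: "sqint Pr (xR s)" if s: "s \<in> {0..T}" for s
  proof -
    have "xR s = (\<lambda>\<omega>. (if A s \<omega> < R then D s \<omega> + Z 0 s \<omega> else 0) - W 0 s \<omega>)" by (auto simp: xR_def W_def)
    then show ?thesis using sqint_diff[OF cut_sqint[OF sqint_add[OF D_sqint[OF s] Z[OF s, of 0]] s] W(1)[OF s, of 0]] by simp
  qed
  then show "sqint Pr (xR t)" using t by blast
  note iXD = Lam_inner_integrable[OF bR_sqint[OF t] D_Lam_sqint[OF t]]
  note iXx = Lam_inner_integrable[OF bR_sqint[OF t] xR_sqint[OF t]]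
  note iXY = Lam_inner_integrable[OF YR_sqint[OF t] YR_sqint[OF t]]
  let ?bD = "Lint t (\<lambda>s \<omega>. bR s \<omega> \<bullet> (X *v D s \<omega>))"
  let ?bx = "Lint t (\<lambda>s \<omega>. bR s \<omega> \<bullet> (X *v xR s \<omega>))"
  let ?YY = "\<lambda>i j. Lint t (\<lambda>s \<omega>. YR i s \<omega> \<bullet> (X *v YR j s \<omega>))"
  define q where "q n = (\<integral>\<omega>. (D t \<omega> + Z n t \<omega>) \<bullet> (X *v (D t \<omega> + Z n t \<omega>)) \<partial>Pr)" for n
  have q_eq: "q n = 2 * ?bD + 2 * (\<integral>\<omega>. D t \<omega> \<bullet> (X *v Z n t \<omega>) \<partial>Pr) + (\<integral>\<omega>. Z n t \<omega> \<bullet> (X *v Z n t \<omega>) \<partial>Pr)" for n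
  proof -
    note i = sqint_inner_integrable[OF D_sqint[OF t] sqint_matrix[OF D_sqint[OF t], of X]]
      sqint_inner_integrable[OF D_sqint[OF t] sqint_matrix[OF Z[OF t, of n], of X]]
      sqint_inner_integrable[OF Z[OF t, of n] sqint_matrix[OF Z[OF t, of n], of X]]
    have "q n = (\<integral>\<omega>. (D t \<omega> \<bullet> (X *v D t \<omega>) + 2 * (D t \<omega> \<bullet> (X *v Z n t \<omega>))) + Z n t \<omega> \<bullet> (X *v Z n t \<omega>) \<partial>Pr)"
      unfolding q_def
      by (intro Bochner_Integration.integral_cong refl)
         (simp add: matrix_vector_right_distrib inner_add_left inner_add_right X_sym[of "Z n t _" "D t _"])
    also have "\<dots> = (\<integral>\<omega>. D t \<omega> \<bullet> (X *v D t \<omega>) \<partial>Pr) + 2 * (\<integral>\<omega>. D t \<omega> \<bullet> (X *v Z n t \<omega>) \<partial>Pr) + (\<integral>\<omega>. Z n t \<omega> \<bullet> (X *v Z n t \<omega>) \<partial>Pr)"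
      using i by simp
    finally show ?thesis by (simp add: drift_quadratic[OF t])
  qed
  \<comment> \<open>The isometry makes this a quadratic expression in the integrands over the
    product, where \<open>G i n\<close> converges to \<open>YR i\<close>.\<close>
  have lim1: "(\<lambda>n. \<integral>\<omega>. Z n t \<omega> \<bullet> (X *v Z n t \<omega>) \<partial>Pr) \<longlonglongrightarrow> (\<Sum>i\<in>UNIV. \<Sum>j\<in>UNIV. K $ i $ j * ?YY i j)"
  proof -
    have eq: "(\<integral>\<omega>. Z n t \<omega> \<bullet> (X *v Z n t \<omega>) \<partial>Pr) = (\<Sum>i\<in>UNIV. \<Sum>j\<in>UNIV. K $ i $ j *
        (\<integral>z. (indicator {0..t} (fst z) *\<^sub>R G i n (fst z) (snd z)) \<bullet> (X *v (indicator {0..t} (fst z) *\<^sub>R G j n (fst z) (snd z))) \<partial>Lam))" for n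
    proof -
      have "(\<integral>\<omega>. Z n t \<omega> \<bullet> (X *v Z n t \<omega>) \<partial>Pr) = (\<integral>\<omega>. (\<Sum>i\<in>UNIV. \<Sum>j\<in>UNIV. S i n i t \<omega> \<bullet> (X *v S j n j t \<omega>)) \<partial>Pr)"
        by (simp add: Z_def linear_sum[OF matrix_vector_mul_linear] inner_sum_left inner_sum_right)
           (subst sum.swap, rule refl)
      also have "\<dots> = (\<Sum>i\<in>UNIV. \<Sum>j\<in>UNIV. \<integral>\<omega>. S i n i t \<omega> \<bullet> (X *v S j n j t \<omega>) \<partial>Pr)"
      proof -
        have "integrable Pr (\<lambda>\<omega>. S i n i t \<omega> \<bullet> (X *v S j n j t \<omega>))" for i j
          by (intro sqint_inner_integrable sqint_matrix elementary_int_sqint[OF el t])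
        then show ?thesis by (simp add: Bochner_Integration.integral_sum)
      qed
      finally show ?thesis by (simp only: elementary_isometry[OF el el t] indicator_inner)
    qed
    have c: "(\<lambda>n. \<integral>z. (norm (indicator {0..t} (fst z) *\<^sub>R G i n (fst z) (snd z) - indicator {0..t} (fst z) *\<^sub>R YR i (fst z) (snd z)))\<^sup>2 \<partial>Lam) \<longlonglongrightarrow> 0" for i
    proof (rule tendsto_sandwich[OF always_eventually always_eventually tendsto_const Gc[of i]]; intro allI)
      fix n
      show "(\<integral>z. (norm (indicator {0..t} (fst z) *\<^sub>R G i n (fst z) (snd z) - indicator {0..t} (fst z) *\<^sub>R YR i (fst z) (snd z)))\<^sup>2 \<partial>Lam) \<le>
        (Lint T (\<lambda>s \<omega>. (norm (G i n s \<omega> - YR i s \<omega>))\<^sup>2))"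
      proof (rule integral_mono')
        have TT: "T \<in> {0..T}" using T_pos by simp
        have "(norm (indicator {0..T} (fst z) *\<^sub>R G i n (fst z) (snd z) - indicator {0..T} (fst z) *\<^sub>R YR i (fst z) (snd z)))\<^sup>2
          = indicator {0..T} (fst z) * (norm (G i n (fst z) (snd z) - YR i (fst z) (snd z)))\<^sup>2" for z
          by (auto split: split_indicator)
        then show "Lintegrable T (\<lambda>s \<omega>. (norm (G i n s \<omega> - YR i s \<omega>))\<^sup>2)"
          using sqint_integrable[OF sqint_diff[OF elementary_sqint[OF el[of i n], of T] YR_sqint[OF TT, of i]]] by simp
      qed (use t in \<open>auto split: split_indicator\<close>)
    qed simp
    show ?thesis unfolding eq indicator_inner[symmetric]
      by (intro tendsto_intros sqint_inner_tendsto sqint_matrix_tendsto c sqint_matrix elementary_sqint[OF el] YR_sqint[OF t])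
  qed
  \<comment> \<open>On the clock event at \<open>s\<close>, \<open>Z n s\<close> approximates
    \<open>x s - D s\<close>, and elsewhere \<open>bR s\<close> vanishes. The error is uniform in
    \<open>s\<close> up to a factor integrable in \<open>s\<close>, so it still vanishes after
    integration over time.\<close>
  have lim2: "(\<lambda>n. \<integral>\<omega>. D t \<omega> \<bullet> (X *v Z n t \<omega>) \<partial>Pr) \<longlonglongrightarrow> ?bx - ?bD"
  proof -
    obtain k where k: "0 \<le> k" "\<And>v. norm (X *v v) \<le> k * norm v" using matrix_vector_norm_le[of X] by metis
    note bi = Lam_time(2)[OF bR_int]
    have bt: "set_integrable lborel {0..t} (\<lambda>s. 1 + (\<integral>\<omega>. (norm (bR s \<omega>))\<^sup>2 \<partial>Pr))"
    proof (rule set_integral_add(1))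
      show "set_integrable lborel {0..t} (\<lambda>s. 1::real)" unfolding set_integrable_def using t by simp
      show "set_integrable lborel {0..t} (\<lambda>s. \<integral>\<omega>. (norm (bR s \<omega>))\<^sup>2 \<partial>Pr)"
        using t by (intro set_integrable_subset[OF bi]) auto
    qed
    define E where "E = (LINT s:{0..t}|lborel. 1 + (\<integral>\<omega>. (norm (bR s \<omega>))\<^sup>2 \<partial>Pr))"
    have cross: "\<bar>(\<integral>\<omega>. bR s \<omega> \<bullet> (X *v Z n s \<omega>) \<partial>Pr) - ((\<integral>\<omega>. bR s \<omega> \<bullet> (X *v xR s \<omega>) \<partial>Pr) - (\<integral>\<omega>. bR s \<omega> \<bullet> (X *v D s \<omega>) \<partial>Pr))\<bar>
        \<le> k * sqrt (e n) * (1 + (\<integral>\<omega>. (norm (bR s \<omega>))\<^sup>2 \<partial>Pr))" (is "\<bar>?l\<bar> \<le> _")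
      if sT: "s \<in> {0..T}" and b: "sqint Pr (bR s)" for s n
    proof -
      note bX = sqint_matrix[OF b, of X]
      note i = sqint_inner_integrable[OF b sqint_matrix[OF Z[OF sT, of n], of X]]
        sqint_inner_integrable[OF b sqint_matrix[OF xs[OF sT], of X]] sqint_inner_integrable[OF b sqint_matrix[OF D_sqint[OF sT], of X]]
      have "?l = (\<integral>\<omega>. bR s \<omega> \<bullet> (X *v Z n s \<omega>) - (bR s \<omega> \<bullet> (X *v xR s \<omega>) - bR s \<omega> \<bullet> (X *v D s \<omega>)) \<partial>Pr)"
        by (simp only: Bochner_Integration.integral_diff[OF i(1) Bochner_Integration.integrable_diff[OF i(2,3)]]
          Bochner_Integration.integral_diff[OF i(2,3)])
      also have "\<dots> = (\<integral>\<omega>. (X *v bR s \<omega>) \<bullet> W n s \<omega> \<partial>Pr)"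
      proof (intro Bochner_Integration.integral_cong refl)
        fix \<omega>
        have "bR s \<omega> \<bullet> (X *v Z n s \<omega>) - (bR s \<omega> \<bullet> (X *v xR s \<omega>) - bR s \<omega> \<bullet> (X *v D s \<omega>)) = bR s \<omega> \<bullet> (X *v (Z n s \<omega> - (xR s \<omega> - D s \<omega>)))"
          by (simp add: matrix_vector_mult_diff_distrib inner_diff_right)
        also have "\<dots> = bR s \<omega> \<bullet> (X *v W n s \<omega>)" by (simp add: W_def bR_def xR_def)
        also have "\<dots> = W n s \<omega> \<bullet> (X *v bR s \<omega>)" by (rule X_sym)
        also have "\<dots> = (X *v bR s \<omega>) \<bullet> W n s \<omega>" by (rule inner_commute)
        finally show "bR s \<omega> \<bullet> (X *v Z n s \<omega>) - (bR s \<omega> \<bullet> (X *v xR s \<omega>) - bR s \<omega> \<bullet> (X *v D s \<omega>)) = (X *v bR s \<omega>) \<bullet> W n s \<omega>" .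
      qed
      finally have "\<bar>?l\<bar> \<le> sqrt ((\<integral>\<omega>. (norm (X *v bR s \<omega>))\<^sup>2 \<partial>Pr) * (\<integral>\<omega>. (norm (W n s \<omega>))\<^sup>2 \<partial>Pr))"
        using integral_inner_cauchy_schwarz[OF bX W(1)[OF sT]] by (simp only:)
      also have "\<dots> \<le> sqrt ((k\<^sup>2 * (\<integral>\<omega>. (norm (bR s \<omega>))\<^sup>2 \<partial>Pr)) * e n)"
      proof (intro real_sqrt_le_mono mult_mono W(2)[OF sT])
        have "(\<integral>\<omega>. (norm (X *v bR s \<omega>))\<^sup>2 \<partial>Pr) \<le> (\<integral>\<omega>. k\<^sup>2 * (norm (bR s \<omega>))\<^sup>2 \<partial>Pr)"
        proof (rule integral_mono')
          show "integrable Pr (\<lambda>\<omega>. k\<^sup>2 * (norm (bR s \<omega>))\<^sup>2)" using sqint_integrable[OF b] by simp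
          show "(norm (X *v bR s \<omega>))\<^sup>2 \<le> k\<^sup>2 * (norm (bR s \<omega>))\<^sup>2" for \<omega>
            unfolding power_mult_distrib[symmetric] by (intro power_mono k) auto
        qed auto
        then show "(\<integral>\<omega>. (norm (X *v bR s \<omega>))\<^sup>2 \<partial>Pr) \<le> k\<^sup>2 * (\<integral>\<omega>. (norm (bR s \<omega>))\<^sup>2 \<partial>Pr)" by simp
      qed auto
      also have "\<dots> = k * sqrt (e n) * sqrt (\<integral>\<omega>. (norm (bR s \<omega>))\<^sup>2 \<partial>Pr)"
        using k(1) by (simp add: real_sqrt_mult)
      also have "\<dots> \<le> k * sqrt (e n) * (1 + (\<integral>\<omega>. (norm (bR s \<omega>))\<^sup>2 \<partial>Pr))"
      proof (rule mult_left_mono)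
        \<comment> \<open>Trades the root of the second moment of the drift for an expression whose
          integrability in time is \<open>bt\<close>.\<close>
        have "sqrt y \<le> 1 + y" if "0 \<le> y" for y :: real
          using that by (intro real_le_lsqrt) (auto simp: power2_eq_square algebra_simps)
        then show "sqrt (\<integral>\<omega>. (norm (bR s \<omega>))\<^sup>2 \<partial>Pr) \<le> 1 + (\<integral>\<omega>. (norm (bR s \<omega>))\<^sup>2 \<partial>Pr)" by simp
        have "0 \<le> e n" by (rule order_trans[OF _ W(2)[OF sT, of n]]) simp
        then show "0 \<le> k * sqrt (e n)" using k(1) by simp
      qed
      finally show ?thesis .
    qed
    have le: "norm ((\<integral>\<omega>. D t \<omega> \<bullet> (X *v Z n t \<omega>) \<partial>Pr) - (?bx - ?bD)) \<le> k * sqrt (e n) * E" for n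
    proof -
      note dm = drift_martingale[where G="\<lambda>i. G i n" and S="\<lambda>i. S i n", OF el t, folded Z_def]
      note Lx = Lam_time[where g="\<lambda>s \<omega>. bR s \<omega> \<bullet> (X *v xR s \<omega>)", OF iXx]
      note LD = Lam_time[where g="\<lambda>s \<omega>. bR s \<omega> \<bullet> (X *v D s \<omega>)", OF iXD]
      define f where "f s = (\<integral>\<omega>. bR s \<omega> \<bullet> (X *v Z n t \<omega>) \<partial>Pr) - ((\<integral>\<omega>. bR s \<omega> \<bullet> (X *v xR s \<omega>) \<partial>Pr) - (\<integral>\<omega>. bR s \<omega> \<bullet> (X *v D s \<omega>) \<partial>Pr))" for s
      note d2 = set_integral_diff[OF Lx(2) LD(2)]
      note d1 = set_integral_diff[OF dm(1) d2(1), folded f_def]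
      have "(\<integral>\<omega>. D t \<omega> \<bullet> (X *v Z n t \<omega>) \<partial>Pr) - (?bx - ?bD) = (LINT s:{0..t}|lborel. f s)"
        unfolding dm(3) Lx(1) LD(1) d1(2) d2(2) ..
      also have "norm \<dots> \<le> (LINT s:{0..t}|lborel. \<bar>f s\<bar>)"
        using integral_norm_bound[of lborel "\<lambda>s. indicator {0..t} s *\<^sub>R f s"]
        by (simp add: set_lebesgue_integral_def abs_mult)
      also have "\<dots> \<le> (LINT s:{0..t}|lborel. k * sqrt (e n) * (1 + (\<integral>\<omega>. (norm (bR s \<omega>))\<^sup>2 \<partial>Pr)))"
      proof (rule set_integral_mono_AE[OF set_integrable_abs[OF d1(1)] set_integrable_mult_right[OF bt]])
        show "AE s\<in>{0..t} in lborel. \<bar>f s\<bar> \<le> k * sqrt (e n) * (1 + (\<integral>\<omega>. (norm (bR s \<omega>))\<^sup>2 \<partial>Pr))"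
          using dm(2) bR_section_sqint
        proof eventually_elim
          case (elim s)
          show ?case
          proof
            assume s: "s \<in> {0..t}"
            then have "s \<in> {0..T}" using t by auto
            with elim(2) cross[of s n] show "\<bar>f s\<bar> \<le> k * sqrt (e n) * (1 + (\<integral>\<omega>. (norm (bR s \<omega>))\<^sup>2 \<partial>Pr))"
              unfolding f_def elim(1)[rule_format, OF s] by blast
          qed
        qed
      qed
      also have "\<dots> = k * sqrt (e n) * E" unfolding E_def by (rule set_integral_mult_right)
      finally show ?thesis .
    qed
    have lim: "(\<lambda>n. k * sqrt (e n) * E) \<longlonglongrightarrow> 0"
    proof -
      have "(\<lambda>n. k * sqrt (e n) * E) \<longlonglongrightarrow> k * sqrt 0 * E" by (intro tendsto_intros e)
      then show ?thesis by simp
    qed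
    have "(\<lambda>n. (\<integral>\<omega>. D t \<omega> \<bullet> (X *v Z n t \<omega>) \<partial>Pr) - (?bx - ?bD)) \<longlonglongrightarrow> 0"
      by (rule Lim_null_comparison[OF always_eventually[OF allI[OF le]] lim])
    then show ?thesis by (rule LIM_zero_cancel)
  qed
  have q_lim: "q \<longlonglongrightarrow> 2 * ?bD + 2 * (?bx - ?bD) + (\<Sum>i\<in>UNIV. \<Sum>j\<in>UNIV. K $ i $ j * ?YY i j)"
    unfolding q_eq[abs_def] by (intro tendsto_intros lim1 lim2)
  \<comment> \<open>\<open>D t + Z n t\<close> restricted to the clock event: it converges to
    \<open>xR t\<close>, and its quadratic form is pointwise at most that of the unrestricted
    sum.\<close>
  define V where "V n \<omega> = (if A t \<omega> < R then D t \<omega> + Z n t \<omega> else 0)" for n \<omega>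
  have V: "sqint Pr (V n)" for n unfolding V_def by (intro cut_sqint[OF _ t] sqint_add D_sqint[OF t] Z[OF t])
  have VW: "V n \<omega> - xR t \<omega> = W n t \<omega>" for n \<omega> by (simp add: V_def xR_def W_def)
  have V0: "(\<lambda>n. \<integral>\<omega>. (norm (V n \<omega> - xR t \<omega>))\<^sup>2 \<partial>Pr) \<longlonglongrightarrow> 0"
    unfolding VW by (rule tendsto_sandwich[OF always_eventually always_eventually tendsto_const e]) (use W(2)[OF t] in auto)
  have V1: "(\<lambda>n. \<integral>\<omega>. (norm (X *v V n \<omega> - X *v xR t \<omega>))\<^sup>2 \<partial>Pr) \<longlonglongrightarrow> 0"
    by (rule sqint_matrix_tendsto[OF V xs[OF t] V0])
  have "(\<lambda>n. \<integral>\<omega>. V n \<omega> \<bullet> (X *v V n \<omega>) \<partial>Pr) \<longlonglongrightarrow> (\<integral>\<omega>. xR t \<omega> \<bullet> (X *v xR t \<omega>) \<partial>Pr)"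
    by (rule sqint_inner_tendsto[OF V xs[OF t] V0 sqint_matrix[OF V] sqint_matrix[OF xs[OF t]] V1])
  moreover have "(\<integral>\<omega>. V n \<omega> \<bullet> (X *v V n \<omega>) \<partial>Pr) \<le> q n" for n
    unfolding q_def
  proof (rule integral_mono)
    show "integrable Pr (\<lambda>\<omega>. V n \<omega> \<bullet> (X *v V n \<omega>))" by (intro sqint_inner_integrable sqint_matrix V)
    show "integrable Pr (\<lambda>\<omega>. (D t \<omega> + Z n t \<omega>) \<bullet> (X *v (D t \<omega> + Z n t \<omega>)))"
      by (intro sqint_inner_integrable sqint_matrix sqint_add D_sqint[OF t] Z[OF t])
    show "V n \<omega> \<bullet> (X *v V n \<omega>) \<le> (D t \<omega> + Z n t \<omega>) \<bullet> (X *v (D t \<omega> + Z n t \<omega>))" for \<omega>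
      using X_pos by (simp add: V_def)
  qed
  ultimately have "(\<integral>\<omega>. xR t \<omega> \<bullet> (X *v xR t \<omega>) \<partial>Pr) \<le> 2 * ?bD + 2 * (?bx - ?bD) + (\<Sum>i\<in>UNIV. \<Sum>j\<in>UNIV. K $ i $ j * ?YY i j)"
    by (intro LIMSEQ_le[OF _ q_lim]) auto
  \<comment> \<open>The two occurrences of \<open>?bD\<close> cancel: together, the pure drift term
    and the mixed term pair the drift with the state.\<close>
  also have "\<dots> = 2 * ?bx + (\<Sum>i\<in>UNIV. \<Sum>j\<in>UNIV. K $ i $ j * ?YY i j)" by simp
  also have "\<dots> = (\<integral>z. 2 * (indicator {0..t} (fst z) * (bR (fst z) (snd z) \<bullet> (X *v xR (fst z) (snd z)))) +
      (\<Sum>i\<in>UNIV. \<Sum>j\<in>UNIV. K $ i $ j * (indicator {0..t} (fst z) * (YR i (fst z) (snd z) \<bullet> (X *v YR j (fst z) (snd z))))) \<partial>Lam)"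
    using iXx iXY by (simp add: Bochner_Integration.integral_sum)
  also have "\<dots> = (Lint t (\<lambda>s \<omega>. 2 * (bR s \<omega> \<bullet> (X *v xR s \<omega>))
       + (\<Sum>i\<in>UNIV. \<Sum>j\<in>UNIV. K $ i $ j * (YR i s \<omega> \<bullet> (X *v YR j s \<omega>)))))"
    by (intro Bochner_Integration.integral_cong refl) (simp add: distrib_left sum_distrib_left mult_ac)
  finally show "(\<integral>\<omega>. xR t \<omega> \<bullet> (X *v xR t \<omega>) \<partial>Pr) \<le> (Lint t (\<lambda>s \<omega>. 2 * (bR s \<omega> \<bullet> (X *v xR s \<omega>))
       + (\<Sum>i\<in>UNIV. \<Sum>j\<in>UNIV. K $ i $ j * (YR i s \<omega> \<bullet> (X *v YR j s \<omega>)))))" .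
qed

end

section \<open>Eigenbases and matrix inequalities\<close>

text \<open>The remainder \<open>w\<close> is orthogonal to every basis vector and lies in their
  span, so it is orthogonal to itself.\<close>

lemma orthonormal_expansion:
  assumes b: "orthonormal_eigenbasis X b lam"
  shows "v = (\<Sum>k\<in>UNIV. (b k \<bullet> v) *\<^sub>R b k)"
proof -
  define w where "w = v - (\<Sum>k\<in>UNIV. (b k \<bullet> v) *\<^sub>R b k)"
  have bb: "b i \<bullet> b j = (if i = j then 1 else 0)" for i j using b by (simp add: orthonormal_eigenbasis_def)
  have "w \<bullet> b j = 0" for j
    by (simp add: w_def inner_diff_left inner_sum_left bb inner_commute[of v] if_distrib[of "(*) _"] cong: if_cong)
  then have "\<forall>y\<in>span (range b). w \<bullet> y = 0"
    using orthogonal_to_span[of _ "range b" w] by (auto simp: orthogonal_def)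
  moreover have "w \<in> span (range b)" using b by (simp add: orthonormal_eigenbasis_def)
  ultimately have "w \<bullet> w = 0" by blast
  then show ?thesis by (simp add: w_def)
qed

lemma eigenbasis_mult:
  assumes b: "orthonormal_eigenbasis X b lam"
  shows "X *v v = (\<Sum>k\<in>UNIV. (lam k * (b k \<bullet> v)) *\<^sub>R b k)"
proof -
  have "X *v v = X *v (\<Sum>k\<in>UNIV. (b k \<bullet> v) *\<^sub>R b k)" using orthonormal_expansion[OF b, of v] by simp
  also have "\<dots> = (\<Sum>k\<in>UNIV. (b k \<bullet> v) *\<^sub>R (X *v b k))"
    by (simp add: linear_sum[OF matrix_vector_mul_linear] linear_scale[OF matrix_vector_mul_linear])
  also have "\<dots> = (\<Sum>k\<in>UNIV. (lam k * (b k \<bullet> v)) *\<^sub>R b k)"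
    using b by (simp add: orthonormal_eigenbasis_def mult.commute)
  finally show ?thesis .
qed

lemma eigenbasis_inner:
  assumes b: "orthonormal_eigenbasis X b lam"
  shows "w \<bullet> (X *v v) = (\<Sum>k\<in>UNIV. lam k * (b k \<bullet> w) * (b k \<bullet> v))"
  by (simp add: eigenbasis_mult[OF b] inner_sum_right inner_commute mult_ac)

lemma eigenbasis_sym: "orthonormal_eigenbasis X b lam \<Longrightarrow> v \<bullet> (X *v w) = w \<bullet> (X *v v)"
  by (simp add: eigenbasis_inner mult_ac)

lemma eigenbasis_nonneg:
  "orthonormal_eigenbasis X b lam \<Longrightarrow> (\<And>k. 0 < lam k) \<Longrightarrow> 0 \<le> v \<bullet> (X *v v)"
  unfolding eigenbasis_inner mult.assoc
  by (intro sum_nonneg mult_nonneg_nonneg[OF less_imp_le zero_le_square]) auto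

lemma eigenbasis_pos:
  assumes "pos_definite X" "orthonormal_eigenbasis X b lam"
  shows "0 < lam k"
proof -
  have bb: "b k \<bullet> b k = 1" using assms(2) by (simp add: orthonormal_eigenbasis_def)
  then have "b k \<noteq> 0" by auto
  then have "0 < b k \<bullet> (X *v b k)" using assms(1) by (simp add: pos_definite_def)
  then show ?thesis using assms(2) bb by (simp add: orthonormal_eigenbasis_def)
qed

lemma eigenbasis_matrix_inv:
  assumes P: "pos_definite P" and b: "orthonormal_eigenbasis P b lam"
  shows "orthonormal_eigenbasis (matrix_inv P) b (\<lambda>k. inverse (lam k))"
proof -
  have "v = 0" if "P *v v = 0" for v
    using P that by (auto simp: pos_definite_def dest: spec[of _ v])
  then have "invertible P"
    using matrix_left_invertible_ker[of P] by (auto simp: invertible_left_inverse)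
  then have i: "matrix_inv P ** P = mat 1"
    unfolding invertible_def matrix_inv_def by (metis (mono_tags, lifting) someI_ex)
  have "matrix_inv P *v b k = inverse (lam k) *\<^sub>R b k" for k
  proof -
    have "b k = matrix_inv P *v (P *v b k)" by (simp add: matrix_vector_mul_assoc i)
    also have "\<dots> = lam k *\<^sub>R (matrix_inv P *v b k)"
      using b by (simp add: orthonormal_eigenbasis_def linear_scale[OF matrix_vector_mul_linear])
    finally have "inverse (lam k) *\<^sub>R b k = inverse (lam k) *\<^sub>R lam k *\<^sub>R (matrix_inv P *v b k)" by (rule arg_cong)
    then show ?thesis using eigenbasis_pos[OF P b, of k] by simp
  qed
  then show ?thesis using b by (simp add: orthonormal_eigenbasis_def)
qed

lemma transpose_inner: "(transpose A *v v) \<bullet> w = v \<bullet> ((A::real^'n^'m) *v w)"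
  by (simp add: transpose_matrix_vector dot_lmul_matrix)

lemma inner_transpose: "w \<bullet> (transpose A *v v) = ((A::real^'n^'m) *v w) \<bullet> v"
  using transpose_inner[of A v w] by (simp add: inner_commute)

lemma matrix_eqI_mult: "(\<And>v. A *v v = B *v v) \<Longrightarrow> A = (B::real^'n^'m)"
  by (metis matrix_eq)

text \<open>\<open>matrix_sqrt\<close> is a definite description, so existence and uniqueness of the
  root have to be supplied. The root is built on the eigenbasis with the square roots of the
  eigenvalues.\<close>

lemma matrix_sqrt_eigenbasis:
  assumes b: "orthonormal_eigenbasis X b lam" and pos: "\<And>k. 0 < lam k"
  shows "(norm (matrix_sqrt X *v v))\<^sup>2 = v \<bullet> (X *v v)"
proof -
  have bb: "b i \<bullet> b j = (if i = j then 1 else 0)" for i j using b by (simp add: orthonormal_eigenbasis_def)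
  define r where "r v = (\<Sum>k\<in>UNIV. (sqrt (lam k) * (b k \<bullet> v)) *\<^sub>R b k)" for v
  define R where "R = matrix r"
  have "linear r" unfolding r_def
    by (intro linear_compose_sum ballI) (auto intro!: linearI simp: inner_add_right algebra_simps)
  then have Rv: "R *v v = r v" for v unfolding R_def
    by (intro matrix_works) (simp add: linear_def scalar_mult_eq_scaleR[abs_def])
  have br: "b j \<bullet> r v = sqrt (lam j) * (b j \<bullet> v)" for j v
    by (simp add: r_def inner_sum_right bb if_distrib[of "(*) _"] cong: if_cong)
  have rr: "r (r v) = X *v v" for v
    unfolding eigenbasis_mult[OF b] r_def[of "r v"] br using pos
    by (intro sum.cong refl) (simp add: mult.assoc[symmetric] less_imp_le)
  have rin: "v \<bullet> r w = r v \<bullet> w" for v w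
    by (simp add: r_def inner_sum_right inner_sum_left inner_commute mult_ac)
  have "transpose R = R"
  proof (rule matrix_eqI_mult)
    fix v
    have "(transpose R *v v) \<bullet> w = (R *v v) \<bullet> w" for w
      unfolding transpose_inner Rv by (rule rin)
    then show "transpose R *v v = R *v v" by (metis vector_eq_rdot)
  qed
  moreover have "0 \<le> v \<bullet> (R *v v)" for v
    unfolding Rv r_def using pos
    unfolding inner_sum_right
    by (intro sum_nonneg) (auto simp: inner_commute[of v] mult.assoc less_imp_le intro!: mult_nonneg_nonneg)
  ultimately have psd: "pos_semidefinite R" by (simp add: pos_semidefinite_def symmetric_matrix_def)
  have RR: "R ** R = X" by (rule matrix_eqI_mult) (simp add: matrix_vector_mul_assoc[symmetric] Rv rr)
  have uniq: "R' = R" if R': "pos_semidefinite R'" "R' ** R' = X" for R'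
  proof (rule matrix_eqI_mult)
    have R'b: "R' *v b k = sqrt (lam k) *\<^sub>R b k" for k
    proof -
      \<comment> \<open>Applying \<open>R'\<close> to \<open>w\<close> and adding
        \<open>sqrt (lam k) *\<^sub>R w\<close> gives \<open>X *v b k - lam k *\<^sub>R b k\<close>,
        which is zero. As \<open>R'\<close> is positive semidefinite and the added multiple is
        positive, \<open>w = 0\<close>, so any other root acts on the basis in the same way.\<close>
      define w where "w = R' *v b k - sqrt (lam k) *\<^sub>R b k"
      have "R' *v w + sqrt (lam k) *\<^sub>R w = R' *v (R' *v b k) - (sqrt (lam k) * sqrt (lam k)) *\<^sub>R b k"
        by (simp add: w_def linear_diff[OF matrix_vector_mul_linear] linear_scale[OF matrix_vector_mul_linear] algebra_simps)
      also have "\<dots> = 0"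
        using b pos[of k] R'(2) by (simp add: matrix_vector_mul_assoc orthonormal_eigenbasis_def)
      finally have "w \<bullet> (R' *v w) + sqrt (lam k) * (w \<bullet> w) = 0"
        by (metis inner_add_right inner_scaleR_right inner_zero_right)
      moreover have "0 \<le> w \<bullet> (R' *v w)" using R'(1) by (simp add: pos_semidefinite_def)
      moreover have "0 \<le> sqrt (lam k) * (w \<bullet> w)" using pos[of k] by simp
      ultimately have "sqrt (lam k) * (w \<bullet> w) = 0" by linarith
      then have "w = 0" using pos[of k] by simp
      then show ?thesis by (simp add: w_def)
    qed
    fix v
    have "R' *v v = R' *v (\<Sum>k\<in>UNIV. (b k \<bullet> v) *\<^sub>R b k)" using orthonormal_expansion[OF b, of v] by simp
    also have "\<dots> = r v"
      by (simp add: linear_sum[OF matrix_vector_mul_linear] linear_scale[OF matrix_vector_mul_linear] R'b r_def mult.commute)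
    finally show "R' *v v = R *v v" by (simp add: Rv)
  qed
  have "matrix_sqrt X = R" unfolding matrix_sqrt_def
    by (rule the_equality) (use psd RR uniq in blast)+
  then have "(norm (matrix_sqrt X *v v))\<^sup>2 = r v \<bullet> r v" by (simp add: Rv power2_norm_eq_inner)
  also have "\<dots> = v \<bullet> (X *v v)" by (simp add: rin[symmetric] rr)
  finally show ?thesis .
qed

text \<open>One term of the nonnegative spectral sum for \<open>matrix_inv P\<close>, multiplied by
  \<open>lam k\<close>. This is where the eigenvalue enters the bound on the state.\<close>

lemma eigenbasis_coefficient_le:
  assumes P: "pos_definite P" and b: "orthonormal_eigenbasis P b lam"
  shows "(v \<bullet> b k)\<^sup>2 \<le> lam k * (v \<bullet> (matrix_inv P *v v))"
proof -
  have pos: "0 < lam k" for k by (rule eigenbasis_pos[OF P b])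
  have "inverse (lam k) * (b k \<bullet> v) * (b k \<bullet> v) \<le> (\<Sum>k\<in>UNIV. inverse (lam k) * (b k \<bullet> v) * (b k \<bullet> v))"
  proof (rule member_le_sum)
    show "0 \<le> inverse (lam j) * (b j \<bullet> v) * (b j \<bullet> v)" for j
      unfolding mult.assoc using pos[of j] by (intro mult_nonneg_nonneg zero_le_square) auto
  qed auto
  then have "inverse (lam k) * (v \<bullet> b k)\<^sup>2 \<le> v \<bullet> (matrix_inv P *v v)"
    unfolding eigenbasis_inner[OF eigenbasis_matrix_inv[OF P b]] by (simp add: power2_eq_square inner_commute mult.assoc)
  from mult_left_mono[OF this, of "lam k"] pos[of k] show ?thesis by (simp add: mult.assoc[symmetric])
qed

lemma scaleR_matrix_mult: "(c *\<^sub>R (A::real^'n^'m)) *v v = c *\<^sub>R (A *v v)"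
  by (simp add: vec_eq_iff matrix_vector_mult_def sum_distrib_left mult.assoc)

lemma sum_matrix_mult: "(\<Sum>i\<in>I. (A i::real^'n^'m)) *v v = (\<Sum>i\<in>I. A i *v v)"
  by (induction I rule: infinite_finite_induct) (auto simp: matrix_vector_mult_add_rdistrib matrix_vector_mult_0)

text \<open>The Gramian inequality tested with the vector \<open>v\<close>. The shift of
  \<open>A\<close> by \<open>c1\<close> becomes the term
  \<open>- 2 * c1 * (v \<bullet> (X *v v))\<close>, which later competes with the constant
  \<open>c2\<close> of the nonlinearity. \<open>S\<close> stands for
  \<open>matrix_inv P ** B ** transpose B ** matrix_inv P\<close> or for
  \<open>transpose C ** C\<close>.\<close>

lemma loewner_quadratic:
  fixes A X S :: "real^'n^'n" and N :: "'d::finite \<Rightarrow> real^'n^'n" and K :: "real^'d^'d"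
  assumes le: "loewner_le (transpose (A + c1 *\<^sub>R mat 1) ** X + X ** (A + c1 *\<^sub>R mat 1)
          + (\<Sum>i\<in>UNIV. \<Sum>j\<in>UNIV. K $ i $ j *\<^sub>R (transpose (N i) ** X ** N j))) (- S)"
    and X: "\<And>v w. v \<bullet> (X *v w) = w \<bullet> (X *v v)"
  shows "2 * ((A *v v) \<bullet> (X *v v)) + (\<Sum>i\<in>UNIV. \<Sum>j\<in>UNIV. K $ i $ j * ((N i *v v) \<bullet> (X *v (N j *v v))))
     \<le> - 2 * c1 * (v \<bullet> (X *v v)) - v \<bullet> (S *v v)"
proof -
  let ?L = "transpose (A + c1 *\<^sub>R mat 1) ** X + X ** (A + c1 *\<^sub>R mat 1)
          + (\<Sum>i\<in>UNIV. \<Sum>j\<in>UNIV. K $ i $ j *\<^sub>R (transpose (N i) ** X ** N j))"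
  have "0 \<le> v \<bullet> ((- S - ?L) *v v)" using le by (simp add: loewner_le_def pos_semidefinite_def)
  also have "\<dots> = - (v \<bullet> (S *v v)) - v \<bullet> (?L *v v)"
    using scaleR_matrix_mult[of "-1" S v] by (simp add: matrix_vector_mult_diff_rdistrib inner_diff_right)

  also have "v \<bullet> (?L *v v) = 2 * ((A *v v) \<bullet> (X *v v)) + 2 * c1 * (v \<bullet> (X *v v)) + (\<Sum>i\<in>UNIV. \<Sum>j\<in>UNIV. K $ i $ j * ((N i *v v) \<bullet> (X *v (N j *v v))))"
    by (simp add: matrix_vector_mult_add_rdistrib inner_add_right inner_add_left sum_matrix_mult inner_sum_right
        scaleR_matrix_mult matrix_vector_mul_assoc[symmetric] inner_transpose X[of v "A *v v + c1 *\<^sub>R v"] X[of v "A *v v"]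
        del: transpose_matrix_vector)
  finally show ?thesis by simp
qed

section \<open>The controlled system\<close>

locale controlled_system = levy_driven Pr T F M K
  for Pr :: "'a measure" and T :: real and F :: "real \<Rightarrow> 'a measure"
    and M :: "real \<Rightarrow> 'a \<Rightarrow> real^'d" and K :: "real^'d^'d" +
  fixes A :: "real^'n^'n" and B :: "real^'m^'n" and N :: "'d \<Rightarrow> real^'n^'n"
    and f :: "real^'n \<Rightarrow> real^'n" and c_f :: real
    and u :: "real \<Rightarrow> 'a \<Rightarrow> real^'m" and x :: "real \<Rightarrow> 'a \<Rightarrow> real^'n"
  assumes f_lip: "\<forall>R. \<exists>L. lipschitz_on L {v. norm v \<le> R} f"
    and f_growth: "\<forall>v. v \<bullet> f v \<le> c_f * (norm v)\<^sup>2"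
    and u_L2: "u \<in> L2_controls Pr T F"
    and x_sol: "state_solution Pr T F M A B N f u x"
begin

text \<open>Truncations of state and control to the time horizon, outside of which nothing is known.\<close>

definition xT :: "real \<Rightarrow> 'a \<Rightarrow> real^'n" where "xT s \<omega> = (if s \<in> {0..T} then x s \<omega> else 0)"

definition uT :: "real \<Rightarrow> 'a \<Rightarrow> real^'m" where "uT s \<omega> = (if s \<in> {0..T} then u s \<omega> else 0)"

definition bT :: "real \<Rightarrow> 'a \<Rightarrow> real^'n" where
  "bT s \<omega> = (if s \<in> {0..T} then A *v x s \<omega> + B *v u s \<omega> + f (x s \<omega>) else 0)"

text \<open>The summand 1 makes the clock strictly increasing. The squares let a level of the clock
  bound, up to constants, the energy of the noise integrands and of the state-dependent drift before
  that level is reached.\<close>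

definition rate :: "real \<Rightarrow> 'a \<Rightarrow> real" where
  "rate s \<omega> = 1 + (norm (xT s \<omega>))\<^sup>2 + (norm (f (xT s \<omega>)))\<^sup>2"

text \<open>A continuous adapted clock. Localizing with the events \<open>clk t < R\<close> takes the place of stopping
  times; since it is continuous, jumps of the state play no role.\<close>

definition clk :: "real \<Rightarrow> 'a \<Rightarrow> real" where "clk t \<omega> = (LINT s:{0..t}|lborel. rate s \<omega>)"

lemma x_adapted: "s \<in> {0..T} \<Longrightarrow> x s \<in> borel_measurable (F s)"
  using x_sol by (auto simp: state_solution_def adapted_def)

lemma x_cadlag: "\<omega> \<in> space Pr \<Longrightarrow> cadlag_on T (\<lambda>t. x t \<omega>)"
  using x_sol by (auto simp: state_solution_def)

lemma u_adapted: "s \<in> {0..T} \<Longrightarrow> u s \<in> borel_measurable (F s)"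
  using u_L2 by (auto simp: L2_controls_def adapted_def)

lemma f_continuous: "continuous_on UNIV f"
proof -
  have "isCont f v" for v
  proof -
    obtain L where "lipschitz_on L {w. norm w \<le> norm v + 1} f" using f_lip by blast
    then have "continuous_on {w. norm w \<le> norm v + 1} f" by (rule lipschitz_on_continuous_on)
    moreover have "v \<in> interior {w. norm w \<le> norm v + 1}"
    proof (rule interiorI[of "ball v 1"])
      show "ball v 1 \<subseteq> {w. norm w \<le> norm v + 1}"
      proof
        fix w assume "w \<in> ball v 1"
        then show "w \<in> {w. norm w \<le> norm v + 1}"
          using norm_triangle_ineq2[of w v] by (simp add: dist_norm norm_minus_commute)
      qed
    qed auto
    ultimately show ?thesis by (rule continuous_on_interior)
  qed
  then show ?thesis by (simp add: continuous_on_eq_continuous_at)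
qed

lemma f_measurable [measurable]: "f \<in> borel_measurable borel"
  by (rule borel_measurable_continuous_onI[OF f_continuous])

text \<open>Progressive measurability of the state, which makes the clock at \<open>t\<close>
  measurable with respect to \<open>F t\<close>.\<close>

lemma x_meas_upto:
  assumes "t \<in> {0..T}"
  shows "(\<lambda>(s, \<omega>). indicator {0..t} s *\<^sub>R x s \<omega>) \<in> borel_measurable (borel \<Otimes>\<^sub>M F t)"
proof (rule cadlag_adapted_measurable)
  show "x s \<in> borel_measurable (F t)" if "s \<in> {0..t}" for s
    using that assms by (intro F_measurable_mono[OF x_adapted]) auto
  show "((\<lambda>s. x s \<omega>) \<longlongrightarrow> x s \<omega>) (at_right s)" if "s \<in> {0..<t}" "\<omega> \<in> space (F t)" for s \<omega>
    using x_cadlag[of \<omega>] that assms by (auto simp: cadlag_on_def space_F)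
qed (use assms in simp)

lemma xT_meas [measurable]: "joint xT"
proof -
  have "(\<lambda>(s, \<omega>). indicator {0..T} s *\<^sub>R x s \<omega>) \<in> borel_measurable (borel \<Otimes>\<^sub>M Pr)"
  proof (rule cadlag_adapted_measurable)
    show "((\<lambda>s. x s \<omega>) \<longlongrightarrow> x s \<omega>) (at_right s)" if "s \<in> {0..<T}" "\<omega> \<in> space Pr" for s \<omega>
      using x_cadlag[OF that(2)] that by (auto simp: cadlag_on_def)
  qed (use T_pos F_measurable_Pr x_adapted in auto)
  moreover have "(\<lambda>(s, \<omega>). indicator {0..T} s *\<^sub>R x s \<omega>) = (\<lambda>z. xT (fst z) (snd z))"
    by (auto simp: fun_eq_iff xT_def)
  ultimately show ?thesis by simp
qed

lemma uT_meas [measurable]: "joint uT"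
proof -
  have "jointly_measurable Pr T u" using u_L2 by (simp add: L2_controls_def)
  then have "(\<lambda>(s, \<omega>). indicator {0..T} s *\<^sub>R u s \<omega>) \<in> borel_measurable (borel \<Otimes>\<^sub>M Pr)"
    by (simp add: jointly_measurable_iff[OF prob_space_axioms])
  moreover have "(\<lambda>(s, \<omega>). indicator {0..T} s *\<^sub>R u s \<omega>) = (\<lambda>z. uT (fst z) (snd z))"
    by (auto simp: fun_eq_iff uT_def)
  ultimately show ?thesis by simp
qed

lemma uT_int: "Lintegrable T (\<lambda>s \<omega>. (norm (uT s \<omega>))\<^sup>2)"
proof -
  have "time_integrable Pr T (\<lambda>s \<omega>. (norm (u s \<omega>))\<^sup>2)" using u_L2 by (simp add: L2_controls_def)
  then have "integrable Lam (\<lambda>(s, \<omega>). indicator {0..T} s * (norm (u s \<omega>))\<^sup>2)"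
    by (simp add: time_integrable_iff[OF prob_space_axioms])
  moreover have "(\<lambda>(s, \<omega>). indicator {0..T} s * (norm (u s \<omega>))\<^sup>2) = (\<lambda>z. indicator {0..T} (fst z) * (norm (uT (fst z) (snd z)))\<^sup>2)"
    by (auto simp: fun_eq_iff uT_def)
  ultimately show ?thesis by simp
qed

lemma bT_eq: "s \<in> {0..T} \<Longrightarrow> bT s \<omega> = A *v xT s \<omega> + B *v uT s \<omega> + f (xT s \<omega>)"
  by (simp add: bT_def xT_def uT_def)

lemma bT_meas [measurable]: "joint bT"
proof -
  have "joint (\<lambda>s \<omega>. if s \<in> {0..T} then A *v xT s \<omega> + B *v uT s \<omega> + f (xT s \<omega>) else 0)" by measurable
  also have "(\<lambda>z. if fst z \<in> {0..T} then A *v xT (fst z) (snd z) + B *v uT (fst z) (snd z) + f (xT (fst z) (snd z)) else 0)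
     = (\<lambda>z. bT (fst z) (snd z))" by (auto simp: fun_eq_iff bT_def xT_def uT_def)
  finally show ?thesis .
qed

section \<open>The clock\<close>

lemma rate_meas [measurable]: "joint rate"
  unfolding rate_def by measurable

lemma rate_ge: "1 \<le> rate s \<omega>" "(norm (xT s \<omega>))\<^sup>2 \<le> rate s \<omega>" "(norm (f (xT s \<omega>)))\<^sup>2 \<le> rate s \<omega>"
  by (auto simp: rate_def)

text \<open>A cadlag path is bounded on the horizon, and the continuous \<open>f\<close> is bounded
  on the corresponding closed ball. The bound depends on the path.\<close>

lemma rate_bounded:
  assumes w: "\<omega> \<in> space Pr"
  obtains C where "0 \<le> C" "\<And>s. rate s \<omega> \<le> C"
proof -
  obtain C1 where C1: "\<And>s. s \<in> {0..T} \<Longrightarrow> norm (x s \<omega>) \<le> C1"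
    using cadlag_on_bounded[OF x_cadlag[OF w]] unfolding bounded_iff by blast
  have C1': "norm (xT s \<omega>) \<le> max 0 C1" for s using C1[of s] by (auto simp: xT_def le_max_iff_disj)
  have "compact (f ` cball 0 (max 0 C1))"
    by (intro compact_continuous_image continuous_on_subset[OF f_continuous]) auto
  from compact_imp_bounded[OF this, unfolded bounded_iff]
  obtain C2 where C2': "\<forall>y\<in>f ` cball 0 (max 0 C1). norm y \<le> C2" ..
  have C2: "norm (f v) \<le> C2" if "v \<in> cball 0 (max 0 C1)" for v
    using C2' that by blast
  have "rate s \<omega> \<le> 1 + (max 0 C1)\<^sup>2 + C2\<^sup>2" for s
    unfolding rate_def using C1'[of s] C2[of "xT s \<omega>"] by (intro add_mono power_mono) auto
  then show thesis by (intro that[of "1 + (max 0 C1)\<^sup>2 + C2\<^sup>2"]) auto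
qed

lemma rate_integrable:
  assumes w: "\<omega> \<in> space Pr" and I: "I \<in> sets borel" "bounded I"
  shows "set_integrable lborel I (\<lambda>s. rate s \<omega>)"
proof -
  obtain C where C: "\<And>s. rate s \<omega> \<le> C" using rate_bounded[OF w] by metis
  note [measurable] = slice_measurable[OF rate_meas w] I(1)
  show ?thesis
    unfolding set_integrable_def
  proof (rule Bochner_Integration.integrable_bound)
    have "emeasure lborel I < \<infinity>" using I(2) by (rule emeasure_bounded_finite)
    then show "integrable lborel (\<lambda>s. C * indicator I s)"
      by (intro integrable_mult_right integrable_real_indicator) auto
    show "AE s in lborel. norm (indicator I s *\<^sub>R rate s \<omega>) \<le> norm (C * indicator I s)"
      using C rate_ge(1) by (intro AE_I2) (auto split: split_indicator intro: order_trans order_trans[OF _ abs_ge_self] simp: abs_of_nonneg[OF order_trans[OF zero_le_one rate_ge(1)]])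
  qed measurable
qed

lemma clk_diff:
  assumes w: "\<omega> \<in> space Pr" and st: "0 \<le> s" "s \<le> t"
  shows "clk t \<omega> - clk s \<omega> = (LINT r:{s<..t}|lborel. rate r \<omega>)"
proof -
  have "(LINT r:{0..s} \<union> {s<..t}|lborel. rate r \<omega>) = (LINT r:{0..s}|lborel. rate r \<omega>) + (LINT r:{s<..t}|lborel. rate r \<omega>)"
    by (intro set_integral_Un rate_integrable w) auto
  moreover have "{0..s} \<union> {s<..t} = {0..t}" using st by auto
  ultimately show ?thesis by (simp add: clk_def)
qed

lemma clk_diff_ge:
  assumes w: "\<omega> \<in> space Pr" and st: "0 \<le> s" "s \<le> t"
  shows "t - s \<le> clk t \<omega> - clk s \<omega>"
proof -
  have "(LINT r:{s<..t}|lborel. 1) \<le> (LINT r:{s<..t}|lborel. rate r \<omega>)"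
    using st by (intro set_integral_mono rate_integrable w rate_ge) (auto simp: set_integrable_def)
  then show ?thesis using st by (simp add: clk_diff[OF w st] set_lebesgue_integral_def)
qed

lemma clk_diff_le:
  assumes w: "\<omega> \<in> space Pr" and st: "0 \<le> s" "s \<le> t" and C: "\<And>s. rate s \<omega> \<le> C"
  shows "clk t \<omega> - clk s \<omega> \<le> C * (t - s)"
proof -
  have "(LINT r:{s<..t}|lborel. rate r \<omega>) \<le> (LINT r:{s<..t}|lborel. C)"
    using st C by (intro set_integral_mono rate_integrable w) (auto simp: set_integrable_def)
  then show ?thesis using st by (simp add: clk_diff[OF w st] set_lebesgue_integral_def mult.commute)
qed

lemma clk_continuous:
  assumes w: "\<omega> \<in> space Pr"
  shows "continuous_on {0..T} (\<lambda>s. clk s \<omega>)"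
proof -
  obtain C where C: "0 \<le> C" "\<And>s. rate s \<omega> \<le> C" using rate_bounded[OF w] by metis
  have "lipschitz_on C {0..T} (\<lambda>s. clk s \<omega>)"
  proof (rule lipschitz_onI[OF _ C(1)])
    have le: "dist (clk s \<omega>) (clk t \<omega>) \<le> C * dist s t" if "0 \<le> s" "s \<le> t" for s t
      using clk_diff_ge[OF w that] clk_diff_le[OF w that C(2)] that by (simp add: dist_real_def)
    fix s t assume "s \<in> {0..T}" "t \<in> {0..T}"
    then show "dist (clk s \<omega>) (clk t \<omega>) \<le> C * dist s t"
      using le[of s t] le[of t s] by (cases "s \<le> t") (auto simp: dist_commute)
  qed
  then show ?thesis by (rule lipschitz_on_continuous_on)
qed

lemma clk_mono: "\<omega> \<in> space Pr \<Longrightarrow> 0 \<le> s \<Longrightarrow> s \<le> t \<Longrightarrow> clk s \<omega> \<le> clk t \<omega>"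
  using clk_diff_ge[of \<omega> s t] by simp

lemma clk_meas [measurable]: "joint clk"
  unfolding clk_def by (rule indefinite_integral_joint[OF rate_meas])

text \<open>The state is first multiplied by the indicator of \<open>[0,t]\<close>, the version
  known to be measurable for \<open>F t\<close>; integrating out time stays within this
  sigma-algebra.\<close>

lemma clk_adapted:
  assumes t: "t \<in> {0..T}"
  shows "clk t \<in> borel_measurable (F t)"
proof -
  have m: "(\<lambda>z. indicator {0..t} (fst z) *\<^sub>R x (fst z) (snd z)) \<in> borel_measurable (borel \<Otimes>\<^sub>M F t)"
    using x_meas_upto[OF t] by (simp add: split_beta')
  have sw: "(\<lambda>p. (snd p, fst p)) \<in> F t \<Otimes>\<^sub>M lborel \<rightarrow>\<^sub>M borel \<Otimes>\<^sub>M F t" by measurable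
  have [measurable]: "(\<lambda>p. indicator {0..t} (snd p) *\<^sub>R x (snd p) (fst p)) \<in> borel_measurable (F t \<Otimes>\<^sub>M lborel)"
    using measurable_compose[OF sw m] by simp
  have "(\<lambda>p. indicator {0..t} (snd p) *\<^sub>R (1 + (norm (indicator {0..t} (snd p) *\<^sub>R x (snd p) (fst p)))\<^sup>2 + (norm (f (indicator {0..t} (snd p) *\<^sub>R x (snd p) (fst p))))\<^sup>2))
     \<in> borel_measurable (F t \<Otimes>\<^sub>M lborel)" by measurable
  then have "(\<lambda>\<omega>. LINT s|lborel. indicator {0..t} s *\<^sub>R (1 + (norm (indicator {0..t} s *\<^sub>R x s \<omega>))\<^sup>2 + (norm (f (indicator {0..t} s *\<^sub>R x s \<omega>)))\<^sup>2))
     \<in> borel_measurable (F t)"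
    by (intro lborel.borel_measurable_lebesgue_integral) (simp add: split_beta')
  also have "(\<lambda>\<omega>. LINT s|lborel. indicator {0..t} s *\<^sub>R (1 + (norm (indicator {0..t} s *\<^sub>R x s \<omega>))\<^sup>2 + (norm (f (indicator {0..t} s *\<^sub>R x s \<omega>)))\<^sup>2)) = clk t"
    unfolding clk_def set_lebesgue_integral_def rate_def xT_def
    by (intro ext Bochner_Integration.integral_cong refl) (use t in \<open>auto split: split_indicator\<close>)
  finally show ?thesis .
qed

lemma clk_energy:
  assumes w: "\<omega> \<in> space Pr" and R: "0 < R"
  shows "(LINT s:{0..T}|lborel. (if clk s \<omega> < R then rate s \<omega> else 0)) \<le> R"
proof -
  have T0: "0 \<le> T" using T_pos by simp
  have c0: "clk 0 \<omega> \<le> R"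
  proof -
    obtain C where C: "\<And>s. rate s \<omega> \<le> C" using rate_bounded[OF w] by metis
    have "clk 0 \<omega> = (LINT s|lborel. indicator {0} s *\<^sub>R rate s \<omega>)" by (simp add: clk_def set_lebesgue_integral_def)
    also have "\<dots> = (LINT s::real|lborel. 0)"
      by (rule integral_cong_AE) (use AE_lborel_singleton[of 0] slice_measurable[OF rate_meas w] in \<open>auto elim!: eventually_mono\<close>)
    finally show ?thesis using R by simp
  qed
  \<comment> \<open>The time at which the clock reaches \<open>R\<close>, or \<open>T\<close> if it
    never exceeds \<open>R\<close>. After \<open>\<sigma>\<close> the integrand vanishes, and up to
    \<open>\<sigma>\<close> the rate integrates to at most \<open>R\<close>.\<close>
  obtain \<sigma> where s: "\<sigma> \<in> {0..T}" "clk \<sigma> \<omega> \<le> R" "\<And>s. s \<in> {0..T} \<Longrightarrow> clk s \<omega> < R \<Longrightarrow> s \<le> \<sigma>"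
  proof (cases "clk T \<omega> \<le> R")
    case True
    then show thesis using that[of T] T0 by auto
  next
    case False
    then obtain \<sigma> where s: "0 \<le> \<sigma>" "\<sigma> \<le> T" "clk \<sigma> \<omega> = R"
      using IVT'[of "\<lambda>s. clk s \<omega>" 0 R T] c0 T0 clk_continuous[OF w] by auto
    have "s \<le> \<sigma>" if "s \<in> {0..T}" "clk s \<omega> < R" for s
      using clk_mono[OF w s(1), of s] s(3) that by (cases "s \<le> \<sigma>") auto
    then show thesis using that[of \<sigma>] s by auto
  qed
  have "(LINT s:{0..T}|lborel. (if clk s \<omega> < R then rate s \<omega> else 0)) \<le> clk \<sigma> \<omega>"
    unfolding clk_def[of \<sigma>] set_lebesgue_integral_def
  proof (rule integral_mono')
    show "integrable lborel (\<lambda>s. indicator {0..\<sigma>} s *\<^sub>R rate s \<omega>)"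
      using rate_integrable[OF w, of "{0..\<sigma>}"] by (simp add: set_integrable_def)
    fix r show "indicator {0..T} r *\<^sub>R (if clk r \<omega> < R then rate r \<omega> else 0) \<le> indicator {0..\<sigma>} r *\<^sub>R rate r \<omega>"
      using s(3)[of r] order_trans[OF zero_le_one rate_ge(1), of r \<omega>] by (auto split: split_indicator)
    show "0 \<le> indicator {0..\<sigma>} r *\<^sub>R rate r \<omega>"
      using order_trans[OF zero_le_one rate_ge(1), of r \<omega>] by (auto split: split_indicator)
  qed
  then show ?thesis using s(2) by simp
qed

lemma path_integrable_le_rate:
  assumes w: "\<omega> \<in> space Pr" and g: "(\<lambda>s. g s) \<in> borel_measurable borel" "\<And>s. 0 \<le> g s" "\<And>s. g s \<le> k * rate s \<omega>"
  shows "set_integrable lborel {0..t} g"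
proof (rule set_integrable_bound)
  show "set_integrable lborel {0..t} (\<lambda>s. k * rate s \<omega>)" by (intro set_integrable_mult_right rate_integrable[OF w]) auto
  show "set_borel_measurable lborel {0..t} g" unfolding set_borel_measurable_def using g(1) by measurable
  show "AE s in lborel. s \<in> {0..t} \<longrightarrow> norm (g s) \<le> norm (k * rate s \<omega>)"
    using g(2,3) by (intro AE_I2) (auto intro: order_trans[OF _ abs_ge_self])
qed

text \<open>Before the clock reaches \<open>R\<close> the rate integrates to at most
  \<open>R\<close> on every path, so anything dominated by a multiple of the rate inherits a
  deterministic bound.\<close>

lemma clk_cut_integrable:
  fixes g :: "real \<Rightarrow> 'a \<Rightarrow> real"
  assumes [measurable]: "joint g"
    and g: "\<And>s \<omega>. 0 \<le> g s \<omega>" "\<And>s \<omega>. g s \<omega> \<le> k * rate s \<omega>" and k: "0 \<le> k" and R: "0 < R"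
  shows "\<omega> \<in> space Pr \<Longrightarrow> (LINT s:{0..T}|lborel. (if clk s \<omega> < R then g s \<omega> else 0)) \<le> k * R"
    and "Lintegrable T (\<lambda>s \<omega>. if clk s \<omega> < R then g s \<omega> else 0)"
proof -
  have int: "set_integrable lborel {0..T} (\<lambda>s. (if clk s \<omega> < R then h s \<omega> else 0))"
    if w: "\<omega> \<in> space Pr" and [measurable]: "joint h"
     and h: "\<And>s. 0 \<le> h s \<omega>" "\<And>s. h s \<omega> \<le> k' * rate s \<omega>" for \<omega> k' and h :: "real \<Rightarrow> 'a \<Rightarrow> real"
  proof (rule path_integrable_le_rate[OF w, of _ k'])
    note [measurable] = slice_measurable[OF that(2) w] slice_measurable[OF clk_meas w]
    show "(\<lambda>s. if clk s \<omega> < R then h s \<omega> else 0) \<in> borel_measurable borel" by measurable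
    have "0 \<le> k' * rate s \<omega>" for s using h[of s] by linarith
    then show "(if clk s \<omega> < R then h s \<omega> else 0) \<le> k' * rate s \<omega>" for s using h[of s] by auto
  qed (use h in auto)
  show le: "(LINT s:{0..T}|lborel. (if clk s \<omega> < R then g s \<omega> else 0)) \<le> k * R" if w: "\<omega> \<in> space Pr" for \<omega>
  proof -
    have ri: "set_integrable lborel {0..T} (\<lambda>s. if clk s \<omega> < R then rate s \<omega> else 0)"
      by (rule int[OF w rate_meas, of 1]) (use order_trans[OF zero_le_one rate_ge(1)] in auto)
    have "(LINT s:{0..T}|lborel. (if clk s \<omega> < R then g s \<omega> else 0)) \<le> (LINT s:{0..T}|lborel. k * (if clk s \<omega> < R then rate s \<omega> else 0))"
      by (rule set_integral_mono[OF int[OF w assms(1) g] set_integrable_mult_right[OF ri]]) (use g in auto)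
    also have "\<dots> = k * (LINT s:{0..T}|lborel. (if clk s \<omega> < R then rate s \<omega> else 0))" by (rule set_integral_mult_right)
    also have "\<dots> \<le> k * R" by (rule mult_left_mono[OF clk_energy[OF w R] k])
    finally show ?thesis .
  qed
  show "Lintegrable T (\<lambda>s \<omega>. if clk s \<omega> < R then g s \<omega> else 0)"
    by (rule time_prob_integrable[where g="\<lambda>s \<omega>. if clk s \<omega> < R then g s \<omega> else 0" and C="k * R"])
       (use g le int[OF _ assms(1) g] in \<open>auto\<close>)
qed

end

text \<open>Allows the state in place of its left limit under time integrals, since countable sets
  of times are null.\<close>

lemma left_lim_eq_countable:
  fixes X :: "real \<Rightarrow> 'a \<Rightarrow> real^'n"
  assumes "cadlag_on T (\<lambda>t. X t \<omega>)"
  shows "countable {t \<in> {0..T}. left_lim X t \<omega> \<noteq> X t \<omega>}"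
proof (rule countable_subset[OF _ countable_left_jumps[of "\<lambda>t. X t \<omega>"]])
  show "{t \<in> {0..T}. left_lim X t \<omega> \<noteq> X t \<omega>} \<subseteq> {t. \<exists>l. ((\<lambda>s. X s \<omega>) \<longlongrightarrow> l) (at_left t) \<and> l \<noteq> X t \<omega>}"
  proof (safe)
    fix t assume t: "t \<in> {0..T}" and ne: "left_lim X t \<omega> \<noteq> X t \<omega>"
    then have "0 < t" by (cases "t = 0") (auto simp: left_lim_def)
    with t obtain l where l: "((\<lambda>s. X s \<omega>) \<longlongrightarrow> l) (at_left t)"
      using assms unfolding cadlag_on_def by force
    then have "Lim (at_left t) (\<lambda>s. X s \<omega>) = l" by (intro tendsto_Lim) auto
    then have "l \<noteq> X t \<omega>" using ne \<open>0 < t\<close> by (simp add: left_lim_def)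
    with l show "\<exists>l. ((\<lambda>s. X s \<omega>) \<longlongrightarrow> l) (at_left t) \<and> l \<noteq> X t \<omega>" by blast
  qed
qed

lemma matrix_family_norm_le:
  fixes N :: "'d::finite \<Rightarrow> real^'n^'m"
  obtains k where "0 \<le> k" "\<And>i v. norm (N i *v v) \<le> k * norm v"
proof -
  have "\<exists>c. 0 \<le> c \<and> (\<forall>v. norm (N i *v v) \<le> c * norm v)" for i using matrix_vector_norm_le[of "N i"] by metis
  then obtain c where c: "\<And>i. 0 \<le> c i" "\<And>i v. norm (N i *v v) \<le> c i * norm v" by metis
  have "c i \<le> sum c UNIV" for i using c(1) by (intro member_le_sum) auto
  then have "norm (N i *v v) \<le> sum c UNIV * norm v" for i v
    by (intro order_trans[OF c(2)] mult_right_mono) auto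
  then show thesis using that[of "sum c UNIV"] c(1) by (simp add: sum_nonneg)
qed

section \<open>Second moments and energy inequalities for the state\<close>

context controlled_system
begin

text \<open>The generator of the state equation applied to the quadratic form of \<open>X\<close>.\<close>

definition gen :: "real^'n^'n \<Rightarrow> real \<Rightarrow> 'a \<Rightarrow> real" where
  "gen X s \<omega> = 2 * (bT s \<omega> \<bullet> (X *v xT s \<omega>)) +
     (\<Sum>i\<in>UNIV. \<Sum>j\<in>UNIV. K $ i $ j * ((N i *v xT s \<omega>) \<bullet> (X *v (N j *v xT s \<omega>))))"

lemma xT_adapted: "s \<in> {0..T} \<Longrightarrow> xT s \<in> borel_measurable (F s)"
  using x_adapted by (simp add: xT_def[abs_def])

lemma bT_adapted: "s \<in> {0..T} \<Longrightarrow> bT s \<in> borel_measurable (F s)"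
proof -
  assume s: "s \<in> {0..T}"
  note [measurable] = x_adapted[OF s] u_adapted[OF s]
  have "(\<lambda>\<omega>. A *v x s \<omega> + B *v u s \<omega> + f (x s \<omega>)) \<in> borel_measurable (F s)" by measurable
  then show ?thesis using s by (simp add: bT_def[abs_def])
qed

text \<open>The state-dependent parts of the drift are dominated by the rate and handled by the
  clock; the control part is integrable over the product because \<open>u\<close> lies in
  \<open>L2_controls\<close>.\<close>

lemma bT_cut_integrable:
  assumes R: "0 < R"
  shows "Lintegrable T (\<lambda>s \<omega>. if clk s \<omega> < R then (norm (bT s \<omega>))\<^sup>2 else 0)"
proof -
  obtain kA where kA: "0 \<le> kA" "\<And>v. norm (A *v v) \<le> kA * norm v" using matrix_vector_norm_le[of A] by metis
  obtain kB where kB: "0 \<le> kB" "\<And>v. norm (B *v v) \<le> kB * norm v" using matrix_vector_norm_le[of B] by metis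
  have le: "(norm (bT s \<omega>))\<^sup>2 \<le> (4 * kA\<^sup>2 + 2) * rate s \<omega> + 4 * kB\<^sup>2 * (norm (uT s \<omega>))\<^sup>2" if "s \<in> {0..T}" for s \<omega>
  proof -
    have "(norm (bT s \<omega>))\<^sup>2 \<le> 2 * (2 * (norm (A *v xT s \<omega>))\<^sup>2 + 2 * (norm (B *v uT s \<omega>))\<^sup>2) + 2 * (norm (f (xT s \<omega>)))\<^sup>2"
      unfolding bT_eq[OF that]
      by (rule order_trans[OF norm_add_sq_le]) (intro add_mono mult_left_mono norm_add_sq_le; simp)
    also have "\<dots> \<le> 2 * (2 * (kA * norm (xT s \<omega>))\<^sup>2 + 2 * (kB * norm (uT s \<omega>))\<^sup>2) + 2 * (norm (f (xT s \<omega>)))\<^sup>2"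
      by (intro add_mono mult_left_mono power_mono kA kB order_refl) auto
    also have "\<dots> = 4 * kA\<^sup>2 * (norm (xT s \<omega>))\<^sup>2 + 2 * (norm (f (xT s \<omega>)))\<^sup>2 + 4 * kB\<^sup>2 * (norm (uT s \<omega>))\<^sup>2"
      by (simp add: power_mult_distrib)
    also have "\<dots> \<le> 4 * kA\<^sup>2 * rate s \<omega> + 2 * rate s \<omega> + 4 * kB\<^sup>2 * (norm (uT s \<omega>))\<^sup>2"
      by (intro add_mono mult_left_mono rate_ge order_refl) auto
    finally show ?thesis by (simp add: distrib_right)
  qed
  have ri: "Lintegrable T (\<lambda>s \<omega>. if clk s \<omega> < R then rate s \<omega> else 0)"
    by (rule clk_cut_integrable(2)[OF rate_meas _ _ _ R, of 1]) (use order_trans[OF zero_le_one rate_ge(1)] in auto)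
  have [measurable]: "(\<lambda>z. bT (fst z) (snd z)) \<in> borel_measurable Lam" "(\<lambda>z. clk (fst z) (snd z)) \<in> borel_measurable Lam"
    by (rule Lam_measurable[OF bT_meas] Lam_measurable[OF clk_meas])+
  show ?thesis
  proof (rule Bochner_Integration.integrable_bound)
    show "integrable Lam (\<lambda>z. (4 * kA\<^sup>2 + 2) * (indicator {0..T} (fst z) * (if clk (fst z) (snd z) < R then rate (fst z) (snd z) else 0))
       + 4 * kB\<^sup>2 * (indicator {0..T} (fst z) * (norm (uT (fst z) (snd z)))\<^sup>2))"
      by (intro Bochner_Integration.integrable_add integrable_mult_right ri uT_int)
    show "(\<lambda>z. indicator {0..T} (fst z) * (if clk (fst z) (snd z) < R then (norm (bT (fst z) (snd z)))\<^sup>2 else 0)) \<in> borel_measurable Lam"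
      by measurable
    show "AE z in Lam. norm (indicator {0..T} (fst z) * (if clk (fst z) (snd z) < R then (norm (bT (fst z) (snd z)))\<^sup>2 else 0)) \<le>
       norm ((4 * kA\<^sup>2 + 2) * (indicator {0..T} (fst z) * (if clk (fst z) (snd z) < R then rate (fst z) (snd z) else 0))
       + 4 * kB\<^sup>2 * (indicator {0..T} (fst z) * (norm (uT (fst z) (snd z)))\<^sup>2))"
    proof (rule AE_I2)
      fix z :: "real \<times> 'a"
      show "norm (indicator {0..T} (fst z) * (if clk (fst z) (snd z) < R then (norm (bT (fst z) (snd z)))\<^sup>2 else 0)) \<le>
       norm ((4 * kA\<^sup>2 + 2) * (indicator {0..T} (fst z) * (if clk (fst z) (snd z) < R then rate (fst z) (snd z) else 0))
       + 4 * kB\<^sup>2 * (indicator {0..T} (fst z) * (norm (uT (fst z) (snd z)))\<^sup>2))"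
      proof (cases "fst z \<in> {0..T} \<and> clk (fst z) (snd z) < R")
        case True
        then show ?thesis using le[of "fst z" "snd z"] by (auto intro: order_trans[OF _ abs_ge_self])
      qed auto
    qed
  qed
qed

text \<open>The link between the state equation and the Ito inequality: all estimates below start
  from here and remove the level \<open>R\<close> afterwards.\<close>

lemma localized_inequality:
  fixes X :: "real^'n^'n"
  assumes R: "0 < R" and X: "\<And>v w. v \<bullet> (X *v w) = w \<bullet> (X *v v)" "\<And>v. 0 \<le> v \<bullet> (X *v v)" and t: "t \<in> {0..T}"
  shows "sqint Pr (\<lambda>\<omega>. if clk t \<omega> < R then xT t \<omega> else 0)"
    "Lintegrable t (\<lambda>s \<omega>. if clk s \<omega> < R then gen X s \<omega> else 0)"
    "(\<integral>\<omega>. (if clk t \<omega> < R then xT t \<omega> \<bullet> (X *v xT t \<omega>) else 0) \<partial>Pr) \<le>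
      (Lint t (\<lambda>s \<omega>. if clk s \<omega> < R then gen X s \<omega> else 0))"
proof -
  obtain J where J: "\<And>i. has_ito_integral Pr T F (\<lambda>t \<omega>. M t \<omega> $ i) (\<lambda>s \<omega>. N i *v left_lim x s \<omega>) (J i)"
    and x_eq: "AE \<omega> in Pr. \<forall>t\<in>{0..T}. x t \<omega> = (LINT s:{0..t}|lborel. A *v x s \<omega> + B *v u s \<omega> + f (x s \<omega>)) + (\<Sum>i\<in>UNIV. J i t \<omega>)"
    using x_sol unfolding state_solution_def by blast
  define ap where "ap i m \<tau> \<xi> \<longleftrightarrow> (\<forall>n. simple_data Pr T F (m n) (\<tau> n) (\<xi> n)) \<and>
        converges_in_prob Pr
          (\<lambda>n \<omega>. LINT s:{0..T}|lborel. (norm (simple_process (m n) (\<tau> n) (\<xi> n) s \<omega> - N i *v left_lim x s \<omega>))\<^sup>2)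
          (\<lambda>\<omega>. 0) \<and>
        (\<forall>t\<in>{0..T}. converges_in_prob Pr
          (\<lambda>n. simple_integral (m n) (\<tau> n) (\<xi> n) (\<lambda>t \<omega>. M t \<omega> $ i) t) (J i t))" for i and m :: "nat \<Rightarrow> nat" and \<tau> :: "nat \<Rightarrow> nat \<Rightarrow> real" and \<xi>
  have "\<exists>m \<tau> \<xi>. ap i m \<tau> \<xi>" for i using J[of i] unfolding has_ito_integral_def ap_def by blast
  then obtain m \<tau> \<xi> where ap: "\<And>i. ap i (m i) (\<tau> i) (\<xi> i)" by metis
  obtain kN where kN: "0 \<le> kN" "\<And>i v. norm (N i *v v) \<le> kN * norm v" using matrix_family_norm_le[of N] by metis
  have NY: "(norm (N i *v xT s \<omega>))\<^sup>2 \<le> kN\<^sup>2 * rate s \<omega>" for i s \<omega>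
  proof -
    have "(norm (N i *v xT s \<omega>))\<^sup>2 \<le> kN\<^sup>2 * (norm (xT s \<omega>))\<^sup>2"
      unfolding power_mult_distrib[symmetric] by (intro power_mono kN) auto
    also have "\<dots> \<le> kN\<^sup>2 * rate s \<omega>" by (intro mult_left_mono rate_ge) auto
    finally show ?thesis .
  qed
  \<comment> \<open>\<open>kN\<^sup>2 * R\<close> bounds the energy of
    \<open>N i *v xT s \<omega>\<close> while the clock is below \<open>R\<close>, as its square is
    at most \<open>kN\<^sup>2\<close> times the rate. One \<open>kN\<close> serves all components,
    so they can share the bound.\<close>
  have cut: "ito_cut Pr T F M K i (\<lambda>s \<omega>. N i *v xT s \<omega>) (J i) (m i) (\<tau> i) (\<xi> i) clk R (kN\<^sup>2 * R)" for i
  proof (intro ito_cut.intro[OF levy_driven_axioms] ito_cut_axioms.intro)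
    show NM: "joint (\<lambda>s \<omega>. N i *v xT s \<omega>)" by measurable
    show "set_integrable lborel {0..T} (\<lambda>s. (norm (N i *v xT s \<omega>))\<^sup>2)" if w: "\<omega> \<in> space Pr" for \<omega>
    proof (rule path_integrable_le_rate[OF w _ _ NY])
      note [measurable] = slice_measurable[OF NM w]
      show "(\<lambda>s. (norm (N i *v xT s \<omega>))\<^sup>2) \<in> borel_measurable borel" by measurable
    qed auto
    show "simple_data Pr T F (m i n) (\<tau> i n) (\<xi> i n)" for n using ap[of i] by (simp add: ap_def)
    \<comment> \<open>Left limits are exchanged for values here, which alters the integrand at
      countably many times only.\<close>
    have "(LINT s:{0..T}|lborel. (norm (simple_process (m i n) (\<tau> i n) (\<xi> i n) s \<omega> - N i *v xT s \<omega>))\<^sup>2) =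
       (LINT s:{0..T}|lborel. (norm (simple_process (m i n) (\<tau> i n) (\<xi> i n) s \<omega> - N i *v left_lim x s \<omega>))\<^sup>2)" if "\<omega> \<in> space Pr" for n \<omega>
      unfolding set_lebesgue_integral_def
      by (rule integral_discrete_difference[OF left_lim_eq_countable[of T x, OF x_cadlag[OF that]]])
         (auto simp: xT_def split: split_indicator)
    then show "converges_in_prob Pr (\<lambda>n \<omega>. LINT s:{0..T}|lborel. (norm (simple_process (m i n) (\<tau> i n) (\<xi> i n) s \<omega> - N i *v xT s \<omega>))\<^sup>2) (\<lambda>\<omega>. 0)"
      using ap[of i] by (simp add: ap_def converges_in_prob_def cong: conj_cong)
    show "converges_in_prob Pr (\<lambda>n. simple_integral (m i n) (\<tau> i n) (\<xi> i n) (\<lambda>t \<omega>. M t \<omega> $ i) t) (J i t)" if "t \<in> {0..T}" for t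
      using ap[of i] that by (simp add: ap_def)
    show "J i t \<in> borel_measurable Pr" if "t \<in> {0..T}" for t
      using J[of i] that by (intro F_measurable_Pr[OF that]) (auto simp: has_ito_integral_def adapted_def)
    show "clk s \<in> borel_measurable (F s)" if "s \<in> {0..T}" for s by (rule clk_adapted[OF that])
    show "joint clk" by (rule clk_meas)
    show "clk s \<omega> < clk t \<omega>" if "0 \<le> s" "s < t" "t \<le> T" "\<omega> \<in> space Pr" for s t \<omega>
      using clk_diff_ge[OF that(4,1), of t] that by simp
    show "continuous_on {0..T} (\<lambda>s. clk s \<omega>)" if "\<omega> \<in> space Pr" for \<omega> by (rule clk_continuous[OF that])
    show "0 \<le> kN\<^sup>2 * R" using R by simp
    show "(LINT s:{0..T}|lborel. (if clk s \<omega> < R then (norm (N i *v xT s \<omega>))\<^sup>2 else 0)) \<le> kN\<^sup>2 * R" if "\<omega> \<in> space Pr" for \<omega>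
      by (rule clk_cut_integrable(1)[OF _ _ _ _ R that]) (use NY in auto)
  qed
  interpret S: ito_system Pr T F M K xT bT "\<lambda>i s \<omega>. N i *v xT s \<omega>" J m \<tau> \<xi> clk R "kN\<^sup>2 * R" X
  proof (intro ito_system.intro[OF levy_driven_axioms] ito_system_axioms.intro cut bT_meas xT_meas bT_adapted X)
    show "Lintegrable T (\<lambda>s \<omega>. if clk s \<omega> < R then (norm (bT s \<omega>))\<^sup>2 else 0)"
      by (rule bT_cut_integrable[OF R])
    show "Lintegrable T (\<lambda>s \<omega>. if clk s \<omega> < R then (norm (xT s \<omega>))\<^sup>2 else 0)"
      by (rule clk_cut_integrable(2)[OF _ _ _ _ R, of _ 1]) (use rate_ge in auto)
    show "AE \<omega> in Pr. \<forall>t\<in>{0..T}. xT t \<omega> = (LINT s:{0..t}|lborel. bT s \<omega>) + (\<Sum>i\<in>UNIV. J i t \<omega>)"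
      using x_eq
    proof eventually_elim
      case (elim \<omega>)
      show ?case
      proof
        fix t assume t: "t \<in> {0..T}"
        have "(LINT s:{0..t}|lborel. A *v x s \<omega> + B *v u s \<omega> + f (x s \<omega>)) = (LINT s:{0..t}|lborel. bT s \<omega>)"
          unfolding set_lebesgue_integral_def
          by (intro Bochner_Integration.integral_cong refl) (use t in \<open>auto simp: bT_def split: split_indicator\<close>)
        then show "xT t \<omega> = (LINT s:{0..t}|lborel. bT s \<omega>) + (\<Sum>i\<in>UNIV. J i t \<omega>)" using elim t by (simp add: xT_def)
      qed
    qed
  qed auto
  note ii = S.ito_inequality[OF t]
  show "sqint Pr (\<lambda>\<omega>. if clk t \<omega> < R then xT t \<omega> else 0)" using ii(1) by (simp add: S.xR_def[abs_def])
  have e1: "S.xR t \<omega> \<bullet> (X *v S.xR t \<omega>) = (if clk t \<omega> < R then xT t \<omega> \<bullet> (X *v xT t \<omega>) else 0)" for \<omega>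
    by (simp add: S.xR_def)
  have e2: "2 * (S.bR s \<omega> \<bullet> (X *v S.xR s \<omega>)) + (\<Sum>i\<in>UNIV. \<Sum>j\<in>UNIV. K $ i $ j * (S.YR i s \<omega> \<bullet> (X *v S.YR j s \<omega>)))
     = (if clk s \<omega> < R then gen X s \<omega> else 0)" for s \<omega>
    by (simp add: S.xR_def S.bR_def S.YR_def gen_def)
  show "(\<integral>\<omega>. (if clk t \<omega> < R then xT t \<omega> \<bullet> (X *v xT t \<omega>) else 0) \<partial>Pr) \<le>
      (Lint t (\<lambda>s \<omega>. if clk s \<omega> < R then gen X s \<omega> else 0))"
    using ii(2) unfolding e1 e2 .
  have "integrable Lam (\<lambda>z. 2 * (indicator {0..t} (fst z) * (S.bR (fst z) (snd z) \<bullet> (X *v S.xR (fst z) (snd z)))) +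
      (\<Sum>i\<in>UNIV. \<Sum>j\<in>UNIV. K $ i $ j * (indicator {0..t} (fst z) * (S.YR i (fst z) (snd z) \<bullet> (X *v S.YR j (fst z) (snd z))))))"
    by (intro Bochner_Integration.integrable_add Bochner_Integration.integrable_sum integrable_mult_right
       S.Lam_inner_integrable S.bR_sqint[OF t] S.xR_sqint[OF t] S.YR_sqint[OF t])
  moreover have "2 * (indicator {0..t} s * (S.bR s \<omega> \<bullet> (X *v S.xR s \<omega>))) +
      (\<Sum>i\<in>UNIV. \<Sum>j\<in>UNIV. K $ i $ j * (indicator {0..t} s * (S.YR i s \<omega> \<bullet> (X *v S.YR j s \<omega>)))) =
      indicator {0..t} s * (if clk s \<omega> < R then gen X s \<omega> else 0)" for s \<omega>
    unfolding e2[symmetric] by (auto split: split_indicator)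
  ultimately show "Lintegrable t (\<lambda>s \<omega>. if clk s \<omega> < R then gen X s \<omega> else 0)"
    by simp
qed

text \<open>For \<open>X = mat 1\<close> the nonlinearity enters only through its inner product with
  the state, which the one-sided growth condition controls even if \<open>f\<close> grows faster
  than linearly. The control term is split by Young's inequality. The absolute value of
  \<open>c_f\<close> keeps \<open>c0\<close> nonnegative, as Gronwall's inequality requires.\<close>

lemma gen_bound:
  obtains c0 k where "0 \<le> c0" "0 \<le> k" "\<And>s \<omega>. s \<in> {0..T} \<Longrightarrow> gen (mat 1) s \<omega> \<le> c0 * (norm (xT s \<omega>))\<^sup>2 + k * (norm (uT s \<omega>))\<^sup>2"
proof -
  obtain kA where kA: "0 \<le> kA" "\<And>v. norm (A *v v) \<le> kA * norm v" using matrix_vector_norm_le[of A] by metis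
  obtain kB where kB: "0 \<le> kB" "\<And>v. norm (B *v v) \<le> kB * norm v" using matrix_vector_norm_le[of B] by metis
  obtain kN where kN: "0 \<le> kN" "\<And>i v. norm (N i *v v) \<le> kN * norm v" using matrix_family_norm_le[of N] by metis
  define S where "S = (\<Sum>i\<in>UNIV. \<Sum>j\<in>UNIV. \<bar>K $ i $ j\<bar> * kN\<^sup>2)"
  have S0: "0 \<le> S" unfolding S_def by (intro sum_nonneg) auto
  have "gen (mat 1) s \<omega> \<le> (2 * kA + 1 + 2 * \<bar>c_f\<bar> + S) * (norm (xT s \<omega>))\<^sup>2 + kB\<^sup>2 * (norm (uT s \<omega>))\<^sup>2" if s: "s \<in> {0..T}" for s \<omega>
  proof -
    let ?x = "xT s \<omega>" and ?u = "uT s \<omega>"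
    have 1: "(A *v ?x) \<bullet> ?x \<le> kA * (norm ?x)\<^sup>2"
      using norm_cauchy_schwarz[of "A *v ?x" ?x] mult_right_mono[OF kA(2)[of ?x] norm_ge_zero[of ?x]]
      by (simp add: power2_eq_square mult.assoc)
    have 2: "2 * ((B *v ?u) \<bullet> ?x) \<le> (norm ?x)\<^sup>2 + kB\<^sup>2 * (norm ?u)\<^sup>2"
    proof -
      have "2 * ((B *v ?u) \<bullet> ?x) \<le> 2 * norm (B *v ?u) * norm ?x" using norm_cauchy_schwarz[of "B *v ?u" ?x] by simp
      also have "\<dots> \<le> (norm (B *v ?u))\<^sup>2 + (norm ?x)\<^sup>2" by (rule sum_squares_bound)
      also have "(norm (B *v ?u))\<^sup>2 \<le> (kB * norm ?u)\<^sup>2" by (intro power_mono kB) auto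
      finally show ?thesis by (simp add: power_mult_distrib)
    qed
    have "f ?x \<bullet> ?x \<le> c_f * (norm ?x)\<^sup>2" using f_growth by (simp add: inner_commute)
    also have "\<dots> \<le> \<bar>c_f\<bar> * (norm ?x)\<^sup>2" by (intro mult_right_mono) auto
    finally have 3: "f ?x \<bullet> ?x \<le> \<bar>c_f\<bar> * (norm ?x)\<^sup>2" .
    have 4: "(\<Sum>i\<in>UNIV. \<Sum>j\<in>UNIV. K $ i $ j * ((N i *v ?x) \<bullet> (N j *v ?x))) \<le> S * (norm ?x)\<^sup>2"
      unfolding S_def sum_distrib_right
    proof (intro sum_mono)
      fix i j
      have "K $ i $ j * ((N i *v ?x) \<bullet> (N j *v ?x)) \<le> \<bar>K $ i $ j\<bar> * \<bar>(N i *v ?x) \<bullet> (N j *v ?x)\<bar>"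
        by (metis abs_ge_self abs_mult)
      also have "\<dots> \<le> \<bar>K $ i $ j\<bar> * (norm (N i *v ?x) * norm (N j *v ?x))"
        by (intro mult_left_mono Cauchy_Schwarz_ineq2) auto
      also have "\<dots> \<le> \<bar>K $ i $ j\<bar> * ((kN * norm ?x) * (kN * norm ?x))"
        by (intro mult_left_mono mult_mono kN) (use kN(1) in auto)
      finally show "K $ i $ j * ((N i *v ?x) \<bullet> (N j *v ?x)) \<le> \<bar>K $ i $ j\<bar> * kN\<^sup>2 * (norm ?x)\<^sup>2"
        by (simp add: power2_eq_square mult_ac)
    qed
    have "gen (mat 1) s \<omega> = 2 * ((A *v ?x) \<bullet> ?x) + 2 * ((B *v ?u) \<bullet> ?x) + 2 * (f ?x \<bullet> ?x) +
        (\<Sum>i\<in>UNIV. \<Sum>j\<in>UNIV. K $ i $ j * ((N i *v ?x) \<bullet> (N j *v ?x)))"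
      by (simp add: gen_def bT_eq[OF s] inner_add_left)
    also have "\<dots> \<le> 2 * (kA * (norm ?x)\<^sup>2) + ((norm ?x)\<^sup>2 + kB\<^sup>2 * (norm ?u)\<^sup>2) + 2 * (\<bar>c_f\<bar> * (norm ?x)\<^sup>2) + S * (norm ?x)\<^sup>2"
      using 1 2 3 4 by linarith
    finally show ?thesis by (simp add: algebra_simps)
  qed
  then show thesis using that[of "2 * kA + 1 + 2 * \<bar>c_f\<bar> + S" "kB\<^sup>2"] kA(1) S0 by simp
qed

text \<open>On the clock event at level \<open>R\<close> the second moments are finite, so
  Gronwall's inequality applies to them; its constants come from \<open>gen_bound\<close> and do not
  depend on \<open>R\<close>. The events exhaust the space as \<open>R\<close> runs through the
  positive integers, and Fatou's lemma transfers the bound.\<close>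

lemma second_moments:
  obtains C where "\<And>t. t \<in> {0..T} \<Longrightarrow> sqint Pr (xT t)" "\<And>t. t \<in> {0..T} \<Longrightarrow> (\<integral>\<omega>. (norm (xT t \<omega>))\<^sup>2 \<partial>Pr) \<le> C"
proof -
  obtain c0 k where c0: "0 \<le> c0" "0 \<le> k" and gen: "\<And>s \<omega>. s \<in> {0..T} \<Longrightarrow> gen (mat 1) s \<omega> \<le> c0 * (norm (xT s \<omega>))\<^sup>2 + k * (norm (uT s \<omega>))\<^sup>2"
    using gen_bound by metis
  define U where "U s = k * (\<integral>\<omega>. (norm (uT s \<omega>))\<^sup>2 \<partial>Pr)" for s
  have Ui: "set_integrable lborel {0..T} U" unfolding U_def by (rule set_integrable_mult_right[OF Lam_time(2)[OF uT_int]])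
  have U0: "0 \<le> U s" for s unfolding U_def using c0 by simp
  \<comment> \<open>\<open>exp (c0 * T)\<close> dominates all Gronwall factors, so that one constant
    serves all times.\<close>
  define C where "C = (LINT s:{0..T}|lborel. exp (c0 * T) * U s)"
  have C0: "0 \<le> C" unfolding C_def set_lebesgue_integral_def
    by (rule integral_nonneg_AE) (use U0 in \<open>auto split: split_indicator\<close>)
  have loc: "(\<integral>\<omega>. (norm (if clk t \<omega> < R then xT t \<omega> else 0))\<^sup>2 \<partial>Pr) \<le> C" if R: "0 < R" and t: "t \<in> {0..T}" for R t
  proof -
    define g where "g s = (\<integral>\<omega>. (if clk s \<omega> < R then (norm (xT s \<omega>))\<^sup>2 else 0) \<partial>Pr)" for s
    have xi: "Lintegrable T (\<lambda>s \<omega>. if clk s \<omega> < R then (norm (xT s \<omega>))\<^sup>2 else 0)"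
      by (rule clk_cut_integrable(2)[OF _ _ _ _ R, of _ 1]) (use rate_ge in auto)
    have gi: "set_integrable lborel {0..T} g"
      unfolding g_def by (rule Lam_time(2)[OF xi])
    have "g t \<le> (LINT s:{0..t}|lborel. U s) + c0 * (LINT s:{0..t}|lborel. g s)" if t: "t \<in> {0..T}" for t
    proof -
      note xit = Lam_subinterval[OF xi t] and uit = Lam_subinterval[OF uT_int t]
      have "g t \<le> (Lint t (\<lambda>s \<omega>. if clk s \<omega> < R then gen (mat 1) s \<omega> else 0))"
      proof -
        have "v \<bullet> (mat 1 *v v) = (norm v)\<^sup>2" for v :: "real^'n" by (simp add: power2_norm_eq_inner)
        then show ?thesis
          using localized_inequality(3)[OF R _ _ t, of "mat 1"] by (simp only: g_def) (simp add: inner_commute)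
      qed
      also have "\<dots> \<le> (\<integral>z. c0 * (indicator {0..t} (fst z) * (if clk (fst z) (snd z) < R then (norm (xT (fst z) (snd z)))\<^sup>2 else 0))
           + k * (indicator {0..t} (fst z) * (norm (uT (fst z) (snd z)))\<^sup>2) \<partial>Lam)"
      proof (rule integral_mono)
        show "Lintegrable t (\<lambda>s \<omega>. if clk s \<omega> < R then gen (mat 1) s \<omega> else 0)"
          by (rule localized_inequality(2)[OF R _ _ t]) (auto simp: inner_commute)
        show "integrable Lam (\<lambda>z. c0 * (indicator {0..t} (fst z) * (if clk (fst z) (snd z) < R then (norm (xT (fst z) (snd z)))\<^sup>2 else 0))
           + k * (indicator {0..t} (fst z) * (norm (uT (fst z) (snd z)))\<^sup>2))"
          by (intro Bochner_Integration.integrable_add integrable_mult_right xit uit)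
        fix z :: "real \<times> 'a"
        show "indicator {0..t} (fst z) * (if clk (fst z) (snd z) < R then gen (mat 1) (fst z) (snd z) else 0) \<le>
           c0 * (indicator {0..t} (fst z) * (if clk (fst z) (snd z) < R then (norm (xT (fst z) (snd z)))\<^sup>2 else 0))
           + k * (indicator {0..t} (fst z) * (norm (uT (fst z) (snd z)))\<^sup>2)"
          using gen[of "fst z" "snd z"] t c0 by (auto split: split_indicator)
      qed
      also have "\<dots> = c0 * (LINT s:{0..t}|lborel. g s) + (LINT s:{0..t}|lborel. U s)"
        using xit uit Lam_time(1)[OF xit] Lam_time(1)[OF uit] by (simp add: U_def g_def)
      finally show ?thesis by simp
    qed
    from gronwall_integrable[OF c0(1) gi Ui this t]
    have "g t \<le> (LINT s:{0..t}|lborel. exp (c0 * (t - s)) * U s)" .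
    also have "\<dots> \<le> C"
      unfolding C_def set_lebesgue_integral_def
    proof (rule integral_mono')
      show "integrable lborel (\<lambda>s. indicator {0..T} s *\<^sub>R (exp (c0 * T) * U s))"
        using set_integrable_mult_right[OF Ui, of "exp (c0 * T)"] by (simp add: set_integrable_def)
      fix s
      show "indicator {0..t} s *\<^sub>R (exp (c0 * (t - s)) * U s) \<le> indicator {0..T} s *\<^sub>R (exp (c0 * T) * U s)"
        using U0[of s] t c0(1) by (auto split: split_indicator intro!: mult_right_mono mult_left_mono)
    qed (use U0 in \<open>auto split: split_indicator\<close>)
    finally show ?thesis by (simp add: g_def if_distrib[of norm] if_distrib[of "\<lambda>y. y\<^sup>2"] cong: if_cong)
  qed
  have nn: "(\<integral>\<^sup>+\<omega>. ennreal ((norm (xT t \<omega>))\<^sup>2) \<partial>Pr) \<le> ennreal C" if t: "t \<in> {0..T}" for t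
  proof -
    let ?h = "\<lambda>n \<omega>. ennreal ((norm (if clk t \<omega> < real (Suc n) then xT t \<omega> else 0))\<^sup>2)"
    note [measurable] = F_measurable_Pr[OF t clk_adapted[OF t]] F_measurable_Pr[OF t xT_adapted[OF t]]
    have "liminf (\<lambda>n. ?h n \<omega>) = ennreal ((norm (xT t \<omega>))\<^sup>2)" for \<omega>
    proof (intro lim_imp_Liminf tendsto_eventually)
      obtain n0 :: nat where n0: "clk t \<omega> < real n0" using reals_Archimedean2 by blast
      show "\<forall>\<^sub>F n in sequentially. ?h n \<omega> = ennreal ((norm (xT t \<omega>))\<^sup>2)"
        using eventually_ge_at_top[of n0] by eventually_elim (use n0 in auto)
    qed auto
    then have "(\<integral>\<^sup>+\<omega>. ennreal ((norm (xT t \<omega>))\<^sup>2) \<partial>Pr) = (\<integral>\<^sup>+\<omega>. liminf (\<lambda>n. ?h n \<omega>) \<partial>Pr)" by simp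
    also have "\<dots> \<le> liminf (\<lambda>n. \<integral>\<^sup>+\<omega>. ?h n \<omega> \<partial>Pr)" by (rule nn_integral_liminf) measurable
    also have "\<dots> \<le> ennreal C"
    proof (rule Liminf_le)
      show "\<forall>\<^sub>F n in sequentially. (\<integral>\<^sup>+\<omega>. ?h n \<omega> \<partial>Pr) \<le> ennreal C"
      proof (intro always_eventually allI)
        fix n
        have "sqint Pr (\<lambda>\<omega>. if clk t \<omega> < real (Suc n) then xT t \<omega> else 0)"
          by (rule localized_inequality(1)[OF _ _ _ t, of _ "mat 1"]) (auto simp: inner_commute)
        from nn_integral_eq_integral[OF sqint_integrable[OF this]] loc[of "real (Suc n)", OF _ t]
        show "(\<integral>\<^sup>+\<omega>. ?h n \<omega> \<partial>Pr) \<le> ennreal C" by (auto intro: ennreal_leI)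
      qed
    qed simp
    finally show ?thesis .
  qed
  have s: "sqint Pr (xT t)" if t: "t \<in> {0..T}" for t
  proof (rule sqintI)
    show m: "xT t \<in> borel_measurable Pr" by (rule F_measurable_Pr[OF t xT_adapted[OF t]])
    show "integrable Pr (\<lambda>\<omega>. (norm (xT t \<omega>))\<^sup>2)"
      by (rule integrableI_bounded) (use m le_less_trans[OF nn[OF t]] in auto)
  qed
  moreover have "(\<integral>\<omega>. (norm (xT t \<omega>))\<^sup>2 \<partial>Pr) \<le> C" if t: "t \<in> {0..T}" for t
  proof -
    have "ennreal (\<integral>\<omega>. (norm (xT t \<omega>))\<^sup>2 \<partial>Pr) \<le> ennreal C"
      using nn_integral_eq_integral[OF sqint_integrable[OF s[OF t]]] nn[OF t] by simp
    then show ?thesis using C0 by simp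
  qed
  ultimately show thesis using that by blast
qed

lemma xT_Lam_integrable: "Lintegrable T (\<lambda>s \<omega>. (norm (xT s \<omega>))\<^sup>2)"
proof (rule integrableI_bounded)
  obtain C where C: "\<And>t. t \<in> {0..T} \<Longrightarrow> sqint Pr (xT t)" "\<And>t. t \<in> {0..T} \<Longrightarrow> (\<integral>\<omega>. (norm (xT t \<omega>))\<^sup>2 \<partial>Pr) \<le> C"
    using second_moments by metis
  have [measurable]: "(\<lambda>z. xT (fst z) (snd z)) \<in> borel_measurable Lam"
    by (rule Lam_measurable[OF xT_meas])
  show "(\<lambda>z. indicator {0..T} (fst z) * (norm (xT (fst z) (snd z)))\<^sup>2) \<in> borel_measurable Lam" by measurable
  have "(\<integral>\<^sup>+z. ennreal (norm (indicator {0..T} (fst z) * (norm (xT (fst z) (snd z)))\<^sup>2)) \<partial>Lam)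
     = (\<integral>\<^sup>+s. (\<integral>\<^sup>+\<omega>. ennreal (norm (indicator {0..T} s * (norm (xT s \<omega>))\<^sup>2)) \<partial>Pr) \<partial>lborel)"
    by (subst nn_integral_fst[symmetric]) auto
  also have "\<dots> \<le> (\<integral>\<^sup>+s. ennreal C * indicator {0..T} s \<partial>lborel)"
  proof (rule nn_integral_mono)
    fix s :: real
    show "(\<integral>\<^sup>+\<omega>. ennreal (norm (indicator {0..T} s * (norm (xT s \<omega>))\<^sup>2)) \<partial>Pr) \<le> ennreal C * indicator {0..T} s"
    proof (cases "s \<in> {0..T}")
      case True
      then show ?thesis
        using nn_integral_eq_integral[OF sqint_integrable[OF C(1)[OF True]]] C(2)[OF True] by (auto intro: ennreal_leI)
    qed simp
  qed
  also have "\<dots> < \<infinity>" using T_pos by (simp add: nn_integral_cmult_indicator ennreal_mult_less_top)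
  finally show "(\<integral>\<^sup>+z. ennreal (norm (indicator {0..T} (fst z) * (norm (xT (fst z) (snd z)))\<^sup>2)) \<partial>Lam) < \<infinity>" .
qed

lemmas xT_Lam_sqint = Lam_sqintI[OF xT_meas xT_Lam_integrable]
lemmas uT_Lam_sqint = Lam_sqintI[OF uT_meas uT_int]

lemma Lam_bilinear_integrable:
  fixes V :: "real^'i^'l" and W :: "real^'j^'l"
  assumes "Lsqint t g" "Lsqint t h"
  shows "Lintegrable t (\<lambda>s \<omega>. (V *v g s \<omega>) \<bullet> (W *v h s \<omega>))"
proof -
  have "(V *v (indicator {0..t} s *\<^sub>R v)) \<bullet> (W *v (indicator {0..t} s *\<^sub>R w)) = indicator {0..t} s * ((V *v v) \<bullet> (W *v w))" for s :: real and v w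
    by (auto split: split_indicator)
  then show ?thesis
    using sqint_inner_integrable[OF sqint_matrix[OF assms(1), of V] sqint_matrix[OF assms(2), of W]] by simp
qed

lemma quadratic_xT_integrable:
  "t \<in> {0..T} \<Longrightarrow> Lintegrable t (\<lambda>s \<omega>. xT s \<omega> \<bullet> (X *v xT s \<omega>))"
  using Lam_bilinear_integrable[OF xT_Lam_sqint xT_Lam_sqint, of t "mat 1" X] by simp

text \<open>Second moments of state and control dominate every part of \<open>gen X\<close> except
  the one with \<open>f\<close>, whose integrability is therefore assumed in \<open>fi\<close>.
  Dominated convergence then removes the clock on both sides.\<close>

lemma energy_inequality:
  fixes X :: "real^'n^'n"
  assumes X: "\<And>v w. v \<bullet> (X *v w) = w \<bullet> (X *v v)" "\<And>v. 0 \<le> v \<bullet> (X *v v)" and t: "t \<in> {0..T}"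
    and fi: "Lintegrable t (\<lambda>s \<omega>. xT s \<omega> \<bullet> (X *v f (xT s \<omega>)))"
  shows "Lintegrable t (gen X)"
    "(\<integral>\<omega>. xT t \<omega> \<bullet> (X *v xT t \<omega>) \<partial>Pr) \<le> (Lint t (gen X))"
proof -
  note x = xT_Lam_sqint[OF t] and u = uT_Lam_sqint[OF t]
  have gen_eq: "indicator {0..t} s * gen X s \<omega> = 2 * (indicator {0..t} s * ((A *v xT s \<omega>) \<bullet> (X *v xT s \<omega>)))
      + 2 * (indicator {0..t} s * ((B *v uT s \<omega>) \<bullet> (X *v xT s \<omega>))) + 2 * (indicator {0..t} s * (xT s \<omega> \<bullet> (X *v f (xT s \<omega>))))
      + (\<Sum>i\<in>UNIV. \<Sum>j\<in>UNIV. K $ i $ j * (indicator {0..t} s * ((N i *v xT s \<omega>) \<bullet> ((X ** N j) *v xT s \<omega>))))" for s \<omega>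
  proof (cases "s \<in> {0..t}")
    case True
    then have "s \<in> {0..T}" using t by auto
    then show ?thesis using True
      by (simp add: gen_def bT_eq inner_add_left matrix_vector_mul_assoc[symmetric] X(1)[of "xT s \<omega>" "f (xT s \<omega>)"])
  qed simp
  show gi: "Lintegrable t (gen X)"
    unfolding gen_eq
    by (intro Bochner_Integration.integrable_add Bochner_Integration.integrable_sum integrable_mult_right fi
       Lam_bilinear_integrable[OF x x] Lam_bilinear_integrable[OF u x])
  have clkm [measurable]: "(\<lambda>z. clk (fst z) (snd z)) \<in> borel_measurable Lam"
    by (rule Lam_measurable[OF clk_meas])
  have ev: "\<forall>\<^sub>F n in sequentially. clk s \<omega> < real (Suc n)" for s \<omega>
  proof -
    obtain n0 :: nat where n0: "clk s \<omega> < real n0" using reals_Archimedean2 by blast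
    show ?thesis using eventually_ge_at_top[of n0] by eventually_elim (use n0 in auto)
  qed
  let ?g = "\<lambda>n z. indicator {0..t} (fst z) * (if clk (fst z) (snd z) < real (Suc n) then gen X (fst z) (snd z) else 0)"
  have R: "(\<lambda>n. \<integral>z. ?g n z \<partial>Lam) \<longlonglongrightarrow> (Lint t (gen X))"
  proof (rule integral_dominated_convergence[where w="\<lambda>z. norm (indicator {0..t} (fst z) * gen X (fst z) (snd z))"])
    show "integrable Lam (\<lambda>z. norm (indicator {0..t} (fst z) * gen X (fst z) (snd z)))" by (rule integrable_norm[OF gi])
    show "(\<lambda>z. indicator {0..t} (fst z) * gen X (fst z) (snd z)) \<in> borel_measurable Lam"
      by (rule borel_measurable_integrable[OF gi])
    show "?g n \<in> borel_measurable Lam" for n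
      by (rule borel_measurable_integrable[OF localized_inequality(2)[OF _ X t]]) simp
    show "AE z in Lam. (\<lambda>n. ?g n z) \<longlonglongrightarrow> indicator {0..t} (fst z) * gen X (fst z) (snd z)"
    proof (intro AE_I2 tendsto_eventually)
      fix z show "\<forall>\<^sub>F n in sequentially. ?g n z = indicator {0..t} (fst z) * gen X (fst z) (snd z)"
        using ev[of "fst z" "snd z"] by eventually_elim simp
    qed
    show "AE z in Lam. norm (?g n z) \<le> norm (indicator {0..t} (fst z) * gen X (fst z) (snd z))" for n
      by (intro AE_I2) (auto split: split_indicator)
  qed
  have xs: "sqint Pr (xT t)" using second_moments t by metis
  have qi: "integrable Pr (\<lambda>\<omega>. xT t \<omega> \<bullet> (X *v xT t \<omega>))" by (rule sqint_inner_integrable[OF xs sqint_matrix[OF xs]])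
  let ?h = "\<lambda>n \<omega>. if clk t \<omega> < real (Suc n) then xT t \<omega> \<bullet> (X *v xT t \<omega>) else 0"
  have L: "(\<lambda>n. \<integral>\<omega>. ?h n \<omega> \<partial>Pr) \<longlonglongrightarrow> (\<integral>\<omega>. xT t \<omega> \<bullet> (X *v xT t \<omega>) \<partial>Pr)"
  proof (rule integral_dominated_convergence[where w="\<lambda>\<omega>. norm (xT t \<omega> \<bullet> (X *v xT t \<omega>))"])
    note [measurable] = F_measurable_Pr[OF t clk_adapted[OF t]] F_measurable_Pr[OF t xT_adapted[OF t]]
    show "integrable Pr (\<lambda>\<omega>. norm (xT t \<omega> \<bullet> (X *v xT t \<omega>)))" by (rule integrable_norm[OF qi])
    show "(\<lambda>\<omega>. xT t \<omega> \<bullet> (X *v xT t \<omega>)) \<in> borel_measurable Pr" by measurable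
    show "?h n \<in> borel_measurable Pr" for n by measurable
    show "AE \<omega> in Pr. (\<lambda>n. ?h n \<omega>) \<longlonglongrightarrow> xT t \<omega> \<bullet> (X *v xT t \<omega>)"
    proof (intro AE_I2 tendsto_eventually)
      fix \<omega> show "\<forall>\<^sub>F n in sequentially. ?h n \<omega> = xT t \<omega> \<bullet> (X *v xT t \<omega>)"
        using ev[of t \<omega>] by eventually_elim simp
    qed
  qed auto
  show "(\<integral>\<omega>. xT t \<omega> \<bullet> (X *v xT t \<omega>) \<partial>Pr) \<le> (Lint t (gen X))"
    by (rule LIMSEQ_le[OF L R]) (use localized_inequality(3)[OF _ X t] in \<open>auto simp del: of_nat_Suc\<close>)
qed

lemma Lam_exp_integrable:
  fixes h :: "real \<Rightarrow> 'a \<Rightarrow> real"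
  assumes "Lintegrable t h"
  shows "Lintegrable t (\<lambda>s \<omega>. h s \<omega> * exp (c * (t - s)))"
proof (rule Bochner_Integration.integrable_bound[OF integrable_mult_right[OF assms, of "exp (\<bar>c\<bar> * t)"]])
  note [measurable] = borel_measurable_integrable[OF assms]
  have "(\<lambda>z. (indicator {0..t} (fst z) * h (fst z) (snd z)) * exp (c * (t - fst z))) \<in> borel_measurable Lam" by measurable
  then show "(\<lambda>z. indicator {0..t} (fst z) * (h (fst z) (snd z) * exp (c * (t - fst z)))) \<in> borel_measurable Lam"
    by (simp add: mult.assoc)
  have "c * (t - s) \<le> \<bar>c\<bar> * t" if "s \<in> {0..t}" for s
  proof -
    have "c * (t - s) \<le> \<bar>c\<bar> * (t - s)" using that by (intro mult_right_mono) auto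
    also have "\<dots> \<le> \<bar>c\<bar> * t" using that by (intro mult_left_mono) auto
    finally show ?thesis .
  qed
  then show "AE z in Lam. norm (indicator {0..t} (fst z) * (h (fst z) (snd z) * exp (c * (t - fst z)))) \<le>
      norm (exp (\<bar>c\<bar> * t) * (indicator {0..t} (fst z) * h (fst z) (snd z)))"
    by (intro AE_I2) (auto simp: abs_mult mult.commute[of "exp _"] split: split_indicator intro!: mult_left_mono)
qed

text \<open>\<open>lyap\<close> bounds the linear and noise parts of the generator by
  \<open>- 2 * c1\<close> times the quadratic form minus the form of \<open>S\<close>, and average
  monotonicity bounds the nonlinear part in the mean by \<open>2 * c2\<close> times the quadratic
  form. What remains is Gronwall's hypothesis with rate \<open>2 * (c2 - c1)\<close>, raised to
  \<open>c\<close> because the rate must not be negative. The form of \<open>S\<close> stays in the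
  integrand, where it later absorbs the control or yields the output.\<close>

lemma gramian_estimate:
  fixes X S :: "real^'n^'n"
  assumes X: "\<And>v w. v \<bullet> (X *v w) = w \<bullet> (X *v v)" "\<And>v. 0 \<le> v \<bullet> (X *v v)"
    and lyap: "\<And>v. 2 * ((A *v v) \<bullet> (X *v v)) + (\<Sum>i\<in>UNIV. \<Sum>j\<in>UNIV. K $ i $ j * ((N i *v v) \<bullet> (X *v (N j *v v))))
       \<le> - 2 * c1 * (v \<bullet> (X *v v)) - v \<bullet> (S *v v)"
    and fi: "\<And>t. t \<in> {0..T} \<Longrightarrow> Lintegrable t (\<lambda>s \<omega>. xT s \<omega> \<bullet> (X *v f (xT s \<omega>)))"
    and fle: "\<And>t. t \<in> {0..T} \<Longrightarrow> (Lint t (\<lambda>s \<omega>. xT s \<omega> \<bullet> (X *v f (xT s \<omega>))))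
       \<le> c2 * (Lint t (\<lambda>s \<omega>. xT s \<omega> \<bullet> (X *v xT s \<omega>)))"
    and c: "c = max 0 (2 * (c2 - c1))" and t: "t \<in> {0..T}"
  shows "(\<integral>\<omega>. xT t \<omega> \<bullet> (X *v xT t \<omega>) \<partial>Pr) \<le>
     (Lint t (\<lambda>s \<omega>. (2 * ((B *v uT s \<omega>) \<bullet> (X *v xT s \<omega>)) - xT s \<omega> \<bullet> (S *v xT s \<omega>))
        * exp (c * (t - s))))"
proof -
  define a where "a s \<omega> = 2 * ((B *v uT s \<omega>) \<bullet> (X *v xT s \<omega>)) - xT s \<omega> \<bullet> (S *v xT s \<omega>)" for s \<omega>
  define q where "q s \<omega> = xT s \<omega> \<bullet> (X *v xT s \<omega>)" for s \<omega>
  have c0: "0 \<le> c" using c by simp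
  have TT: "T \<in> {0..T}" using T_pos by simp
  have ai: "Lintegrable t a" if t: "t \<in> {0..T}" for t
  proof -
    have "integrable Lam (\<lambda>z. 2 * (indicator {0..t} (fst z) * ((B *v uT (fst z) (snd z)) \<bullet> (X *v xT (fst z) (snd z))))
        - indicator {0..t} (fst z) * (xT (fst z) (snd z) \<bullet> (S *v xT (fst z) (snd z))))"
      by (intro Bochner_Integration.integrable_diff integrable_mult_right Lam_bilinear_integrable[OF uT_Lam_sqint[OF t] xT_Lam_sqint[OF t]]
         quadratic_xT_integrable[OF t])
    then show ?thesis by (simp add: a_def right_diff_distrib mult.left_commute)
  qed
  have qi: "Lintegrable t q" if t: "t \<in> {0..T}" for t
    unfolding q_def by (rule quadratic_xT_integrable[OF t])
  define g where "g s = (\<integral>\<omega>. q s \<omega> \<partial>Pr)" for s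
  define \<alpha> where "\<alpha> s = (\<integral>\<omega>. a s \<omega> \<partial>Pr)" for s
  have g0: "0 \<le> g s" for s unfolding g_def q_def using X(2) by simp
  have gi: "set_integrable lborel {0..T} g" and \<alpha>i: "set_integrable lborel {0..T} \<alpha>"
    unfolding g_def \<alpha>_def using Lam_time(2)[OF qi[OF TT]] Lam_time(2)[OF ai[OF TT]] by auto
  have step: "g t \<le> (LINT s:{0..t}|lborel. \<alpha> s) + c * (LINT s:{0..t}|lborel. g s)" if t: "t \<in> {0..T}" for t
  proof -
    let ?f = "\<lambda>z. indicator {0..t} (fst z) * (xT (fst z) (snd z) \<bullet> (X *v f (xT (fst z) (snd z))))"
    let ?q = "\<lambda>z. indicator {0..t} (fst z) * q (fst z) (snd z)"
    let ?a = "\<lambda>z. indicator {0..t} (fst z) * a (fst z) (snd z)"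
    note E = energy_inequality[OF X t fi[OF t]]
    have "g t \<le> (Lint t (gen X))" using E(2) by (simp add: g_def q_def)
    also have "\<dots> \<le> (\<integral>z. 2 * ?f z + (?a z - 2 * c1 * ?q z) \<partial>Lam)"
    proof (rule integral_mono[OF E(1)])
      show "integrable Lam (\<lambda>z. 2 * ?f z + (?a z - 2 * c1 * ?q z))"
        by (intro Bochner_Integration.integrable_add Bochner_Integration.integrable_diff integrable_mult_right fi[OF t] ai[OF t] qi[OF t])
      fix z :: "real \<times> 'a"
      show "indicator {0..t} (fst z) * gen X (fst z) (snd z) \<le> 2 * ?f z + (?a z - 2 * c1 * ?q z)"
      proof (cases "fst z \<in> {0..t}")
        case True
        then have s: "fst z \<in> {0..T}" using t by auto
        show ?thesis
          using lyap[of "xT (fst z) (snd z)"] True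
          by (simp add: gen_def bT_eq[OF s] a_def q_def inner_add_left X(1)[of "xT (fst z) (snd z)" "f (xT (fst z) (snd z))"])
      qed simp
    qed
    also have "\<dots> = 2 * (\<integral>z. ?f z \<partial>Lam) + ((\<integral>z. ?a z \<partial>Lam) - 2 * c1 * (\<integral>z. ?q z \<partial>Lam))"
      using fi[OF t] ai[OF t] qi[OF t] by simp
    also have "\<dots> \<le> 2 * (c2 * (\<integral>z. ?q z \<partial>Lam)) + ((\<integral>z. ?a z \<partial>Lam) - 2 * c1 * (\<integral>z. ?q z \<partial>Lam))"
      using fle[OF t] by (simp add: q_def)
    also have "\<dots> = (LINT s:{0..t}|lborel. \<alpha> s) + 2 * (c2 - c1) * (LINT s:{0..t}|lborel. g s)"
      unfolding \<alpha>_def g_def Lam_time(1)[OF qi[OF t]] Lam_time(1)[OF ai[OF t]] by (simp add: algebra_simps)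
    \<comment> \<open>The mean quadratic form is nonnegative, so its factor may be enlarged to
      \<open>c\<close>.\<close>
    also have "\<dots> \<le> (LINT s:{0..t}|lborel. \<alpha> s) + c * (LINT s:{0..t}|lborel. g s)"
    proof (intro add_left_mono mult_right_mono)
      show "0 \<le> (LINT s:{0..t}|lborel. g s)"
        unfolding set_lebesgue_integral_def by (rule integral_nonneg_AE) (use g0 in auto)
    qed (simp add: c)
    finally show ?thesis .
  qed
  have "g t \<le> (LINT s:{0..t}|lborel. exp (c * (t - s)) * \<alpha> s)"
    by (rule gronwall_integrable[OF c0 gi \<alpha>i step t])
  also have "\<dots> = (LINT s:{0..t}|lborel. \<integral>\<omega>. a s \<omega> * exp (c * (t - s)) \<partial>Pr)"
    by (simp add: \<alpha>_def mult.commute)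
  also have "\<dots> = (Lint t (\<lambda>s \<omega>. a s \<omega> * exp (c * (t - s))))"
    by (rule Lam_time(1)[symmetric]) (rule Lam_exp_integrable[OF ai[OF t]])
  finally show "(\<integral>\<omega>. xT t \<omega> \<bullet> (X *v xT t \<omega>) \<partial>Pr) \<le>
     (Lint t (\<lambda>s \<omega>. (2 * ((B *v uT s \<omega>) \<bullet> (X *v xT s \<omega>)) - xT s \<omega> \<bullet> (S *v xT s \<omega>))
        * exp (c * (t - s))))" by (simp add: g_def q_def a_def)
qed

section \<open>The two estimates in terms of \<open>time_mean\<close>\<close>

lemma time_Lam:
  assumes t: "t \<in> {0..T}" and eq: "\<And>s \<omega>. s \<in> {0..T} \<Longrightarrow> g s \<omega> = h s \<omega>"
  shows "time_integrable Pr t g \<longleftrightarrow> Lintegrable t h"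
    and "time_integrable Pr t g \<Longrightarrow> time_mean Pr t g = (Lint t h)"
proof -
  have e: "indicator {0..t} s * g s \<omega> = indicator {0..t} s * h s \<omega>" for s \<omega>
    using t eq[of s \<omega>] by (auto split: split_indicator)
  show "time_integrable Pr t g \<longleftrightarrow> Lintegrable t h"
    unfolding time_integrable_iff[OF prob_space_axioms] split_beta' e ..
  show "time_integrable Pr t g \<Longrightarrow> time_mean Pr t g = (Lint t h)"
    using time_mean_eq(1)[OF prob_space_axioms, of t g] by (simp add: e)
qed

lemma control_norm: "(L2_norm_control Pr T u)\<^sup>2 = (Lint T (\<lambda>s \<omega>. (norm (uT s \<omega>))\<^sup>2))"
proof -
  have TT: "T \<in> {0..T}" using T_pos by simp
  have "time_integrable Pr T (\<lambda>s \<omega>. (norm (u s \<omega>))\<^sup>2)" using u_L2 by (simp add: L2_controls_def)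
  from time_Lam(2)[OF TT _ this, of "\<lambda>s \<omega>. (norm (uT s \<omega>))\<^sup>2"]
  have e: "time_mean Pr T (\<lambda>s \<omega>. (norm (u s \<omega>))\<^sup>2) = (Lint T (\<lambda>s \<omega>. (norm (uT s \<omega>))\<^sup>2))"
    by (simp add: uT_def)
  have "0 \<le> (Lint T (\<lambda>s \<omega>. (norm (uT s \<omega>))\<^sup>2))"
    by (rule integral_nonneg_AE) auto
  then show ?thesis by (simp add: L2_norm_control_def e)
qed

text \<open>Completing the square in the control: with
  \<open>y = transpose B *v (matrix_inv P *v w)\<close> for state \<open>w\<close> and control
  \<open>v\<close>, the integrand is \<open>2 * (v \<bullet> y) - (norm y)\<^sup>2\<close> up to the
  exponential weight, and this is at most \<open>(norm v)\<^sup>2\<close>. A single coordinate of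
  the state is then bounded through the spectral sum of \<open>matrix_inv P\<close>.\<close>

lemma reachability_estimate:
  assumes P: "pos_definite P" and p: "orthonormal_eigenbasis P p lam"
    and est: "(\<integral>\<omega>. xT t \<omega> \<bullet> (matrix_inv P *v xT t \<omega>) \<partial>Pr) \<le>
     (Lint t (\<lambda>s \<omega>. (2 * ((B *v uT s \<omega>) \<bullet> (matrix_inv P *v xT s \<omega>))
        - xT s \<omega> \<bullet> ((matrix_inv P ** B ** transpose B ** matrix_inv P) *v xT s \<omega>)) * exp (c * (t - s))))"
    and c: "0 \<le> c" and t: "t \<in> {0..T}"
  shows "(\<integral>\<^sup>+\<omega>. ennreal ((x t \<omega> \<bullet> p k)\<^sup>2) \<partial>Pr) \<le> ennreal (lam k * exp (c * T) * (L2_norm_control Pr T u)\<^sup>2)"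
proof -
  let ?X = "matrix_inv P"
  note X = eigenbasis_sym[OF eigenbasis_matrix_inv[OF P p]]
  have pt: "2 * ((B *v v) \<bullet> (?X *v w)) - w \<bullet> ((?X ** B ** transpose B ** ?X) *v w) \<le> (norm v)\<^sup>2" for v w
  proof -
    define y where "y = transpose B *v (?X *v w)"
    have 1: "(B *v v) \<bullet> (?X *v w) = v \<bullet> y" unfolding y_def by (rule inner_transpose[symmetric])
    have "w \<bullet> ((?X ** B ** transpose B ** ?X) *v w) = w \<bullet> (?X *v (B *v y))"
      by (simp only: y_def matrix_vector_mul_assoc matrix_mul_assoc)
    also have "\<dots> = (B *v y) \<bullet> (?X *v w)" by (rule X)
    also have "\<dots> = y \<bullet> y" by (rule inner_transpose[of y B "?X *v w", folded y_def, symmetric])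
    also have "\<dots> = (norm y)\<^sup>2" by (simp only: power2_norm_eq_inner)
    finally have 2: "w \<bullet> ((?X ** B ** transpose B ** ?X) *v w) = (norm y)\<^sup>2" .
    have "0 \<le> (norm (v - y))\<^sup>2" by simp
    then show ?thesis unfolding 1 2 by (simp add: power2_norm_eq_inner inner_diff_left inner_diff_right inner_commute)
  qed
  have pos: "0 < lam k" by (rule eigenbasis_pos[OF P p])
  have xs: "sqint Pr (xT t)" using second_moments t by metis
  have qi: "integrable Pr (\<lambda>\<omega>. xT t \<omega> \<bullet> (?X *v xT t \<omega>))" by (rule sqint_inner_integrable[OF xs sqint_matrix[OF xs]])
  have "(\<integral>\<omega>. xT t \<omega> \<bullet> (?X *v xT t \<omega>) \<partial>Pr) \<le> (\<integral>z. exp (c * T) * (indicator {0..T} (fst z) * (norm (uT (fst z) (snd z)))\<^sup>2) \<partial>Lam)"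
  proof (rule order_trans[OF est], rule integral_mono')
    show "integrable Lam (\<lambda>z. exp (c * T) * (indicator {0..T} (fst z) * (norm (uT (fst z) (snd z)))\<^sup>2))"
      by (rule integrable_mult_right[OF uT_int])
    fix z :: "real \<times> 'a"
    show "indicator {0..t} (fst z) * ((2 * ((B *v uT (fst z) (snd z)) \<bullet> (?X *v xT (fst z) (snd z)))
        - xT (fst z) (snd z) \<bullet> ((?X ** B ** transpose B ** ?X) *v xT (fst z) (snd z))) * exp (c * (t - fst z)))
        \<le> exp (c * T) * (indicator {0..T} (fst z) * (norm (uT (fst z) (snd z)))\<^sup>2)"
    proof (cases "fst z \<in> {0..t}")
      case True
      have "(2 * ((B *v uT (fst z) (snd z)) \<bullet> (?X *v xT (fst z) (snd z)))
        - xT (fst z) (snd z) \<bullet> ((?X ** B ** transpose B ** ?X) *v xT (fst z) (snd z))) * exp (c * (t - fst z))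
        \<le> (norm (uT (fst z) (snd z)))\<^sup>2 * exp (c * (t - fst z))"
        by (rule mult_right_mono[OF pt]) simp
      \<comment> \<open>Since \<open>c\<close> is nonnegative, the weight is largest for the longest
        possible time difference \<open>T\<close>.\<close>
      also have "\<dots> \<le> (norm (uT (fst z) (snd z)))\<^sup>2 * exp (c * T)"
        using True t c by (intro mult_left_mono) (auto intro!: mult_left_mono)
      finally show ?thesis using True t by (simp add: mult.commute)
    qed auto
  qed auto
  then have le: "(\<integral>\<omega>. xT t \<omega> \<bullet> (?X *v xT t \<omega>) \<partial>Pr) \<le> exp (c * T) * (L2_norm_control Pr T u)\<^sup>2"
    by (simp add: control_norm)
  have "(\<integral>\<^sup>+\<omega>. ennreal ((x t \<omega> \<bullet> p k)\<^sup>2) \<partial>Pr) \<le> (\<integral>\<^sup>+\<omega>. ennreal (lam k * (xT t \<omega> \<bullet> (?X *v xT t \<omega>))) \<partial>Pr)"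
    using t eigenbasis_coefficient_le[OF P p] by (intro nn_integral_mono ennreal_leI) (simp add: xT_def)
  also have "\<dots> = ennreal (\<integral>\<omega>. lam k * (xT t \<omega> \<bullet> (?X *v xT t \<omega>)) \<partial>Pr)"
  proof (rule nn_integral_eq_integral)
    have "0 \<le> v \<bullet> (?X *v v)" for v
      by (rule eigenbasis_nonneg[OF eigenbasis_matrix_inv[OF P p]]) (use eigenbasis_pos[OF P p] in simp)
    then show "AE \<omega> in Pr. 0 \<le> lam k * (xT t \<omega> \<bullet> (?X *v xT t \<omega>))" using pos by simp
  qed (use qi in simp)
  also have "\<dots> \<le> ennreal (lam k * exp (c * T) * (L2_norm_control Pr T u)\<^sup>2)"
    using mult_left_mono[OF le, of "lam k"] pos by (intro ennreal_leI) (simp add: mult.assoc)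
  finally show ?thesis .
qed

text \<open>The mean quadratic form of \<open>Q\<close> on the left is nonnegative and is dropped,
  which moves the weighted output energy to the other side. Its weight is at least 1 and may be
  removed there, but has to stay on the term with the control, whose sign is unknown. The final
  identity expands \<open>Q\<close> in its eigenbasis.\<close>

lemma observability_estimate:
  fixes C :: "real^'n^'p" and Q :: "real^'n^'n"
  assumes q: "orthonormal_eigenbasis Q q lam" "\<And>k. 0 < lam k"
    and est: "(\<integral>\<omega>. xT t \<omega> \<bullet> (Q *v xT t \<omega>) \<partial>Pr) \<le>
     (Lint t (\<lambda>s \<omega>. (2 * ((B *v uT s \<omega>) \<bullet> (Q *v xT s \<omega>))
        - xT s \<omega> \<bullet> ((transpose C ** C) *v xT s \<omega>)) * exp (c * (t - s))))"
    and c: "0 \<le> c" and t: "t \<in> {0..T}"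
  shows "time_integrable Pr t (\<lambda>s \<omega>. (norm (C *v x s \<omega>))\<^sup>2)" (is ?A)
    "time_integrable Pr t (\<lambda>s \<omega>. ((Q *v x s \<omega>) \<bullet> (B *v u s \<omega>)) * exp (c * (t - s)))" (is ?B)
    "\<And>k. time_integrable Pr t (\<lambda>s \<omega>. (q k \<bullet> x s \<omega>) * (q k \<bullet> (B *v u s \<omega>)) * exp (c * (t - s)))" (is "\<And>k. ?Cc k")
    "time_mean Pr t (\<lambda>s \<omega>. (norm (C *v x s \<omega>))\<^sup>2)
         \<le> 2 * time_mean Pr t (\<lambda>s \<omega>. ((Q *v x s \<omega>) \<bullet> (B *v u s \<omega>)) * exp (c * (t - s)))"
    "2 * time_mean Pr t (\<lambda>s \<omega>. ((Q *v x s \<omega>) \<bullet> (B *v u s \<omega>)) * exp (c * (t - s)))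
         = 2 * (\<Sum>k\<in>UNIV. lam k *
             time_mean Pr t (\<lambda>s \<omega>. (q k \<bullet> x s \<omega>) * (q k \<bullet> (B *v u s \<omega>)) * exp (c * (t - s))))"
proof -
  note x = xT_Lam_sqint[OF t] and u = uT_Lam_sqint[OF t]
  define h1 where "h1 s \<omega> = (norm (C *v xT s \<omega>))\<^sup>2" for s \<omega>
  define h2 where "h2 s \<omega> = ((Q *v xT s \<omega>) \<bullet> (B *v uT s \<omega>))" for s \<omega>
  define h3 where "h3 k s \<omega> = (q k \<bullet> xT s \<omega>) * (q k \<bullet> (B *v uT s \<omega>))" for k s \<omega>
  have i1: "Lintegrable t h1"
    using Lam_bilinear_integrable[OF x x, of C C] by (simp add: h1_def power2_norm_eq_inner)
  have i2: "Lintegrable t h2"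
    using Lam_bilinear_integrable[OF x u, of Q B] by (simp add: h2_def)
  have i3: "Lintegrable t (h3 k)" for k
  proof -
    \<comment> \<open>The product of two coordinates is written as a bilinear form with a rank-one
      matrix, so that \<open>Lam_bilinear_integrable\<close> applies.\<close>
    have "linear (\<lambda>v. (q k \<bullet> v) *\<^sub>R q k)" by (intro linearI) (auto simp: inner_add_right scaleR_add_left)
    then have "matrix (\<lambda>v. (q k \<bullet> v) *\<^sub>R q k) *v v = (q k \<bullet> v) *\<^sub>R q k" for v
      by (intro matrix_works) (simp add: linear_def scalar_mult_eq_scaleR[abs_def])
    then show ?thesis
      using Lam_bilinear_integrable[OF x u, of "matrix (\<lambda>v. (q k \<bullet> v) *\<^sub>R q k)" B] by (simp add: h3_def)
  qed
  note e2 = Lam_exp_integrable[OF i2, where c=c] and e3 = Lam_exp_integrable[OF i3, where c=c]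
  have T1: "s \<in> {0..T} \<Longrightarrow> (norm (C *v x s \<omega>))\<^sup>2 = h1 s \<omega>"
    and T2: "s \<in> {0..T} \<Longrightarrow> ((Q *v x s \<omega>) \<bullet> (B *v u s \<omega>)) * exp (c * (t - s)) = h2 s \<omega> * exp (c * (t - s))"
    and T3: "s \<in> {0..T} \<Longrightarrow> (q k \<bullet> x s \<omega>) * (q k \<bullet> (B *v u s \<omega>)) * exp (c * (t - s)) = h3 k s \<omega> * exp (c * (t - s))" for s \<omega> k
    by (simp_all add: h1_def h2_def h3_def xT_def uT_def)
  show A: ?A using i1 by (subst time_Lam(1)[OF t T1])
  show Bb: ?B using e2 by (subst time_Lam(1)[OF t T2])
  show Cc: "?Cc k" for k using e3 by (subst time_Lam(1)[OF t T3])
  have mA: "time_mean Pr t (\<lambda>s \<omega>. (norm (C *v x s \<omega>))\<^sup>2) = (Lint t h1)"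
    by (rule time_Lam(2)[OF t T1 A])
  have mB: "time_mean Pr t (\<lambda>s \<omega>. ((Q *v x s \<omega>) \<bullet> (B *v u s \<omega>)) * exp (c * (t - s))) =
      (Lint t (\<lambda>s \<omega>. h2 s \<omega> * exp (c * (t - s))))"
    by (rule time_Lam(2)[OF t T2 Bb])
  have mC: "time_mean Pr t (\<lambda>s \<omega>. (q k \<bullet> x s \<omega>) * (q k \<bullet> (B *v u s \<omega>)) * exp (c * (t - s))) =
      (Lint t (\<lambda>s \<omega>. h3 k s \<omega> * exp (c * (t - s))))" for k
    by (rule time_Lam(2)[OF t T3 Cc])
  let ?I1 = "Lint t (\<lambda>s \<omega>. h1 s \<omega> * exp (c * (t - s)))"
  let ?I2 = "Lint t (\<lambda>s \<omega>. h2 s \<omega> * exp (c * (t - s)))"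
  note e1 = Lam_exp_integrable[OF i1, where c=c]
  have "0 \<le> (\<integral>\<omega>. xT t \<omega> \<bullet> (Q *v xT t \<omega>) \<partial>Pr)"
    by (rule integral_nonneg_AE) (use eigenbasis_nonneg[OF q] in auto)
  also note est
  also have "(Lint t (\<lambda>s \<omega>. (2 * ((B *v uT s \<omega>) \<bullet> (Q *v xT s \<omega>))
        - xT s \<omega> \<bullet> ((transpose C ** C) *v xT s \<omega>)) * exp (c * (t - s))))
     = (\<integral>z. 2 * (indicator {0..t} (fst z) * (h2 (fst z) (snd z) * exp (c * (t - fst z)))) - indicator {0..t} (fst z) * (h1 (fst z) (snd z) * exp (c * (t - fst z))) \<partial>Lam)"
  proof (intro Bochner_Integration.integral_cong refl)
    fix z :: "real \<times> 'a"
    have "v \<bullet> ((transpose C ** C) *v v) = (norm (C *v v))\<^sup>2" for v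
      by (simp only: matrix_vector_mul_assoc[symmetric] inner_transpose power2_norm_eq_inner)
    then show "indicator {0..t} (fst z) * ((2 * ((B *v uT (fst z) (snd z)) \<bullet> (Q *v xT (fst z) (snd z)))
        - xT (fst z) (snd z) \<bullet> ((transpose C ** C) *v xT (fst z) (snd z))) * exp (c * (t - fst z)))
      = 2 * (indicator {0..t} (fst z) * (h2 (fst z) (snd z) * exp (c * (t - fst z)))) - indicator {0..t} (fst z) * (h1 (fst z) (snd z) * exp (c * (t - fst z)))"
      by (simp add: h1_def h2_def inner_commute algebra_simps)
  qed
  also have "\<dots> = 2 * ?I2 - ?I1" using e1 e2 by simp
  finally have le: "?I1 \<le> 2 * ?I2" by simp
  have "(Lint t h1) \<le> ?I1"
  proof (rule integral_mono[OF i1 e1])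
    fix z :: "real \<times> 'a"
    have "h1 (fst z) (snd z) * 1 \<le> h1 (fst z) (snd z) * exp (c * (t - fst z))" if "fst z \<in> {0..t}"
      using that c by (intro mult_left_mono) (auto simp: h1_def)
    then show "indicator {0..t} (fst z) * h1 (fst z) (snd z) \<le> indicator {0..t} (fst z) * (h1 (fst z) (snd z) * exp (c * (t - fst z)))"
      by (auto split: split_indicator)
  qed
  with le show "time_mean Pr t (\<lambda>s \<omega>. (norm (C *v x s \<omega>))\<^sup>2)
         \<le> 2 * time_mean Pr t (\<lambda>s \<omega>. ((Q *v x s \<omega>) \<bullet> (B *v u s \<omega>)) * exp (c * (t - s)))"
    unfolding mA mB by simp
  have "?I2 = (\<integral>z. (\<Sum>k\<in>UNIV. lam k * (indicator {0..t} (fst z) * (h3 k (fst z) (snd z) * exp (c * (t - fst z))))) \<partial>Lam)"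
  proof (intro Bochner_Integration.integral_cong refl)
    fix z :: "real \<times> 'a"
    have "h2 (fst z) (snd z) = (\<Sum>k\<in>UNIV. lam k * h3 k (fst z) (snd z))"
      by (simp add: h2_def h3_def inner_commute[of "Q *v _"] eigenbasis_inner[OF q(1)] mult_ac)
    then show "indicator {0..t} (fst z) * (h2 (fst z) (snd z) * exp (c * (t - fst z))) = (\<Sum>k\<in>UNIV. lam k * (indicator {0..t} (fst z) * (h3 k (fst z) (snd z) * exp (c * (t - fst z)))))"
      by (simp add: sum_distrib_left sum_distrib_right mult_ac)
  qed
  also have "\<dots> = (\<Sum>k\<in>UNIV. lam k * (Lint t (\<lambda>s \<omega>. h3 k s \<omega> * exp (c * (t - s)))))"
    using e3 by (simp add: Bochner_Integration.integral_sum)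
  finally show "2 * time_mean Pr t (\<lambda>s \<omega>. ((Q *v x s \<omega>) \<bullet> (B *v u s \<omega>)) * exp (c * (t - s)))
         = 2 * (\<Sum>k\<in>UNIV. lam k *
             time_mean Pr t (\<lambda>s \<omega>. (q k \<bullet> x s \<omega>) * (q k \<bullet> (B *v u s \<omega>)) * exp (c * (t - s))))"
    unfolding mB mC by simp
qed

end

theorem theorem4p7:
  fixes Pr :: "'a measure" and T :: real and F :: "real \<Rightarrow> 'a measure"
    and M :: "real \<Rightarrow> 'a \<Rightarrow> real^'d" and K :: "real^'d^'d"
    and A :: "real^'n^'n" and B :: "real^'m^'n" and C :: "real^'n^'p"
    and N :: "'d \<Rightarrow> real^'n^'n" and f :: "real^'n \<Rightarrow> real^'n"
    and c_f c1 c2 c :: real and \<U> :: "(real \<Rightarrow> 'a \<Rightarrow> real^'m) set"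
    and P Q :: "real^'n^'n"
    and p q :: "'n \<Rightarrow> real^'n" and lamP lamQ :: "'n \<Rightarrow> real"
  assumes "0 < T"
    and "filtered_prob_space Pr T F"
    and "levy_noise Pr T F M K"
    and "f 0 = 0"
    and "\<forall>R. \<exists>L. lipschitz_on L {v. norm v \<le> R} f"
    and "\<forall>v. v \<bullet> f v \<le> c_f * (norm v)\<^sup>2"
    and "\<forall>z. complex_eigenvalue
           (kronecker (mat 1) (A + c1 *\<^sub>R mat 1) + kronecker (A + c1 *\<^sub>R mat 1) (mat 1)
              + (\<Sum>i\<in>UNIV. \<Sum>j\<in>UNIV. K $ i $ j *\<^sub>R kronecker (N i) (N j))) z \<longrightarrow> Re z < 0"
    and "\<U> \<subseteq> L2_controls Pr T F"
    and "average_monotonicity_gramians Pr T F M K A B C N f c1 c2 \<U> P Q"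
    and "orthonormal_eigenbasis P p lamP"
    and "orthonormal_eigenbasis Q q lamQ"
    and "c = max 0 (2 * (c2 - c1))"
  shows "\<forall>u\<in>\<U>. \<forall>x. state_solution Pr T F M A B N f u x \<longrightarrow>
    (\<forall>k. (SUP t\<in>{0..T}. \<integral>\<^sup>+\<omega>. ennreal ((x t \<omega> \<bullet> p k)\<^sup>2) \<partial>Pr)
            \<le> ennreal (lamP k * exp (c * T) * (L2_norm_control Pr T u)\<^sup>2)) \<and>
    (\<forall>t\<in>{0..T}.
       time_integrable Pr t (\<lambda>s \<omega>. (norm (C *v x s \<omega>))\<^sup>2) \<and>
       time_integrable Pr t (\<lambda>s \<omega>. ((Q *v x s \<omega>) \<bullet> (B *v u s \<omega>)) * exp (c * (t - s))) \<and>
       (\<forall>k. time_integrable Pr t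
              (\<lambda>s \<omega>. (q k \<bullet> x s \<omega>) * (q k \<bullet> (B *v u s \<omega>)) * exp (c * (t - s)))) \<and>
       time_mean Pr t (\<lambda>s \<omega>. (norm (C *v x s \<omega>))\<^sup>2)
         \<le> 2 * time_mean Pr t (\<lambda>s \<omega>. ((Q *v x s \<omega>) \<bullet> (B *v u s \<omega>)) * exp (c * (t - s))) \<and>
       2 * time_mean Pr t (\<lambda>s \<omega>. ((Q *v x s \<omega>) \<bullet> (B *v u s \<omega>)) * exp (c * (t - s)))
         = 2 * (\<Sum>k\<in>UNIV. lamQ k *
             time_mean Pr t (\<lambda>s \<omega>. (q k \<bullet> x s \<omega>) * (q k \<bullet> (B *v u s \<omega>)) * exp (c * (t - s)))))"
proof (intro ballI allI impI)
  fix u x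
  assume u: "u \<in> \<U>" and x: "state_solution Pr T F M A B N f u x"
  note gram = assms(9)[unfolded average_monotonicity_gramians_def]
  have P: "pos_definite P" and Q: "pos_definite Q" using gram by auto
  interpret levy_driven Pr T F M K using assms(1-3) by unfold_locales
  interpret controlled_system Pr T F M K A B N f c_f u x
    using assms(5,6) u x assms(8) by unfold_locales auto
  define Pi where "Pi = matrix_inv P"
  note Pb = eigenbasis_matrix_inv[OF P assms(10), folded Pi_def]
  have lamP: "0 < lamP k" for k by (rule eigenbasis_pos[OF P assms(10)])
  have lamPi: "0 < inverse (lamP k)" for k using lamP by simp
  have lamQ: "0 < lamQ k" for k by (rule eigenbasis_pos[OF Q assms(11)])
  have c0: "0 \<le> c" using assms(12) by simp
  \<comment> \<open>Proved once for both Gramians: \<open>X\<close> is \<open>matrix_inv P\<close>,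
    whose eigenvalues are the inverses of those of \<open>P\<close>, or \<open>Q\<close>. The
    eigenbasis supplies symmetry, positivity and the square root in the monotonicity
    condition.\<close>
  have est: "(\<integral>\<omega>. xT t \<omega> \<bullet> (X *v xT t \<omega>) \<partial>Pr) \<le>
     (Lint t (\<lambda>s \<omega>. (2 * ((B *v uT s \<omega>) \<bullet> (X *v xT s \<omega>)) - xT s \<omega> \<bullet> (S *v xT s \<omega>))
        * exp (c * (t - s))))"
    if b: "orthonormal_eigenbasis X b lam" "\<And>k. 0 < lam k" and t: "t \<in> {0..T}"
      and lo: "loewner_le (transpose (A + c1 *\<^sub>R mat 1) ** X + X ** (A + c1 *\<^sub>R mat 1)
          + (\<Sum>i\<in>UNIV. \<Sum>j\<in>UNIV. K $ i $ j *\<^sub>R (transpose (N i) ** X ** N j))) (- S)"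
      and mon: "\<And>t. t \<in> {0..T} \<Longrightarrow> time_integrable Pr t (\<lambda>s \<omega>. x s \<omega> \<bullet> (X *v f (x s \<omega>)))"
        "\<And>t. t \<in> {0..T} \<Longrightarrow> time_mean Pr t (\<lambda>s \<omega>. x s \<omega> \<bullet> (X *v f (x s \<omega>)))
          \<le> c2 * time_mean Pr t (\<lambda>s \<omega>. (norm (matrix_sqrt X *v x s \<omega>))\<^sup>2)"
    for X S b lam t
  proof (rule gramian_estimate[where ?c1.0=c1 and ?c2.0=c2, OF eigenbasis_sym[OF b(1)] eigenbasis_nonneg[OF b] _ _ _ assms(12) t])
    show "2 * ((A *v v) \<bullet> (X *v v)) + (\<Sum>i\<in>UNIV. \<Sum>j\<in>UNIV. K $ i $ j * ((N i *v v) \<bullet> (X *v (N j *v v))))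
       \<le> - 2 * c1 * (v \<bullet> (X *v v)) - v \<bullet> (S *v v)" for v
      by (rule loewner_quadratic[OF lo eigenbasis_sym[OF b(1)]])
    fix t assume t: "t \<in> {0..T}"
    have e1: "s \<in> {0..T} \<Longrightarrow> x s \<omega> \<bullet> (X *v f (x s \<omega>)) = xT s \<omega> \<bullet> (X *v f (xT s \<omega>))"
      and e2: "s \<in> {0..T} \<Longrightarrow> (norm (matrix_sqrt X *v x s \<omega>))\<^sup>2 = xT s \<omega> \<bullet> (X *v xT s \<omega>)" for s \<omega>
      by (simp_all add: xT_def matrix_sqrt_eigenbasis[OF b])
    \<comment> \<open>By the second moments the right-hand side of the monotonicity condition is a
      genuine integral and not the default value 0.\<close>
    have i2: "time_integrable Pr t (\<lambda>s \<omega>. (norm (matrix_sqrt X *v x s \<omega>))\<^sup>2)"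
      using quadratic_xT_integrable[OF t] by (subst time_Lam(1)[OF t e2])
    show "Lintegrable t (\<lambda>s \<omega>. xT s \<omega> \<bullet> (X *v f (xT s \<omega>)))"
      using mon(1)[OF t] by (subst (asm) time_Lam(1)[OF t e1])
    have m1: "time_mean Pr t (\<lambda>s \<omega>. x s \<omega> \<bullet> (X *v f (x s \<omega>))) =
        (Lint t (\<lambda>s \<omega>. xT s \<omega> \<bullet> (X *v f (xT s \<omega>))))"
      by (rule time_Lam(2)[OF t e1 mon(1)[OF t]])
    have m2: "time_mean Pr t (\<lambda>s \<omega>. (norm (matrix_sqrt X *v x s \<omega>))\<^sup>2) =
        (Lint t (\<lambda>s \<omega>. xT s \<omega> \<bullet> (X *v xT s \<omega>)))"
      by (rule time_Lam(2)[OF t e2 i2])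
    show "(Lint t (\<lambda>s \<omega>. xT s \<omega> \<bullet> (X *v f (xT s \<omega>))))
       \<le> c2 * (Lint t (\<lambda>s \<omega>. xT s \<omega> \<bullet> (X *v xT s \<omega>)))"
      using mon(2)[OF t] unfolding m1 m2 .
  qed
  have estP: "(\<integral>\<omega>. xT t \<omega> \<bullet> (matrix_inv P *v xT t \<omega>) \<partial>Pr) \<le>
     (Lint t (\<lambda>s \<omega>. (2 * ((B *v uT s \<omega>) \<bullet> (matrix_inv P *v xT s \<omega>))
        - xT s \<omega> \<bullet> ((matrix_inv P ** B ** transpose B ** matrix_inv P) *v xT s \<omega>)) * exp (c * (t - s))))"
    if t: "t \<in> {0..T}" for t
    by (rule est[OF Pb[unfolded Pi_def] lamPi t]) (use gram u x in blast)+
  have estQ: "(\<integral>\<omega>. xT t \<omega> \<bullet> (Q *v xT t \<omega>) \<partial>Pr) \<le>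
     (Lint t (\<lambda>s \<omega>. (2 * ((B *v uT s \<omega>) \<bullet> (Q *v xT s \<omega>))
        - xT s \<omega> \<bullet> ((transpose C ** C) *v xT s \<omega>)) * exp (c * (t - s))))"
    if t: "t \<in> {0..T}" for t
    by (rule est[OF assms(11) lamQ t]) (use gram u x in blast)+
  note O = observability_estimate[OF assms(11) lamQ estQ c0]
  show "(\<forall>k. (SUP t\<in>{0..T}. \<integral>\<^sup>+\<omega>. ennreal ((x t \<omega> \<bullet> p k)\<^sup>2) \<partial>Pr)
            \<le> ennreal (lamP k * exp (c * T) * (L2_norm_control Pr T u)\<^sup>2)) \<and>
    (\<forall>t\<in>{0..T}.
       time_integrable Pr t (\<lambda>s \<omega>. (norm (C *v x s \<omega>))\<^sup>2) \<and>
       time_integrable Pr t (\<lambda>s \<omega>. ((Q *v x s \<omega>) \<bullet> (B *v u s \<omega>)) * exp (c * (t - s))) \<and>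
       (\<forall>k. time_integrable Pr t
              (\<lambda>s \<omega>. (q k \<bullet> x s \<omega>) * (q k \<bullet> (B *v u s \<omega>)) * exp (c * (t - s)))) \<and>
       time_mean Pr t (\<lambda>s \<omega>. (norm (C *v x s \<omega>))\<^sup>2)
         \<le> 2 * time_mean Pr t (\<lambda>s \<omega>. ((Q *v x s \<omega>) \<bullet> (B *v u s \<omega>)) * exp (c * (t - s))) \<and>
       2 * time_mean Pr t (\<lambda>s \<omega>. ((Q *v x s \<omega>) \<bullet> (B *v u s \<omega>)) * exp (c * (t - s)))
         = 2 * (\<Sum>k\<in>UNIV. lamQ k *
             time_mean Pr t (\<lambda>s \<omega>. (q k \<bullet> x s \<omega>) * (q k \<bullet> (B *v u s \<omega>)) * exp (c * (t - s)))))"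
  proof (intro conjI allI ballI)
    fix k
    show "(SUP t\<in>{0..T}. \<integral>\<^sup>+\<omega>. ennreal ((x t \<omega> \<bullet> p k)\<^sup>2) \<partial>Pr)
            \<le> ennreal (lamP k * exp (c * T) * (L2_norm_control Pr T u)\<^sup>2)"
      by (rule SUP_least) (rule reachability_estimate[OF P assms(10) estP c0])
  qed (use O in blast)+
qed

end
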